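(* Let $\mathcal S$ be a triangulated category with an excellent metric $\{\mathcal M_i,\ i\in\mathbb N\}$, let $\mathfrak S(\mathcal S)$ carry its induced good metric $\{\mathcal N_i\}$, and give $\mathfrak S(\mathcal S)^{op}$ the good metric $\{\mathcal N_i^{op}\}$. Let $$\widehat Y:\big(\mathrm{Mod}\text{-}\mathcal S\big)^{op}\to\mathrm{Mod}\text{-}\mathfrak S(\mathcal S)^{op},\qquad \widehat Y(M)=\mathrm{Hom}_{\mathrm{Mod}\text{-}\mathcal S}(M,-)\big|_{\mathfrak S(\mathcal S)} .$$ Then: (i) $\widehat Y$ induces an equivalence of $\mathfrak L(\mathcal S)^{op}\subset(\mathrm{Mod}\text{-}\mathcal S)^{op}$ with $\mathfrak L\big(\mathfrak S(\mathcal S)^{op}\big)\subset\mathrm{Mod}\text{-}\mathfrak S(\mathcal S)^{op}$. (ii) $\widehat Y$ takes strong triangles in $\mathfrak L(\mathcal S)$ to strong triangles in $\mathfrak L\big(\mathfrak S(\mathcal S)^{op}\big)$; that is, if $A\xrightarrow{f}B\xrightarrow{g}C\xrightarrow{h}\Sigma A$ is a strong triangle in $\mathfrak L(\mathcal S)$ then $\widehat Y(\Sigma A)\xrightarrow{\widehat Y(h)}\widehat Y(C)\xrightarrow{\widehat Y(g)}\widehat Y(B)\xrightarrow{\widehat Y(f)}\widehat Y(A)$ is a strong triangle in $\mathfrak L\big(\mathfrak S(\mathcal S)^{op}\big)$.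
   Context: Conventions: subcategories are full; $\Sigma$ is the shift; $\mathcal A*\mathcal B$ is the class of $b$ admitting a distinguished triangle $a\to b\to c\to\Sigma a$ with $a\in\mathcal A,c\in\mathcal B$; $\mathcal A^\perp=\{b:\mathrm{Hom}(a,b)=0\ \forall a\in\mathcal A\}$, ${}^\perp\mathcal A=\{b:\mathrm{Hom}(b,a)=0\ \forall a\in\mathcal A\}$. The opposite $\mathcal C^{op}$ of a triangulated category has shift $\Sigma^{-1}$, and $x\to y\to z\to\Sigma^{-1}x$ is distinguished in $\mathcal C^{op}$ iff, read in $\mathcal C$, $\Sigma^{-1}x\to z\to y\to x$ is distinguished. Good metric on a triangulated category $\mathcal S$: full subcategories $\{\mathcal M_i,\ i\in\mathbb N\}$ with $0\in\mathcal M_i$, $\Sigma^{-1}\mathcal M_{i+1}\cup\mathcal M_{i+1}\cup\Sigma\mathcal M_{i+1}\subset\mathcal M_i$ and $\mathcal M_i*\mathcal M_i\subset\mathcal M_i$. Then $\{\mathcal M_i^{op}\}$ is a good metric on $\mathcal S^{op}$. A sequence $E_1\to E_2\to\cdots$ in $\mathcal S$ is Cauchy if for every $i$ there is $N$ such that for all $k>j\ge N$ the cone of $E_j\to E_k$ lies in $\mathcal M_i$. A Cauchy sequence of triangles is a sequence $a_*\to b_*\to c_*\to\Sigma a_*$ of distinguished triangles and maps of triangles, with $a_*,b_*,c_*$ Cauchy. $\mathrm{Mod}\text{-}\mathcal S$ is the category of additive functors $\mathcal S^{op}\to\mathrm{Ab}$, $Y$ the Yoneda embedding, $\Sigma$ extended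 so that $Y\Sigma=\Sigma Y$. $\mathfrak L(\mathcal S)\subset\mathrm{Mod}\text{-}\mathcal S$ is the full subcategory of objects isomorphic to $\mathrm{colim}\,Y(E_* )$, $E_*$ Cauchy. $\mathfrak S(\mathcal S)=\mathfrak L(\mathcal S)\cap\bigcup_iY(\mathcal M_i)^\perp$. Strong triangles in $\mathfrak L(\mathcal S)$ are the sequences $A\to B\to C\to\Sigma A$ isomorphic to colimits of images under $Y$ of Cauchy sequences of triangles. $\mathfrak S(\mathcal S)$ is triangulated (earlier work), its distinguished triangles being the strong triangles with all objects in $\mathfrak S(\mathcal S)$. $\mathcal L_i\subset\mathfrak L(\mathcal S)$ is the full subcategory of objects isomorphic to $\mathrm{colim}\,Y(E_* )$ with $E_*$ Cauchy and contained in $\mathcal M_i$; $\mathcal N_i=\mathcal L_i\cap\mathfrak S(\mathcal S)$; $\{\mathcal N_i\}$ is a good metric on $\mathfrak S(\mathcal S)$. $\mathfrak L\big(\mathfrak S(\mathcal S)^{op}\big)$ and its strong triangles are the same constructions applied to $\mathfrak S(\mathcal S)^{op}$ with the metric $\{\mathcal N_i^{op}\}$. Type-$n$ morphisms: let $A=\mathrm{colim}\,Y(a_* )$, $B=\mathrm{colim}\,Y(b_* )$ with $a_*,b_*$ Cauchy in $\mathcal S$. A morphism $G:A\to B$ is of type-$n$ with respect to $(a_*,b_* )$ if there are subsequences $a'_*$ of $a_*$ and $b'_*$ of $b_*$ and a map of sequences $f_*:a'_*\to b'_*$ with $G=\mathrm{colim}\,Y(f_* )$ and with the cone of $f_i$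 in $\mathcal M_n$ for all $i\gg0$. A good metric $\{\mathcal M_i\}$ on $\mathcal S$ is excellent if: (a) $\mathcal S=\bigcup_{i}{}^\perp\mathcal M_i$; (b) for every $m\in\mathbb N$ there is $n>m$ such that every $F\in\mathcal S$ admits a distinguished triangle $E\to F\to D\to\Sigma E$ in $\mathcal S$ with $E\in{}^\perp\mathcal M_n$ and $D\in\mathcal M_m$; (c) for every $m\in\mathbb N$ there is $n>m$ such that for every $F\in\mathcal S$ there exist a Cauchy sequence $d_*$ in $\mathcal S$ with $D=\mathrm{colim}\,Y(d_* )\in\mathfrak S(\mathcal S)\cap\mathcal L_n^\perp$ and a morphism $Y(F)\to D$ of type-$m$ with respect to $(F,d_* )$, where $F$ denotes the constant sequence. *)

theory Defs
  imports "HOL-Algebra.Weak_Morphisms" "HOL-Library.FuncSet"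
begin

section \<open>Categories with additive structure, shift and triangles\<close>

text \<open>A category has a set of objects and a set of arrows; each arrow has one source and
  one target, so that different hom-sets are disjoint.  Outside of these carriers all the
  operations are arbitrary.\<close>

record ('o, 'm) cat =
  Obj :: "'o set"
  Arr :: "'m set"
  Src :: "'m \<Rightarrow> 'o"
  Tgt :: "'m \<Rightarrow> 'o"
  Ident :: "'o \<Rightarrow> 'm"
  Comp :: "'m \<Rightarrow> 'm \<Rightarrow> 'm"  (infixl "\<cdot>\<index>" 70)

record ('o, 'm) add_cat = "('o, 'm) cat" +
  Add :: "'m \<Rightarrow> 'm \<Rightarrow> 'm"
  ZeroArr :: "'o \<Rightarrow> 'o \<Rightarrow> 'm"

record ('o, 'm) shift_cat = "('o, 'm) add_cat" +
  ShO :: "'o \<Rightarrow> 'o"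
  ShA :: "'m \<Rightarrow> 'm"

text \<open>A triangle \<open>a \<rightarrow> b \<rightarrow> c \<rightarrow> \<Sigma> a\<close> is given by its three arrows.\<close>

record ('o, 'm) tri_cat = "('o, 'm) shift_cat" +
  Tri :: "('m \<times> 'm \<times> 'm) set"

definition Hom :: "('o, 'm, 'z) cat_scheme \<Rightarrow> 'o \<Rightarrow> 'o \<Rightarrow> 'm set" where
  "Hom C a b = {f \<in> Arr C. Src C f = a \<and> Tgt C f = b}"

locale category =
  fixes C :: "('o, 'm, 'z) cat_scheme" (structure)
  assumes Src_Obj: "f \<in> Arr C \<Longrightarrow> Src C f \<in> Obj C"
    and Tgt_Obj: "f \<in> Arr C \<Longrightarrow> Tgt C f \<in> Obj C"
    and Ident_Hom: "a \<in> Obj C \<Longrightarrow> Ident C a \<in> Hom C a a"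
    and Comp_Hom: "\<lbrakk>f \<in> Hom C a b; g \<in> Hom C b c\<rbrakk> \<Longrightarrow> g \<cdot> f \<in> Hom C a c"
    and Comp_Ident: "f \<in> Hom C a b \<Longrightarrow> f \<cdot> Ident C a = f"
    and Ident_Comp: "f \<in> Hom C a b \<Longrightarrow> Ident C b \<cdot> f = f"
    and Comp_assoc: "\<lbrakk>f \<in> Hom C a b; g \<in> Hom C b c; h \<in> Hom C c d\<rbrakk>
      \<Longrightarrow> (h \<cdot> g) \<cdot> f = h \<cdot> (g \<cdot> f)"

definition is_invertible :: "('o, 'm, 'z) cat_scheme \<Rightarrow> 'm \<Rightarrow> bool" where
  "is_invertible C f \<longleftrightarrow> f \<in> Arr C \<and> (\<exists>g \<in> Hom C (Tgt C f) (Src C f).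
     g \<cdot>\<^bsub>C\<^esub> f = Ident C (Src C f) \<and> f \<cdot>\<^bsub>C\<^esub> g = Ident C (Tgt C f))"

definition full_subcat :: "('o, 'm, 'z) cat_scheme \<Rightarrow> 'o set \<Rightarrow> ('o, 'm, 'z) cat_scheme" where
  "full_subcat C X = C\<lparr>Obj := X, Arr := {f \<in> Arr C. Src C f \<in> X \<and> Tgt C f \<in> X}\<rparr>"

definition op_cat :: "('o, 'm, 'z) cat_scheme \<Rightarrow> ('o, 'm) cat" where
  "op_cat C = \<lparr>Obj = Obj C, Arr = Arr C, Src = Tgt C, Tgt = Src C, Ident = Ident C,
     Comp = (\<lambda>g f. f \<cdot>\<^bsub>C\<^esub> g)\<rparr>"

definition is_functor :: "('o, 'm, 'z) cat_scheme \<Rightarrow> ('p, 'n, 'y) cat_scheme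
    \<Rightarrow> ('o \<Rightarrow> 'p) \<Rightarrow> ('m \<Rightarrow> 'n) \<Rightarrow> bool" where
  "is_functor C D Fo Fa \<longleftrightarrow>
     (\<forall>x \<in> Obj C. Fo x \<in> Obj D \<and> Fa (Ident C x) = Ident D (Fo x)) \<and>
     (\<forall>f \<in> Arr C. Fa f \<in> Hom D (Fo (Src C f)) (Fo (Tgt C f))) \<and>
     (\<forall>f \<in> Arr C. \<forall>g \<in> Arr C. Tgt C f = Src C g \<longrightarrow> Fa (g \<cdot>\<^bsub>C\<^esub> f) = Fa g \<cdot>\<^bsub>D\<^esub> Fa f)"

definition is_nat_iso :: "('o, 'm, 'z) cat_scheme \<Rightarrow> ('p, 'n, 'y) cat_scheme
    \<Rightarrow> ('o \<Rightarrow> 'p) \<Rightarrow> ('m \<Rightarrow> 'n) \<Rightarrow> ('o \<Rightarrow> 'p) \<Rightarrow> ('m \<Rightarrow> 'n) \<Rightarrow> ('o \<Rightarrow> 'n) \<Rightarrow> bool" where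
  "is_nat_iso C D Fo Fa Go Ga \<eta> \<longleftrightarrow>
     (\<forall>x \<in> Obj C. \<eta> x \<in> Hom D (Fo x) (Go x) \<and> is_invertible D (\<eta> x)) \<and>
     (\<forall>f \<in> Arr C. \<eta> (Tgt C f) \<cdot>\<^bsub>D\<^esub> Fa f = Ga f \<cdot>\<^bsub>D\<^esub> \<eta> (Src C f))"

definition is_equivalence :: "('o, 'm, 'z) cat_scheme \<Rightarrow> ('p, 'n, 'y) cat_scheme
    \<Rightarrow> ('o \<Rightarrow> 'p) \<Rightarrow> ('m \<Rightarrow> 'n) \<Rightarrow> bool" where
  "is_equivalence C D Fo Fa \<longleftrightarrow> is_functor C D Fo Fa \<and>
     (\<exists>Go Ga. is_functor D C Go Ga \<and>
        (\<exists>\<eta>. is_nat_iso C C id id (Go \<circ> Fo) (Ga \<circ> Fa) \<eta>) \<and>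
        (\<exists>\<epsilon>. is_nat_iso D D (Fo \<circ> Go) (Fa \<circ> Ga) id id \<epsilon>))"

definition hom_group :: "('o, 'm, 'z) add_cat_scheme \<Rightarrow> 'o \<Rightarrow> 'o \<Rightarrow> 'm monoid" where
  "hom_group C a b = \<lparr>carrier = Hom C a b, mult = Add C, one = ZeroArr C a b\<rparr>"

definition is_zero_obj :: "('o, 'm, 'z) add_cat_scheme \<Rightarrow> 'o \<Rightarrow> bool" where
  "is_zero_obj C z \<longleftrightarrow> z \<in> Obj C \<and> Ident C z = ZeroArr C z z"

locale additive_category = category C
  for C :: "('o, 'm, 'z) add_cat_scheme" (structure) +
  assumes hom_comm_group: "\<lbrakk>a \<in> Obj C; b \<in> Obj C\<rbrakk> \<Longrightarrow> comm_group (hom_group C a b)"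
    and Comp_Add: "\<lbrakk>f \<in> Hom C a b; f' \<in> Hom C a b; g \<in> Hom C b c\<rbrakk>
      \<Longrightarrow> g \<cdot> Add C f f' = Add C (g \<cdot> f) (g \<cdot> f')"
    and Add_Comp: "\<lbrakk>f \<in> Hom C a b; g \<in> Hom C b c; g' \<in> Hom C b c\<rbrakk>
      \<Longrightarrow> Add C g g' \<cdot> f = Add C (g \<cdot> f) (g' \<cdot> f)"
    and zero_obj: "\<exists>z. is_zero_obj C z"
    and biproduct: "\<lbrakk>a \<in> Obj C; b \<in> Obj C\<rbrakk> \<Longrightarrow>
      \<exists>s \<in> Obj C. \<exists>i \<in> Hom C a s. \<exists>j \<in> Hom C b s. \<exists>p \<in> Hom C s a. \<exists>q \<in> Hom C s b.
        p \<cdot> i = Ident C a \<and> q \<cdot> j = Ident C b \<and>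
        p \<cdot> j = ZeroArr C b a \<and> q \<cdot> i = ZeroArr C a b \<and>
        Add C (i \<cdot> p) (j \<cdot> q) = Ident C s"

text \<open>The shift of a triangulated category is an automorphism (not just a
  self-equivalence); \<open>UnO\<close> and \<open>UnA\<close> are its inverse on objects and arrows.\<close>

definition UnO :: "('o, 'm, 'z) shift_cat_scheme \<Rightarrow> 'o \<Rightarrow> 'o" where
  "UnO C = inv_into (Obj C) (ShO C)"

definition UnA :: "('o, 'm, 'z) shift_cat_scheme \<Rightarrow> 'm \<Rightarrow> 'm" where
  "UnA C = inv_into (Arr C) (ShA C)"

locale triangulated_category = additive_category C
  for C :: "('o, 'm, 'z) tri_cat_scheme" (structure) +
  assumes shift_functor: "is_functor C C (ShO C) (ShA C)"
    and shift_bij_Obj: "bij_betw (ShO C) (Obj C) (Obj C)"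
    and shift_bij_Arr: "bij_betw (ShA C) (Arr C) (Arr C)"
    and shift_Add: "\<lbrakk>f \<in> Hom C a b; f' \<in> Hom C a b\<rbrakk>
      \<Longrightarrow> ShA C (Add C f f') = Add C (ShA C f) (ShA C f')"
    and Tri_arrows: "(f, g, h) \<in> Tri C \<Longrightarrow>
      f \<in> Arr C \<and> g \<in> Hom C (Tgt C f) (Src C h) \<and> h \<in> Hom C (Tgt C g) (ShO C (Src C f))"
    and Tri_iso: "\<lbrakk>(f, g, h) \<in> Tri C;
        u \<in> Hom C (Src C f) (Src C f'); v \<in> Hom C (Src C g) (Src C g');
        w \<in> Hom C (Src C h) (Src C h'); is_invertible C u; is_invertible C v; is_invertible C w;
        f' \<in> Hom C (Src C f') (Src C g'); g' \<in> Hom C (Src C g') (Src C h');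
        h' \<in> Hom C (Src C h') (ShO C (Src C f'));
        v \<cdot> f = f' \<cdot> u; w \<cdot> g = g' \<cdot> v; ShA C u \<cdot> h = h' \<cdot> w\<rbrakk>
      \<Longrightarrow> (f', g', h') \<in> Tri C"
    and TR1_ident: "\<lbrakk>a \<in> Obj C; is_zero_obj C z\<rbrakk>
      \<Longrightarrow> (Ident C a, ZeroArr C a z, ZeroArr C z (ShO C a)) \<in> Tri C"
    and TR1_cone: "f \<in> Arr C \<Longrightarrow> \<exists>g h. (f, g, h) \<in> Tri C"
    and TR2: "\<lbrakk>f \<in> Hom C a b; g \<in> Hom C b c; h \<in> Hom C c (ShO C a)\<rbrakk> \<Longrightarrow>
      (f, g, h) \<in> Tri C \<longleftrightarrow>
      (g, h, inv\<^bsub>hom_group C (ShO C a) (ShO C b)\<^esub> (ShA C f)) \<in> Tri C"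
    and TR3: "\<lbrakk>(f, g, h) \<in> Tri C; (f', g', h') \<in> Tri C;
        u \<in> Hom C (Src C f) (Src C f'); v \<in> Hom C (Src C g) (Src C g'); v \<cdot> f = f' \<cdot> u\<rbrakk>
      \<Longrightarrow> \<exists>w \<in> Hom C (Src C h) (Src C h'). w \<cdot> g = g' \<cdot> v \<and> ShA C u \<cdot> h = h' \<cdot> w"
    and TR4: "\<lbrakk>f \<in> Hom C x y; g \<in> Hom C y z;
        (f, i, i') \<in> Tri C; (g, j, j') \<in> Tri C; (g \<cdot> f, k, k') \<in> Tri C\<rbrakk>
      \<Longrightarrow> \<exists>u v. u \<in> Hom C (Src C i') (Src C k') \<and> v \<in> Hom C (Src C k') (Src C j') \<and>
            u \<cdot> i = k \<cdot> g \<and> k' \<cdot> u = i' \<and> v \<cdot> k = j \<and> j' \<cdot> v = ShA C f \<cdot> k' \<and>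
            (u, v, ShA C i \<cdot> j') \<in> Tri C"

definition op_tri :: "('o, 'm, 'z) tri_cat_scheme \<Rightarrow> ('o, 'm) tri_cat" where
  "op_tri C = \<lparr>Obj = Obj C, Arr = Arr C, Src = Tgt C, Tgt = Src C, Ident = Ident C,
     Comp = (\<lambda>g f. f \<cdot>\<^bsub>C\<^esub> g), Add = Add C, ZeroArr = (\<lambda>x y. ZeroArr C y x),
     ShO = UnO C, ShA = UnA C, Tri = {(f, g, h). (h, g, f) \<in> Tri C}\<rparr>"


section \<open>Metrics and Cauchy sequences\<close>

text \<open>Full subcategories are given by their sets of objects.\<close>

definition star :: "('o, 'm, 'z) tri_cat_scheme \<Rightarrow> 'o set \<Rightarrow> 'o set \<Rightarrow> 'o set" where
  "star C A B = {b. \<exists>f g h. (f, g, h) \<in> Tri C \<and> Src C f \<in> A \<and> Tgt C f = b \<and> Tgt C g \<in> B}"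

definition right_perp :: "('o, 'm, 'z) add_cat_scheme \<Rightarrow> 'o set \<Rightarrow> 'o set" where
  "right_perp C A = {b \<in> Obj C. \<forall>a \<in> A. Hom C a b = {ZeroArr C a b}}"

definition left_perp :: "('o, 'm, 'z) add_cat_scheme \<Rightarrow> 'o set \<Rightarrow> 'o set" where
  "left_perp C A = {b \<in> Obj C. \<forall>a \<in> A. Hom C b a = {ZeroArr C b a}}"

locale good_metric =
  fixes C :: "('o, 'm, 'z) tri_cat_scheme" and M :: "nat \<Rightarrow> 'o set"
  assumes metric_Obj: "M i \<subseteq> Obj C"
    and metric_zero: "\<exists>z \<in> M i. is_zero_obj C z"
    and metric_shift: "UnO C ` M (Suc i) \<union> M (Suc i) \<union> ShO C ` M (Suc i) \<subseteq> M i"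
    and metric_star: "star C (M i) (M i) \<subseteq> M i"

text \<open>A sequence \<open>E\<^sub>0 \<rightarrow> E\<^sub>1 \<rightarrow> \<dots>\<close> is given by its connecting arrows, so that
  \<open>E\<^sub>n = Src C (E n)\<close>.  The arrow \<open>transition C E j k\<close> is the composite
  \<open>E\<^sub>j \<rightarrow> E\<^sub>k\<close>; it is meaningful for \<open>j \<le> k\<close>.\<close>

definition is_seq :: "('o, 'm, 'z) cat_scheme \<Rightarrow> (nat \<Rightarrow> 'm) \<Rightarrow> bool" where
  "is_seq C E \<longleftrightarrow> (\<forall>n. E n \<in> Arr C \<and> Tgt C (E n) = Src C (E (Suc n)))"

primrec seq_comp :: "('o, 'm, 'z) cat_scheme \<Rightarrow> (nat \<Rightarrow> 'm) \<Rightarrow> nat \<Rightarrow> nat \<Rightarrow> 'm" where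
  "seq_comp C E j 0 = Ident C (Src C (E j))"
| "seq_comp C E j (Suc d) = E (j + d) \<cdot>\<^bsub>C\<^esub> seq_comp C E j d"

definition transition :: "('o, 'm, 'z) cat_scheme \<Rightarrow> (nat \<Rightarrow> 'm) \<Rightarrow> nat \<Rightarrow> nat \<Rightarrow> 'm" where
  "transition C E j k = seq_comp C E j (k - j)"

definition subsequence :: "('o, 'm, 'z) cat_scheme \<Rightarrow> (nat \<Rightarrow> 'm) \<Rightarrow> (nat \<Rightarrow> nat) \<Rightarrow> nat \<Rightarrow> 'm" where
  "subsequence C E r = (\<lambda>n. transition C E (r n) (r (Suc n)))"

definition const_seq :: "('o, 'm, 'z) cat_scheme \<Rightarrow> 'o \<Rightarrow> nat \<Rightarrow> 'm" where
  "const_seq C x = (\<lambda>n. Ident C x)"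

definition seq_map :: "('o, 'm, 'z) cat_scheme \<Rightarrow> (nat \<Rightarrow> 'm) \<Rightarrow> (nat \<Rightarrow> 'm) \<Rightarrow> (nat \<Rightarrow> 'm) \<Rightarrow> bool" where
  "seq_map C a b f \<longleftrightarrow> (\<forall>n. f n \<in> Hom C (Src C (a n)) (Src C (b n)) \<and>
     f (Suc n) \<cdot>\<^bsub>C\<^esub> a n = b n \<cdot>\<^bsub>C\<^esub> f n)"

definition cone_in :: "('o, 'm, 'z) tri_cat_scheme \<Rightarrow> 'm \<Rightarrow> 'o set \<Rightarrow> bool" where
  "cone_in C f X \<longleftrightarrow> (\<exists>g h. (f, g, h) \<in> Tri C \<and> Tgt C g \<in> X)"

definition cauchy :: "('o, 'm, 'z) tri_cat_scheme \<Rightarrow> (nat \<Rightarrow> 'o set) \<Rightarrow> (nat \<Rightarrow> 'm) \<Rightarrow> bool" where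
  "cauchy C M E \<longleftrightarrow> is_seq C E \<and>
     (\<forall>i. \<exists>N. \<forall>j\<ge>N. \<forall>k>j. cone_in C (transition C E j k) (M i))"

definition cauchy_triangles :: "('o, 'm, 'z) tri_cat_scheme \<Rightarrow> (nat \<Rightarrow> 'o set)
    \<Rightarrow> (nat \<Rightarrow> 'm) \<Rightarrow> (nat \<Rightarrow> 'm) \<Rightarrow> (nat \<Rightarrow> 'm)
    \<Rightarrow> (nat \<Rightarrow> 'm) \<Rightarrow> (nat \<Rightarrow> 'm) \<Rightarrow> (nat \<Rightarrow> 'm) \<Rightarrow> bool" where
  "cauchy_triangles C M a b c f g h \<longleftrightarrow>
     cauchy C M a \<and> cauchy C M b \<and> cauchy C M c \<and>
     seq_map C a b f \<and> seq_map C b c g \<and> seq_map C c (\<lambda>n. ShA C (a n)) h \<and>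
     (\<forall>n. (f n, g n, h n) \<in> Tri C)"

definition is_cocone :: "('o, 'm, 'z) cat_scheme \<Rightarrow> (nat \<Rightarrow> 'm) \<Rightarrow> 'o \<Rightarrow> (nat \<Rightarrow> 'm) \<Rightarrow> bool" where
  "is_cocone C E A \<kappa> \<longleftrightarrow> A \<in> Obj C \<and>
     (\<forall>n. \<kappa> n \<in> Hom C (Src C (E n)) A \<and> \<kappa> (Suc n) \<cdot>\<^bsub>C\<^esub> E n = \<kappa> n)"

definition is_colim :: "('o, 'm, 'z) cat_scheme \<Rightarrow> (nat \<Rightarrow> 'm) \<Rightarrow> 'o \<Rightarrow> (nat \<Rightarrow> 'm) \<Rightarrow> bool" where
  "is_colim C E A \<kappa> \<longleftrightarrow> is_cocone C E A \<kappa> \<and>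
     (\<forall>B \<mu>. is_cocone C E B \<mu> \<longrightarrow> (\<exists>!u. u \<in> Hom C A B \<and> (\<forall>n. u \<cdot>\<^bsub>C\<^esub> \<kappa> n = \<mu> n)))"


section \<open>The category of modules and the Yoneda embedding\<close>

text \<open>An object of \<open>ModCat C\<close> is an additive functor from the opposite of \<open>C\<close> to the abelian
  groups whose carrier is a subset of the type \<open>'u\<close>, which plays the role of the universe of
  sets.  Abelian groups are written multiplicatively, as in HOL-Algebra.  Values of functors
  and of natural transformations outside of their domains are normalised to \<open>undefined\<close>.\<close>

record ('o, 'm, 'u) presheaf =
  FunO :: "'o \<Rightarrow> 'u monoid"
  FunA :: "'m \<Rightarrow> 'u \<Rightarrow> 'u"

record ('o, 'm, 'u) presheaf_map =
  MSrc :: "('o, 'm, 'u) presheaf"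
  MTgt :: "('o, 'm, 'u) presheaf"
  At :: "'o \<Rightarrow> 'u \<Rightarrow> 'u"

definition is_module :: "('o, 'm, 'z) add_cat_scheme \<Rightarrow> ('o, 'm, 'u) presheaf \<Rightarrow> bool" where
  "is_module C F \<longleftrightarrow>
     FunO F \<in> extensional (Obj C) \<and> FunA F \<in> extensional (Arr C) \<and>
     (\<forall>x \<in> Obj C. comm_group (FunO F x)) \<and>
     (\<forall>f \<in> Arr C. FunA F f \<in> hom (FunO F (Tgt C f)) (FunO F (Src C f)) \<and>
                  FunA F f \<in> extensional (carrier (FunO F (Tgt C f)))) \<and>
     (\<forall>x \<in> Obj C. \<forall>u \<in> carrier (FunO F x). FunA F (Ident C x) u = u) \<and>
     (\<forall>f \<in> Arr C. \<forall>g \<in> Arr C. Tgt C f = Src C g \<longrightarrow>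
        (\<forall>u \<in> carrier (FunO F (Tgt C g)). FunA F (g \<cdot>\<^bsub>C\<^esub> f) u = FunA F f (FunA F g u))) \<and>
     (\<forall>f \<in> Arr C. \<forall>g \<in> Hom C (Src C f) (Tgt C f). \<forall>u \<in> carrier (FunO F (Tgt C f)).
        FunA F (Add C f g) u = FunA F f u \<otimes>\<^bsub>FunO F (Src C f)\<^esub> FunA F g u)"

definition is_module_map :: "('o, 'm, 'z) add_cat_scheme \<Rightarrow> ('o, 'm, 'u) presheaf_map \<Rightarrow> bool" where
  "is_module_map C \<eta> \<longleftrightarrow>
     is_module C (MSrc \<eta>) \<and> is_module C (MTgt \<eta>) \<and> At \<eta> \<in> extensional (Obj C) \<and>
     (\<forall>x \<in> Obj C. At \<eta> x \<in> hom (FunO (MSrc \<eta>) x) (FunO (MTgt \<eta>) x) \<and>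
                  At \<eta> x \<in> extensional (carrier (FunO (MSrc \<eta>) x))) \<and>
     (\<forall>f \<in> Arr C. \<forall>u \<in> carrier (FunO (MSrc \<eta>) (Tgt C f)).
        FunA (MTgt \<eta>) f (At \<eta> (Tgt C f) u) = At \<eta> (Src C f) (FunA (MSrc \<eta>) f u))"

text \<open>The shift of \<open>F\<close> is \<open>F \<circ> \<Sigma>\<^sup>-\<^sup>1\<close>.\<close>

definition ModCat :: "('o, 'm, 'z) shift_cat_scheme
    \<Rightarrow> (('o, 'm, 'u) presheaf, ('o, 'm, 'u) presheaf_map) shift_cat" where
  "ModCat C =
    (let shift = (\<lambda>F. \<lparr>FunO = (\<lambda>x \<in> Obj C. FunO F (UnO C x)),
                       FunA = (\<lambda>f \<in> Arr C. FunA F (UnA C f))\<rparr>)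
     in \<lparr>Obj = {F. is_module C F}, Arr = {\<eta>. is_module_map C \<eta>}, Src = MSrc, Tgt = MTgt,
         Ident = (\<lambda>F. \<lparr>MSrc = F, MTgt = F, At = (\<lambda>x \<in> Obj C. \<lambda>u \<in> carrier (FunO F x). u)\<rparr>),
         Comp = (\<lambda>\<eta> \<theta>. \<lparr>MSrc = MSrc \<theta>, MTgt = MTgt \<eta>,
           At = (\<lambda>x \<in> Obj C. \<lambda>u \<in> carrier (FunO (MSrc \<theta>) x). At \<eta> x (At \<theta> x u))\<rparr>),
         Add = (\<lambda>\<eta> \<theta>. \<lparr>MSrc = MSrc \<eta>, MTgt = MTgt \<eta>,
           At = (\<lambda>x \<in> Obj C. \<lambda>u \<in> carrier (FunO (MSrc \<eta>) x).
                   At \<eta> x u \<otimes>\<^bsub>FunO (MTgt \<eta>) x\<^esub> At \<theta> x u)\<rparr>),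
         ZeroArr = (\<lambda>F G. \<lparr>MSrc = F, MTgt = G,
           At = (\<lambda>x \<in> Obj C. \<lambda>u \<in> carrier (FunO F x). \<one>\<^bsub>FunO G x\<^esub>)\<rparr>),
         ShO = shift,
         ShA = (\<lambda>\<eta>. \<lparr>MSrc = shift (MSrc \<eta>), MTgt = shift (MTgt \<eta>),
           At = (\<lambda>x \<in> Obj C. At \<eta> (UnO C x))\<rparr>)\<rparr>)"

text \<open>An injection \<open>e\<close> from the type of arrows into the universe makes \<open>Hom(a, b)\<close> a group
  in that universe: its carrier is the image of \<open>Hom(a, b)\<close> under \<open>e\<close>.  If moreover the
  universe is infinite, then it contains a copy of every sequential colimit of groups in it, so
  that \<open>ModCat C\<close> has all sequential colimits and they are computed objectwise.\<close>

definition hom_in :: "('m \<Rightarrow> 'u) \<Rightarrow> ('o, 'm, 'z) add_cat_scheme \<Rightarrow> 'o \<Rightarrow> 'o \<Rightarrow> 'u monoid" where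
  "hom_in e C a b = image_group e (hom_group C a b)"

abbreviation decode :: "('m \<Rightarrow> 'u) \<Rightarrow> 'u \<Rightarrow> 'm" where
  "decode e \<equiv> inv_into UNIV e"

definition YonO :: "('m \<Rightarrow> 'u) \<Rightarrow> ('o, 'm, 'z) add_cat_scheme \<Rightarrow> 'o \<Rightarrow> ('o, 'm, 'u) presheaf" where
  "YonO e C x = \<lparr>FunO = (\<lambda>a \<in> Obj C. hom_in e C a x),
     FunA = (\<lambda>f \<in> Arr C. \<lambda>u \<in> carrier (hom_in e C (Tgt C f) x). e (decode e u \<cdot>\<^bsub>C\<^esub> f))\<rparr>"

definition YonA :: "('m \<Rightarrow> 'u) \<Rightarrow> ('o, 'm, 'z) add_cat_scheme \<Rightarrow> 'm \<Rightarrow> ('o, 'm, 'u) presheaf_map" where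
  "YonA e C f = \<lparr>MSrc = YonO e C (Src C f), MTgt = YonO e C (Tgt C f),
     At = (\<lambda>a \<in> Obj C. \<lambda>u \<in> carrier (hom_in e C a (Src C f)). e (f \<cdot>\<^bsub>C\<^esub> decode e u))\<rparr>"

text \<open>The canonical isomorphism \<open>Y(\<Sigma> x) \<rightarrow> \<Sigma> Y(x)\<close>, given on \<open>a\<close> by
  \<open>\<Sigma>\<^sup>-\<^sup>1 : Hom(a, \<Sigma> x) \<rightarrow> Hom(\<Sigma>\<^sup>-\<^sup>1 a, x)\<close>.\<close>

definition Yon_shift :: "('m \<Rightarrow> 'u) \<Rightarrow> ('o, 'm, 'z) shift_cat_scheme \<Rightarrow> 'o \<Rightarrow> ('o, 'm, 'u) presheaf_map" where
  "Yon_shift e C x = \<lparr>MSrc = YonO e C (ShO C x), MTgt = ShO (ModCat C) (YonO e C x),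
     At = (\<lambda>a \<in> Obj C. \<lambda>u \<in> carrier (hom_in e C a (ShO C x)). e (UnA C (decode e u)))\<rparr>"


section \<open>The completion with respect to a metric\<close>

text \<open>\<open>A\<close> is a colimit of \<open>Y(E)\<close> with colimit cocone \<open>\<kappa>\<close>.  Colimits are determined up to
  isomorphism only, so all objects isomorphic to a given colimit are included.\<close>

definition Yon_colim :: "('m \<Rightarrow> 'u) \<Rightarrow> ('o, 'm, 'z) shift_cat_scheme \<Rightarrow> (nat \<Rightarrow> 'm)
    \<Rightarrow> ('o, 'm, 'u) presheaf \<Rightarrow> (nat \<Rightarrow> ('o, 'm, 'u) presheaf_map) \<Rightarrow> bool" where
  "Yon_colim e C E A \<kappa> \<longleftrightarrow> is_colim (ModCat C) (\<lambda>n. YonA e C (E n)) A \<kappa>"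

definition LObj :: "('m \<Rightarrow> 'u) \<Rightarrow> ('o, 'm, 'z) tri_cat_scheme \<Rightarrow> (nat \<Rightarrow> 'o set)
    \<Rightarrow> ('o, 'm, 'u) presheaf set" where
  "LObj e C M = {A. \<exists>E \<kappa>. cauchy C M E \<and> Yon_colim e C E A \<kappa>}"

definition LiObj :: "('m \<Rightarrow> 'u) \<Rightarrow> ('o, 'm, 'z) tri_cat_scheme \<Rightarrow> (nat \<Rightarrow> 'o set)
    \<Rightarrow> nat \<Rightarrow> ('o, 'm, 'u) presheaf set" where
  "LiObj e C M i = {A. \<exists>E \<kappa>. cauchy C M E \<and> (\<forall>n. Src C (E n) \<in> M i) \<and> Yon_colim e C E A \<kappa>}"

definition SObj :: "('m \<Rightarrow> 'u) \<Rightarrow> ('o, 'm, 'z) tri_cat_scheme \<Rightarrow> (nat \<Rightarrow> 'o set)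
    \<Rightarrow> ('o, 'm, 'u) presheaf set" where
  "SObj e C M = LObj e C M \<inter> (\<Union>i. right_perp (ModCat C) (YonO e C ` M i))"

text \<open>\<open>F\<close>, \<open>G\<close> and \<open>H\<close> are the maps induced on colimits by \<open>Y(f)\<close>, \<open>Y(g)\<close> and
  \<open>Y(h)\<close>, where \<open>Y(\<Sigma> a\<^sub>n)\<close> is identified with \<open>\<Sigma> Y(a\<^sub>n)\<close>.\<close>

definition strong_triangles :: "('m \<Rightarrow> 'u) \<Rightarrow> ('o, 'm, 'z) tri_cat_scheme \<Rightarrow> (nat \<Rightarrow> 'o set)
    \<Rightarrow> (('o, 'm, 'u) presheaf_map \<times> ('o, 'm, 'u) presheaf_map \<times> ('o, 'm, 'u) presheaf_map) set" where
  "strong_triangles e C M = {(F, G, H). \<exists>a b c f g h A \<alpha> B \<beta> D \<gamma>.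
     cauchy_triangles C M a b c f g h \<and>
     Yon_colim e C a A \<alpha> \<and> Yon_colim e C b B \<beta> \<and> Yon_colim e C c D \<gamma> \<and>
     F \<in> Hom (ModCat C) A B \<and> G \<in> Hom (ModCat C) B D \<and> H \<in> Hom (ModCat C) D (ShO (ModCat C) A) \<and>
     (\<forall>n. F \<cdot>\<^bsub>ModCat C\<^esub> \<alpha> n = \<beta> n \<cdot>\<^bsub>ModCat C\<^esub> YonA e C (f n) \<and>
          G \<cdot>\<^bsub>ModCat C\<^esub> \<beta> n = \<gamma> n \<cdot>\<^bsub>ModCat C\<^esub> YonA e C (g n) \<and>
          H \<cdot>\<^bsub>ModCat C\<^esub> \<gamma> n =
            ShA (ModCat C) (\<alpha> n) \<cdot>\<^bsub>ModCat C\<^esub> (Yon_shift e C (Src C (a n)) \<cdot>\<^bsub>ModCat C\<^esub> YonA e C (h n)))}"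

definition SCat :: "('m \<Rightarrow> 'u) \<Rightarrow> ('o, 'm, 'z) tri_cat_scheme \<Rightarrow> (nat \<Rightarrow> 'o set)
    \<Rightarrow> (('o, 'm, 'u) presheaf, ('o, 'm, 'u) presheaf_map) tri_cat" where
  "SCat e C M = shift_cat.extend (full_subcat (ModCat C) (SObj e C M))
     (tri_cat.fields {(F, G, H) \<in> strong_triangles e C M.
        MSrc F \<in> SObj e C M \<and> MSrc G \<in> SObj e C M \<and> MSrc H \<in> SObj e C M})"

definition SMetric :: "('m \<Rightarrow> 'u) \<Rightarrow> ('o, 'm, 'z) tri_cat_scheme \<Rightarrow> (nat \<Rightarrow> 'o set)
    \<Rightarrow> nat \<Rightarrow> ('o, 'm, 'u) presheaf set" where
  "SMetric e C M i = LiObj e C M i \<inter> SObj e C M"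

text \<open>Here \<open>\<alpha>\<close> and \<open>\<beta>\<close> are the colimit cocones exhibiting the source and the target
  of \<open>G\<close> as \<open>colim Y(a)\<close> and \<open>colim Y(b)\<close>.\<close>

definition type_n :: "('m \<Rightarrow> 'u) \<Rightarrow> ('o, 'm, 'z) tri_cat_scheme \<Rightarrow> (nat \<Rightarrow> 'o set) \<Rightarrow> nat
    \<Rightarrow> (nat \<Rightarrow> 'm) \<Rightarrow> (nat \<Rightarrow> ('o, 'm, 'u) presheaf_map)
    \<Rightarrow> (nat \<Rightarrow> 'm) \<Rightarrow> (nat \<Rightarrow> ('o, 'm, 'u) presheaf_map)
    \<Rightarrow> ('o, 'm, 'u) presheaf_map \<Rightarrow> bool" where
  "type_n e C M n a \<alpha> b \<beta> G \<longleftrightarrow>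
     (\<exists>r s f. strict_mono r \<and> strict_mono s \<and> seq_map C (subsequence C a r) (subsequence C b s) f \<and>
        (\<forall>i. G \<cdot>\<^bsub>ModCat C\<^esub> \<alpha> (r i) = \<beta> (s i) \<cdot>\<^bsub>ModCat C\<^esub> YonA e C (f i)) \<and>
        (\<exists>N. \<forall>i\<ge>N. cone_in C (f i) (M n)))"

text \<open>The constant sequence on \<open>F\<close> has colimit \<open>Y(F)\<close>, with all the maps of the colimit
  cocone being identities.\<close>

locale excellent_metric = good_metric C M
  for C :: "('o, 'm, 'z) tri_cat_scheme" and M :: "nat \<Rightarrow> 'o set" +
  fixes e :: "'m \<Rightarrow> 'u"
  assumes excellent_a: "Obj C = (\<Union>i. left_perp C (M i))"
    and excellent_b: "\<exists>n>m. \<forall>F \<in> Obj C. \<exists>f g h. (f, g, h) \<in> Tri C \<and>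
      Src C f \<in> left_perp C (M n) \<and> Tgt C f = F \<and> Tgt C g \<in> M m"
    and excellent_c: "\<exists>n>m. \<forall>F \<in> Obj C. \<exists>d D \<delta> G.
      cauchy C M d \<and> Yon_colim e C d D \<delta> \<and>
      D \<in> SObj e C M \<inter> right_perp (ModCat C) (LiObj e C M n) \<and>
      G \<in> Hom (ModCat C) (YonO e C F) D \<and>
      type_n e C M m (const_seq C F) (\<lambda>i. Ident (ModCat C) (YonO e C F)) d \<delta> G"


section \<open>The restricted Yoneda functor on the opposite category\<close>

text \<open>For a full subcategory of \<open>D\<close> with set of objects \<open>X\<close>, the functor sending
  \<open>m\<close> in the opposite of \<open>D\<close> to \<open>Hom(m, -)\<close> restricted to \<open>X\<close>, a module over the opposite
  of that subcategory.\<close>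

definition YhatO :: "('m \<Rightarrow> 'u) \<Rightarrow> ('o, 'm, 'z) add_cat_scheme \<Rightarrow> 'o set \<Rightarrow> 'o
    \<Rightarrow> ('o, 'm, 'u) presheaf" where
  "YhatO e D X m = \<lparr>FunO = (\<lambda>x \<in> X. hom_in e D m x),
     FunA = (\<lambda>g \<in> Arr (full_subcat D X). \<lambda>u \<in> carrier (hom_in e D m (Src D g)).
               e (g \<cdot>\<^bsub>D\<^esub> decode e u))\<rparr>"

definition YhatA :: "('m \<Rightarrow> 'u) \<Rightarrow> ('o, 'm, 'z) add_cat_scheme \<Rightarrow> 'o set \<Rightarrow> 'm
    \<Rightarrow> ('o, 'm, 'u) presheaf_map" where
  "YhatA e D X f = \<lparr>MSrc = YhatO e D X (Tgt D f), MTgt = YhatO e D X (Src D f),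
     At = (\<lambda>x \<in> X. \<lambda>u \<in> carrier (hom_in e D (Tgt D f) x). e (decode e u \<cdot>\<^bsub>D\<^esub> f))\<rparr>"

text \<open>The canonical isomorphism from \<open>Hom(m, -)\<close> to the shift of \<open>Hom(\<Sigma> m, -)\<close>, given on
  \<open>x\<close> by \<open>\<Sigma> : Hom(m, x) \<rightarrow> Hom(\<Sigma> m, \<Sigma> x)\<close>.  The shift is that of modules over the category
  \<open>B\<close>, the opposite of the full subcategory of \<open>D\<close> on \<open>X\<close>; since \<open>B\<close> has shift \<open>\<Sigma>\<^sup>-\<^sup>1\<close>, the
  shift of \<open>N\<close> is \<open>N \<circ> \<Sigma>\<close>.\<close>

definition Yhat_shift :: "('m \<Rightarrow> 'u) \<Rightarrow> ('o, 'm, 'z) shift_cat_scheme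
    \<Rightarrow> ('o, 'm, 'y) shift_cat_scheme \<Rightarrow> 'o set \<Rightarrow> 'o \<Rightarrow> ('o, 'm, 'u) presheaf_map" where
  "Yhat_shift e B D X m = \<lparr>MSrc = YhatO e D X m, MTgt = ShO (ModCat B) (YhatO e D X (ShO D m)),
     At = (\<lambda>x \<in> X. \<lambda>u \<in> carrier (hom_in e D m x). e (ShA D (decode e u)))\<rparr>"

end

theory Submission
  imports Defs
begin

text \<open>Through the Yoneda lemma a colimit of \<open>Y(E)\<close> is a module \<open>A\<close> with compatible elements
  \<open>t n \<in> A(E n)\<close>, and a map from it into a compactly supported object is determined by, and can be
  prescribed on, one late stage of \<open>E\<close>.  Axiom (c) then yields, for each \<open>A\<close>, an inverse system of objects of
  the completion under \<open>A\<close>: a map of large type induces bijections on \<open>Hom(-, x)\<close> for a fixed compactly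
  supported \<open>x\<close> and, by axiom (a), on evaluation at a fixed object of the category.  So \<open>A\<close> is the pointwise
  limit of the system, while \<open>Hom(A, -)\<close> is the colimit of the functors it represents; this gives full
  faithfulness.  Conversely, axiom (b) approximates the terms of a Cauchy inverse system by objects of the
  category, which map to one another and form a Cauchy sequence with the required colimit.  A strong triangle
  is approximated termwise by completing maps between approximations of its first two vertices.\<close>

section \<open>Categories\<close>

text \<open>Two obstacles shape the argument. First, only \<open>M (Suc i)\<close> shifts into
  \<open>M i\<close>. Composing maps with cone in \<open>M n\<close> costs nothing, but cancelling a
  factor costs one index; every estimate carries this loss, and the bounds \<open>m k\<close> and
  \<open>n k\<close> of a tower are interleaved so as to absorb it. Second, the classes
  \<open>M i\<close> are closed under extensions but not assumed closed under direct summands.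
  Having cones in \<open>M i\<close> is therefore a property of a map of colimits together with
  presentations of its two ends: presentations are carried along as data, and where a connecting map
  only has small cones for a suitable presentation, that presentation is constructed. For the same
  reason TR3 is replaced by a fill-in composed from two octahedra, whose cone can be bounded. In the
  opposite of the completion a cone is a fibre of the original map, so fibres of maps of given type
  have to be produced as strong triangles. Triangles of the completion are handled through the exact
  sequences of their values at the objects of the category.\<close>

lemma Hom_Arr: "f \<in> Hom C a b \<Longrightarrow> f \<in> Arr C"
  and Hom_Src: "f \<in> Hom C a b \<Longrightarrow> Src C f = a"
  and Hom_Tgt: "f \<in> Hom C a b \<Longrightarrow> Tgt C f = b"
  by (simp_all add: Hom_def)

lemma Arr_Hom: "f \<in> Arr C \<Longrightarrow> f \<in> Hom C (Src C f) (Tgt C f)"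
  by (simp add: Hom_def)

lemma (in category) Hom_Obj: "f \<in> Hom C a b \<Longrightarrow> a \<in> Obj C" "f \<in> Hom C a b \<Longrightarrow> b \<in> Obj C"
  using Src_Obj Tgt_Obj by (auto simp: Hom_def)

lemma full_subcat_simps [simp]:
  "Obj (full_subcat C X) = X"
  "Arr (full_subcat C X) = {f \<in> Arr C. Src C f \<in> X \<and> Tgt C f \<in> X}"
  "Src (full_subcat C X) = Src C" "Tgt (full_subcat C X) = Tgt C"
  "Ident (full_subcat C X) = Ident C" "Comp (full_subcat C X) = Comp C"
  by (simp_all add: full_subcat_def)

lemma full_subcat_simps_add [simp]:
  "Add (full_subcat C X) = Add C" "ZeroArr (full_subcat C X) = ZeroArr C"
  by (simp_all add: full_subcat_def)

lemma full_subcat_simps_shift [simp]: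
  "ShO (full_subcat C X) = ShO C" "ShA (full_subcat C X) = ShA C"
  by (simp_all add: full_subcat_def)

lemma Hom_full_subcat: "Hom (full_subcat C X) a b = (if a \<in> X \<and> b \<in> X then Hom C a b else {})"
  by (auto simp: Hom_def)

lemma op_cat_simps [simp]:
  "Obj (op_cat C) = Obj C" "Arr (op_cat C) = Arr C" "Src (op_cat C) = Tgt C" "Tgt (op_cat C) = Src C"
  "Ident (op_cat C) = Ident C" "Comp (op_cat C) g f = f \<cdot>\<^bsub>C\<^esub> g"
  by (simp_all add: op_cat_def)

lemma Hom_op_cat: "Hom (op_cat C) a b = Hom C b a"
  by (auto simp: Hom_def)

lemma (in category) category_op_cat: "category (op_cat C)"
  by unfold_locales (simp_all add: Hom_op_cat Src_Obj Tgt_Obj Ident_Hom Comp_Hom Comp_Ident Ident_Comp Comp_assoc)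

lemma (in category) category_full_subcat:
  assumes "X \<subseteq> Obj C" shows "category (full_subcat C X)"
proof
  fix f assume "f \<in> Arr (full_subcat C X)"
  then show "Src (full_subcat C X) f \<in> Obj (full_subcat C X)"
    "Tgt (full_subcat C X) f \<in> Obj (full_subcat C X)" by auto
next
  fix a assume "a \<in> Obj (full_subcat C X)"
  then show "Ident (full_subcat C X) a \<in> Hom (full_subcat C X) a a"
    using assms Ident_Hom by (auto simp: Hom_full_subcat)
next
  fix f g a b c assume "f \<in> Hom (full_subcat C X) a b" "g \<in> Hom (full_subcat C X) b c"
  then show "g \<cdot>\<^bsub>full_subcat C X\<^esub> f \<in> Hom (full_subcat C X) a c"
    by (auto simp: Hom_full_subcat Comp_Hom split: if_splits)
next
  fix f a b assume "f \<in> Hom (full_subcat C X) a b"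
  then show "f \<cdot>\<^bsub>full_subcat C X\<^esub> Ident (full_subcat C X) a = f"
    "Ident (full_subcat C X) b \<cdot>\<^bsub>full_subcat C X\<^esub> f = f"
    by (auto simp: Hom_full_subcat Comp_Ident Ident_Comp split: if_splits)
next
  fix f g h a b c d assume "f \<in> Hom (full_subcat C X) a b" "g \<in> Hom (full_subcat C X) b c"
    "h \<in> Hom (full_subcat C X) c d"
  then show "(h \<cdot>\<^bsub>full_subcat C X\<^esub> g) \<cdot>\<^bsub>full_subcat C X\<^esub> f =
    h \<cdot>\<^bsub>full_subcat C X\<^esub> (g \<cdot>\<^bsub>full_subcat C X\<^esub> f)"
    by (auto simp: Hom_full_subcat Comp_assoc split: if_splits)
qed

lemma (in category) is_invertibleI:
  assumes "f \<in> Hom C a b" "g \<in> Hom C b a" "g \<cdot> f = Ident C a" "f \<cdot> g = Ident C b"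
  shows "is_invertible C f"
  using assms unfolding is_invertible_def Hom_def by auto

lemma (in category) is_invertibleE:
  assumes "is_invertible C f" "f \<in> Hom C a b"
  obtains g where "g \<in> Hom C b a" "g \<cdot> f = Ident C a" "f \<cdot> g = Ident C b"
  using assms unfolding is_invertible_def Hom_def by auto

text \<open>\<open>is_equivalence\<close> asks for an explicit quasi-inverse. Objects
  \<open>Go y\<close> with isomorphisms \<open>i y\<close> are chosen, and \<open>Ga g\<close> is
  the unique preimage of the conjugate of \<open>g\<close> by them. Uniqueness of preimages makes
  \<open>Ga\<close> functorial and yields the unit as the preimage of \<open>j\<close>.\<close>

lemma fully_faithful_ess_surj_equivalence:
  assumes C: "category C" and D: "category D" and F: "is_functor C D Fo Fa"
    and ff: "\<And>x y g. \<lbrakk>x \<in> Obj C; y \<in> Obj C; g \<in> Hom D (Fo x) (Fo y)\<rbrakk> \<Longrightarrow> \<exists>!f. f \<in> Hom C x y \<and> Fa f = g"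
    and es: "\<And>y. y \<in> Obj D \<Longrightarrow> \<exists>x \<in> Obj C. \<exists>i \<in> Hom D (Fo x) y. is_invertible D i"
  shows "is_equivalence C D Fo Fa"
proof -
  interpret C: category C by fact
  interpret D: category D by fact
  have FHom: "Fa f \<in> Hom D (Fo x) (Fo y)" if "f \<in> Hom C x y" for f x y
    using F that unfolding is_functor_def by (auto simp: Hom_def)
  have FComp: "Fa (g \<cdot>\<^bsub>C\<^esub> f) = Fa g \<cdot>\<^bsub>D\<^esub> Fa f" if "f \<in> Hom C x y" "g \<in> Hom C y z" for f g x y z
    using F that unfolding is_functor_def by (auto simp: Hom_def)
  have FId: "Fo x \<in> Obj D" "Fa (Ident C x) = Ident D (Fo x)" if "x \<in> Obj C" for x
    using F that unfolding is_functor_def by auto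
  have inj: "f = f'" if f: "f \<in> Hom C x y" "f' \<in> Hom C x y" and e: "Fa f = Fa f'" for f f' x y
  proof -
    have "\<exists>!h. h \<in> Hom C x y \<and> Fa h = Fa f'" by (rule ff) (use f C.Hom_Obj FHom in blast)+
    then show ?thesis using f e by blast
  qed
  have "\<forall>y. \<exists>x i j. y \<in> Obj D \<longrightarrow> x \<in> Obj C \<and> i \<in> Hom D (Fo x) y \<and> j \<in> Hom D y (Fo x) \<and>
      j \<cdot>\<^bsub>D\<^esub> i = Ident D (Fo x) \<and> i \<cdot>\<^bsub>D\<^esub> j = Ident D y"
    using es by (metis D.is_invertibleE)
  then obtain Go i j where G: "\<And>y. y \<in> Obj D \<Longrightarrow> Go y \<in> Obj C"
    and i: "\<And>y. y \<in> Obj D \<Longrightarrow> i y \<in> Hom D (Fo (Go y)) y"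
    and j: "\<And>y. y \<in> Obj D \<Longrightarrow> j y \<in> Hom D y (Fo (Go y))"
    and ji: "\<And>y. y \<in> Obj D \<Longrightarrow> j y \<cdot>\<^bsub>D\<^esub> i y = Ident D (Fo (Go y))"
    and ij: "\<And>y. y \<in> Obj D \<Longrightarrow> i y \<cdot>\<^bsub>D\<^esub> j y = Ident D y" by metis
  have "\<forall>g. \<exists>f. g \<in> Arr D \<longrightarrow> f \<in> Hom C (Go (Src D g)) (Go (Tgt D g)) \<and>
      Fa f = j (Tgt D g) \<cdot>\<^bsub>D\<^esub> (g \<cdot>\<^bsub>D\<^esub> i (Src D g))"
  proof (intro allI)
    fix g show "\<exists>f. g \<in> Arr D \<longrightarrow> f \<in> Hom C (Go (Src D g)) (Go (Tgt D g)) \<and>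
      Fa f = j (Tgt D g) \<cdot>\<^bsub>D\<^esub> (g \<cdot>\<^bsub>D\<^esub> i (Src D g))"
      using ff[of "Go (Src D g)" "Go (Tgt D g)" "j (Tgt D g) \<cdot>\<^bsub>D\<^esub> (g \<cdot>\<^bsub>D\<^esub> i (Src D g))"]
        D.Src_Obj[of g] D.Tgt_Obj[of g] G i j D.Comp_Hom Arr_Hom by metis
  qed
  then obtain Ga where Ga: "\<And>g. g \<in> Arr D \<Longrightarrow> Ga g \<in> Hom C (Go (Src D g)) (Go (Tgt D g))"
    and FGa: "\<And>g. g \<in> Arr D \<Longrightarrow> Fa (Ga g) = j (Tgt D g) \<cdot>\<^bsub>D\<^esub> (g \<cdot>\<^bsub>D\<^esub> i (Src D g))" by metis
  have GaH: "Ga g \<in> Hom C (Go a) (Go b)" "Fa (Ga g) = j b \<cdot>\<^bsub>D\<^esub> (g \<cdot>\<^bsub>D\<^esub> i a)"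
    if "g \<in> Hom D a b" for g a b
    using Ga[of g] FGa[of g] that by (auto simp: Hom_def)
  have iGa: "i b \<cdot>\<^bsub>D\<^esub> Fa (Ga g) = g \<cdot>\<^bsub>D\<^esub> i a" if g: "g \<in> Hom D a b" for g a b
  proof -
    have o: "a \<in> Obj D" "b \<in> Obj D" using g D.Hom_Obj by auto
    have gi: "g \<cdot>\<^bsub>D\<^esub> i a \<in> Hom D (Fo (Go a)) b" using i[OF o(1)] g D.Comp_Hom by auto
    show ?thesis using GaH[OF g] D.Comp_assoc[OF gi j[OF o(2)] i[OF o(2)]] ij[OF o(2)] D.Ident_Comp[OF gi]
      by simp
  qed
  \<comment> \<open>Cancelling the isomorphism \<open>i y\<close> reduces the multiplicativity of
    \<open>Ga\<close> to the naturality \<open>iGa\<close>.\<close>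
  have i_mono: "f = f'" if e: "i y \<cdot>\<^bsub>D\<^esub> f = i y \<cdot>\<^bsub>D\<^esub> f'" and f: "f \<in> Hom D x (Fo (Go y))"
    "f' \<in> Hom D x (Fo (Go y))" and y: "y \<in> Obj D" for f f' x y
    using D.Comp_assoc[OF f(1) i[OF y] j[OF y]] D.Comp_assoc[OF f(2) i[OF y] j[OF y]] ji[OF y] e
      D.Ident_Comp[OF f(1)] D.Ident_Comp[OF f(2)] by simp
  have Gfun: "is_functor D C Go Ga"
    unfolding is_functor_def
  proof (intro conjI ballI impI)
    fix x assume x: "x \<in> Obj D"
    show "Go x \<in> Obj C" by (rule G[OF x])
    show "Ga (Ident D x) = Ident C (Go x)"
    proof (rule inj)
      show "Ga (Ident D x) \<in> Hom C (Go x) (Go x)" using GaH D.Ident_Hom x by auto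
      show "Ident C (Go x) \<in> Hom C (Go x) (Go x)" using C.Ident_Hom G x by auto
      show "Fa (Ga (Ident D x)) = Fa (Ident C (Go x))"
        using GaH(2)[OF D.Ident_Hom[OF x]] D.Ident_Comp[OF i[OF x]] ji[OF x] FId(2)[OF G[OF x]] by simp
    qed
  next
    fix f assume "f \<in> Arr D" then show "Ga f \<in> Hom C (Go (Src D f)) (Go (Tgt D f))" by (rule Ga)
  next
    fix f g assume "f \<in> Arr D" "g \<in> Arr D" "Tgt D f = Src D g"
    then obtain a b c where f: "f \<in> Hom D a b" and g: "g \<in> Hom D b c" by (auto simp: Hom_def)
    have o: "a \<in> Obj D" "b \<in> Obj D" "c \<in> Obj D" using f g D.Hom_Obj by auto
    note gf = D.Comp_Hom[OF f g]
    show "Ga (g \<cdot>\<^bsub>D\<^esub> f) = Ga g \<cdot>\<^bsub>C\<^esub> Ga f"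
    proof (rule inj)
      show "Ga (g \<cdot>\<^bsub>D\<^esub> f) \<in> Hom C (Go a) (Go c)" using GaH gf by auto
      show "Ga g \<cdot>\<^bsub>C\<^esub> Ga f \<in> Hom C (Go a) (Go c)" by (rule C.Comp_Hom[OF GaH(1)[OF f] GaH(1)[OF g]])
      show "Fa (Ga (g \<cdot>\<^bsub>D\<^esub> f)) = Fa (Ga g \<cdot>\<^bsub>C\<^esub> Ga f)"
      proof (rule i_mono)
        have H: "Fa (Ga f) \<in> Hom D (Fo (Go a)) (Fo (Go b))" "Fa (Ga g) \<in> Hom D (Fo (Go b)) (Fo (Go c))"
          using FHom[OF GaH(1)[OF f]] FHom[OF GaH(1)[OF g]] .
        have "i c \<cdot>\<^bsub>D\<^esub> Fa (Ga g \<cdot>\<^bsub>C\<^esub> Ga f) = (i c \<cdot>\<^bsub>D\<^esub> Fa (Ga g)) \<cdot>\<^bsub>D\<^esub> Fa (Ga f)"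
          using FComp[OF GaH(1)[OF f] GaH(1)[OF g]] D.Comp_assoc[OF H i[OF o(3)]] by simp
        also have "\<dots> = g \<cdot>\<^bsub>D\<^esub> (i b \<cdot>\<^bsub>D\<^esub> Fa (Ga f))"
          using iGa[OF g] D.Comp_assoc[OF H(1) i[OF o(2)] g] by simp
        also have "\<dots> = (g \<cdot>\<^bsub>D\<^esub> f) \<cdot>\<^bsub>D\<^esub> i a" using iGa[OF f] D.Comp_assoc[OF i[OF o(1)] f g] by simp
        finally show "i c \<cdot>\<^bsub>D\<^esub> Fa (Ga (g \<cdot>\<^bsub>D\<^esub> f)) = i c \<cdot>\<^bsub>D\<^esub> Fa (Ga g \<cdot>\<^bsub>C\<^esub> Ga f)"
          using iGa[OF gf] by simp
        show "Fa (Ga (g \<cdot>\<^bsub>D\<^esub> f)) \<in> Hom D (Fo (Go a)) (Fo (Go c))" by (rule FHom[OF GaH(1)[OF gf]])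
        show "Fa (Ga g \<cdot>\<^bsub>C\<^esub> Ga f) \<in> Hom D (Fo (Go a)) (Fo (Go c))"
            by (rule FHom[OF C.Comp_Hom[OF GaH(1)[OF f] GaH(1)[OF g]]])
      qed (fact o)
    qed
  qed
  have "\<forall>x. \<exists>f. x \<in> Obj C \<longrightarrow> f \<in> Hom C x (Go (Fo x)) \<and> Fa f = j (Fo x)"
    using ff G j FId by metis
  then obtain h where h: "\<And>x. x \<in> Obj C \<Longrightarrow> h x \<in> Hom C x (Go (Fo x))"
    and Fh: "\<And>x. x \<in> Obj C \<Longrightarrow> Fa (h x) = j (Fo x)" by metis
  have hinv: "is_invertible C (h x)" if x: "x \<in> Obj C" for x
  proof -
    have Fx: "Fo x \<in> Obj D" using FId x by auto
    obtain k where k: "k \<in> Hom C (Go (Fo x)) x" "Fa k = i (Fo x)"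
      using ff[OF G[OF Fx] x i[OF Fx]] by auto
    show ?thesis
    proof (rule C.is_invertibleI[OF h[OF x] k(1)])
      show "k \<cdot>\<^bsub>C\<^esub> h x = Ident C x"
        using inj[OF C.Comp_Hom[OF h[OF x] k(1)] C.Ident_Hom[OF x]] FComp[OF h[OF x] k(1)] Fh[OF x] k ij[OF Fx]
          FId[OF x] by simp
      show "h x \<cdot>\<^bsub>C\<^esub> k = Ident C (Go (Fo x))"
        using inj[OF C.Comp_Hom[OF k(1) h[OF x]] C.Ident_Hom[OF G[OF Fx]]] FComp[OF k(1) h[OF x]] Fh[OF x] k ji[OF Fx]
          FId[OF G[OF Fx]] by simp
    qed
  qed
  have "is_nat_iso C C id id (Go \<circ> Fo) (Ga \<circ> Fa) h"
    unfolding is_nat_iso_def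
  proof (intro conjI ballI)
    fix x assume "x \<in> Obj C" then show "h x \<in> Hom C (id x) ((Go \<circ> Fo) x)" "is_invertible C (h x)"
      using h hinv by auto
  next
    fix f assume "f \<in> Arr C" then obtain x y where f: "f \<in> Hom C x y" by (auto simp: Hom_def)
    have o: "x \<in> Obj C" "y \<in> Obj C" "Fo x \<in> Obj D" "Fo y \<in> Obj D" using f C.Hom_Obj FId by auto
    note Ff = FHom[OF f]
    have gfi: "Fa f \<cdot>\<^bsub>D\<^esub> i (Fo x) \<in> Hom D (Fo (Go (Fo x))) (Fo y)" using Ff i[OF o(3)] D.Comp_Hom by auto
    have e: "Fa (Ga (Fa f)) \<cdot>\<^bsub>D\<^esub> j (Fo x) = j (Fo y) \<cdot>\<^bsub>D\<^esub> Fa f"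
      using GaH(2)[OF Ff] D.Comp_assoc[OF j[OF o(3)] gfi j[OF o(4)]] D.Comp_assoc[OF j[OF o(3)] i[OF o(3)] Ff]
        ij[OF o(3)] D.Comp_Ident[OF Ff] by simp
    have "h y \<cdot>\<^bsub>C\<^esub> f = Ga (Fa f) \<cdot>\<^bsub>C\<^esub> h x"
      using inj[OF C.Comp_Hom[OF f h[OF o(2)]] C.Comp_Hom[OF h[OF o(1)] GaH(1)[OF Ff]]]
        FComp[OF f h[OF o(2)]] FComp[OF h[OF o(1)] GaH(1)[OF Ff]] Fh o e by simp
    then show "h (Tgt C f) \<cdot>\<^bsub>C\<^esub> id f = (Ga \<circ> Fa) f \<cdot>\<^bsub>C\<^esub> h (Src C f)"
      using f by (simp add: Hom_def)
  qed
  moreover have "is_nat_iso D D (Fo \<circ> Go) (Fa \<circ> Ga) id id i"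
    unfolding is_nat_iso_def
  proof (intro conjI ballI)
    fix x assume x: "x \<in> Obj D" then show "i x \<in> Hom D ((Fo \<circ> Go) x) (id x)" using i by auto
    show "is_invertible D (i x)" using D.is_invertibleI[OF i j ji ij] x by auto
  next
    fix f assume "f \<in> Arr D"
    then show "i (Tgt D f) \<cdot>\<^bsub>D\<^esub> (Fa \<circ> Ga) f = id f \<cdot>\<^bsub>D\<^esub> i (Src D f)"
      using iGa[OF Arr_Hom] by simp
  qed
  ultimately show ?thesis unfolding is_equivalence_def using F Gfun by blast
qed


section \<open>Preadditive categories with shift\<close>

text \<open>The common base of the given category, its modules, the completion and the opposite of
  the completion, so that one set of lemmas on signs and zeros serves all of them.\<close>

locale preadditive = category C
  for C :: "('o, 'm, 'z) add_cat_scheme" (structure) +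
  assumes hom_comm_group: "\<lbrakk>a \<in> Obj C; b \<in> Obj C\<rbrakk> \<Longrightarrow> comm_group (hom_group C a b)"
    and Comp_Add: "\<lbrakk>f \<in> Hom C a b; f' \<in> Hom C a b; g \<in> Hom C b c\<rbrakk>
      \<Longrightarrow> g \<cdot> Add C f f' = Add C (g \<cdot> f) (g \<cdot> f')"
    and Add_Comp: "\<lbrakk>f \<in> Hom C a b; g \<in> Hom C b c; g' \<in> Hom C b c\<rbrakk>
      \<Longrightarrow> Add C g g' \<cdot> f = Add C (g \<cdot> f) (g' \<cdot> f)"

lemma hom_group_simps [simp]:
  "carrier (hom_group C a b) = Hom C a b" "mult (hom_group C a b) = Add C" "one (hom_group C a b) = ZeroArr C a b"
  by (simp_all add: hom_group_def)

definition Neg :: "('o, 'm, 'z) add_cat_scheme \<Rightarrow> 'm \<Rightarrow> 'm" where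
  "Neg C f = inv\<^bsub>hom_group C (Src C f) (Tgt C f)\<^esub> f"

context preadditive
begin

lemma hgrp: assumes "f \<in> Hom C a b" shows "comm_group (hom_group C a b)"
  using hom_comm_group Hom_Obj[OF assms] by auto

lemma Zero_Hom: assumes "a \<in> Obj C" "b \<in> Obj C" shows "ZeroArr C a b \<in> Hom C a b"
proof -
  interpret comm_group "hom_group C a b" using hom_comm_group assms .
  show ?thesis using one_closed by simp
qed

lemma assumes f: "f \<in> Hom C a b"
  shows Add_Hom: "g \<in> Hom C a b \<Longrightarrow> Add C f g \<in> Hom C a b"
    and Add_commute: "g \<in> Hom C a b \<Longrightarrow> Add C f g = Add C g f"
    and Add_Zero: "Add C f (ZeroArr C a b) = f"
    and Zero_Add: "Add C (ZeroArr C a b) f = f"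
    and Neg_Hom: "Neg C f \<in> Hom C a b"
    and Add_Neg: "Add C f (Neg C f) = ZeroArr C a b"
proof -
  interpret comm_group "hom_group C a b" using hgrp[OF f] .
  show "g \<in> Hom C a b \<Longrightarrow> Add C f g \<in> Hom C a b" "g \<in> Hom C a b \<Longrightarrow> Add C f g = Add C g f"
    using m_closed[of f g] m_comm[of f g] f by simp_all
  show "Add C f (ZeroArr C a b) = f" "Add C (ZeroArr C a b) f = f" using r_one[of f] l_one[of f] f by simp_all
  show "Neg C f \<in> Hom C a b" "Add C f (Neg C f) = ZeroArr C a b"
    using inv_closed[of f] r_inv[of f] f by (simp_all add: Neg_def Hom_Src[OF f] Hom_Tgt[OF f])
qed

lemma Neg_eq: assumes "f \<in> Hom C a b" shows "inv\<^bsub>hom_group C a b\<^esub> f = Neg C f"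
  using assms by (simp add: Neg_def Hom_def)

lemma Add_eq_Zero_Neg: assumes "f \<in> Hom C a b" "g \<in> Hom C a b" "Add C f g = ZeroArr C a b"
  shows "g = Neg C f"
proof -
  interpret comm_group "hom_group C a b" using hgrp[OF assms(1)] .
  show ?thesis using inv_equality[of g f] m_comm[of f g] assms Neg_eq[OF assms(1)] by simp
qed

lemma Neg_Neg: assumes "f \<in> Hom C a b" shows "Neg C (Neg C f) = f"
proof -
  interpret comm_group "hom_group C a b" using hgrp[OF assms(1)] .
  show ?thesis using inv_inv[of f] assms by (simp add: Neg_eq Neg_Hom)
qed

lemma diff_Zero_iff: assumes "f \<in> Hom C a b" "g \<in> Hom C a b"
  shows "Add C f (Neg C g) = ZeroArr C a b \<longleftrightarrow> f = g"
proof
  assume a: "Add C f (Neg C g) = ZeroArr C a b"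
  then show "f = g" using Add_eq_Zero_Neg[OF assms(1) Neg_Hom[OF assms(2)]] Neg_Neg assms by metis
qed (use Add_Neg assms in auto)

lemma Zero_unique: assumes "f \<in> Hom C a b" "Add C f f = f" shows "f = ZeroArr C a b"
proof -
  interpret comm_group "hom_group C a b" using hgrp[OF assms(1)] .
  show ?thesis using l_cancel_one'[of f f] assms by simp
qed

lemma Comp_Zero: assumes "g \<in> Hom C b c" "a \<in> Obj C" shows "g \<cdot> ZeroArr C a b = ZeroArr C a c"
proof (rule Zero_unique)
  have z: "ZeroArr C a b \<in> Hom C a b" using Zero_Hom Hom_Obj assms by metis
  show "g \<cdot> ZeroArr C a b \<in> Hom C a c" using z assms Comp_Hom by metis
  show "Add C (g \<cdot> ZeroArr C a b) (g \<cdot> ZeroArr C a b) = g \<cdot> ZeroArr C a b"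
    using Comp_Add[OF z z assms(1)] Add_Zero[OF z] by simp
qed

lemma Zero_Comp: assumes "f \<in> Hom C a b" "c \<in> Obj C" shows "ZeroArr C b c \<cdot> f = ZeroArr C a c"
proof (rule Zero_unique)
  have z: "ZeroArr C b c \<in> Hom C b c" using Zero_Hom Hom_Obj assms by metis
  show "ZeroArr C b c \<cdot> f \<in> Hom C a c" using z assms Comp_Hom by metis
  show "Add C (ZeroArr C b c \<cdot> f) (ZeroArr C b c \<cdot> f) = ZeroArr C b c \<cdot> f"
    using Add_Comp[OF assms(1) z z] Add_Zero[OF z] by simp
qed

lemma Comp_Neg: assumes "f \<in> Hom C a b" "g \<in> Hom C b c" shows "g \<cdot> Neg C f = Neg C (g \<cdot> f)"
proof (rule Add_eq_Zero_Neg)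
  show "g \<cdot> f \<in> Hom C a c" "g \<cdot> Neg C f \<in> Hom C a c" using assms Comp_Hom Neg_Hom by metis+
  show "Add C (g \<cdot> f) (g \<cdot> Neg C f) = ZeroArr C a c"
    using Comp_Add[OF assms(1) Neg_Hom[OF assms(1)] assms(2)] Add_Neg[OF assms(1)]
      Comp_Zero[OF assms(2)] Hom_Obj assms by simp
qed

lemma Neg_Comp: assumes "f \<in> Hom C a b" "g \<in> Hom C b c" shows "Neg C g \<cdot> f = Neg C (g \<cdot> f)"
proof (rule Add_eq_Zero_Neg)
  show "g \<cdot> f \<in> Hom C a c" "Neg C g \<cdot> f \<in> Hom C a c" using assms Comp_Hom Neg_Hom by metis+
  show "Add C (g \<cdot> f) (Neg C g \<cdot> f) = ZeroArr C a c"
    using Add_Comp[OF assms(1) assms(2) Neg_Hom[OF assms(2)]] Add_Neg[OF assms(2)]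
      Zero_Comp[OF assms(1)] Hom_Obj assms by metis
qed

lemma Neg_Zero: "\<lbrakk>a \<in> Obj C; b \<in> Obj C\<rbrakk> \<Longrightarrow> Neg C (ZeroArr C a b) = ZeroArr C a b"
  using Add_eq_Zero_Neg[of "ZeroArr C a b" a b "ZeroArr C a b"] Zero_Hom Add_Zero by fastforce

lemma Neg_inj: "\<lbrakk>f \<in> Hom C a b; g \<in> Hom C a b; Neg C f = Neg C g\<rbrakk> \<Longrightarrow> f = g"
  by (metis Neg_Neg)

lemma Comp_diff:
  assumes "f \<in> Hom C a b" "f' \<in> Hom C a b" "g \<in> Hom C b c"
  shows "g \<cdot> Add C f (Neg C f') = Add C (g \<cdot> f) (Neg C (g \<cdot> f'))"
  using Comp_Add[OF assms(1) Neg_Hom[OF assms(2)] assms(3)] Comp_Neg[OF assms(2,3)] by simp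

text \<open>The difference of the two arrows lies in the kernel.\<close>

lemma mono_of_kernel:
  assumes k: "\<And>h. \<lbrakk>h \<in> Hom C a b; g \<cdot> h = ZeroArr C a c\<rbrakk> \<Longrightarrow> h = ZeroArr C a b"
    and "g \<in> Hom C b c" "f \<in> Hom C a b" "f' \<in> Hom C a b" "g \<cdot> f = g \<cdot> f'"
  shows "f = f'"
proof -
  have "g \<cdot> Add C f (Neg C f') = ZeroArr C a c"
    using Comp_diff[OF assms(3,4,2)] assms(5) Add_Neg Comp_Hom[OF assms(4,2)] by simp
  then have "Add C f (Neg C f') = ZeroArr C a b" using k Add_Hom Neg_Hom assms by metis
  then show ?thesis using diff_Zero_iff assms by simp
qed

end

text \<open>Modules and their sequential colimits are developed at this generality because they
  occur twice: over the given category and over the opposite of its completion.\<close>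

locale shifted = preadditive C
  for C :: "('o, 'm, 'z) shift_cat_scheme" (structure) +
  assumes shift_functor: "is_functor C C (ShO C) (ShA C)"
    and shift_bij_Obj: "bij_betw (ShO C) (Obj C) (Obj C)"
    and shift_bij_Arr: "bij_betw (ShA C) (Arr C) (Arr C)"
    and shift_Add: "\<lbrakk>f \<in> Hom C a b; f' \<in> Hom C a b\<rbrakk>
      \<Longrightarrow> ShA C (Add C f f') = Add C (ShA C f) (ShA C f')"
begin

lemma ShO_Obj: "a \<in> Obj C \<Longrightarrow> ShO C a \<in> Obj C"
  and ShA_Hom: "f \<in> Hom C a b \<Longrightarrow> ShA C f \<in> Hom C (ShO C a) (ShO C b)"
  and ShA_Ident: "a \<in> Obj C \<Longrightarrow> ShA C (Ident C a) = Ident C (ShO C a)"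
  and ShA_Comp: "\<lbrakk>f \<in> Hom C a b; g \<in> Hom C b c\<rbrakk> \<Longrightarrow> ShA C (g \<cdot> f) = ShA C g \<cdot> ShA C f"
  using shift_functor unfolding is_functor_def by (auto simp: Hom_def)

lemma UnO_Obj: "a \<in> Obj C \<Longrightarrow> UnO C a \<in> Obj C"
  and ShO_UnO: "a \<in> Obj C \<Longrightarrow> ShO C (UnO C a) = a"
  and UnO_ShO: "a \<in> Obj C \<Longrightarrow> UnO C (ShO C a) = a"
  using shift_bij_Obj unfolding UnO_def
  by (auto simp: bij_betw_def f_inv_into_f inv_into_into)

lemma UnA_Arr: "f \<in> Arr C \<Longrightarrow> UnA C f \<in> Arr C"
  and ShA_UnA: "f \<in> Arr C \<Longrightarrow> ShA C (UnA C f) = f"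
  and UnA_ShA: "f \<in> Arr C \<Longrightarrow> UnA C (ShA C f) = f"
  using shift_bij_Arr unfolding UnA_def
  by (auto simp: bij_betw_def f_inv_into_f inv_into_into)

lemma ShA_Src_Tgt: "f \<in> Arr C \<Longrightarrow> Src C (ShA C f) = ShO C (Src C f) \<and> Tgt C (ShA C f) = ShO C (Tgt C f)"
  using ShA_Hom[OF Arr_Hom] by (auto simp: Hom_def)

lemma UnA_Src_Tgt: assumes "f \<in> Arr C"
  shows "Src C (UnA C f) = UnO C (Src C f)" "Tgt C (UnA C f) = UnO C (Tgt C f)"
  using ShA_Src_Tgt[OF UnA_Arr[OF assms]] ShA_UnA[OF assms] UnO_ShO Src_Obj Tgt_Obj UnA_Arr[OF assms]
  by metis+

lemma UnA_Hom: "f \<in> Hom C a b \<Longrightarrow> UnA C f \<in> Hom C (UnO C a) (UnO C b)"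
  using UnA_Arr UnA_Src_Tgt by (auto simp: Hom_def)

lemma UnA_Comp: assumes "f \<in> Hom C a b" "g \<in> Hom C b c" shows "UnA C (g \<cdot> f) = UnA C g \<cdot> UnA C f"
proof -
  have "ShA C (UnA C g \<cdot> UnA C f) = g \<cdot> f"
    using ShA_Comp[OF UnA_Hom[OF assms(1)] UnA_Hom[OF assms(2)]] ShA_UnA Hom_Arr assms by metis
  then show ?thesis using UnA_ShA Comp_Hom[OF UnA_Hom[OF assms(1)] UnA_Hom[OF assms(2)]] Hom_Arr by metis
qed

lemma UnA_Ident: "a \<in> Obj C \<Longrightarrow> UnA C (Ident C a) = Ident C (UnO C a)"
  by (metis UnA_ShA ShA_Ident UnO_Obj ShO_UnO Ident_Hom Hom_Arr)

lemma UnA_Add: assumes "f \<in> Hom C a b" "g \<in> Hom C a b" shows "UnA C (Add C f g) = Add C (UnA C f) (UnA C g)"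
proof -
  have "ShA C (Add C (UnA C f) (UnA C g)) = Add C f g"
    using shift_Add[OF UnA_Hom[OF assms(1)] UnA_Hom[OF assms(2)]] ShA_UnA Hom_Arr assms by metis
  then show ?thesis using UnA_ShA Add_Hom[OF UnA_Hom[OF assms(1)] UnA_Hom[OF assms(2)]] Hom_Arr by metis
qed

lemma ShA_Zero: assumes "a \<in> Obj C" "b \<in> Obj C" shows "ShA C (ZeroArr C a b) = ZeroArr C (ShO C a) (ShO C b)"
proof (rule Zero_unique)
  note z = Zero_Hom[OF assms]
  show "ShA C (ZeroArr C a b) \<in> Hom C (ShO C a) (ShO C b)" by (rule ShA_Hom[OF z])
  show "Add C (ShA C (ZeroArr C a b)) (ShA C (ZeroArr C a b)) = ShA C (ZeroArr C a b)"
    using shift_Add[OF z z] Add_Zero[OF z] by simp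
qed

lemma ShA_Neg: assumes "f \<in> Hom C a b" shows "ShA C (Neg C f) = Neg C (ShA C f)"
proof (rule Add_eq_Zero_Neg)
  show "ShA C f \<in> Hom C (ShO C a) (ShO C b)" "ShA C (Neg C f) \<in> Hom C (ShO C a) (ShO C b)"
    using assms ShA_Hom Neg_Hom by auto
  show "Add C (ShA C f) (ShA C (Neg C f)) = ZeroArr C (ShO C a) (ShO C b)"
    using shift_Add[OF assms Neg_Hom[OF assms]] Add_Neg[OF assms] ShA_Zero Hom_Obj assms by simp
qed

end

section \<open>Modules\<close>

abbreviation el :: "('o, 'm, 'u) presheaf \<Rightarrow> 'o \<Rightarrow> 'u set" where
  "el A x \<equiv> carrier (FunO A x)"

lemma ModCat_simps [simp]:
  "Obj (ModCat C) = {F. is_module C F}" "Arr (ModCat C) = {\<eta>. is_module_map C \<eta>}"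
  "Src (ModCat C) = MSrc" "Tgt (ModCat C) = MTgt"
  by (simp_all add: ModCat_def Let_def)

lemma Hom_ModCat: "\<eta> \<in> Hom (ModCat C) A B \<longleftrightarrow> is_module_map C \<eta> \<and> MSrc \<eta> = A \<and> MTgt \<eta> = B"
  by (simp add: Hom_def)

text \<open>Restriction to objects and carriers puts an arbitrary formula into the normal form
  required of module maps, so that equality can be tested on elements.\<close>

definition mkmap :: "('o, 'm, 'z) cat_scheme \<Rightarrow> ('o, 'm, 'u) presheaf \<Rightarrow> ('o, 'm, 'u) presheaf
    \<Rightarrow> ('o \<Rightarrow> 'u \<Rightarrow> 'u) \<Rightarrow> ('o, 'm, 'u) presheaf_map" where
  "mkmap C A B \<phi> = \<lparr>MSrc = A, MTgt = B, At = (\<lambda>x \<in> Obj C. \<lambda>u \<in> el A x. \<phi> x u)\<rparr>"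

lemma mkmap_simps [simp]: "MSrc (mkmap C A B \<phi>) = A" "MTgt (mkmap C A B \<phi>) = B"
  by (simp_all add: mkmap_def)

lemma At_mkmap: "\<lbrakk>x \<in> Obj C; u \<in> el A x\<rbrakk> \<Longrightarrow> At (mkmap C A B \<phi>) x u = \<phi> x u"
  by (simp add: mkmap_def)

text \<open>Precomposition with the shift: an explicit inverse of the shift of modules, whereas
  \<open>UnO (ModCat C)\<close> is an inverse by choice only.\<close>

definition unshO :: "('o, 'm, 'z) shift_cat_scheme \<Rightarrow> ('o, 'm, 'u) presheaf \<Rightarrow> ('o, 'm, 'u) presheaf" where
  "unshO C F = \<lparr>FunO = (\<lambda>x \<in> Obj C. FunO F (ShO C x)), FunA = (\<lambda>f \<in> Arr C. FunA F (ShA C f))\<rparr>"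

definition unshA :: "('o, 'm, 'z) shift_cat_scheme \<Rightarrow> ('o, 'm, 'u) presheaf_map \<Rightarrow> ('o, 'm, 'u) presheaf_map" where
  "unshA C \<eta> = \<lparr>MSrc = unshO C (MSrc \<eta>), MTgt = unshO C (MTgt \<eta>), At = (\<lambda>x \<in> Obj C. At \<eta> (ShO C x))\<rparr>"

lemma ModCat_shift_simps:
  "FunO (ShO (ModCat C) F) = (\<lambda>x \<in> Obj C. FunO F (UnO C x))"
  "FunA (ShO (ModCat C) F) = (\<lambda>f \<in> Arr C. FunA F (UnA C f))"
  "MSrc (ShA (ModCat C) \<eta>) = ShO (ModCat C) (MSrc \<eta>)"
  "MTgt (ShA (ModCat C) \<eta>) = ShO (ModCat C) (MTgt \<eta>)"
  "At (ShA (ModCat C) \<eta>) = (\<lambda>x \<in> Obj C. At \<eta> (UnO C x))"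
  by (simp_all add: ModCat_def Let_def)

lemma presheaf_map_eqI:
  "\<lbrakk>MSrc \<eta> = MSrc \<theta>; MTgt \<eta> = MTgt \<theta>; At \<eta> = At \<theta>\<rbrakk> \<Longrightarrow> \<eta> = (\<theta> :: ('o, 'm, 'u) presheaf_map)"
  by (cases \<eta>; cases \<theta>) simp

lemma presheaf_eqI:
  "\<lbrakk>FunO A = FunO B; FunA A = FunA B\<rbrakk> \<Longrightarrow> A = (B :: ('o, 'm, 'u) presheaf)"
  by (cases A; cases B) simp

context shifted
begin

lemma assumes "is_module C A"
  shows module_group: "x \<in> Obj C \<Longrightarrow> comm_group (FunO A x)"
    and act_closed: "\<lbrakk>f \<in> Hom C x y; u \<in> el A y\<rbrakk> \<Longrightarrow> FunA A f u \<in> el A x"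
    and act_mult: "\<lbrakk>f \<in> Hom C x y; u \<in> el A y; v \<in> el A y\<rbrakk>
      \<Longrightarrow> FunA A f (u \<otimes>\<^bsub>FunO A y\<^esub> v) = FunA A f u \<otimes>\<^bsub>FunO A x\<^esub> FunA A f v"
    and act_ident: "\<lbrakk>x \<in> Obj C; u \<in> el A x\<rbrakk> \<Longrightarrow> FunA A (Ident C x) u = u"
    and act_comp: "\<lbrakk>f \<in> Hom C x y; g \<in> Hom C y z; u \<in> el A z\<rbrakk> \<Longrightarrow> FunA A (g \<cdot> f) u = FunA A f (FunA A g u)"
    and act_Add: "\<lbrakk>f \<in> Hom C x y; g \<in> Hom C x y; u \<in> el A y\<rbrakk>
      \<Longrightarrow> FunA A (Add C f g) u = FunA A f u \<otimes>\<^bsub>FunO A x\<^esub> FunA A g u"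
  using assms unfolding is_module_def Hom_def hom_def by auto

lemma module_mult: assumes "is_module C A" "x \<in> Obj C" "u \<in> el A x" "v \<in> el A x"
  shows "u \<otimes>\<^bsub>FunO A x\<^esub> v \<in> el A x"
proof -
  interpret comm_group "FunO A x" using module_group[OF assms(1,2)] .
  show ?thesis using assms by simp
qed

text \<open>Cancellation in the group. It is the way in which actions of arrows, zero arrows and
  module maps are seen to take the unit as value.\<close>

lemma module_idem: assumes "is_module C A" "x \<in> Obj C" "u \<in> el A x" "u \<otimes>\<^bsub>FunO A x\<^esub> u = u"
  shows "u = \<one>\<^bsub>FunO A x\<^esub>"
proof -
  interpret comm_group "FunO A x" using module_group[OF assms(1,2)] .
  show ?thesis using l_cancel_one'[of u u] assms by simp
qed

lemma act_one: assumes "is_module C A" "f \<in> Hom C x y"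
  shows "FunA A f \<one>\<^bsub>FunO A y\<^esub> = \<one>\<^bsub>FunO A x\<^esub>"
proof -
  have o: "x \<in> Obj C" "y \<in> Obj C" using Hom_Obj assms by auto
  interpret comm_group "FunO A y" using module_group[OF assms(1) o(2)] .
  show ?thesis
    using module_idem[OF assms(1) o(1) act_closed[OF assms one_closed]] act_mult[OF assms one_closed one_closed]
    by simp
qed

lemma act_Zero: assumes "is_module C A" "x \<in> Obj C" "y \<in> Obj C" "u \<in> el A y"
  shows "FunA A (ZeroArr C x y) u = \<one>\<^bsub>FunO A x\<^esub>"
proof -
  have z: "ZeroArr C x y \<in> Hom C x y" using Zero_Hom assms by blast
  show ?thesis
    using module_idem[OF assms(1,2) act_closed[OF assms(1) z assms(4)]] act_Add[OF assms(1) z z assms(4)] Add_Zero[OF z]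
    by simp
qed

text \<open>The values outside the domains agree because they are normalised. Getting equality, not
  just isomorphism, makes the shift of modules an automorphism in the strict sense.\<close>

lemma module_eqI:
  assumes "is_module C A" "is_module C B" "\<And>x. x \<in> Obj C \<Longrightarrow> FunO A x = FunO B x"
    and "\<And>f u. \<lbrakk>f \<in> Arr C; u \<in> el A (Tgt C f)\<rbrakk> \<Longrightarrow> FunA A f u = FunA B f u"
  shows "A = B"
proof (rule presheaf_eqI)
  show "FunO A = FunO B"
    by (rule extensionalityI[of _ "Obj C"]) (use assms in \<open>auto simp: is_module_def\<close>)
  show "FunA A = FunA B"
  proof (rule extensionalityI[of _ "Arr C"])
    fix f assume f: "f \<in> Arr C"
    have "FunO B (Tgt C f) = FunO A (Tgt C f)" using assms(3) Tgt_Obj[OF f] by simp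
    then have "FunA A f \<in> extensional (el A (Tgt C f))" "FunA B f \<in> extensional (el A (Tgt C f))"
      using assms(1,2) f unfolding is_module_def by auto
    then show "FunA A f = FunA B f" by (rule extensionalityI) (use assms(4) f in auto)
  qed (use assms in \<open>auto simp: is_module_def\<close>)
qed

lemma assumes "\<eta> \<in> Hom (ModCat C) A B"
  shows MH_mod: "is_module C A" "is_module C B"
    and MH_closed: "\<lbrakk>x \<in> Obj C; u \<in> el A x\<rbrakk> \<Longrightarrow> At \<eta> x u \<in> el B x"
    and MH_mult: "\<lbrakk>x \<in> Obj C; u \<in> el A x; v \<in> el A x\<rbrakk>
      \<Longrightarrow> At \<eta> x (u \<otimes>\<^bsub>FunO A x\<^esub> v) = At \<eta> x u \<otimes>\<^bsub>FunO B x\<^esub> At \<eta> x v"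
    and MH_act: "\<lbrakk>f \<in> Hom C x y; u \<in> el A y\<rbrakk> \<Longrightarrow> FunA B f (At \<eta> y u) = At \<eta> x (FunA A f u)"
  using assms[unfolded Hom_ModCat is_module_map_def] unfolding Hom_def hom_def by auto

lemma MH_one: assumes "\<eta> \<in> Hom (ModCat C) A B" "x \<in> Obj C" shows "At \<eta> x \<one>\<^bsub>FunO A x\<^esub> = \<one>\<^bsub>FunO B x\<^esub>"
proof -
  note m = MH_mod[OF assms(1)]
  interpret comm_group "FunO A x" using module_group[OF m(1)] assms(2) by blast
  show ?thesis
    using module_idem[OF m(2) assms(2) MH_closed[OF assms one_closed]] MH_mult[OF assms one_closed one_closed]
    by simp
qed

lemma MH_eqI:
  assumes "\<eta> \<in> Hom (ModCat C) A B" "\<theta> \<in> Hom (ModCat C) A B"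
    and "\<And>x u. \<lbrakk>x \<in> Obj C; u \<in> el A x\<rbrakk> \<Longrightarrow> At \<eta> x u = At \<theta> x u"
  shows "\<eta> = \<theta>"
proof (rule presheaf_map_eqI)
  show "At \<eta> = At \<theta>"
  proof (rule extensionalityI[of _ "Obj C"])
    fix x assume x: "x \<in> Obj C"
    have "At \<eta> x \<in> extensional (el A x)" "At \<theta> x \<in> extensional (el A x)"
      using assms(1,2) x unfolding Hom_ModCat is_module_map_def by auto
    then show "At \<eta> x = At \<theta> x" by (rule extensionalityI) (use assms(3) x in auto)
  qed (use assms in \<open>auto simp: Hom_ModCat is_module_map_def\<close>)
qed (use assms in \<open>auto simp: Hom_ModCat\<close>)

lemma mkmap_Hom:
  assumes "is_module C A" "is_module C B"
    and "\<And>x u. \<lbrakk>x \<in> Obj C; u \<in> el A x\<rbrakk> \<Longrightarrow> \<phi> x u \<in> el B x"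
    and "\<And>x u v. \<lbrakk>x \<in> Obj C; u \<in> el A x; v \<in> el A x\<rbrakk>
      \<Longrightarrow> \<phi> x (u \<otimes>\<^bsub>FunO A x\<^esub> v) = \<phi> x u \<otimes>\<^bsub>FunO B x\<^esub> \<phi> x v"
    and "\<And>x y f u. \<lbrakk>f \<in> Hom C x y; u \<in> el A y\<rbrakk> \<Longrightarrow> FunA B f (\<phi> y u) = \<phi> x (FunA A f u)"
  shows "mkmap C A B \<phi> \<in> Hom (ModCat C) A B"
proof -
  have "At (mkmap C A B \<phi>) x \<in> hom (FunO A x) (FunO B x)" if x: "x \<in> Obj C" for x
  proof (rule homI)
    fix u assume u: "u \<in> el A x" then show "At (mkmap C A B \<phi>) x u \<in> el B x"
      using assms(3) x by (simp add: At_mkmap)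
    fix v assume v: "v \<in> el A x"
    have "u \<otimes>\<^bsub>FunO A x\<^esub> v \<in> el A x" by (rule module_mult[OF assms(1) x u v])
    then show "At (mkmap C A B \<phi>) x (u \<otimes>\<^bsub>FunO A x\<^esub> v) = At (mkmap C A B \<phi>) x u \<otimes>\<^bsub>FunO B x\<^esub> At (mkmap C A B \<phi>) x v"
      using assms(4) x u v by (simp add: At_mkmap)
  qed
  moreover have "FunA B f (At (mkmap C A B \<phi>) (Tgt C f) u) = At (mkmap C A B \<phi>) (Src C f) (FunA A f u)"
    if f: "f \<in> Arr C" and u: "u \<in> el A (Tgt C f)" for f u
    using assms(5)[OF Arr_Hom[OF f] u] act_closed[OF assms(1) Arr_Hom[OF f] u] u Src_Obj[OF f] Tgt_Obj[OF f]
    by (simp add: At_mkmap)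
  ultimately show ?thesis
    unfolding Hom_ModCat is_module_map_def using assms(1,2) by (auto simp: mkmap_def)
qed

lemma mkmap_Comp: "\<eta> \<cdot>\<^bsub>ModCat C\<^esub> \<theta> = mkmap C (MSrc \<theta>) (MTgt \<eta>) (\<lambda>x u. At \<eta> x (At \<theta> x u))"
  and mkmap_Ident: "Ident (ModCat C) A = mkmap C A A (\<lambda>x u. u)"
  and mkmap_Zero: "ZeroArr (ModCat C) A B = mkmap C A B (\<lambda>x u. \<one>\<^bsub>FunO B x\<^esub>)"
  and mkmap_Add: "Add (ModCat C) \<eta> \<theta> = mkmap C (MSrc \<eta>) (MTgt \<eta>) (\<lambda>x u. At \<eta> x u \<otimes>\<^bsub>FunO (MTgt \<eta>) x\<^esub> At \<theta> x u)"
  by (simp_all add: ModCat_def mkmap_def Let_def)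

lemma At_Comp: "\<lbrakk>\<theta> \<in> Hom (ModCat C) A B; x \<in> Obj C; u \<in> el A x\<rbrakk> \<Longrightarrow> At (\<eta> \<cdot>\<^bsub>ModCat C\<^esub> \<theta>) x u = At \<eta> x (At \<theta> x u)"
  by (simp add: mkmap_Comp At_mkmap Hom_ModCat)

lemma At_Ident: "\<lbrakk>x \<in> Obj C; u \<in> el A x\<rbrakk> \<Longrightarrow> At (Ident (ModCat C) A) x u = u"
  by (simp add: mkmap_Ident At_mkmap)

lemma At_Zero: "\<lbrakk>x \<in> Obj C; u \<in> el A x\<rbrakk> \<Longrightarrow> At (ZeroArr (ModCat C) A B) x u = \<one>\<^bsub>FunO B x\<^esub>"
  by (simp add: mkmap_Zero At_mkmap)

lemma At_Add: "\<lbrakk>\<eta> \<in> Hom (ModCat C) A B; x \<in> Obj C; u \<in> el A x\<rbrakk>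
    \<Longrightarrow> At (Add (ModCat C) \<eta> \<theta>) x u = At \<eta> x u \<otimes>\<^bsub>FunO B x\<^esub> At \<theta> x u"
  by (simp add: mkmap_Add At_mkmap Hom_ModCat)

lemma MComp_Hom: assumes "\<theta> \<in> Hom (ModCat C) A B" "\<eta> \<in> Hom (ModCat C) B D"
  shows "\<eta> \<cdot>\<^bsub>ModCat C\<^esub> \<theta> \<in> Hom (ModCat C) A D"
proof -
  have "mkmap C A D (\<lambda>x u. At \<eta> x (At \<theta> x u)) \<in> Hom (ModCat C) A D"
    by (rule mkmap_Hom)
      (use MH_mod[OF assms(1)] MH_mod[OF assms(2)] in \<open>auto simp: MH_mult[OF assms(1)] MH_mult[OF assms(2)] 
        MH_closed[OF assms(1)] MH_closed[OF assms(2)] MH_act[OF assms(1)] MH_act[OF assms(2)] Hom_Obj\<close>)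
  then show ?thesis using assms by (simp add: mkmap_Comp Hom_ModCat)
qed

lemma MIdent_Hom: "is_module C A \<Longrightarrow> Ident (ModCat C) A \<in> Hom (ModCat C) A A"
  unfolding mkmap_Ident by (rule mkmap_Hom) auto

lemma category_ModCat: "category (ModCat C)"
proof
  fix f assume "f \<in> Arr (ModCat C)"
  then show "Src (ModCat C) f \<in> Obj (ModCat C)" "Tgt (ModCat C) f \<in> Obj (ModCat C)"
    by (auto simp: is_module_map_def)
next
  fix a assume "a \<in> Obj (ModCat C)"
  then show "Ident (ModCat C) a \<in> Hom (ModCat C) a a" by (simp add: MIdent_Hom)
next
  fix f g a b c assume "f \<in> Hom (ModCat C) a b" "g \<in> Hom (ModCat C) b c"
  then show "g \<cdot>\<^bsub>ModCat C\<^esub> f \<in> Hom (ModCat C) a c" by (rule MComp_Hom)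
next
  fix f a b assume f: "f \<in> Hom (ModCat C) a b"
  note i = MIdent_Hom[OF MH_mod(1)[OF f]] MIdent_Hom[OF MH_mod(2)[OF f]]
  show "f \<cdot>\<^bsub>ModCat C\<^esub> Ident (ModCat C) a = f"
    by (rule MH_eqI[OF MComp_Hom[OF i(1) f] f]) (simp add: At_Comp[OF i(1)] At_Ident)
  show "Ident (ModCat C) b \<cdot>\<^bsub>ModCat C\<^esub> f = f"
    by (rule MH_eqI[OF MComp_Hom[OF f i(2)] f]) (simp add: At_Comp[OF f] At_Ident MH_closed[OF f])
next
  fix f g h a b c d assume f: "f \<in> Hom (ModCat C) a b" and g: "g \<in> Hom (ModCat C) b c"
    and h: "h \<in> Hom (ModCat C) c d"
  show "(h \<cdot>\<^bsub>ModCat C\<^esub> g) \<cdot>\<^bsub>ModCat C\<^esub> f = h \<cdot>\<^bsub>ModCat C\<^esub> (g \<cdot>\<^bsub>ModCat C\<^esub> f)"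
    by (rule MH_eqI[OF MComp_Hom[OF f MComp_Hom[OF g h]] MComp_Hom[OF MComp_Hom[OF f g] h]])
      (simp add: At_Comp[OF f] At_Comp[OF g] At_Comp[OF MComp_Hom[OF f g]] MH_closed[OF f])
qed

lemma MAdd_Hom: assumes "\<theta> \<in> Hom (ModCat C) A B" "\<eta> \<in> Hom (ModCat C) A B"
  shows "Add (ModCat C) \<eta> \<theta> \<in> Hom (ModCat C) A B"
proof -
  note m = MH_mod[OF assms(1)]
  have "mkmap C A B (\<lambda>x u. At \<eta> x u \<otimes>\<^bsub>FunO B x\<^esub> At \<theta> x u) \<in> Hom (ModCat C) A B"
  proof (rule mkmap_Hom[OF m])
    fix x u assume xu: "x \<in> Obj C" "u \<in> el A x"
    interpret comm_group "FunO B x" using module_group[OF m(2)] xu by blast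
    note c = MH_closed[OF assms(1) xu] MH_closed[OF assms(2) xu]
    show "At \<eta> x u \<otimes>\<^bsub>FunO B x\<^esub> At \<theta> x u \<in> el B x" using c by simp
    fix v assume v: "v \<in> el A x"
    note c' = MH_closed[OF assms(1) xu(1) v] MH_closed[OF assms(2) xu(1) v]
    show "At \<eta> x (u \<otimes>\<^bsub>FunO A x\<^esub> v) \<otimes>\<^bsub>FunO B x\<^esub> At \<theta> x (u \<otimes>\<^bsub>FunO A x\<^esub> v) =
      At \<eta> x u \<otimes>\<^bsub>FunO B x\<^esub> At \<theta> x u \<otimes>\<^bsub>FunO B x\<^esub> (At \<eta> x v \<otimes>\<^bsub>FunO B x\<^esub> At \<theta> x v)"
      using MH_mult[OF assms(1) xu v] MH_mult[OF assms(2) xu v] c c' by (simp add: m_ac)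
  next
    fix x y f u assume f: "f \<in> Hom C x y" and u: "u \<in> el A y"
    have y: "y \<in> Obj C" using Hom_Obj f by auto
    show "FunA B f (At \<eta> y u \<otimes>\<^bsub>FunO B y\<^esub> At \<theta> y u) = At \<eta> x (FunA A f u) \<otimes>\<^bsub>FunO B x\<^esub> At \<theta> x (FunA A f u)"
      using act_mult[OF m(2) f MH_closed[OF assms(2) y u] MH_closed[OF assms(1) y u]]
        MH_act[OF assms(1) f u] MH_act[OF assms(2) f u] by simp
  qed
  then show ?thesis using assms by (simp add: mkmap_Add Hom_ModCat)
qed

lemma MZero_Hom: assumes "is_module C A" "is_module C B" shows "ZeroArr (ModCat C) A B \<in> Hom (ModCat C) A B"
  unfolding mkmap_Zero
proof (rule mkmap_Hom[OF assms])
  fix x u assume "x \<in> Obj C" "u \<in> el A x"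
  interpret comm_group "FunO B x" using module_group[OF assms(2)] \<open>x \<in> Obj C\<close> by blast
  show "\<one>\<^bsub>FunO B x\<^esub> \<in> el B x" "\<one>\<^bsub>FunO B x\<^esub> = \<one>\<^bsub>FunO B x\<^esub> \<otimes>\<^bsub>FunO B x\<^esub> \<one>\<^bsub>FunO B x\<^esub>" by simp_all
qed (rule act_one[OF assms(2)])

lemma preadditive_ModCat: "preadditive (ModCat C :: (('o, 'm, 'u) presheaf, ('o, 'm, 'u) presheaf_map) shift_cat)"
proof (rule preadditive.intro, rule category_ModCat, rule preadditive_axioms.intro)
    fix A B :: "('o, 'm, 'u) presheaf" assume "A \<in> Obj (ModCat C)" "B \<in> Obj (ModCat C)"
    then have m: "is_module C A" "is_module C B" by auto
    show "comm_group (hom_group (ModCat C) A B)"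
    proof (rule comm_groupI, simp_all)
      fix f g assume f: "f \<in> Hom (ModCat C) A B" and g: "g \<in> Hom (ModCat C) A B"
      show "Add (ModCat C) f g \<in> Hom (ModCat C) A B" by (rule MAdd_Hom[OF g f])
      have ac: "At f x u \<otimes>\<^bsub>FunO B x\<^esub> At g x u = At g x u \<otimes>\<^bsub>FunO B x\<^esub> At f x u"
        if "x \<in> Obj C" "u \<in> el A x" for x u
      proof -
        interpret comm_group "FunO B x" using module_group[OF m(2)] that by blast
        show ?thesis using m_comm[OF MH_closed[OF f that] MH_closed[OF g that]] .
      qed
      show "Add (ModCat C) f g = Add (ModCat C) g f"
        by (rule MH_eqI[OF MAdd_Hom[OF g f] MAdd_Hom[OF f g]]) (simp add: At_Add[OF f] At_Add[OF g] ac)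
      fix h assume h: "h \<in> Hom (ModCat C) A B"
      have as: "At f x u \<otimes>\<^bsub>FunO B x\<^esub> At g x u \<otimes>\<^bsub>FunO B x\<^esub> At h x u =
        At f x u \<otimes>\<^bsub>FunO B x\<^esub> (At g x u \<otimes>\<^bsub>FunO B x\<^esub> At h x u)"
        if "x \<in> Obj C" "u \<in> el A x" for x u
      proof -
        interpret comm_group "FunO B x" using module_group[OF m(2)] that by blast
        show ?thesis using m_assoc[OF MH_closed[OF f that] MH_closed[OF g that] MH_closed[OF h that]] .
      qed
      show "Add (ModCat C) (Add (ModCat C) f g) h = Add (ModCat C) f (Add (ModCat C) g h)"
        by (rule MH_eqI[OF MAdd_Hom[OF h MAdd_Hom[OF g f]] MAdd_Hom[OF MAdd_Hom[OF h g] f]])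
          (simp add: At_Add[OF f] At_Add[OF g] At_Add[OF MAdd_Hom[OF g f]] as)
    next
      show Z: "ZeroArr (ModCat C) A B \<in> Hom (ModCat C) A B" by (rule MZero_Hom[OF m])
      fix f assume f: "f \<in> Hom (ModCat C) A B"
      have l: "\<one>\<^bsub>FunO B x\<^esub> \<otimes>\<^bsub>FunO B x\<^esub> At f x u = At f x u" if "x \<in> Obj C" "u \<in> el A x" for x u
      proof -
        interpret comm_group "FunO B x" using module_group[OF m(2)] that by blast
        show ?thesis using l_one[OF MH_closed[OF f that]] .
      qed
      show "Add (ModCat C) (ZeroArr (ModCat C) A B) f = f"
        by (rule MH_eqI[OF MAdd_Hom[OF f Z] f]) (simp add: At_Add[OF Z] At_Zero l)
      let ?n = "mkmap C A B (\<lambda>x u. inv\<^bsub>FunO B x\<^esub> (At f x u))"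
      have n: "?n \<in> Hom (ModCat C) A B"
      proof (rule mkmap_Hom[OF m])
        fix x u assume xu: "x \<in> Obj C" "u \<in> el A x"
        interpret comm_group "FunO B x" using module_group[OF m(2)] xu by blast
        show "inv\<^bsub>FunO B x\<^esub> (At f x u) \<in> el B x" using MH_closed[OF f xu] by simp
        fix v assume v: "v \<in> el A x"
        show "inv\<^bsub>FunO B x\<^esub> (At f x (u \<otimes>\<^bsub>FunO A x\<^esub> v)) = inv\<^bsub>FunO B x\<^esub> (At f x u) \<otimes>\<^bsub>FunO B x\<^esub> inv\<^bsub>FunO B x\<^esub> (At f x v)"
          using MH_closed[OF f xu] MH_closed[OF f xu(1) v] MH_mult[OF f xu v] by (simp add: inv_mult)
      next
        fix x y g u assume g: "g \<in> Hom C x y" and u: "u \<in> el A y"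
        have o: "x \<in> Obj C" "y \<in> Obj C" using g Hom_Obj by auto
        interpret X: comm_group "FunO B x" using module_group[OF m(2)] o by blast
        interpret Y: comm_group "FunO B y" using module_group[OF m(2)] o by blast
        note c = MH_closed[OF f o(2) u]
        have "FunA B g (inv\<^bsub>FunO B y\<^esub> (At f y u)) \<otimes>\<^bsub>FunO B x\<^esub> FunA B g (At f y u) = \<one>\<^bsub>FunO B x\<^esub>"
          using act_mult[OF m(2) g Y.inv_closed[OF c] c] act_one[OF m(2) g] c by simp
        then show "FunA B g (inv\<^bsub>FunO B y\<^esub> (At f y u)) = inv\<^bsub>FunO B x\<^esub> (At f x (FunA A g u))"
          using X.inv_equality act_closed[OF m(2) g c] act_closed[OF m(2) g Y.inv_closed[OF c]] MH_act[OF f g u]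
          by simp
      qed
      have "At ?n x u \<otimes>\<^bsub>FunO B x\<^esub> At f x u = \<one>\<^bsub>FunO B x\<^esub>" if "x \<in> Obj C" "u \<in> el A x" for x u
      proof -
        interpret comm_group "FunO B x" using module_group[OF m(2)] that by blast
        show ?thesis using l_inv[OF MH_closed[OF f that]] that by (simp add: At_mkmap)
      qed
      then have "Add (ModCat C) ?n f = ZeroArr (ModCat C) A B"
        by (intro MH_eqI[OF MAdd_Hom[OF f n] Z]) (simp add: At_Add[OF n] At_Zero)
      then show "\<exists>h \<in> Hom (ModCat C) A B. Add (ModCat C) h f = ZeroArr (ModCat C) A B" using n by blast
    qed
  next
    fix f f' g A B D assume f: "f \<in> Hom (ModCat C) A B" and f': "f' \<in> Hom (ModCat C) A B"
      and g: "g \<in> Hom (ModCat C) B D"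
    show "g \<cdot>\<^bsub>ModCat C\<^esub> Add (ModCat C) f f' = Add (ModCat C) (g \<cdot>\<^bsub>ModCat C\<^esub> f) (g \<cdot>\<^bsub>ModCat C\<^esub> f')"
      by (rule MH_eqI[OF MComp_Hom[OF MAdd_Hom[OF f' f] g] MAdd_Hom[OF MComp_Hom[OF f' g] MComp_Hom[OF f g]]])
        (simp add: At_Add[OF f] At_Comp[OF MAdd_Hom[OF f' f]] At_Add[OF MComp_Hom[OF f g]] At_Comp[OF f] At_Comp[OF f']
          MH_mult[OF g] MH_closed[OF f] MH_closed[OF f'])
  next
    fix f g g' A B D assume f: "f \<in> Hom (ModCat C) A B" and g: "g \<in> Hom (ModCat C) B D"
      and g': "g' \<in> Hom (ModCat C) B D"
    show "Add (ModCat C) g g' \<cdot>\<^bsub>ModCat C\<^esub> f = Add (ModCat C) (g \<cdot>\<^bsub>ModCat C\<^esub> f) (g' \<cdot>\<^bsub>ModCat C\<^esub> f)"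
      by (rule MH_eqI[OF MComp_Hom[OF f MAdd_Hom[OF g' g]] MAdd_Hom[OF MComp_Hom[OF f g'] MComp_Hom[OF f g]]])
        (simp add: At_Comp[OF f] At_Add[OF MComp_Hom[OF f g]] At_Add[OF g] MH_closed[OF f])
  qed

section \<open>The shift of modules is an automorphism\<close>

lemma shM_simps:
  "x \<in> Obj C \<Longrightarrow> FunO (ShO (ModCat C) A) x = FunO A (UnO C x)"
  "f \<in> Arr C \<Longrightarrow> FunA (ShO (ModCat C) A) f = FunA A (UnA C f)"
  "x \<in> Obj C \<Longrightarrow> At (ShA (ModCat C) \<eta>) x = At \<eta> (UnO C x)"
  by (simp_all add: ModCat_shift_simps)

lemma unsh_simps:
  "x \<in> Obj C \<Longrightarrow> FunO (unshO C A) x = FunO A (ShO C x)"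
  "f \<in> Arr C \<Longrightarrow> FunA (unshO C A) f = FunA A (ShA C f)"
  "x \<in> Obj C \<Longrightarrow> At (unshA C \<eta>) x = At \<eta> (ShO C x)"
  by (simp_all add: unshO_def unshA_def)

lemma module_shift: assumes A: "is_module C A" shows "is_module C (ShO (ModCat C) A)"
  unfolding is_module_def
proof (intro conjI ballI impI)
  show "FunO (ShO (ModCat C) A) \<in> extensional (Obj C)" "FunA (ShO (ModCat C) A) \<in> extensional (Arr C)"
    by (simp_all add: ModCat_shift_simps)
next
  fix x assume x: "x \<in> Obj C"
  show "comm_group (FunO (ShO (ModCat C) A) x)" using module_group[OF A UnO_Obj[OF x]] x by (simp add: shM_simps)
  fix u assume "u \<in> el (ShO (ModCat C) A) x"
  then show "FunA (ShO (ModCat C) A) (Ident C x) u = u"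
    using act_ident[OF A UnO_Obj[OF x]] x UnA_Ident[OF x] Hom_Arr[OF Ident_Hom[OF x]] by (simp add: shM_simps)
next
  fix f assume f: "f \<in> Arr C"
  note h = UnA_Hom[OF Arr_Hom[OF f]] and o = Src_Obj[OF f] Tgt_Obj[OF f]
  have u: "UnA C f \<in> Arr C" "Src C (UnA C f) = UnO C (Src C f)" "Tgt C (UnA C f) = UnO C (Tgt C f)"
    using h by (auto simp: Hom_def)
  show "FunA (ShO (ModCat C) A) f \<in> hom (FunO (ShO (ModCat C) A) (Tgt C f)) (FunO (ShO (ModCat C) A) (Src C f))"
    "FunA (ShO (ModCat C) A) f \<in> extensional (el (ShO (ModCat C) A) (Tgt C f))"
    using A f o u unfolding is_module_def by (auto simp: shM_simps)
next
  fix f g u assume fg: "f \<in> Arr C" "g \<in> Arr C" "Tgt C f = Src C g" and u: "u \<in> el (ShO (ModCat C) A) (Tgt C g)"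
  then have h: "f \<in> Hom C (Src C f) (Tgt C f)" "g \<in> Hom C (Tgt C f) (Tgt C g)" by (auto simp: Hom_def)
  show "FunA (ShO (ModCat C) A) (g \<cdot> f) u = FunA (ShO (ModCat C) A) f (FunA (ShO (ModCat C) A) g u)"
    using act_comp[OF A UnA_Hom[OF h(1)] UnA_Hom[OF h(2)], of u] UnA_Comp[OF h] fg u Hom_Arr[OF Comp_Hom[OF h]]
      Tgt_Obj[OF fg(2)] by (simp add: shM_simps)
next
  fix f g u assume f: "f \<in> Arr C" and g: "g \<in> Hom C (Src C f) (Tgt C f)" and u: "u \<in> el (ShO (ModCat C) A) (Tgt C f)"
  note h = Arr_Hom[OF f]
  show "FunA (ShO (ModCat C) A) (Add C f g) u =
    FunA (ShO (ModCat C) A) f u \<otimes>\<^bsub>FunO (ShO (ModCat C) A) (Src C f)\<^esub> FunA (ShO (ModCat C) A) g u"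
    using act_Add[OF A UnA_Hom[OF h] UnA_Hom[OF g], of u] UnA_Add[OF h g] Hom_Arr[OF Add_Hom[OF h g]]
      Hom_Arr[OF g] f u Tgt_Obj[OF f] Src_Obj[OF f] by (simp add: shM_simps)
qed

lemma module_unshift: assumes A: "is_module C A" shows "is_module C (unshO C A)"
  unfolding is_module_def
proof (intro conjI ballI impI)
  show "FunO (unshO C A) \<in> extensional (Obj C)" "FunA (unshO C A) \<in> extensional (Arr C)"
    by (simp_all add: unshO_def)
next
  fix x assume x: "x \<in> Obj C"
  show "comm_group (FunO (unshO C A) x)" using module_group[OF A ShO_Obj[OF x]] x by (simp add: unsh_simps)
  fix u assume "u \<in> el (unshO C A) x"
  then show "FunA (unshO C A) (Ident C x) u = u"
    using act_ident[OF A ShO_Obj[OF x]] x ShA_Ident[OF x] Hom_Arr[OF Ident_Hom[OF x]] by (simp add: unsh_simps)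
next
  fix f assume f: "f \<in> Arr C"
  note h = ShA_Hom[OF Arr_Hom[OF f]] and o = Src_Obj[OF f] Tgt_Obj[OF f]
  have u: "ShA C f \<in> Arr C" "Src C (ShA C f) = ShO C (Src C f)" "Tgt C (ShA C f) = ShO C (Tgt C f)"
    using h by (auto simp: Hom_def)
  show "FunA (unshO C A) f \<in> hom (FunO (unshO C A) (Tgt C f)) (FunO (unshO C A) (Src C f))"
    "FunA (unshO C A) f \<in> extensional (el (unshO C A) (Tgt C f))"
    using A f o u unfolding is_module_def by (auto simp: unsh_simps)
next
  fix f g u assume fg: "f \<in> Arr C" "g \<in> Arr C" "Tgt C f = Src C g" and u: "u \<in> el (unshO C A) (Tgt C g)"
  then have h: "f \<in> Hom C (Src C f) (Tgt C f)" "g \<in> Hom C (Tgt C f) (Tgt C g)" by (auto simp: Hom_def)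
  show "FunA (unshO C A) (g \<cdot> f) u = FunA (unshO C A) f (FunA (unshO C A) g u)"
    using act_comp[OF A ShA_Hom[OF h(1)] ShA_Hom[OF h(2)], of u] ShA_Comp[OF h] fg u Hom_Arr[OF Comp_Hom[OF h]]
      Tgt_Obj[OF fg(2)] by (simp add: unsh_simps)
next
  fix f g u assume f: "f \<in> Arr C" and g: "g \<in> Hom C (Src C f) (Tgt C f)" and u: "u \<in> el (unshO C A) (Tgt C f)"
  note h = Arr_Hom[OF f]
  show "FunA (unshO C A) (Add C f g) u =
    FunA (unshO C A) f u \<otimes>\<^bsub>FunO (unshO C A) (Src C f)\<^esub> FunA (unshO C A) g u"
    using act_Add[OF A ShA_Hom[OF h] ShA_Hom[OF g], of u] shift_Add[OF h g] Hom_Arr[OF Add_Hom[OF h g]]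
      Hom_Arr[OF g] f u Tgt_Obj[OF f] Src_Obj[OF f] by (simp add: unsh_simps)
qed

lemma sh_unsh: assumes "is_module C A" shows "ShO (ModCat C) (unshO C A) = A"
proof (rule module_eqI[OF module_shift[OF module_unshift[OF assms]] assms])
  fix x assume "x \<in> Obj C" then show "FunO (ShO (ModCat C) (unshO C A)) x = FunO A x"
    by (simp add: shM_simps unsh_simps UnO_Obj ShO_UnO)
next
  fix f u assume "f \<in> Arr C" then show "FunA (ShO (ModCat C) (unshO C A)) f u = FunA A f u"
    by (simp add: shM_simps unsh_simps UnA_Arr ShA_UnA)
qed

lemma unsh_sh: assumes "is_module C A" shows "unshO C (ShO (ModCat C) A) = A"
proof (rule module_eqI[OF module_unshift[OF module_shift[OF assms]] assms])
  fix x assume "x \<in> Obj C" then show "FunO (unshO C (ShO (ModCat C) A)) x = FunO A x"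
    by (simp add: shM_simps unsh_simps ShO_Obj UnO_ShO)
next
  fix f u assume f: "f \<in> Arr C" then show "FunA (unshO C (ShO (ModCat C) A)) f u = FunA A f u"
    by (simp add: shM_simps unsh_simps Hom_Arr[OF ShA_Hom[OF Arr_Hom[OF f]]] UnA_ShA)
qed

text \<open>\<open>ShA\<close> does not restrict the components to the carriers again; they are in
  normal form because those of the original map are.\<close>

lemma shA_mkmap: "ShA (ModCat C) \<eta> = mkmap C (ShO (ModCat C) (MSrc \<eta>)) (ShO (ModCat C) (MTgt \<eta>)) (\<lambda>x. At \<eta> (UnO C x))"
  if "is_module_map C \<eta>"
proof (rule presheaf_map_eqI)
  show "At (ShA (ModCat C) \<eta>) = At (mkmap C (ShO (ModCat C) (MSrc \<eta>)) (ShO (ModCat C) (MTgt \<eta>)) (\<lambda>x. At \<eta> (UnO C x)))"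
  proof
    fix x show "At (ShA (ModCat C) \<eta>) x = At (mkmap C (ShO (ModCat C) (MSrc \<eta>)) (ShO (ModCat C) (MTgt \<eta>)) (\<lambda>x. At \<eta> (UnO C x))) x"
    proof (cases "x \<in> Obj C")
      case True
      have "At \<eta> (UnO C x) \<in> extensional (el (MSrc \<eta>) (UnO C x))"
        using that UnO_Obj[OF True] unfolding is_module_map_def by auto
      then show ?thesis using True by (simp add: shM_simps mkmap_def extensional_restrict)
    qed (simp add: ModCat_shift_simps mkmap_def)
  qed
qed (simp_all add: ModCat_shift_simps)

lemma unshA_mkmap: "unshA C \<eta> = mkmap C (unshO C (MSrc \<eta>)) (unshO C (MTgt \<eta>)) (\<lambda>x. At \<eta> (ShO C x))"
  if "is_module_map C \<eta>"
proof (rule presheaf_map_eqI)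
  show "At (unshA C \<eta>) = At (mkmap C (unshO C (MSrc \<eta>)) (unshO C (MTgt \<eta>)) (\<lambda>x. At \<eta> (ShO C x)))"
  proof
    fix x show "At (unshA C \<eta>) x = At (mkmap C (unshO C (MSrc \<eta>)) (unshO C (MTgt \<eta>)) (\<lambda>x. At \<eta> (ShO C x))) x"
    proof (cases "x \<in> Obj C")
      case True
      have "At \<eta> (ShO C x) \<in> extensional (el (MSrc \<eta>) (ShO C x))"
        using that ShO_Obj[OF True] unfolding is_module_map_def by auto
      then show ?thesis using True by (simp add: unsh_simps mkmap_def extensional_restrict)
    qed (simp add: unshA_def mkmap_def)
  qed
qed (simp_all add: unshA_def)

lemma MShA_Hom: assumes \<eta>: "\<eta> \<in> Hom (ModCat C) A B"
  shows "ShA (ModCat C) \<eta> \<in> Hom (ModCat C) (ShO (ModCat C) A) (ShO (ModCat C) B)"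
proof -
  have e: "MSrc \<eta> = A" "MTgt \<eta> = B" "is_module_map C \<eta>" using \<eta> by (auto simp: Hom_ModCat)
  note m = MH_mod[OF \<eta>]
  show ?thesis unfolding shA_mkmap[OF e(3)] e(1,2)
  proof (rule mkmap_Hom[OF module_shift[OF m(1)] module_shift[OF m(2)]])
    fix x y f u assume f: "f \<in> Hom C x y" and "u \<in> el (ShO (ModCat C) A) y"
    then show "FunA (ShO (ModCat C) B) f (At \<eta> (UnO C y) u) = At \<eta> (UnO C x) (FunA (ShO (ModCat C) A) f u)"
      using MH_act[OF \<eta> UnA_Hom[OF f], of u] Hom_Obj[OF f] Hom_Arr[OF f] by (simp add: shM_simps)
  qed (simp_all add: shM_simps MH_closed[OF \<eta>] MH_mult[OF \<eta>] UnO_Obj)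
qed

lemma unshA_Hom: assumes \<eta>: "\<eta> \<in> Hom (ModCat C) A B"
  shows "unshA C \<eta> \<in> Hom (ModCat C) (unshO C A) (unshO C B)"
proof -
  have e: "MSrc \<eta> = A" "MTgt \<eta> = B" "is_module_map C \<eta>" using \<eta> by (auto simp: Hom_ModCat)
  note m = MH_mod[OF \<eta>]
  show ?thesis unfolding unshA_mkmap[OF e(3)] e(1,2)
  proof (rule mkmap_Hom[OF module_unshift[OF m(1)] module_unshift[OF m(2)]])
    fix x y f u assume f: "f \<in> Hom C x y" and "u \<in> el (unshO C A) y"
    then show "FunA (unshO C B) f (At \<eta> (ShO C y) u) = At \<eta> (ShO C x) (FunA (unshO C A) f u)"
      using MH_act[OF \<eta> ShA_Hom[OF f], of u] Hom_Obj[OF f] Hom_Arr[OF f] by (simp add: unsh_simps)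
  qed (simp_all add: unsh_simps MH_closed[OF \<eta>] MH_mult[OF \<eta>] ShO_Obj)
qed

lemma sh_unshA: assumes \<eta>: "\<eta> \<in> Hom (ModCat C) A B" shows "ShA (ModCat C) (unshA C \<eta>) = \<eta>"
proof (rule MH_eqI[OF _ \<eta>])
  show "ShA (ModCat C) (unshA C \<eta>) \<in> Hom (ModCat C) A B"
    using MShA_Hom[OF unshA_Hom[OF \<eta>]] by (simp add: sh_unsh MH_mod[OF \<eta>])
  fix x u assume "x \<in> Obj C" then show "At (ShA (ModCat C) (unshA C \<eta>)) x u = At \<eta> x u"
    by (simp add: shM_simps unsh_simps UnO_Obj ShO_UnO)
qed

lemma unsh_shA: assumes \<eta>: "\<eta> \<in> Hom (ModCat C) A B" shows "unshA C (ShA (ModCat C) \<eta>) = \<eta>"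
proof (rule MH_eqI[OF _ \<eta>])
  show "unshA C (ShA (ModCat C) \<eta>) \<in> Hom (ModCat C) A B"
    using unshA_Hom[OF MShA_Hom[OF \<eta>]] by (simp add: unsh_sh MH_mod[OF \<eta>])
  fix x u assume "x \<in> Obj C" then show "At (unshA C (ShA (ModCat C) \<eta>)) x u = At \<eta> x u"
    by (simp add: shM_simps unsh_simps ShO_Obj UnO_ShO)
qed

lemma shifted_ModCat: "shifted (ModCat C :: (('o, 'm, 'u) presheaf, ('o, 'm, 'u) presheaf_map) shift_cat)"
proof (rule shifted.intro, rule preadditive_ModCat, rule shifted_axioms.intro)
  let ?M = "ModCat C :: (('o, 'm, 'u) presheaf, ('o, 'm, 'u) presheaf_map) shift_cat"
  have mm: "\<eta> \<in> Hom ?M (MSrc \<eta>) (MTgt \<eta>)" if "is_module_map C \<eta>" for \<eta> :: "('o, 'm, 'u) presheaf_map"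
    using that by (simp add: Hom_ModCat)
    show "is_functor ?M ?M (ShO (ModCat C)) (ShA (ModCat C))"
      unfolding is_functor_def
    proof (intro conjI ballI impI)
      fix A assume "A \<in> Obj ?M" then have A: "is_module C A" by simp
      show "ShO (ModCat C) A \<in> Obj ?M" by (simp add: module_shift[OF A])
      show "ShA (ModCat C) (Ident (ModCat C) A) = Ident (ModCat C) (ShO (ModCat C) A)"
        by (rule MH_eqI[OF MShA_Hom[OF MIdent_Hom[OF A]] MIdent_Hom[OF module_shift[OF A]]])
          (simp add: shM_simps At_Ident UnO_Obj)
    next
      fix f assume "f \<in> Arr ?M"
      then show "ShA (ModCat C) f \<in> Hom (ModCat C) (ShO (ModCat C) (Src (ModCat C) f)) (ShO (ModCat C) (Tgt (ModCat C) f))"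
        using MShA_Hom[OF mm] by simp
    next
      fix f g assume a: "f \<in> Arr ?M" "g \<in> Arr ?M" "Tgt (ModCat C) f = Src (ModCat C) g"
      have f: "f \<in> Hom (ModCat C) (MSrc f) (MTgt f)" and g: "g \<in> Hom (ModCat C) (MTgt f) (MTgt g)"
        using a by (auto simp: Hom_ModCat)
      show "ShA (ModCat C) (g \<cdot>\<^bsub>ModCat C\<^esub> f) = ShA (ModCat C) g \<cdot>\<^bsub>ModCat C\<^esub> ShA (ModCat C) f"
        by (rule MH_eqI[OF MShA_Hom[OF MComp_Hom[OF f g]] MComp_Hom[OF MShA_Hom[OF f] MShA_Hom[OF g]]])
          (simp add: At_Comp[OF MShA_Hom[OF f]] shM_simps At_Comp[OF f] UnO_Obj)
    qed
    show "bij_betw (ShO (ModCat C)) (Obj ?M) (Obj ?M)"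
      by (rule bij_betwI[of _ _ _ "unshO C"]) (auto simp: module_shift module_unshift sh_unsh unsh_sh)
    show "bij_betw (ShA (ModCat C)) (Arr ?M) (Arr ?M)"
      by (rule bij_betwI[of _ _ _ "unshA C"])
        (auto simp: Hom_ModCat dest!: mm intro: sh_unshA unsh_shA Hom_ModCat[THEN iffD1, OF MShA_Hom, THEN conjunct1]
          Hom_ModCat[THEN iffD1, OF unshA_Hom, THEN conjunct1])
    fix f f' A B assume f: "f \<in> Hom ?M A B" and f': "f' \<in> Hom ?M A B"
    show "ShA (ModCat C) (Add (ModCat C) f f') = Add (ModCat C) (ShA (ModCat C) f) (ShA (ModCat C) f')"
      by (rule MH_eqI[OF MShA_Hom[OF MAdd_Hom[OF f' f]] MAdd_Hom[OF MShA_Hom[OF f'] MShA_Hom[OF f]]])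
        (simp add: shM_simps At_Add[OF f] At_Add[OF MShA_Hom[OF f]] UnO_Obj)
qed

end

section \<open>Sequences\<close>

context category
begin

lemma seq_Hom: "is_seq C E \<Longrightarrow> E n \<in> Hom C (Src C (E n)) (Src C (E (Suc n)))"
  by (simp add: is_seq_def Hom_def)

lemma seq_Obj: "is_seq C E \<Longrightarrow> Src C (E n) \<in> Obj C"
  using seq_Hom Hom_Obj by blast

lemma is_seqI: assumes "\<And>n. E n \<in> Hom C (a n) (a (Suc n))"
  shows "is_seq C E" "Src C (E n) = a n"
  using assms unfolding is_seq_def by (auto simp: Hom_def)

lemma seq_comp_Hom: assumes "is_seq C E" shows "seq_comp C E j d \<in> Hom C (Src C (E j)) (Src C (E (j + d)))"
proof (induction d)
  case (Suc d) then show ?case using Comp_Hom[OF Suc seq_Hom[OF assms]] by simp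
qed (simp add: Ident_Hom seq_Obj[OF assms])

lemma trans_Hom: assumes "is_seq C E" "j \<le> k" shows "transition C E j k \<in> Hom C (Src C (E j)) (Src C (E k))"
  using seq_comp_Hom[OF assms(1), of j "k - j"] assms(2) by (simp add: transition_def)

lemma trans_refl: "transition C E j j = Ident C (Src C (E j))"
  by (simp add: transition_def)

lemma trans_Suc: "j \<le> k \<Longrightarrow> transition C E j (Suc k) = E k \<cdot> transition C E j k"
  by (simp add: transition_def Suc_diff_le)

lemma trans_step: "is_seq C E \<Longrightarrow> transition C E j (Suc j) = E j"
  by (simp add: trans_Suc trans_refl Comp_Ident[OF seq_Hom])

lemma trans_comp: assumes E: "is_seq C E" and "i \<le> j" "j \<le> k"
  shows "transition C E j k \<cdot> transition C E i j = transition C E i k"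
  using assms(3)
proof (induction k rule: dec_induct)
  case base then show ?case by (simp add: trans_refl Ident_Comp[OF trans_Hom[OF E assms(2)]])
next
  case (step k)
  then show ?case
    using Comp_assoc[OF trans_Hom[OF E assms(2)] trans_Hom[OF E step(1)] seq_Hom[OF E]] assms(2)
    by (simp add: trans_Suc)
qed

lemma trans_comp_assoc: assumes E: "is_seq C E" and "i \<le> j" "j \<le> k" "f \<in> Hom C x (Src C (E i))"
  shows "transition C E j k \<cdot> (transition C E i j \<cdot> f) = transition C E i k \<cdot> f"
  using Comp_assoc[OF assms(4) trans_Hom[OF E assms(2)] trans_Hom[OF E assms(3)]] trans_comp[OF assms(1-3)]
  by simp

lemma trans_push: assumes E: "is_seq C E" and "f \<in> Hom C x (Src C (E i))" "i \<le> j"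
  shows "transition C E i j \<cdot> f \<in> Hom C x (Src C (E j))"
  using Comp_Hom[OF assms(2) trans_Hom[OF E assms(3)]] .

lemma subseq_seq: assumes E: "is_seq C E" and r: "strict_mono r"
  shows "is_seq C (subsequence C E r)" "Src C (subsequence C E r n) = Src C (E (r n))"
proof -
  have "subsequence C E r n \<in> Hom C (Src C (E (r n))) (Src C (E (r (Suc n))))" for n
    unfolding subsequence_def using trans_Hom[OF E] r by (simp add: strict_mono_less_eq)
  then show "is_seq C (subsequence C E r)" "Src C (subsequence C E r n) = Src C (E (r n))"
    by (rule is_seqI[where a = "\<lambda>n. Src C (E (r n))"])+
qed

lemma subseq_trans: assumes E: "is_seq C E" and r: "strict_mono r" and "j \<le> k"
  shows "transition C (subsequence C E r) j k = transition C E (r j) (r k)"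
  using assms(3)
proof (induction k rule: dec_induct)
  case base then show ?case by (simp add: trans_refl subseq_seq[OF E r])
next
  case (step k)
  then show ?case using trans_comp[OF E, of "r j" "r k" "r (Suc k)"] r
    by (simp add: trans_Suc subsequence_def strict_mono_less_eq)
qed

lemma map_trans: assumes a: "is_seq C a" and b: "is_seq C b" and f: "seq_map C a b f" and "j \<le> k"
  shows "f k \<cdot> transition C a j k = transition C b j k \<cdot> f j"
  using assms(4)
proof (induction k rule: dec_induct)
  case base
  have "f j \<in> Hom C (Src C (a j)) (Src C (b j))" using f by (simp add: seq_map_def)
  then show ?case by (simp add: trans_refl Ident_Comp Comp_Ident)
next
  case (step k)
  have fk: "f n \<in> Hom C (Src C (a n)) (Src C (b n))" "f (Suc n) \<cdot> a n = b n \<cdot> f n" for n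
    using f by (auto simp: seq_map_def)
  show ?case
    using Comp_assoc[OF trans_Hom[OF a step(1)] seq_Hom[OF a] fk(1)] Comp_assoc[OF trans_Hom[OF a step(1)] fk(1) seq_Hom[OF b]]
      Comp_assoc[OF fk(1) trans_Hom[OF b step(1)] seq_Hom[OF b]] fk(2) step by (simp add: trans_Suc)
qed

end

lemma (in shifted) shift_seq: assumes E: "is_seq C E"
  shows "is_seq C (\<lambda>n. ShA C (E n))" "Src C (ShA C (E n)) = ShO C (Src C (E n))"
  using is_seqI[of "\<lambda>n. ShA C (E n)" "\<lambda>n. ShO C (Src C (E n))"] ShA_Hom[OF seq_Hom[OF E]] by auto

lemma (in shifted) unshift_seq: assumes E: "is_seq C E"
  shows "is_seq C (\<lambda>n. UnA C (E n))" "Src C (UnA C (E n)) = UnO C (Src C (E n))"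
  using is_seqI[of "\<lambda>n. UnA C (E n)" "\<lambda>n. UnO C (Src C (E n))"] UnA_Hom[OF seq_Hom[OF E]] by auto

lemma (in shifted) shift_trans: assumes E: "is_seq C E" and "j \<le> k"
  shows "transition C (\<lambda>n. ShA C (E n)) j k = ShA C (transition C E j k)"
  using assms(2)
proof (induction k rule: dec_induct)
  case base then show ?case by (simp add: trans_refl shift_seq(2)[OF E] ShA_Ident seq_Obj[OF E])
next
  case (step k)
  then show ?case using ShA_Comp[OF trans_Hom[OF E] seq_Hom[OF E]] by (simp add: trans_Suc)
qed

lemma (in shifted) unshift_trans: assumes E: "is_seq C E" and "j \<le> k"
  shows "transition C (\<lambda>n. UnA C (E n)) j k = UnA C (transition C E j k)"
  using assms(2)
proof (induction k rule: dec_induct)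
  case base then show ?case by (simp add: trans_refl unshift_seq(2)[OF E] UnA_Ident seq_Obj[OF E])
next
  case (step k)
  then show ?case using UnA_Comp[OF trans_Hom[OF E] seq_Hom[OF E]] by (simp add: trans_Suc)
qed


section \<open>Sequential colimits of representable modules\<close>

text \<open>Under the Yoneda lemma a cocone on \<open>Y(E)\<close> with vertex \<open>A\<close> is a compatible family of elements
  \<open>t n \<in> A(E n)\<close>; it is a colimit cocone iff the following holds.\<close>

definition pres :: "('o, 'm, 'z) cat_scheme \<Rightarrow> (nat \<Rightarrow> 'm) \<Rightarrow> ('o, 'm, 'u) presheaf \<Rightarrow> (nat \<Rightarrow> 'u) \<Rightarrow> bool" where
  "pres C E A t \<longleftrightarrow> (\<forall>n. t n \<in> el A (Src C (E n)) \<and> FunA A (E n) (t (Suc n)) = t n) \<and>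
     (\<forall>x \<in> Obj C. \<forall>u \<in> el A x. \<exists>n. \<exists>f \<in> Hom C x (Src C (E n)). u = FunA A f (t n)) \<and>
     (\<forall>n x. \<forall>f \<in> Hom C x (Src C (E n)). \<forall>g \<in> Hom C x (Src C (E n)). FunA A f (t n) = FunA A g (t n) \<longrightarrow>
        (\<exists>k\<ge>n. transition C E n k \<cdot>\<^bsub>C\<^esub> f = transition C E n k \<cdot>\<^bsub>C\<^esub> g))"

context shifted
begin

lemma presD:
  assumes "pres C E A t"
  shows pres_el: "t n \<in> el A (Src C (E n))"
    and pres_step: "FunA A (E n) (t (Suc n)) = t n"
    and pres_surj: "\<lbrakk>x \<in> Obj C; u \<in> el A x\<rbrakk> \<Longrightarrow> \<exists>n. \<exists>f \<in> Hom C x (Src C (E n)). u = FunA A f (t n)"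
    and pres_inj: "\<lbrakk>f \<in> Hom C x (Src C (E n)); g \<in> Hom C x (Src C (E n)); FunA A f (t n) = FunA A g (t n)\<rbrakk>
       \<Longrightarrow> \<exists>k\<ge>n. transition C E n k \<cdot> f = transition C E n k \<cdot> g"
  using assms unfolding pres_def by blast+

lemma pres_trans: assumes E: "is_seq C E" and A: "is_module C A"
    and t: "\<And>n. t n \<in> el A (Src C (E n))" "\<And>n. FunA A (E n) (t (Suc n)) = t n" and "j \<le> k"
  shows "FunA A (transition C E j k) (t k) = t j"
  using assms(5)
proof (induction k rule: dec_induct)
  case base then show ?case using act_ident[OF A seq_Obj[OF E] t(1)] by (simp add: trans_refl)
next
  case (step k)
  then show ?case using act_comp[OF A trans_Hom[OF E step(1)] seq_Hom[OF E] t(1)] t(2) by (simp add: trans_Suc)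
qed

lemma pres_push:
  assumes E: "is_seq C E" and A: "is_module C A" and p: "pres C E A t" and f: "f \<in> Hom C x (Src C (E j))" and "j \<le> k"
  shows "FunA A (transition C E j k \<cdot> f) (t k) = FunA A f (t j)"
  using act_comp[OF A f trans_Hom[OF E assms(5)] pres_el[OF p]] pres_trans[OF E A pres_el[OF p] pres_step[OF p] assms(5)]
  by simp

lemma pres_surj_ge:
  assumes E: "is_seq C E" and A: "is_module C A" and p: "pres C E A t" and "x \<in> Obj C" "u \<in> el A x"
  shows "\<exists>n\<ge>N. \<exists>f \<in> Hom C x (Src C (E n)). u = FunA A f (t n)"
proof -
  obtain n f where f: "f \<in> Hom C x (Src C (E n))" "u = FunA A f (t n)" using pres_surj[OF p assms(4,5)] by blast
  show ?thesis
  proof (intro exI[of _ "max n N"] conjI bexI[of _ "transition C E n (max n N) \<cdot> f"])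
    show "transition C E n (max n N) \<cdot> f \<in> Hom C x (Src C (E (max n N)))" by (rule trans_push[OF E f(1)]) simp
    show "u = FunA A (transition C E n (max n N) \<cdot> f) (t (max n N))" using pres_push[OF E A p f(1)] f(2) by simp
  qed simp
qed

lemma pres_surj_all:
  assumes E: "is_seq C E" and A: "is_module C A" and p: "pres C E A t" and "x \<in> Obj C" "u \<in> el A x"
  shows "\<exists>N. \<forall>n\<ge>N. \<exists>f \<in> Hom C x (Src C (E n)). u = FunA A f (t n)"
proof -
  obtain n f where f: "f \<in> Hom C x (Src C (E n))" "u = FunA A f (t n)" using pres_surj[OF p assms(4,5)] by blast
  show ?thesis
  proof (intro exI[of _ n] allI impI bexI)
    fix k assume k: "k \<ge> n"
    show "transition C E n k \<cdot> f \<in> Hom C x (Src C (E k))" by (rule trans_push[OF E f(1) k])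
    show "u = FunA A (transition C E n k \<cdot> f) (t k)" using pres_push[OF E A p f(1) k] f(2) by simp
  qed
qed

text \<open>Both representatives are pushed to one stage before the injectivity clause of
  \<open>pres\<close> applies. The conclusion is stated for all late stages so that several such
  identifications can be combined.\<close>

lemma pres_inj_ge:
  assumes E: "is_seq C E" and A: "is_module C A" and p: "pres C E A t"
    and f: "f \<in> Hom C x (Src C (E n))" and g: "g \<in> Hom C x (Src C (E m))" and e: "FunA A f (t n) = FunA A g (t m)"
  shows "\<exists>K. \<forall>k\<ge>K. n \<le> k \<and> m \<le> k \<and> transition C E n k \<cdot> f = transition C E m k \<cdot> g"
proof -
  define l where "l = max n m"
  have l: "n \<le> l" "m \<le> l" by (auto simp: l_def)
  obtain k where k: "k \<ge> l" "transition C E l k \<cdot> (transition C E n l \<cdot> f) = transition C E l k \<cdot> (transition C E m l \<cdot> g)"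
    using pres_inj[OF p trans_push[OF E f l(1)] trans_push[OF E g l(2)]] pres_push[OF E A p f l(1)]
      pres_push[OF E A p g l(2)] e by auto
  have eq: "transition C E n k \<cdot> f = transition C E m k \<cdot> g"
    using k trans_comp_assoc[OF E l(1) k(1) f] trans_comp_assoc[OF E l(2) k(1) g] by simp
  have nk: "n \<le> k" "m \<le> k" using l k by auto
  show ?thesis
  proof (intro exI[of _ k] allI impI conjI)
    fix i assume i: "i \<ge> k"
    show "n \<le> i" "m \<le> i" using nk i by auto
    show "transition C E n i \<cdot> f = transition C E m i \<cdot> g"
      using trans_comp_assoc[OF E nk(1) i f] trans_comp_assoc[OF E nk(2) i g] eq by simp
  qed
qed

text \<open>Every element of \<open>A\<close> comes from some \<open>t n\<close> with
  \<open>n\<close> as late as desired, so the late values determine the map.\<close>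

lemma pres_eqI:
  assumes E: "is_seq C E" and p: "pres C E A t"
    and G: "G \<in> Hom (ModCat C) A B" and G': "G' \<in> Hom (ModCat C) A B"
    and e: "\<And>n. n \<ge> N \<Longrightarrow> At G (Src C (E n)) (t n) = At G' (Src C (E n)) (t n)"
  shows "G = G'"
proof (rule MH_eqI[OF G G'])
  fix x u assume x: "x \<in> Obj C" and u: "u \<in> el A x"
  obtain n f where n: "n \<ge> N" "f \<in> Hom C x (Src C (E n))" "u = FunA A f (t n)"
    using pres_surj_ge[OF E MH_mod(1)[OF G] p x u] by blast
  show "At G x u = At G' x u"
    using MH_act[OF G n(2) pres_el[OF p]] MH_act[OF G' n(2) pres_el[OF p]] e[OF n(1)] n(3) by simp
qed

text \<open>This is the universal property of the colimit in terms of elements. The value at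
  \<open>FunA A f (t n)\<close> has to be \<open>FunA B f (s n)\<close>; it is well defined because
  two representations of an element agree at a late stage and \<open>s\<close> is compatible.
  Additivity is seen after moving two elements to one stage.\<close>

lemma pres_hom:
  assumes E: "is_seq C E" and A: "is_module C A" and p: "pres C E A t" and B: "is_module C B"
    and s: "\<And>n. s n \<in> el B (Src C (E n))" "\<And>n. FunA B (E n) (s (Suc n)) = s n"
  shows "\<exists>G \<in> Hom (ModCat C) A B. \<forall>n. At G (Src C (E n)) (t n) = s n"
proof -
  have wd: "FunA B f (s n) = FunA B g (s m)"
    if f: "f \<in> Hom C x (Src C (E n))" and g: "g \<in> Hom C x (Src C (E m))" and e: "FunA A f (t n) = FunA A g (t m)"
    for x f g n m
  proof -
    obtain k where k: "n \<le> k" "m \<le> k" "transition C E n k \<cdot> f = transition C E m k \<cdot> g"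
      using pres_inj_ge[OF E A p f g e] by auto
    have "FunA B (transition C E n k \<cdot> f) (s k) = FunA B f (s n)" "FunA B (transition C E m k \<cdot> g) (s k) = FunA B g (s m)"
      using act_comp[OF B f trans_Hom[OF E k(1)] s(1)] act_comp[OF B g trans_Hom[OF E k(2)] s(1)]
        pres_trans[OF E B s(1) s(2) k(1)] pres_trans[OF E B s(1) s(2) k(2)] by auto
    then show ?thesis using k(3) by simp
  qed
  define \<phi> where "\<phi> x u = (SOME v. \<exists>n. \<exists>f \<in> Hom C x (Src C (E n)). u = FunA A f (t n) \<and> v = FunA B f (s n))" for x u
  have \<phi>: "\<exists>n. \<exists>f \<in> Hom C x (Src C (E n)). u = FunA A f (t n) \<and> \<phi> x u = FunA B f (s n)"
    if "x \<in> Obj C" "u \<in> el A x" for x u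
    unfolding \<phi>_def by (rule someI_ex) (use pres_surj[OF p that] in blast)
  have \<phi>e: "\<phi> x (FunA A f (t n)) = FunA B f (s n)" if f: "f \<in> Hom C x (Src C (E n))" for x f n
  proof -
    obtain m g where g: "g \<in> Hom C x (Src C (E m))" "FunA A f (t n) = FunA A g (t m)"
      "\<phi> x (FunA A f (t n)) = FunA B g (s m)"
      using \<phi>[OF Hom_Obj(1)[OF f] act_closed[OF A f pres_el[OF p]]] by blast
    show ?thesis using wd[OF f g(1,2)] g(3) by simp
  qed
  let ?G = "mkmap C A B \<phi>"
  have G: "?G \<in> Hom (ModCat C) A B"
  proof (rule mkmap_Hom[OF A B])
    fix x u assume x: "x \<in> Obj C" and u: "u \<in> el A x"
    obtain n f where f: "f \<in> Hom C x (Src C (E n))" "u = FunA A f (t n)" using pres_surj[OF p x u] by blast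
    show "\<phi> x u \<in> el B x" using \<phi>e[OF f(1)] f(2) act_closed[OF B f(1) s(1)] by simp
    fix v assume v: "v \<in> el A x"
    obtain m g where m: "m \<ge> n" and g: "g \<in> Hom C x (Src C (E m))" "v = FunA A g (t m)"
      using pres_surj_ge[OF E A p x v] by blast
    let ?f = "transition C E n m \<cdot> f"
    have f': "?f \<in> Hom C x (Src C (E m))" "u = FunA A ?f (t m)"
      using pres_push[OF E A p f(1) m] trans_push[OF E f(1) m] f(2) by auto
    show "\<phi> x (u \<otimes>\<^bsub>FunO A x\<^esub> v) = \<phi> x u \<otimes>\<^bsub>FunO B x\<^esub> \<phi> x v"
      using \<phi>e[OF Add_Hom[OF f'(1) g(1)]] \<phi>e[OF f'(1)] \<phi>e[OF g(1)] act_Add[OF A f'(1) g(1) pres_el[OF p]]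
        act_Add[OF B f'(1) g(1) s(1)] f'(2) g(2) by simp
  next
    fix x y f u assume f: "f \<in> Hom C x y" and u: "u \<in> el A y"
    obtain n g where g: "g \<in> Hom C y (Src C (E n))" "u = FunA A g (t n)"
      using pres_surj[OF p Hom_Obj(2)[OF f] u] by blast
    show "FunA B f (\<phi> y u) = \<phi> x (FunA A f u)"
      using \<phi>e[OF g(1)] \<phi>e[OF Comp_Hom[OF f g(1)]] act_comp[OF A f g(1) pres_el[OF p]]
        act_comp[OF B f g(1) s(1)] g(2) by simp
  qed
  have "At ?G (Src C (E n)) (t n) = s n" for n
    using \<phi>e[OF Ident_Hom[OF seq_Obj[OF E]], of n] act_ident[OF A seq_Obj[OF E] pres_el[OF p], of n]
      act_ident[OF B seq_Obj[OF E] s(1), of n] At_mkmap[OF seq_Obj[OF E] pres_el[OF p], of B \<phi>] by simp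
  then show ?thesis using G by blast
qed

text \<open>The setwise inverses are additive and natural, since both can be checked after applying
  the bijections \<open>At G x\<close>.\<close>

lemma bij_invertible:
  assumes G: "G \<in> Hom (ModCat C) A B" and b: "\<And>x. x \<in> Obj C \<Longrightarrow> bij_betw (At G x) (el A x) (el B x)"
  shows "\<exists>G' \<in> Hom (ModCat C) B A. G' \<cdot>\<^bsub>ModCat C\<^esub> G = Ident (ModCat C) A \<and> G \<cdot>\<^bsub>ModCat C\<^esub> G' = Ident (ModCat C) B"
proof -
  note m = MH_mod[OF G]
  define \<phi> where "\<phi> = (\<lambda>x. inv_into (el A x) (At G x))"
  have c: "\<phi> x v \<in> el A x" "At G x (\<phi> x v) = v" if "x \<in> Obj C" "v \<in> el B x" for x v
    using b[OF that(1)] that unfolding \<phi>_def bij_betw_def by (auto simp: inv_into_into f_inv_into_f)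
  have i: "\<phi> x (At G x u) = u" if "x \<in> Obj C" "u \<in> el A x" for x u
    using b[OF that(1)] that unfolding \<phi>_def bij_betw_def by auto
  have G': "mkmap C B A \<phi> \<in> Hom (ModCat C) B A" (is "?G \<in> _")
  proof (rule mkmap_Hom[OF m(2,1)])
    fix x u assume x: "x \<in> Obj C" and u: "u \<in> el B x"
    show "\<phi> x u \<in> el A x" by (rule c[OF x u])
    fix v assume v: "v \<in> el B x"
    show "\<phi> x (u \<otimes>\<^bsub>FunO B x\<^esub> v) = \<phi> x u \<otimes>\<^bsub>FunO A x\<^esub> \<phi> x v"
      using i[OF x module_mult[OF m(1) x c(1)[OF x u] c(1)[OF x v]]] MH_mult[OF G x c(1)[OF x u] c(1)[OF x v]]
        c(2)[OF x u] c(2)[OF x v] by simp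
  next
    fix x y f u assume f: "f \<in> Hom C x y" and u: "u \<in> el B y"
    note o = Hom_Obj[OF f]
    show "FunA A f (\<phi> y u) = \<phi> x (FunA B f u)"
      using i[OF o(1) act_closed[OF m(1) f c(1)[OF o(2) u]]] MH_act[OF G f c(1)[OF o(2) u]] c(2)[OF o(2) u] by simp
  qed
  have "?G \<cdot>\<^bsub>ModCat C\<^esub> G = Ident (ModCat C) A"
    by (rule MH_eqI[OF MComp_Hom[OF G G'] MIdent_Hom[OF m(1)]])
      (simp add: At_Comp[OF G] At_mkmap MH_closed[OF G] i At_Ident)
  moreover have "G \<cdot>\<^bsub>ModCat C\<^esub> ?G = Ident (ModCat C) B"
    by (rule MH_eqI[OF MComp_Hom[OF G' G] MIdent_Hom[OF m(2)]])
      (simp add: At_Comp[OF G'] At_mkmap c At_Ident)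
  ultimately show ?thesis using G' by blast
qed

lemma pres_transport:
  assumes E: "is_seq C E" and p: "pres C E A t" and G: "G \<in> Hom (ModCat C) A B"
    and b: "\<And>x. x \<in> Obj C \<Longrightarrow> bij_betw (At G x) (el A x) (el B x)"
  shows "pres C E B (\<lambda>n. At G (Src C (E n)) (t n))"
  unfolding pres_def
proof (intro conjI allI ballI impI)
  fix n show "At G (Src C (E n)) (t n) \<in> el B (Src C (E n))"
    by (rule MH_closed[OF G seq_Obj[OF E] pres_el[OF p]])
  show "FunA B (E n) (At G (Src C (E (Suc n))) (t (Suc n))) = At G (Src C (E n)) (t n)"
    using MH_act[OF G seq_Hom[OF E] pres_el[OF p]] pres_step[OF p] by simp
next
  fix x u assume x: "x \<in> Obj C" and u: "u \<in> el B x"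
  then obtain v where v: "v \<in> el A x" "u = At G x v" using b[OF x] unfolding bij_betw_def by blast
  obtain n f where f: "f \<in> Hom C x (Src C (E n))" "v = FunA A f (t n)" using pres_surj[OF p x v(1)] by blast
  show "\<exists>n. \<exists>f\<in>Hom C x (Src C (E n)). u = FunA B f (At G (Src C (E n)) (t n))"
    using f v MH_act[OF G f(1) pres_el[OF p]] by (intro exI[of _ n] bexI[of _ f]) auto
next
  fix n x f g assume f: "f \<in> Hom C x (Src C (E n))" and g: "g \<in> Hom C x (Src C (E n))"
    and e: "FunA B f (At G (Src C (E n)) (t n)) = FunA B g (At G (Src C (E n)) (t n))"
  note m = MH_mod[OF G] and x = Hom_Obj(1)[OF f]
  have "At G x (FunA A f (t n)) = At G x (FunA A g (t n))"
    using e MH_act[OF G f pres_el[OF p]] MH_act[OF G g pres_el[OF p]] by simp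
  then have "FunA A f (t n) = FunA A g (t n)"
    using b[OF x] act_closed[OF m(1) f pres_el[OF p]] act_closed[OF m(1) g pres_el[OF p]]
    unfolding bij_betw_def inj_on_def by blast
  then show "\<exists>k\<ge>n. transition C E n k \<cdot> f = transition C E n k \<cdot> g" using pres_inj[OF p f g] by blast
qed

text \<open>The universal property gives maps in both directions, and the two composites fix the
  generating elements.\<close>

lemma pres_unique:
  assumes E: "is_seq C E" and A: "is_module C A" "pres C E A t" and B: "is_module C B" "pres C E B s"
  shows "\<exists>G \<in> Hom (ModCat C) A B. (\<forall>n. At G (Src C (E n)) (t n) = s n) \<and>
    (\<forall>x \<in> Obj C. bij_betw (At G x) (el A x) (el B x))"
proof -
  obtain G where G: "G \<in> Hom (ModCat C) A B" "\<And>n. At G (Src C (E n)) (t n) = s n"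
    using pres_hom[OF E A B(1) pres_el[OF B(2)] pres_step[OF B(2)]] by blast
  obtain H where H: "H \<in> Hom (ModCat C) B A" "\<And>n. At H (Src C (E n)) (s n) = t n"
    using pres_hom[OF E B A(1) pres_el[OF A(2)] pres_step[OF A(2)]] by blast
  have HG: "H \<cdot>\<^bsub>ModCat C\<^esub> G = Ident (ModCat C) A"
    by (rule pres_eqI[OF E A(2) MComp_Hom[OF G(1) H(1)] MIdent_Hom[OF A(1)]])
      (simp add: At_Comp[OF G(1) seq_Obj[OF E] pres_el[OF A(2)]] At_Ident[OF seq_Obj[OF E] pres_el[OF A(2)]] G(2) H(2))
  have GH: "G \<cdot>\<^bsub>ModCat C\<^esub> H = Ident (ModCat C) B"
    by (rule pres_eqI[OF E B(2) MComp_Hom[OF H(1) G(1)] MIdent_Hom[OF B(1)]])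
      (simp add: At_Comp[OF H(1) seq_Obj[OF E] pres_el[OF B(2)]] At_Ident[OF seq_Obj[OF E] pres_el[OF B(2)]] G(2) H(2))
  have "bij_betw (At G x) (el A x) (el B x)" if x: "x \<in> Obj C" for x
  proof (rule bij_betwI[of _ _ _ "At H x"])
    show "At G x \<in> el A x \<rightarrow> el B x" "At H x \<in> el B x \<rightarrow> el A x" using MH_closed[OF G(1) x] MH_closed[OF H(1) x] by auto
    fix u assume "u \<in> el A x" then show "At H x (At G x u) = u"
      using At_Comp[OF G(1) x, of u H] HG At_Ident[OF x, of u A] by simp
  next
    fix u assume "u \<in> el B x" then show "At G x (At H x u) = u"
      using At_Comp[OF H(1) x, of u G] GH At_Ident[OF x, of u B] by simp
  qed
  then show ?thesis using G by blast
qed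

lemma pres_subseq:
  assumes E: "is_seq C E" and A: "is_module C A" and p: "pres C E A t" and r: "strict_mono r"
  shows "pres C (subsequence C E r) A (\<lambda>n. t (r n))"
  unfolding pres_def subseq_seq(2)[OF E r]
proof (intro conjI allI ballI impI)
  fix n show "t (r n) \<in> el A (Src C (E (r n)))" by (rule pres_el[OF p])
  show "FunA A (subsequence C E r n) (t (r (Suc n))) = t (r n)"
    using pres_trans[OF E A pres_el[OF p] pres_step[OF p], of "r n" "r (Suc n)"] r
    by (simp add: subsequence_def strict_mono_less_eq)
next
  fix x u assume x: "x \<in> Obj C" and u: "u \<in> el A x"
  obtain n f where f: "f \<in> Hom C x (Src C (E n))" "u = FunA A f (t n)" using pres_surj[OF p x u] by blast
  have n: "n \<le> r n" by (rule strict_mono_imp_increasing[OF r])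
  show "\<exists>n. \<exists>f\<in>Hom C x (Src C (E (r n))). u = FunA A f (t (r n))"
    using pres_push[OF E A p f(1) n] trans_push[OF E f(1) n] f(2) by (intro exI[of _ n] bexI) auto
next
  fix n x f g assume fg: "f \<in> Hom C x (Src C (E (r n)))" "g \<in> Hom C x (Src C (E (r n)))"
    "FunA A f (t (r n)) = FunA A g (t (r n))"
  obtain K where K: "\<And>k. k \<ge> K \<Longrightarrow> transition C E (r n) k \<cdot> f = transition C E (r n) k \<cdot> g"
    using pres_inj_ge[OF E A p fg] by blast
  have "max n K \<le> r (max n K)" by (rule strict_mono_imp_increasing[OF r])
  then have "transition C E (r n) (r (max n K)) \<cdot> f = transition C E (r n) (r (max n K)) \<cdot> g"
    by (intro K) simp
  then show "\<exists>k\<ge>n. transition C (subsequence C E r) n k \<cdot> f = transition C (subsequence C E r) n k \<cdot> g"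
    using subseq_trans[OF E r, of n "max n K"] by (intro exI[of _ "max n K"]) simp
qed

text \<open>The same elements serve: the value of the shifted module at the shift of
  \<open>x\<close> is literally the value of \<open>A\<close> at \<open>x\<close>.\<close>

lemma pres_shift:
  assumes E: "is_seq C E" and A: "is_module C A" and p: "pres C E A t"
  shows "pres C (\<lambda>n. ShA C (E n)) (ShO (ModCat C) A) t"
  unfolding pres_def shift_seq(2)[OF E]
proof (intro conjI allI ballI impI)
  note o = seq_Obj[OF E]
  fix n show "t n \<in> el (ShO (ModCat C) A) (ShO C (Src C (E n)))"
    using pres_el[OF p] by (simp add: shM_simps ShO_Obj[OF o] UnO_ShO[OF o])
  show "FunA (ShO (ModCat C) A) (ShA C (E n)) (t (Suc n)) = t n"
    using pres_step[OF p] Hom_Arr[OF seq_Hom[OF E, of n]] Hom_Arr[OF ShA_Hom[OF seq_Hom[OF E, of n]]]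
    by (simp add: shM_simps UnA_ShA)
next
  fix x u assume x: "x \<in> Obj C" and u: "u \<in> el (ShO (ModCat C) A) x"
  then have "u \<in> el A (UnO C x)" by (simp add: shM_simps)
  then obtain n f where f: "f \<in> Hom C (UnO C x) (Src C (E n))" "u = FunA A f (t n)"
    using pres_surj[OF p UnO_Obj[OF x]] by blast
  have "ShA C f \<in> Hom C x (ShO C (Src C (E n)))" using ShA_Hom[OF f(1)] by (simp add: ShO_UnO[OF x])
  moreover from this have "u = FunA (ShO (ModCat C) A) (ShA C f) (t n)"
    using f(2) Hom_Arr[OF f(1)] by (simp add: shM_simps Hom_Arr UnA_ShA)
  ultimately show "\<exists>n. \<exists>f\<in>Hom C x (ShO C (Src C (E n))). u = FunA (ShO (ModCat C) A) f (t n)" by blast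
next
  fix n x f g assume f: "f \<in> Hom C x (ShO C (Src C (E n)))" and g: "g \<in> Hom C x (ShO C (Src C (E n)))"
    and e: "FunA (ShO (ModCat C) A) f (t n) = FunA (ShO (ModCat C) A) g (t n)"
  have uf: "UnA C f \<in> Hom C (UnO C x) (Src C (E n))" "UnA C g \<in> Hom C (UnO C x) (Src C (E n))"
    using UnA_Hom[OF f] UnA_Hom[OF g] by (auto simp: UnO_ShO[OF seq_Obj[OF E]])
  have "FunA A (UnA C f) (t n) = FunA A (UnA C g) (t n)"
    using e Hom_Arr[OF f] Hom_Arr[OF g] by (simp add: shM_simps)
  then obtain k where k: "k \<ge> n" "transition C E n k \<cdot> UnA C f = transition C E n k \<cdot> UnA C g"
    using pres_inj[OF p uf] by blast
  have "transition C (\<lambda>n. ShA C (E n)) n k \<cdot> f = transition C (\<lambda>n. ShA C (E n)) n k \<cdot> g"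
    using ShA_Comp[OF uf(1) trans_Hom[OF E k(1)]] ShA_Comp[OF uf(2) trans_Hom[OF E k(1)]] k
      ShA_UnA[OF Hom_Arr[OF f]] ShA_UnA[OF Hom_Arr[OF g]] shift_trans[OF E k(1)] by simp
  then show "\<exists>k\<ge>n. transition C (\<lambda>n. ShA C (E n)) n k \<cdot> f = transition C (\<lambda>n. ShA C (E n)) n k \<cdot> g"
    using k(1) by blast
qed

lemma pres_unshift:
  assumes E: "is_seq C E" and A: "is_module C A" and p: "pres C E A t"
  shows "pres C (\<lambda>n. UnA C (E n)) (unshO C A) t"
  unfolding pres_def unshift_seq(2)[OF E]
proof (intro conjI allI ballI impI)
  note o = seq_Obj[OF E]
  fix n show "t n \<in> el (unshO C A) (UnO C (Src C (E n)))"
    using pres_el[OF p] by (simp add: unsh_simps UnO_Obj[OF o] ShO_UnO[OF o])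
  show "FunA (unshO C A) (UnA C (E n)) (t (Suc n)) = t n"
    using pres_step[OF p] Hom_Arr[OF seq_Hom[OF E, of n]] Hom_Arr[OF UnA_Hom[OF seq_Hom[OF E, of n]]]
    by (simp add: unsh_simps ShA_UnA)
next
  fix x u assume x: "x \<in> Obj C" and u: "u \<in> el (unshO C A) x"
  then have "u \<in> el A (ShO C x)" by (simp add: unsh_simps)
  then obtain n f where f: "f \<in> Hom C (ShO C x) (Src C (E n))" "u = FunA A f (t n)"
    using pres_surj[OF p ShO_Obj[OF x]] by blast
  have "UnA C f \<in> Hom C x (UnO C (Src C (E n)))" using UnA_Hom[OF f(1)] by (simp add: UnO_ShO[OF x])
  moreover from this have "u = FunA (unshO C A) (UnA C f) (t n)"
    using f(2) Hom_Arr[OF f(1)] by (simp add: unsh_simps Hom_Arr ShA_UnA)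
  ultimately show "\<exists>n. \<exists>f\<in>Hom C x (UnO C (Src C (E n))). u = FunA (unshO C A) f (t n)" by blast
next
  fix n x f g assume f: "f \<in> Hom C x (UnO C (Src C (E n)))" and g: "g \<in> Hom C x (UnO C (Src C (E n)))"
    and e: "FunA (unshO C A) f (t n) = FunA (unshO C A) g (t n)"
  have uf: "ShA C f \<in> Hom C (ShO C x) (Src C (E n))" "ShA C g \<in> Hom C (ShO C x) (Src C (E n))"
    using ShA_Hom[OF f] ShA_Hom[OF g] by (auto simp: ShO_UnO[OF seq_Obj[OF E]])
  have "FunA A (ShA C f) (t n) = FunA A (ShA C g) (t n)"
    using e Hom_Arr[OF f] Hom_Arr[OF g] by (simp add: unsh_simps)
  then obtain k where k: "k \<ge> n" "transition C E n k \<cdot> ShA C f = transition C E n k \<cdot> ShA C g"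
    using pres_inj[OF p uf] by blast
  have "transition C (\<lambda>n. UnA C (E n)) n k \<cdot> f = transition C (\<lambda>n. UnA C (E n)) n k \<cdot> g"
    using UnA_Comp[OF uf(1) trans_Hom[OF E k(1)]] UnA_Comp[OF uf(2) trans_Hom[OF E k(1)]] k
      UnA_ShA[OF Hom_Arr[OF f]] UnA_ShA[OF Hom_Arr[OF g]] unshift_trans[OF E k(1)] by simp
  then show "\<exists>k\<ge>n. transition C (\<lambda>n. UnA C (E n)) n k \<cdot> f = transition C (\<lambda>n. UnA C (E n)) n k \<cdot> g"
    using k(1) by blast
qed

end

text \<open>Cardinal arithmetic: the product of a countable set with an infinite set embeds in the
  latter. It allows pairs of a stage and an arrow to be encoded in the universe.\<close>

lemma inj_pair_universe:
  includes cardinal_syntax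
  assumes inf: "infinite (UNIV :: 'd set)" shows "\<exists>i :: nat \<times> 'd \<Rightarrow> 'd. inj i"
proof -
  have "|UNIV :: nat set| \<le>o |UNIV :: 'd set|" using inf infinite_iff_card_of_nat by blast
  then have "|(UNIV :: nat set) \<times> (UNIV :: 'd set)| =o |UNIV :: 'd set|"
    using card_of_Times_infinite[OF inf, of "UNIV :: nat set"] by auto
  then obtain i :: "nat \<times> 'd \<Rightarrow> 'd" where "bij_betw i (UNIV \<times> UNIV) UNIV"
    unfolding card_of_ordIso[symmetric] by blast
  then show ?thesis by (auto simp: bij_betw_def)
qed

locale yoneda = shifted C
  for C :: "('o, 'm, 'z) shift_cat_scheme" (structure) +
  fixes e :: "'m \<Rightarrow> 'u"
  assumes inj_e: "inj e" and infinite_universe: "infinite (UNIV :: 'u set)"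
begin

lemma dec [simp]: "decode e (e f) = f"
  by (rule inv_f_f[OF inj_e])

lemma e_eq [simp]: "e f = e g \<longleftrightarrow> f = g"
  using inj_e by (auto dest: injD)

lemma hom_in_carrier: "carrier (hom_in e C a b) = e ` Hom C a b"
  by (simp add: hom_in_def image_group_def)

lemma hom_in_mult: assumes "f \<in> Hom C a b" "g \<in> Hom C a b"
  shows "e f \<otimes>\<^bsub>hom_in e C a b\<^esub> e g = e (Add C f g)"
proof -
  have "inj_on e (Hom C a b)" using inj_e by (rule inj_on_subset) simp
  then show ?thesis using assms by (simp add: hom_in_def image_group_def)
qed

lemma hom_in_one: "\<one>\<^bsub>hom_in e C a b\<^esub> = e (ZeroArr C a b)"
  by (simp add: hom_in_def image_group_def)

lemma hom_in_group: assumes ab: "a \<in> Obj C" "b \<in> Obj C" shows "comm_group (hom_in e C a b)"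
proof (rule comm_groupI)
  interpret comm_group "hom_group C a b" by (rule hom_comm_group[OF ab])
  note z = Zero_Hom[OF ab]
  show "\<one>\<^bsub>hom_in e C a b\<^esub> \<in> carrier (hom_in e C a b)" unfolding hom_in_one hom_in_carrier using z by blast
  fix u assume "u \<in> carrier (hom_in e C a b)"
  then obtain f where f: "f \<in> Hom C a b" "u = e f" unfolding hom_in_carrier by blast
  show "\<one>\<^bsub>hom_in e C a b\<^esub> \<otimes>\<^bsub>hom_in e C a b\<^esub> u = u"
    unfolding f hom_in_one hom_in_mult[OF z f(1)] Zero_Add[OF f(1)] ..
  have "e (Neg C f) \<otimes>\<^bsub>hom_in e C a b\<^esub> u = \<one>\<^bsub>hom_in e C a b\<^esub>"
    unfolding f hom_in_one hom_in_mult[OF Neg_Hom[OF f(1)] f(1)] Add_commute[OF Neg_Hom[OF f(1)] f(1)]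
      Add_Neg[OF f(1)] ..
  then show "\<exists>y\<in>carrier (hom_in e C a b). y \<otimes>\<^bsub>hom_in e C a b\<^esub> u = \<one>\<^bsub>hom_in e C a b\<^esub>"
    unfolding hom_in_carrier using Neg_Hom[OF f(1)] by blast
  fix v assume "v \<in> carrier (hom_in e C a b)"
  then obtain g where g: "g \<in> Hom C a b" "v = e g" unfolding hom_in_carrier by blast
  show "u \<otimes>\<^bsub>hom_in e C a b\<^esub> v \<in> carrier (hom_in e C a b)"
    unfolding f g hom_in_mult[OF f(1) g(1)] hom_in_carrier using Add_Hom[OF f(1) g(1)] by blast
  show "u \<otimes>\<^bsub>hom_in e C a b\<^esub> v = v \<otimes>\<^bsub>hom_in e C a b\<^esub> u"
    unfolding f g hom_in_mult[OF f(1) g(1)] hom_in_mult[OF g(1) f(1)] Add_commute[OF f(1) g(1)] ..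
  fix w assume "w \<in> carrier (hom_in e C a b)"
  then obtain h where h: "h \<in> Hom C a b" "w = e h" unfolding hom_in_carrier by blast
  show "u \<otimes>\<^bsub>hom_in e C a b\<^esub> v \<otimes>\<^bsub>hom_in e C a b\<^esub> w = u \<otimes>\<^bsub>hom_in e C a b\<^esub> (v \<otimes>\<^bsub>hom_in e C a b\<^esub> w)"
    unfolding f g h hom_in_mult[OF f(1) g(1)] hom_in_mult[OF g(1) h(1)]
      hom_in_mult[OF Add_Hom[OF f(1) g(1)] h(1)] hom_in_mult[OF f(1) Add_Hom[OF g(1) h(1)]]
    using m_assoc[of f g h] f g h by simp
qed

lemma Yon_O: "a \<in> Obj C \<Longrightarrow> FunO (YonO e C x) a = hom_in e C a x"
  by (simp add: YonO_def)

lemma el_Yon: "a \<in> Obj C \<Longrightarrow> el (YonO e C x) a = e ` Hom C a x"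
  by (simp add: Yon_O hom_in_carrier)

lemma Yon_act: "\<lbrakk>f \<in> Hom C a b; g \<in> Hom C b x\<rbrakk> \<Longrightarrow> FunA (YonO e C x) f (e g) = e (g \<cdot> f)"
  by (simp add: YonO_def Hom_Arr Hom_Tgt hom_in_carrier)

lemma module_Yon: assumes x: "x \<in> Obj C" shows "is_module C (YonO e C x)"
  unfolding is_module_def
proof (intro conjI ballI impI)
  fix a assume a: "a \<in> Obj C"
  show "comm_group (FunO (YonO e C x) a)" using hom_in_group[OF a x] a by (simp add: Yon_O)
  fix u assume "u \<in> el (YonO e C x) a"
  then obtain f where f: "f \<in> Hom C a x" "u = e f" unfolding el_Yon[OF a] by blast
  show "FunA (YonO e C x) (Ident C a) u = u"
    unfolding f(2) Yon_act[OF Ident_Hom[OF a] f(1)] by (simp add: Comp_Ident[OF f(1)])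
next
  fix f assume f': "f \<in> Arr C"
  note f = Arr_Hom[OF f'] and o = Src_Obj[OF f'] Tgt_Obj[OF f']
  show "FunA (YonO e C x) f \<in> hom (FunO (YonO e C x) (Tgt C f)) (FunO (YonO e C x) (Src C f))"
  proof (rule homI)
    fix u v assume "u \<in> el (YonO e C x) (Tgt C f)" "v \<in> el (YonO e C x) (Tgt C f)"
    then obtain g h where g: "g \<in> Hom C (Tgt C f) x" "u = e g" and h: "h \<in> Hom C (Tgt C f) x" "v = e h"
      unfolding el_Yon[OF o(2)] by blast
    note gf = Comp_Hom[OF f g(1)] and hf = Comp_Hom[OF f h(1)]
    show "FunA (YonO e C x) f u \<in> el (YonO e C x) (Src C f)"
      unfolding g(2) Yon_act[OF f g(1)] el_Yon[OF o(1)] using gf by blast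
    show "FunA (YonO e C x) f (u \<otimes>\<^bsub>FunO (YonO e C x) (Tgt C f)\<^esub> v) =
      FunA (YonO e C x) f u \<otimes>\<^bsub>FunO (YonO e C x) (Src C f)\<^esub> FunA (YonO e C x) f v"
      unfolding g(2) h(2) Yon_O[OF o(1)] Yon_O[OF o(2)] hom_in_mult[OF g(1) h(1)]
        Yon_act[OF f g(1)] Yon_act[OF f h(1)] Yon_act[OF f Add_Hom[OF g(1) h(1)]] hom_in_mult[OF gf hf]
        Add_Comp[OF f g(1) h(1)] ..
  qed
  show "FunA (YonO e C x) f \<in> extensional (el (YonO e C x) (Tgt C f))"
    using f' o by (simp add: YonO_def)
next
  fix f g u assume f': "f \<in> Arr C" and g': "g \<in> Arr C" and fg: "Tgt C f = Src C g" and u: "u \<in> el (YonO e C x) (Tgt C g)"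
  have f: "f \<in> Hom C (Src C f) (Src C g)" and g: "g \<in> Hom C (Src C g) (Tgt C g)" using f' g' fg by (auto simp: Hom_def)
  obtain h where h: "h \<in> Hom C (Tgt C g) x" "u = e h" using u unfolding el_Yon[OF Hom_Obj(2)[OF g]] by blast
  show "FunA (YonO e C x) (g \<cdot> f) u = FunA (YonO e C x) f (FunA (YonO e C x) g u)"
    unfolding h(2) Yon_act[OF Comp_Hom[OF f g] h(1)] Yon_act[OF g h(1)] Yon_act[OF f Comp_Hom[OF g h(1)]]
      Comp_assoc[OF f g h(1)] ..
next
  fix f g u assume f': "f \<in> Arr C" and g: "g \<in> Hom C (Src C f) (Tgt C f)" and u: "u \<in> el (YonO e C x) (Tgt C f)"
  note f = Arr_Hom[OF f'] and o = Src_Obj[OF f'] Tgt_Obj[OF f']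
  obtain h where h: "h \<in> Hom C (Tgt C f) x" "u = e h" using u unfolding el_Yon[OF o(2)] by blast
  show "FunA (YonO e C x) (Add C f g) u =
    FunA (YonO e C x) f u \<otimes>\<^bsub>FunO (YonO e C x) (Src C f)\<^esub> FunA (YonO e C x) g u"
    unfolding h(2) Yon_act[OF Add_Hom[OF f g] h(1)] Yon_act[OF f h(1)] Yon_act[OF g h(1)] Yon_O[OF o(1)]
      hom_in_mult[OF Comp_Hom[OF f h(1)] Comp_Hom[OF g h(1)]] Comp_Add[OF f g h(1)] ..
qed (simp_all add: YonO_def)

text \<open>The map from \<open>Y(x)\<close> to \<open>A\<close> that corresponds to the element
  \<open>u\<close> of \<open>A\<close> at \<open>x\<close> under the Yoneda lemma.\<close>

definition ymap :: "('o, 'm, 'u) presheaf \<Rightarrow> 'o \<Rightarrow> 'u \<Rightarrow> ('o, 'm, 'u) presheaf_map" where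
  "ymap A x u = mkmap C (YonO e C x) A (\<lambda>a v. FunA A (decode e v) u)"

lemma At_ymap: assumes "f \<in> Hom C a x" shows "At (ymap A x u) a (e f) = FunA A f u"
  using assms Hom_Obj[OF assms] by (simp add: ymap_def At_mkmap el_Yon)

lemma ymap_Hom: assumes A: "is_module C A" and x: "x \<in> Obj C" and u: "u \<in> el A x"
  shows "ymap A x u \<in> Hom (ModCat C) (YonO e C x) A"
  unfolding ymap_def
proof (rule mkmap_Hom[OF module_Yon[OF x] A])
  fix a v assume a: "a \<in> Obj C" and "v \<in> el (YonO e C x) a"
  then obtain f where f: "f \<in> Hom C a x" "v = e f" unfolding el_Yon[OF a] by blast
  show "FunA A (decode e v) u \<in> el A a" unfolding f(2) dec by (rule act_closed[OF A f(1) u])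
  fix w assume "w \<in> el (YonO e C x) a"
  then obtain g where g: "g \<in> Hom C a x" "w = e g" unfolding el_Yon[OF a] by blast
  show "FunA A (decode e (v \<otimes>\<^bsub>FunO (YonO e C x) a\<^esub> w)) u = FunA A (decode e v) u \<otimes>\<^bsub>FunO A a\<^esub> FunA A (decode e w) u"
    unfolding f(2) g(2) Yon_O[OF a] hom_in_mult[OF f(1) g(1)] dec by (rule act_Add[OF A f(1) g(1) u])
next
  fix a b f v assume f: "f \<in> Hom C a b" and "v \<in> el (YonO e C x) b"
  then obtain g where g: "g \<in> Hom C b x" "v = e g" unfolding el_Yon[OF Hom_Obj(2)[OF f]] by blast
  show "FunA A f (FunA A (decode e v) u) = FunA A (decode e (FunA (YonO e C x) f v)) u"
    unfolding g(2) Yon_act[OF f g(1)] dec by (rule act_comp[OF A f g(1) u, symmetric])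
qed

lemma Ident_el: "x \<in> Obj C \<Longrightarrow> e (Ident C x) \<in> el (YonO e C x) x"
  by (simp add: el_Yon Ident_Hom)

text \<open>Naturality with respect to \<open>f\<close>, applied to the identity of
  \<open>x\<close>.\<close>

lemma Yon_map_eval: assumes G: "G \<in> Hom (ModCat C) (YonO e C x) A" and f: "f \<in> Hom C a x"
  shows "At G a (e f) = FunA A f (At G x (e (Ident C x)))"
proof -
  note x = Hom_Obj(2)[OF f]
  show ?thesis
    using MH_act[OF G f Ident_el[OF x]] Yon_act[OF f Ident_Hom[OF x]] by (simp add: Ident_Comp[OF f])
qed

lemma YonA_ymap: assumes "f \<in> Hom C x y" shows "YonA e C f = ymap (YonO e C y) x (e f)"
proof (rule presheaf_map_eqI)
  show "At (YonA e C f) = At (ymap (YonO e C y) x (e f))"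
    unfolding YonA_def ymap_def mkmap_def presheaf_map.simps Hom_Src[OF assms] Hom_Tgt[OF assms]
  proof (rule restrict_ext)
    fix a assume a: "a \<in> Obj C"
    show "(\<lambda>v \<in> carrier (hom_in e C a x). e (f \<cdot> decode e v)) =
        (\<lambda>v \<in> el (YonO e C x) a. FunA (YonO e C y) (decode e v) (e f))"
      unfolding Yon_O[OF a]
    proof (rule restrict_ext)
      fix v assume "v \<in> carrier (hom_in e C a x)"
      then obtain g where g: "g \<in> Hom C a x" "v = e g" unfolding hom_in_carrier by blast
      show "e (f \<cdot> decode e v) = FunA (YonO e C y) (decode e v) (e f)" unfolding g(2) dec Yon_act[OF g(1) assms] ..
    qed
  qed
qed (simp_all add: YonA_def ymap_def Hom_Src[OF assms] Hom_Tgt[OF assms])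

lemma YonA_Hom: assumes f: "f \<in> Hom C x y" shows "YonA e C f \<in> Hom (ModCat C) (YonO e C x) (YonO e C y)"
  unfolding YonA_ymap[OF f]
  by (rule ymap_Hom[OF module_Yon]) (use Hom_Obj[OF f] f in \<open>auto simp: el_Yon\<close>)

lemma At_YonA: "\<lbrakk>f \<in> Hom C x y; g \<in> Hom C a x\<rbrakk> \<Longrightarrow> At (YonA e C f) a (e g) = e (f \<cdot> g)"
  by (simp add: YonA_ymap At_ymap Yon_act)

lemma Yon_map_eqI: assumes "G \<in> Hom (ModCat C) (YonO e C x) A" "G' \<in> Hom (ModCat C) (YonO e C x) A"
  "At G x (e (Ident C x)) = At G' x (e (Ident C x))" shows "G = G'"
proof (rule MH_eqI[OF assms(1,2)])
  fix a u assume a: "a \<in> Obj C" and "u \<in> el (YonO e C x) a"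
  then obtain f where f: "f \<in> Hom C a x" "u = e f" unfolding el_Yon[OF a] by blast
  show "At G a u = At G' a u" unfolding f(2) Yon_map_eval[OF assms(1) f(1)] Yon_map_eval[OF assms(2) f(1)] assms(3) ..
qed

lemma pres_const: assumes x: "x \<in> Obj C" shows "pres C (const_seq C x) (YonO e C x) (\<lambda>n. e (Ident C x))"
proof -
  have s: "Src C (const_seq C x n) = x" for n using Ident_Hom[OF x] by (simp add: const_seq_def Hom_def)
  show ?thesis
    unfolding pres_def s
  proof (intro conjI allI ballI impI)
    fix n :: nat show "e (Ident C x) \<in> el (YonO e C x) x" by (rule Ident_el[OF x])
    show "FunA (YonO e C x) (const_seq C x n) (e (Ident C x)) = e (Ident C x)"
      unfolding const_seq_def Yon_act[OF Ident_Hom[OF x] Ident_Hom[OF x]] Comp_Ident[OF Ident_Hom[OF x]] ..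
  next
    fix a u assume a: "a \<in> Obj C" and "u \<in> el (YonO e C x) a"
    then obtain f where f: "f \<in> Hom C a x" "u = e f" unfolding el_Yon[OF a] by blast
    then show "\<exists>n::nat. \<exists>f\<in>Hom C a x. u = FunA (YonO e C x) f (e (Ident C x))"
      by (auto simp: Yon_act[OF _ Ident_Hom[OF x]] Ident_Comp)
  next
    fix n :: nat and a f g assume "f \<in> Hom C a x" "g \<in> Hom C a x"
      "FunA (YonO e C x) f (e (Ident C x)) = FunA (YonO e C x) g (e (Ident C x))"
    then have "f = g" by (simp add: Yon_act[OF _ Ident_Hom[OF x]] Ident_Comp)
    then show "\<exists>k\<ge>n. transition C (const_seq C x) n k \<cdot> f = transition C (const_seq C x) n k \<cdot> g" by blast
  qed
qed

lemma const_seq_seq: assumes "x \<in> Obj C" shows "is_seq C (const_seq C x)" "Src C (const_seq C x n) = x"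
  using is_seqI[of "const_seq C x" "\<lambda>_. x"] Ident_Hom[OF assms] by (auto simp: const_seq_def)

end

text \<open>The elements of the colimit at \<open>x\<close> are classes of pairs \<open>(n, f)\<close> with
  \<open>f : x \<rightarrow> E n\<close>; a chosen representative of each class is encoded in the universe.\<close>

locale seq_colimit = yoneda +
  fixes E :: "nat \<Rightarrow> 'b"
  assumes E: "is_seq C E"
begin

definition prs :: "'a \<Rightarrow> (nat \<times> 'b) set" where
  "prs x = {(n, f). f \<in> Hom C x (Src C (E n))}"

definition eqv :: "nat \<times> 'b \<Rightarrow> nat \<times> 'b \<Rightarrow> bool" where
  "eqv p q \<longleftrightarrow> (\<exists>k. fst p \<le> k \<and> fst q \<le> k \<and>
     transition C E (fst p) k \<cdot> snd p = transition C E (fst q) k \<cdot> snd q)"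

definition cd :: "'a \<Rightarrow> nat \<times> 'b \<Rightarrow> 'd" where
  "cd x p = (SOME i. inj i) (map_prod id e (SOME q. q \<in> prs x \<and> eqv p q))"

definition dc :: "'a \<Rightarrow> 'd \<Rightarrow> nat \<times> 'b" where
  "dc x u = (SOME q. q \<in> prs x \<and> cd x q = u)"

lemma eqv_refl: "eqv p p"
  unfolding eqv_def by blast

lemma eqv_sym: "eqv p q \<Longrightarrow> eqv q p"
  unfolding eqv_def by metis

lemma eqv_push: assumes "p \<in> prs x" "q \<in> prs x" "fst p \<le> k" "fst q \<le> k" "k \<le> l"
  "transition C E (fst p) k \<cdot> snd p = transition C E (fst q) k \<cdot> snd q"
  shows "transition C E (fst p) l \<cdot> snd p = transition C E (fst q) l \<cdot> snd q"
proof -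
  have h: "snd p \<in> Hom C x (Src C (E (fst p)))" "snd q \<in> Hom C x (Src C (E (fst q)))" using assms(1,2) by (auto simp: prs_def)
  show ?thesis
    using trans_comp_assoc[OF E assms(3,5) h(1)] trans_comp_assoc[OF E assms(4,5) h(2)] assms(6) by simp
qed

lemma eqv_trans: assumes pqr: "p \<in> prs x" "q \<in> prs x" "r \<in> prs x" and "eqv p q" "eqv q r" shows "eqv p r"
proof -
  obtain k where k: "fst p \<le> k" "fst q \<le> k" "transition C E (fst p) k \<cdot> snd p = transition C E (fst q) k \<cdot> snd q"
    using assms(4) unfolding eqv_def by blast
  obtain l where l: "fst q \<le> l" "fst r \<le> l" "transition C E (fst q) l \<cdot> snd q = transition C E (fst r) l \<cdot> snd r"
    using assms(5) unfolding eqv_def by blast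
  show ?thesis unfolding eqv_def
    using eqv_push[OF pqr(1,2) k(1,2) max.cobounded1[of k l] k(3)] eqv_push[OF pqr(2,3) l(1,2) max.cobounded2[of l k] l(3)]
      k l by (intro exI[of _ "max k l"]) (simp add: le_max_iff_disj)
qed

text \<open>Equivalent pairs satisfy the same predicate, so \<open>SOME\<close> returns the same
  representative for both. Conversely the encoding is injective and every pair is equivalent to its
  representative.\<close>

lemma cd_eq: assumes p: "p \<in> prs x" and q: "q \<in> prs x" shows "cd x p = cd x q \<longleftrightarrow> eqv p q"
proof
  have "\<exists>i :: nat \<times> 'd \<Rightarrow> 'd. inj i" by (rule inj_pair_universe[OF infinite_universe])
  then have i1: "inj (SOME i :: nat \<times> 'd \<Rightarrow> 'd. inj i)" by (rule someI_ex)
  have i2: "inj (map_prod (id :: nat \<Rightarrow> nat) e)" using inj_e by (intro prod.inj_map) auto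
  have ii: "a = b" if "(SOME i :: nat \<times> 'd \<Rightarrow> 'd. inj i) (map_prod id e a) = (SOME i. inj i) (map_prod id e b)" for a b
    using injD[OF i2 injD[OF i1 that]] .
  have c: "(SOME q. q \<in> prs x \<and> eqv p q) \<in> prs x \<and> eqv p (SOME q. q \<in> prs x \<and> eqv p q)" if "p \<in> prs x" for p
    by (rule someI[of "\<lambda>q. q \<in> prs x \<and> eqv p q" p]) (use that eqv_refl in auto)
  assume "cd x p = cd x q"
  then have "(SOME r. r \<in> prs x \<and> eqv p r) = (SOME r. r \<in> prs x \<and> eqv q r)" unfolding cd_def by (rule ii)
  then show "eqv p q" using c[OF p] c[OF q] eqv_sym[of q] eqv_trans[OF p _ q, of "SOME r. r \<in> prs x \<and> eqv q r"] by simp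
next
  assume pq: "eqv p q"
  have "(\<lambda>r. r \<in> prs x \<and> eqv p r) = (\<lambda>r. r \<in> prs x \<and> eqv q r)"
    using eqv_trans[OF p q _ pq] eqv_trans[OF q p _ eqv_sym[OF pq]] by blast
  then show "cd x p = cd x q" unfolding cd_def by simp
qed

lemma cd_push: assumes f: "f \<in> Hom C x (Src C (E n))" and "n \<le> k"
  shows "cd x (k, transition C E n k \<cdot> f) = cd x (n, f)"
  using trans_push[OF E f assms(2)] f assms(2) trans_comp_assoc[OF E assms(2) le_refl f]
  by (subst cd_eq) (auto simp: prs_def eqv_def intro!: exI[of _ k])

lemma dc: assumes "p \<in> prs x" shows "dc x (cd x p) \<in> prs x" "eqv (dc x (cd x p)) p"
proof -
  have "dc x (cd x p) \<in> prs x \<and> cd x (dc x (cd x p)) = cd x p"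
    unfolding dc_def by (rule someI[of "\<lambda>q. q \<in> prs x \<and> cd x q = cd x p" p]) (use assms in auto)
  then show "dc x (cd x p) \<in> prs x" "eqv (dc x (cd x p)) p" using cd_eq[OF _ assms] by blast+
qed

definition plus :: "'a \<Rightarrow> nat \<times> 'b \<Rightarrow> nat \<times> 'b \<Rightarrow> 'd" where
  "plus x p q = (let k = max (fst p) (fst q) in
     cd x (k, Add C (transition C E (fst p) k \<cdot> snd p) (transition C E (fst q) k \<cdot> snd q)))"

definition grp :: "'a \<Rightarrow> 'd monoid" where
  "grp x = \<lparr>carrier = cd x ` prs x, mult = (\<lambda>u v. plus x (dc x u) (dc x v)), one = cd x (0, ZeroArr C x (Src C (E 0)))\<rparr>"

definition colim :: "('a, 'b, 'd) presheaf" where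
  "colim = \<lparr>FunO = (\<lambda>x \<in> Obj C. grp x),
     FunA = (\<lambda>f \<in> Arr C. \<lambda>u \<in> carrier (grp (Tgt C f)). cd (Src C f) (map_prod id (\<lambda>g. g \<cdot> f) (dc (Tgt C f) u)))\<rparr>"

lemma mult_cd: assumes f: "f \<in> Hom C x (Src C (E n))" and g: "g \<in> Hom C x (Src C (E n))"
  shows "cd x (n, f) \<otimes>\<^bsub>grp x\<^esub> cd x (n, g) = cd x (n, Add C f g)"
proof -
  have pf: "(n, f) \<in> prs x" "(n, g) \<in> prs x" using f g by (auto simp: prs_def)
  obtain a f' where a: "dc x (cd x (n, f)) = (a, f')" by (cases "dc x (cd x (n, f))")
  obtain b g' where b: "dc x (cd x (n, g)) = (b, g')" by (cases "dc x (cd x (n, g))")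
  have f': "f' \<in> Hom C x (Src C (E a))" and g': "g' \<in> Hom C x (Src C (E b))"
    using dc(1)[OF pf(1)] dc(1)[OF pf(2)] unfolding a b by (auto simp: prs_def)
  obtain k where k: "a \<le> k" "n \<le> k" "transition C E a k \<cdot> f' = transition C E n k \<cdot> f"
    using dc(2)[OF pf(1)] unfolding a eqv_def by auto
  obtain l where l: "b \<le> l" "n \<le> l" "transition C E b l \<cdot> g' = transition C E n l \<cdot> g"
    using dc(2)[OF pf(2)] unfolding b eqv_def by auto
  \<comment> \<open>\<open>plus\<close> adds the decoded representatives at stage \<open>m\<close>.
    At the later stage \<open>i\<close> both of them have become equal to the given arrows, and
    there the two sums can be compared.\<close>
  define m where "m = max a b"
  define i where "i = max k l"
  have m: "a \<le> m" "b \<le> m" and mi: "m \<le> i" and i: "k \<le> i" "l \<le> i" and ni: "n \<le> i" using k l by (auto simp: m_def i_def)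
  have ef: "transition C E a i \<cdot> f' = transition C E n i \<cdot> f"
    using trans_comp_assoc[OF E k(1) i(1) f'] trans_comp_assoc[OF E k(2) i(1) f] k(3) by simp
  have eg: "transition C E b i \<cdot> g' = transition C E n i \<cdot> g"
    using trans_comp_assoc[OF E l(1) i(2) g'] trans_comp_assoc[OF E l(2) i(2) g] l(3) by simp
  note h = trans_push[OF E f' m(1)] trans_push[OF E g' m(2)]
  have "cd x (n, f) \<otimes>\<^bsub>grp x\<^esub> cd x (n, g) = cd x (m, Add C (transition C E a m \<cdot> f') (transition C E b m \<cdot> g'))"
    by (simp add: grp_def a b plus_def m_def Let_def)
  also have "\<dots> = cd x (i, transition C E m i \<cdot> Add C (transition C E a m \<cdot> f') (transition C E b m \<cdot> g'))"
    by (rule cd_push[OF Add_Hom[OF h] mi, symmetric])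
  also have "transition C E m i \<cdot> Add C (transition C E a m \<cdot> f') (transition C E b m \<cdot> g') =
      Add C (transition C E a i \<cdot> f') (transition C E b i \<cdot> g')"
    unfolding Comp_Add[OF h trans_Hom[OF E mi]] trans_comp_assoc[OF E m(1) mi f'] trans_comp_assoc[OF E m(2) mi g'] ..
  also have "\<dots> = transition C E n i \<cdot> Add C f g"
    unfolding ef eg Comp_Add[OF f g trans_Hom[OF E ni]] ..
  also have "cd x (i, transition C E n i \<cdot> Add C f g) = cd x (n, Add C f g)"
    by (rule cd_push[OF Add_Hom[OF f g] ni])
  finally show ?thesis .
qed

lemma act_cd: assumes f: "f \<in> Hom C x y" and g: "g \<in> Hom C y (Src C (E n))"
  shows "FunA colim f (cd y (n, g)) = cd x (n, g \<cdot> f)"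
proof -
  have pg: "(n, g) \<in> prs y" using g by (auto simp: prs_def)
  obtain a g' where a: "dc y (cd y (n, g)) = (a, g')" by (cases "dc y (cd y (n, g))")
  have g': "g' \<in> Hom C y (Src C (E a))" using dc(1)[OF pg] unfolding a by (auto simp: prs_def)
  obtain k where k: "a \<le> k" "n \<le> k" "transition C E a k \<cdot> g' = transition C E n k \<cdot> g"
    using dc(2)[OF pg] unfolding a eqv_def by auto
  have "FunA colim f (cd y (n, g)) = cd x (a, g' \<cdot> f)"
    using f pg a by (simp add: colim_def Hom_Arr Hom_Src Hom_Tgt grp_def)
  also have "\<dots> = cd x (n, g \<cdot> f)"
  proof (subst cd_eq)
    show "(a, g' \<cdot> f) \<in> prs x" "(n, g \<cdot> f) \<in> prs x" using Comp_Hom[OF f g'] Comp_Hom[OF f g] by (auto simp: prs_def)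
    have "transition C E a k \<cdot> (g' \<cdot> f) = transition C E n k \<cdot> (g \<cdot> f)"
      using Comp_assoc[OF f g' trans_Hom[OF E k(1)]] Comp_assoc[OF f g trans_Hom[OF E k(2)]] k(3) by simp
    then show "eqv (a, g' \<cdot> f) (n, g \<cdot> f)" unfolding eqv_def using k by auto
  qed
  finally show ?thesis .
qed

lemma colim_O: "x \<in> Obj C \<Longrightarrow> FunO colim x = grp x"
  by (simp add: colim_def)

lemma el_colimE: assumes "u \<in> carrier (grp x)"
  obtains n f where "n \<ge> N" "f \<in> Hom C x (Src C (E n))" "u = cd x (n, f)"
proof -
  obtain n f where f: "f \<in> Hom C x (Src C (E n))" "u = cd x (n, f)"
    using assms by (auto simp: grp_def prs_def)
  show thesis
    using that[of "max n N" "transition C E n (max n N) \<cdot> f"] trans_push[OF E f(1), of "max n N"]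
      cd_push[OF f(1), of "max n N"] f(2) by simp
qed

lemma el_colimI: "f \<in> Hom C x (Src C (E n)) \<Longrightarrow> cd x (n, f) \<in> carrier (grp x)"
  by (auto simp: grp_def prs_def)

text \<open>Transitions preserve zero arrows, so the unit, defined at stage 0, can be read off at
  any stage.\<close>

lemma one_cd: assumes x: "x \<in> Obj C" shows "\<one>\<^bsub>grp x\<^esub> = cd x (n, ZeroArr C x (Src C (E n)))"
  using cd_push[OF Zero_Hom[OF x seq_Obj[OF E, of 0]], of n] Comp_Zero[OF trans_Hom[OF E, of 0 n] x]
  by (simp add: grp_def)

lemma grp_group: assumes x: "x \<in> Obj C" shows "comm_group (grp x)"
proof (rule comm_groupI)
  note z = Zero_Hom[OF x seq_Obj[OF E]]
  show "\<one>\<^bsub>grp x\<^esub> \<in> carrier (grp x)" unfolding one_cd[OF x, of 0] by (rule el_colimI[OF z])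
  fix u assume u: "u \<in> carrier (grp x)"
  obtain n f where f: "f \<in> Hom C x (Src C (E n))" "u = cd x (n, f)" by (rule el_colimE[OF u])
  show "\<one>\<^bsub>grp x\<^esub> \<otimes>\<^bsub>grp x\<^esub> u = u"
    unfolding f(2) one_cd[OF x, of n] mult_cd[OF z f(1)] Zero_Add[OF f(1)] ..
  have "cd x (n, Neg C f) \<otimes>\<^bsub>grp x\<^esub> u = \<one>\<^bsub>grp x\<^esub>"
    unfolding f(2) one_cd[OF x, of n] mult_cd[OF Neg_Hom[OF f(1)] f(1)] Add_commute[OF Neg_Hom[OF f(1)] f(1)] Add_Neg[OF f(1)] ..
  then show "\<exists>v\<in>carrier (grp x). v \<otimes>\<^bsub>grp x\<^esub> u = \<one>\<^bsub>grp x\<^esub>" using el_colimI[OF Neg_Hom[OF f(1)]] by blast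
next
  fix u v assume u: "u \<in> carrier (grp x)" and v: "v \<in> carrier (grp x)"
  obtain n f where f: "f \<in> Hom C x (Src C (E n))" "u = cd x (n, f)" by (rule el_colimE[OF u])
  obtain m g where m: "m \<ge> n" and g: "g \<in> Hom C x (Src C (E m))" "v = cd x (m, g)" by (rule el_colimE[OF v, of n])
  have f': "transition C E n m \<cdot> f \<in> Hom C x (Src C (E m))" "u = cd x (m, transition C E n m \<cdot> f)"
    using trans_push[OF E f(1) m] cd_push[OF f(1) m] f(2) by auto
  show "u \<otimes>\<^bsub>grp x\<^esub> v \<in> carrier (grp x)"
    unfolding f'(2) g(2) mult_cd[OF f'(1) g(1)] by (rule el_colimI[OF Add_Hom[OF f'(1) g(1)]])
  show "u \<otimes>\<^bsub>grp x\<^esub> v = v \<otimes>\<^bsub>grp x\<^esub> u"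
    unfolding f'(2) g(2) mult_cd[OF f'(1) g(1)] mult_cd[OF g(1) f'(1)] Add_commute[OF f'(1) g(1)] ..
next
  fix u v w assume u: "u \<in> carrier (grp x)" and v: "v \<in> carrier (grp x)" and w: "w \<in> carrier (grp x)"
  interpret comm_group "hom_group C x (Src C (E n))" for n by (rule hom_comm_group[OF x seq_Obj[OF E]])
  obtain n f where f: "f \<in> Hom C x (Src C (E n))" "u = cd x (n, f)" by (rule el_colimE[OF u])
  obtain m g where m: "m \<ge> n" and g: "g \<in> Hom C x (Src C (E m))" "v = cd x (m, g)" by (rule el_colimE[OF v, of n])
  obtain k h where k: "k \<ge> m" and h: "h \<in> Hom C x (Src C (E k))" "w = cd x (k, h)" by (rule el_colimE[OF w, of m])
  have nk: "n \<le> k" using m k by simp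
  define f' where "f' = transition C E n k \<cdot> f"
  define g' where "g' = transition C E m k \<cdot> g"
  have f': "f' \<in> Hom C x (Src C (E k))" "u = cd x (k, f')" unfolding f'_def
    using trans_push[OF E f(1) nk] cd_push[OF f(1) nk] f(2) by auto
  have g': "g' \<in> Hom C x (Src C (E k))" "v = cd x (k, g')" unfolding g'_def
    using trans_push[OF E g(1) k] cd_push[OF g(1) k] g(2) by auto
  show "u \<otimes>\<^bsub>grp x\<^esub> v \<otimes>\<^bsub>grp x\<^esub> w = u \<otimes>\<^bsub>grp x\<^esub> (v \<otimes>\<^bsub>grp x\<^esub> w)"
    unfolding f'(2) g'(2) h(2) mult_cd[OF f'(1) g'(1)] mult_cd[OF g'(1) h(1)]
      mult_cd[OF Add_Hom[OF f'(1) g'(1)] h(1)] mult_cd[OF f'(1) Add_Hom[OF g'(1) h(1)]]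
    using m_assoc[of f' k g' h] f'(1) g'(1) h(1) by simp
qed

lemma module_colim: "is_module C colim"
  unfolding is_module_def
proof (intro conjI ballI impI)
  fix x assume x: "x \<in> Obj C"
  show "comm_group (FunO colim x)" using grp_group[OF x] by (simp add: colim_O[OF x])
  fix u assume "u \<in> el colim x"
  then have "u \<in> carrier (grp x)" by (simp add: colim_O[OF x])
  then obtain n f where f: "f \<in> Hom C x (Src C (E n))" "u = cd x (n, f)" by (rule el_colimE)
  show "FunA colim (Ident C x) u = u" unfolding f(2) act_cd[OF Ident_Hom[OF x] f(1)] Comp_Ident[OF f(1)] ..
next
  fix f assume f': "f \<in> Arr C"
  note f = Arr_Hom[OF f'] and o = Src_Obj[OF f'] Tgt_Obj[OF f']
  show "FunA colim f \<in> hom (FunO colim (Tgt C f)) (FunO colim (Src C f))"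
    unfolding colim_O[OF o(1)] colim_O[OF o(2)]
  proof (rule homI)
    fix u v assume u: "u \<in> carrier (grp (Tgt C f))" and v: "v \<in> carrier (grp (Tgt C f))"
    obtain n g where g: "g \<in> Hom C (Tgt C f) (Src C (E n))" "u = cd (Tgt C f) (n, g)" by (rule el_colimE[OF u])
    obtain m h where m: "m \<ge> n" and h: "h \<in> Hom C (Tgt C f) (Src C (E m))" "v = cd (Tgt C f) (m, h)"
      by (rule el_colimE[OF v, of n])
    define g' where "g' = transition C E n m \<cdot> g"
    have g': "g' \<in> Hom C (Tgt C f) (Src C (E m))" "u = cd (Tgt C f) (m, g')" unfolding g'_def
      using trans_push[OF E g(1) m] cd_push[OF g(1) m] g(2) by auto
    show "FunA colim f u \<in> carrier (grp (Src C f))"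
      unfolding g(2) act_cd[OF f g(1)] by (rule el_colimI[OF Comp_Hom[OF f g(1)]])
    show "FunA colim f (u \<otimes>\<^bsub>grp (Tgt C f)\<^esub> v) = FunA colim f u \<otimes>\<^bsub>grp (Src C f)\<^esub> FunA colim f v"
      unfolding g'(2) h(2) mult_cd[OF g'(1) h(1)] act_cd[OF f g'(1)] act_cd[OF f h(1)]
        act_cd[OF f Add_Hom[OF g'(1) h(1)]] mult_cd[OF Comp_Hom[OF f g'(1)] Comp_Hom[OF f h(1)]]
        Add_Comp[OF f g'(1) h(1)] ..
  qed
  show "FunA colim f \<in> extensional (el colim (Tgt C f))" using f' o by (simp add: colim_def)
next
  fix f g u assume f': "f \<in> Arr C" and g': "g \<in> Arr C" and fg: "Tgt C f = Src C g" and u: "u \<in> el colim (Tgt C g)"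
  have f: "f \<in> Hom C (Src C f) (Src C g)" and g: "g \<in> Hom C (Src C g) (Tgt C g)" using f' g' fg by (auto simp: Hom_def)
  have "u \<in> carrier (grp (Tgt C g))" using u by (simp add: colim_O[OF Hom_Obj(2)[OF g]])
  then obtain n h where h: "h \<in> Hom C (Tgt C g) (Src C (E n))" "u = cd (Tgt C g) (n, h)" by (rule el_colimE)
  show "FunA colim (g \<cdot> f) u = FunA colim f (FunA colim g u)"
    unfolding h(2) act_cd[OF Comp_Hom[OF f g] h(1)] act_cd[OF g h(1)] act_cd[OF f Comp_Hom[OF g h(1)]]
      Comp_assoc[OF f g h(1)] ..
next
  fix f g u assume f': "f \<in> Arr C" and g: "g \<in> Hom C (Src C f) (Tgt C f)" and u: "u \<in> el colim (Tgt C f)"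
  note f = Arr_Hom[OF f'] and o = Src_Obj[OF f'] Tgt_Obj[OF f']
  have "u \<in> carrier (grp (Tgt C f))" using u by (simp add: colim_O[OF o(2)])
  then obtain n h where h: "h \<in> Hom C (Tgt C f) (Src C (E n))" "u = cd (Tgt C f) (n, h)" by (rule el_colimE)
  show "FunA colim (Add C f g) u = FunA colim f u \<otimes>\<^bsub>FunO colim (Src C f)\<^esub> FunA colim g u"
    unfolding h(2) act_cd[OF Add_Hom[OF f g] h(1)] act_cd[OF f h(1)] act_cd[OF g h(1)] colim_O[OF o(1)]
      mult_cd[OF Comp_Hom[OF f h(1)] Comp_Hom[OF g h(1)]] Comp_Add[OF f g h(1)] ..
qed (simp_all add: colim_def)

text \<open>The presenting elements are the classes of identities. Since \<open>f\<close> sends such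
  a class to the class of \<open>f\<close>, the clauses of \<open>pres\<close> restate the
  construction.\<close>

lemma pres_colim: "pres C E colim (\<lambda>n. cd (Src C (E n)) (n, Ident C (Src C (E n))))"
proof -
  have i: "Ident C (Src C (E n)) \<in> Hom C (Src C (E n)) (Src C (E n))" for n by (rule Ident_Hom[OF seq_Obj[OF E]])
  have a: "FunA colim f (cd (Src C (E n)) (n, Ident C (Src C (E n)))) = cd x (n, f)"
    if "f \<in> Hom C x (Src C (E n))" for f x n
    unfolding act_cd[OF that i] Ident_Comp[OF that] ..
  show ?thesis unfolding pres_def
  proof (intro conjI allI ballI impI)
    fix n show "cd (Src C (E n)) (n, Ident C (Src C (E n))) \<in> el colim (Src C (E n))"
      using el_colimI[OF i] by (simp add: colim_O[OF seq_Obj[OF E]])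
    show "FunA colim (E n) (cd (Src C (E (Suc n))) (Suc n, Ident C (Src C (E (Suc n))))) = cd (Src C (E n)) (n, Ident C (Src C (E n)))"
      unfolding a[OF seq_Hom[OF E]]
      using cd_push[OF i[of n] le_SucI[OF le_refl]] trans_step[OF E] Comp_Ident[OF seq_Hom[OF E]] by simp
  next
    fix x u assume "x \<in> Obj C" "u \<in> el colim x"
    then have "u \<in> carrier (grp x)" by (simp add: colim_O)
    then obtain n f where f: "f \<in> Hom C x (Src C (E n))" "u = cd x (n, f)" by (rule el_colimE)
    then show "\<exists>n. \<exists>f\<in>Hom C x (Src C (E n)). u = FunA colim f (cd (Src C (E n)) (n, Ident C (Src C (E n))))"
      using a by metis
  next
    fix n x f g assume f: "f \<in> Hom C x (Src C (E n))" and g: "g \<in> Hom C x (Src C (E n))"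
      and "FunA colim f (cd (Src C (E n)) (n, Ident C (Src C (E n)))) = FunA colim g (cd (Src C (E n)) (n, Ident C (Src C (E n))))"
    then have "cd x (n, f) = cd x (n, g)" by (simp add: a)
    then have "eqv (n, f) (n, g)" using cd_eq f g by (auto simp: prs_def)
    then show "\<exists>k\<ge>n. transition C E n k \<cdot> f = transition C E n k \<cdot> g" by (auto simp: eqv_def)
  qed
qed

end

context yoneda
begin

lemma colim_exists: assumes "is_seq C E" shows "\<exists>A t. is_module C A \<and> pres C E (A :: ('o, 'm, 'u) presheaf) t"
proof -
  interpret seq_colimit C e E by unfold_locales (rule assms)
  show ?thesis using module_colim pres_colim by blast
qed

text \<open>The Yoneda lemma at every stage; the element \<open>t n\<close> is the value of the
  cocone at the identity of the \<open>n\<close>-th object.\<close>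

lemma cocone_elements:
  assumes E: "is_seq C E" and A: "is_module C A"
  shows "is_cocone (ModCat C) (\<lambda>n. YonA e C (E n)) A \<kappa> \<longleftrightarrow>
    (\<exists>t. (\<forall>n. t n \<in> el A (Src C (E n)) \<and> FunA A (E n) (t (Suc n)) = t n) \<and> \<kappa> = (\<lambda>n. ymap A (Src C (E n)) (t n)))"
    (is "?l \<longleftrightarrow> ?r")
proof
  have s: "Src (ModCat C) (YonA e C (E n)) = YonO e C (Src C (E n))" for n by (simp add: YonA_def)
  have step: "ymap A (Src C (E (Suc n))) u \<cdot>\<^bsub>ModCat C\<^esub> YonA e C (E n) = ymap A (Src C (E n)) (FunA A (E n) u)"
    if u: "u \<in> el A (Src C (E (Suc n)))" for n u
  proof (rule Yon_map_eqI)
    note y = YonA_Hom[OF seq_Hom[OF E, of n]] and m = ymap_Hom[OF A seq_Obj[OF E] u]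
    show "ymap A (Src C (E (Suc n))) u \<cdot>\<^bsub>ModCat C\<^esub> YonA e C (E n) \<in> Hom (ModCat C) (YonO e C (Src C (E n))) A"
      by (rule MComp_Hom[OF y m])
    show "ymap A (Src C (E n)) (FunA A (E n) u) \<in> Hom (ModCat C) (YonO e C (Src C (E n))) A"
      by (rule ymap_Hom[OF A seq_Obj[OF E] act_closed[OF A seq_Hom[OF E] u]])
    note o = seq_Obj[OF E, of n]
    show "At (ymap A (Src C (E (Suc n))) u \<cdot>\<^bsub>ModCat C\<^esub> YonA e C (E n)) (Src C (E n)) (e (Ident C (Src C (E n)))) =
      At (ymap A (Src C (E n)) (FunA A (E n) u)) (Src C (E n)) (e (Ident C (Src C (E n))))"
      unfolding At_Comp[OF y o Ident_el[OF o]] At_YonA[OF seq_Hom[OF E] Ident_Hom[OF o]] Comp_Ident[OF seq_Hom[OF E]]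
        At_ymap[OF seq_Hom[OF E]] At_ymap[OF Ident_Hom[OF o]]
      using act_ident[OF A o act_closed[OF A seq_Hom[OF E] u]] by simp
  qed
  { assume ?l
    then have k: "\<kappa> n \<in> Hom (ModCat C) (YonO e C (Src C (E n))) A" "\<kappa> (Suc n) \<cdot>\<^bsub>ModCat C\<^esub> YonA e C (E n) = \<kappa> n" for n
      unfolding is_cocone_def s by auto
    define t where "t n = At (\<kappa> n) (Src C (E n)) (e (Ident C (Src C (E n))))" for n
    have t: "t n \<in> el A (Src C (E n))" for n unfolding t_def
      by (rule MH_closed[OF k(1) seq_Obj[OF E] Ident_el[OF seq_Obj[OF E]]])
    have kt: "\<kappa> n = ymap A (Src C (E n)) (t n)" for n
      by (rule Yon_map_eqI[OF k(1) ymap_Hom[OF A seq_Obj[OF E] t]])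
        (simp add: At_ymap[OF Ident_Hom[OF seq_Obj[OF E]]] act_ident[OF A seq_Obj[OF E] t] t_def[symmetric])
    have "FunA A (E n) (t (Suc n)) = t n" for n
    proof -
      have "ymap A (Src C (E n)) (FunA A (E n) (t (Suc n))) = \<kappa> n" using step[OF t, of n] k(2)[of n] kt by simp
      then have "At (ymap A (Src C (E n)) (FunA A (E n) (t (Suc n)))) (Src C (E n)) (e (Ident C (Src C (E n)))) = t n"
        by (simp add: t_def)
      then show ?thesis
        by (simp add: At_ymap[OF Ident_Hom[OF seq_Obj[OF E]]] act_ident[OF A seq_Obj[OF E] act_closed[OF A seq_Hom[OF E] t]])
    qed
    then show ?r using t kt by blast }
  assume ?r
  then obtain t where t: "\<And>n. t n \<in> el A (Src C (E n))" "\<And>n. FunA A (E n) (t (Suc n)) = t n"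
    and k: "\<kappa> = (\<lambda>n. ymap A (Src C (E n)) (t n))" by blast
  show ?l unfolding is_cocone_def s k
    using ymap_Hom[OF A seq_Obj[OF E] t(1)] step[OF t(1)] t(2) A by simp
qed

lemma pres_Yon_colim:
  assumes E: "is_seq C E" and A: "is_module C A" and p: "pres C E A t"
  shows "Yon_colim e C E A (\<lambda>n. ymap A (Src C (E n)) (t n))"
  unfolding Yon_colim_def is_colim_def
proof (intro conjI allI impI)
  show "is_cocone (ModCat C) (\<lambda>n. YonA e C (E n)) A (\<lambda>n. ymap A (Src C (E n)) (t n))"
    unfolding cocone_elements[OF E A] using pres_el[OF p] pres_step[OF p] by blast
  fix B \<mu> assume c: "is_cocone (ModCat C) (\<lambda>n. YonA e C (E n)) B \<mu>"
  then have B: "is_module C B" by (simp add: is_cocone_def)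
  then obtain s where s: "\<And>n. s n \<in> el B (Src C (E n))" "\<And>n. FunA B (E n) (s (Suc n)) = s n"
    and mu: "\<mu> = (\<lambda>n. ymap B (Src C (E n)) (s n))" using c unfolding cocone_elements[OF E B] by blast
  note o = seq_Obj[OF E] and i = Ident_Hom[OF seq_Obj[OF E]]
  have iff: "(G \<cdot>\<^bsub>ModCat C\<^esub> ymap A (Src C (E n)) (t n) = ymap B (Src C (E n)) (s n)) \<longleftrightarrow> At G (Src C (E n)) (t n) = s n"
    if G: "G \<in> Hom (ModCat C) A B" for G n
  proof -
    note y = ymap_Hom[OF A o pres_el[OF p], of n]
    have "At (G \<cdot>\<^bsub>ModCat C\<^esub> ymap A (Src C (E n)) (t n)) (Src C (E n)) (e (Ident C (Src C (E n)))) = At G (Src C (E n)) (t n)"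
      unfolding At_Comp[OF y o Ident_el[OF o]] At_ymap[OF i] act_ident[OF A o pres_el[OF p]] ..
    moreover have "At (ymap B (Src C (E n)) (s n)) (Src C (E n)) (e (Ident C (Src C (E n)))) = s n"
      unfolding At_ymap[OF i] act_ident[OF B o s(1)] ..
    ultimately show ?thesis
      using Yon_map_eqI[OF MComp_Hom[OF y G] ymap_Hom[OF B o s(1)]] by auto
  qed
  show "\<exists>!G. G \<in> Hom (ModCat C) A B \<and> (\<forall>n. G \<cdot>\<^bsub>ModCat C\<^esub> ymap A (Src C (E n)) (t n) = \<mu> n)"
  proof (rule ex_ex1I)
    show "\<exists>G. G \<in> Hom (ModCat C) A B \<and> (\<forall>n. G \<cdot>\<^bsub>ModCat C\<^esub> ymap A (Src C (E n)) (t n) = \<mu> n)"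
      using pres_hom[OF E A p B s] iff unfolding mu by auto
    fix G G' assume "G \<in> Hom (ModCat C) A B \<and> (\<forall>n. G \<cdot>\<^bsub>ModCat C\<^esub> ymap A (Src C (E n)) (t n) = \<mu> n)"
      "G' \<in> Hom (ModCat C) A B \<and> (\<forall>n. G' \<cdot>\<^bsub>ModCat C\<^esub> ymap A (Src C (E n)) (t n) = \<mu> n)"
    then show "G = G'" using pres_eqI[OF E p, of G B G' 0] iff unfolding mu by auto
  qed
qed

text \<open>A universal property alone says nothing about elements. The given colimit is compared
  with the constructed one, \<open>B\<close>, for which \<open>pres\<close> is known; the two
  universal properties give an isomorphism, and \<open>pres\<close> is transported along it.\<close>

lemma Yon_colim_pres:
  assumes E: "is_seq C E" and c: "Yon_colim e C E A \<kappa>"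
  shows "is_module C A \<and> (\<exists>t. pres C E A t \<and> \<kappa> = (\<lambda>n. ymap A (Src C (E n)) (t n)))"
proof -
  have cc: "is_cocone (ModCat C) (\<lambda>n. YonA e C (E n)) A \<kappa>"
    and univ: "\<And>B \<mu>. is_cocone (ModCat C) (\<lambda>n. YonA e C (E n)) B \<mu> \<Longrightarrow>
      \<exists>!u. u \<in> Hom (ModCat C) A B \<and> (\<forall>n. u \<cdot>\<^bsub>ModCat C\<^esub> \<kappa> n = \<mu> n)"
    using c unfolding Yon_colim_def is_colim_def by blast+
  have A: "is_module C A" using cc by (simp add: is_cocone_def)
  obtain t where t: "\<And>n. t n \<in> el A (Src C (E n))" "\<And>n. FunA A (E n) (t (Suc n)) = t n"
    and k: "\<kappa> = (\<lambda>n. ymap A (Src C (E n)) (t n))" using cc unfolding cocone_elements[OF E A] by blast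
  obtain B :: "('o, 'm, 'u) presheaf" and s where B: "is_module C B" "pres C E B s" using colim_exists[OF E] by blast
  obtain G where G: "G \<in> Hom (ModCat C) B A" "\<And>n. At G (Src C (E n)) (s n) = t n"
    using pres_hom[OF E B A t] by blast
  have cB: "is_cocone (ModCat C) (\<lambda>n. YonA e C (E n)) B (\<lambda>n. ymap B (Src C (E n)) (s n))"
    using pres_Yon_colim[OF E B] unfolding Yon_colim_def is_colim_def by blast
  note o = seq_Obj[OF E] and i = Ident_Hom[OF seq_Obj[OF E]]
  obtain H where H: "H \<in> Hom (ModCat C) A B" "\<And>n. H \<cdot>\<^bsub>ModCat C\<^esub> \<kappa> n = ymap B (Src C (E n)) (s n)"
    using univ[OF cB] by blast
  have Ht: "At H (Src C (E n)) (t n) = s n" for n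
  proof -
    note y = ymap_Hom[OF A o t(1), of n]
    have "At (H \<cdot>\<^bsub>ModCat C\<^esub> \<kappa> n) (Src C (E n)) (e (Ident C (Src C (E n)))) = At H (Src C (E n)) (t n)"
      unfolding k At_Comp[OF y o Ident_el[OF o]] At_ymap[OF i] act_ident[OF A o t(1)] ..
    then show ?thesis unfolding H(2) At_ymap[OF i] act_ident[OF B(1) o pres_el[OF B(2)]] by simp
  qed
  have HG: "H \<cdot>\<^bsub>ModCat C\<^esub> G = Ident (ModCat C) B"
    by (rule pres_eqI[OF E B(2) MComp_Hom[OF G(1) H(1)] MIdent_Hom[OF B(1)]])
      (simp add: At_Comp[OF G(1) o pres_el[OF B(2)]] At_Ident[OF o pres_el[OF B(2)]] G(2) Ht)
  have Gk: "G \<cdot>\<^bsub>ModCat C\<^esub> ymap B (Src C (E n)) (s n) = \<kappa> n" for n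
  proof (rule Yon_map_eqI)
    note y = ymap_Hom[OF B(1) o pres_el[OF B(2)], of n]
    show "G \<cdot>\<^bsub>ModCat C\<^esub> ymap B (Src C (E n)) (s n) \<in> Hom (ModCat C) (YonO e C (Src C (E n))) A" by (rule MComp_Hom[OF y G(1)])
    show "\<kappa> n \<in> Hom (ModCat C) (YonO e C (Src C (E n))) A" unfolding k by (rule ymap_Hom[OF A o t(1)])
    show "At (G \<cdot>\<^bsub>ModCat C\<^esub> ymap B (Src C (E n)) (s n)) (Src C (E n)) (e (Ident C (Src C (E n)))) = At (\<kappa> n) (Src C (E n)) (e (Ident C (Src C (E n))))"
      unfolding k At_Comp[OF y o Ident_el[OF o]] At_ymap[OF i] act_ident[OF B(1) o pres_el[OF B(2)]] act_ident[OF A o t(1)] G(2) ..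
  qed
  interpret M: category "ModCat C :: (('o, 'm, 'u) presheaf, ('o, 'm, 'u) presheaf_map) shift_cat" by (rule category_ModCat)
  have kH: "\<kappa> n \<in> Hom (ModCat C) (YonO e C (Src C (E n))) A" for n unfolding k by (rule ymap_Hom[OF A o t(1)])
  have GHk: "(G \<cdot>\<^bsub>ModCat C\<^esub> H) \<cdot>\<^bsub>ModCat C\<^esub> \<kappa> n = \<kappa> n" for n
    using M.Comp_assoc[OF kH H(1) G(1)] H(2) Gk by simp
  \<comment> \<open>Both endomorphisms of \<open>A\<close> fix the colimit cocone, so the uniqueness
    clause identifies them.\<close>
  have GH: "G \<cdot>\<^bsub>ModCat C\<^esub> H = Ident (ModCat C) A"
    using univ[OF cc] GHk MComp_Hom[OF H(1) G(1)] MIdent_Hom[OF A] M.Ident_Comp[OF kH] by blast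
  have bij: "bij_betw (At G x) (el B x) (el A x)" if x: "x \<in> Obj C" for x
  proof (rule bij_betwI[of _ _ _ "At H x"])
    show "At G x \<in> el B x \<rightarrow> el A x" "At H x \<in> el A x \<rightarrow> el B x" using MH_closed[OF G(1) x] MH_closed[OF H(1) x] by auto
    fix u assume "u \<in> el B x" then show "At H x (At G x u) = u"
      using At_Comp[OF G(1) x, of u H] HG At_Ident[OF x, of u B] by simp
  next
    fix u assume "u \<in> el A x" then show "At G x (At H x u) = u"
      using At_Comp[OF H(1) x, of u G] GH At_Ident[OF x, of u A] by simp
  qed
  have "pres C E A (\<lambda>n. At G (Src C (E n)) (s n))" by (rule pres_transport[OF E B(2) G(1) bij])
  then have "pres C E A t" by (simp add: G(2))
  then show ?thesis using A k by blast
qed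

end

section \<open>Triangulated categories\<close>

sublocale triangulated_category \<subseteq> shifted
  by (intro shifted.intro preadditive.intro preadditive_axioms.intro shifted_axioms.intro category_axioms
    hom_comm_group Comp_Add Add_Comp shift_functor shift_bij_Obj shift_bij_Arr shift_Add)

context triangulated_category
begin

definition tri :: "'o \<Rightarrow> 'o \<Rightarrow> 'o \<Rightarrow> 'm \<Rightarrow> 'm \<Rightarrow> 'm \<Rightarrow> bool" where
  "tri a b c f g h \<longleftrightarrow> (f, g, h) \<in> Tri C \<and> f \<in> Hom C a b \<and> g \<in> Hom C b c \<and> h \<in> Hom C c (ShO C a)"

lemma triI: assumes "(f, g, h) \<in> Tri C" shows "tri (Src C f) (Tgt C f) (Tgt C g) f g h"
proof -
  have h: "f \<in> Arr C" "g \<in> Hom C (Tgt C f) (Src C h)" "h \<in> Hom C (Tgt C g) (ShO C (Src C f))"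
    using Tri_arrows[OF assms] by auto
  show ?thesis using assms Arr_Hom[OF h(1)] h(2,3) Hom_Src[OF h(3)] by (simp add: tri_def)
qed

lemma tri_Tri: "tri a b c f g h \<Longrightarrow> (f, g, h) \<in> Tri C"
  and tri1: "tri a b c f g h \<Longrightarrow> f \<in> Hom C a b"
  and tri2: "tri a b c f g h \<Longrightarrow> g \<in> Hom C b c"
  and tri3: "tri a b c f g h \<Longrightarrow> h \<in> Hom C c (ShO C a)"
  by (auto simp: tri_def)

lemma tri_of_Tri: assumes "(f, g, h) \<in> Tri C" "f \<in> Hom C a b"
  shows "tri a b (Tgt C g) f g h"
  using triI[OF assms(1)] assms(2) by (simp add: Hom_def)

lemma tri_exists: assumes "f \<in> Hom C a b" shows "\<exists>c g h. tri a b c f g h"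
  using TR1_cone[OF Hom_Arr[OF assms]] tri_of_Tri[OF _ assms] by blast

lemma tri_Obj: assumes "tri a b c f g h" shows "a \<in> Obj C" "b \<in> Obj C" "c \<in> Obj C"
  using Hom_Obj[OF tri1[OF assms]] Hom_Obj[OF tri2[OF assms]] by auto

lemma rot: assumes t: "tri a b c f g h" shows "tri b c (ShO C a) g h (Neg C (ShA C f))"
  using TR2[OF tri1[OF t] tri2[OF t] tri3[OF t]] tri_Tri[OF t] tri2[OF t] tri3[OF t]
    Neg_Hom[OF ShA_Hom[OF tri1[OF t]]] Neg_eq[OF ShA_Hom[OF tri1[OF t]]] by (simp add: tri_def)

text \<open>TR2 read backwards. Its sign is absorbed by taking the negative of the desuspension of
  \<open>k\<close> as first arrow.\<close>

lemma unrot: assumes t: "tri b c d g h k" shows "tri (UnO C d) b c (Neg C (UnA C k)) g h"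
proof -
  note o = tri_Obj[OF t]
  have k: "UnA C k \<in> Hom C (UnO C d) b" using UnA_Hom[OF tri3[OF t]] by (simp add: UnO_ShO[OF o(1)])
  note f = Neg_Hom[OF k]
  have h: "h \<in> Hom C c (ShO C (UnO C d))" using tri2[OF t] by (simp add: ShO_UnO[OF o(3)])
  have "ShA C (Neg C (UnA C k)) = Neg C k"
    using ShA_Neg[OF k] ShA_UnA[OF Hom_Arr[OF tri3[OF t]]] by simp
  then have "Neg C (ShA C (Neg C (UnA C k))) = k" using Neg_Neg[OF tri3[OF t]] by simp
  then have "(Neg C (UnA C k), g, h) \<in> Tri C"
    using TR2[OF f tri1[OF t] h] Neg_eq[OF ShA_Hom[OF f]] tri_Tri[OF t] by simp
  then show ?thesis using f tri1[OF t] h by (simp add: tri_def)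
qed

lemma zero_Obj: "is_zero_obj C z \<Longrightarrow> z \<in> Obj C"
  by (simp add: is_zero_obj_def)

lemma tri_ident: assumes "a \<in> Obj C" "is_zero_obj C z"
  shows "tri a a z (Ident C a) (ZeroArr C a z) (ZeroArr C z (ShO C a))"
  using TR1_ident[OF assms] Ident_Hom[OF assms(1)] Zero_Hom[OF assms(1) zero_Obj[OF assms(2)]]
    Zero_Hom[OF zero_Obj[OF assms(2)] ShO_Obj[OF assms(1)]] by (simp add: tri_def)

lemma tri_fill:
  assumes t: "tri a b c f g h" and t': "tri a' b' c' f' g' h'"
    and u: "u \<in> Hom C a a'" and v: "v \<in> Hom C b b'" and vf: "v \<cdot> f = f' \<cdot> u"
  shows "\<exists>w \<in> Hom C c c'. w \<cdot> g = g' \<cdot> v \<and> ShA C u \<cdot> h = h' \<cdot> w"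
  using TR3[OF tri_Tri[OF t] tri_Tri[OF t'], of u v] u v vf
    Hom_Src[OF tri1[OF t]] Hom_Src[OF tri1[OF t']] Hom_Src[OF tri2[OF t]] Hom_Src[OF tri2[OF t']]
    Hom_Src[OF tri3[OF t]] Hom_Src[OF tri3[OF t']] by simp

text \<open>The triangle on the identity of \<open>a\<close> maps to the given one, and its third
  vertex is a zero object.\<close>

lemma tri_comp_zero: assumes t: "tri a b c f g h" shows "g \<cdot> f = ZeroArr C a c"
proof -
  obtain z where z: "is_zero_obj C z" using zero_obj by blast
  note o = tri_Obj[OF t]
  have "f \<cdot> Ident C a = f \<cdot> Ident C a" ..
  from tri_fill[OF tri_ident[OF o(1) z] t Ident_Hom[OF o(1)] tri1[OF t] this]
  obtain w where w: "w \<in> Hom C z c" "w \<cdot> ZeroArr C a z = g \<cdot> f" by blast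
  then show ?thesis using Comp_Zero[OF w(1) o(1)] by simp
qed

text \<open>The rotated identity triangle of \<open>x\<close> maps to the rotated given triangle by
  \<open>v\<close> and zero. The fill-in is a map between shifts, and its desuspension is the
  factorisation; both third arrows carry a sign, so the signs cancel.\<close>

lemma tri_exact: assumes t: "tri a b c f g h" and v: "v \<in> Hom C x b" "g \<cdot> v = ZeroArr C x c"
  shows "\<exists>u \<in> Hom C x a. f \<cdot> u = v"
proof -
  obtain z where z: "is_zero_obj C z" using zero_obj by blast
  note o = tri_Obj[OF t] and x = Hom_Obj(1)[OF v(1)] and z' = zero_Obj[OF z]
  note i = rot[OF tri_ident[OF x z]] and r = rot[OF t]
  have "ZeroArr C z c \<cdot> ZeroArr C x z = g \<cdot> v"
    using Comp_Zero[OF Zero_Hom[OF z' o(3)] x] v(2) by simp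
  from tri_fill[OF i r v(1) Zero_Hom[OF z' o(3)] this]
  obtain w where w: "w \<in> Hom C (ShO C x) (ShO C a)"
    "ShA C v \<cdot> Neg C (ShA C (Ident C x)) = Neg C (ShA C f) \<cdot> w" by blast
  have sv: "ShA C v \<in> Hom C (ShO C x) (ShO C b)" by (rule ShA_Hom[OF v(1)])
  have "Neg C (ShA C v) = Neg C (ShA C f \<cdot> w)"
    using w(2) Comp_Neg[OF Ident_Hom[OF ShO_Obj[OF x]] sv] Comp_Ident[OF sv] Neg_Comp[OF w(1) ShA_Hom[OF tri1[OF t]]]
    by (simp add: ShA_Ident[OF x])
  then have sv': "ShA C v = ShA C f \<cdot> w" using Neg_inj[OF sv Comp_Hom[OF w(1) ShA_Hom[OF tri1[OF t]]]] by simp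
  have w': "UnA C w \<in> Hom C x a" using UnA_Hom[OF w(1)] by (simp add: UnO_ShO x o)
  have "v = f \<cdot> UnA C w"
    using UnA_Comp[OF w(1) ShA_Hom[OF tri1[OF t]]] sv' UnA_ShA[OF Hom_Arr[OF v(1)]] UnA_ShA[OF Hom_Arr[OF tri1[OF t]]] by simp
  then show ?thesis using w' by blast
qed

text \<open>The dual comparison: the target is the identity triangle of \<open>x\<close> rotated
  backwards, whose first vertex is a desuspended zero object.\<close>

lemma tri_coexact: assumes t: "tri a b c f g h" and v: "v \<in> Hom C b x" "v \<cdot> f = ZeroArr C a x"
  shows "\<exists>u \<in> Hom C c x. u \<cdot> g = v"
proof -
  obtain z where z: "is_zero_obj C z" using zero_obj by blast
  note o = tri_Obj[OF t] and x = Hom_Obj(2)[OF v(1)] and z' = zero_Obj[OF z]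
  note i = unrot[OF tri_ident[OF x z]]
  have u0: "ZeroArr C a (UnO C z) \<in> Hom C a (UnO C z)" by (rule Zero_Hom[OF o(1) UnO_Obj[OF z']])
  have "v \<cdot> f = Neg C (UnA C (ZeroArr C z (ShO C x))) \<cdot> ZeroArr C a (UnO C z)"
    using Comp_Zero[OF tri1[OF i] o(1)] v(2) by simp
  from tri_fill[OF t i u0 v(1) this]
  obtain w where w: "w \<in> Hom C c x" "w \<cdot> g = Ident C x \<cdot> v" by blast
  then show ?thesis using Ident_Comp[OF v(1)] by auto
qed

lemma cone_in_iff: "f \<in> Hom C a b \<Longrightarrow> cone_in C f X \<longleftrightarrow> (\<exists>c g h. tri a b c f g h \<and> c \<in> X)"
  unfolding cone_in_def using tri_of_Tri tri_Tri tri2 Hom_Tgt by metis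

text \<open>The isomorphism of triangles with components -1, 1, 1. It removes the signs that
  rotations produce.\<close>

lemma tri_Neg: assumes t: "tri a b c f g h" shows "tri a b c (Neg C f) g (Neg C h)"
proof -
  note o = tri_Obj[OF t]
  note ia = Ident_Hom[OF o(1)] and ib = Ident_Hom[OF o(2)] and ic = Ident_Hom[OF o(3)]
  have inv: "is_invertible C (Ident C x)" if "x \<in> Obj C" for x
    using is_invertibleI[OF Ident_Hom[OF that] Ident_Hom[OF that]] Comp_Ident[OF Ident_Hom[OF that]] by simp
  have nn: "Neg C (Ident C a) \<cdot> Neg C (Ident C a) = Ident C a"
    using Comp_Neg[OF ia Neg_Hom[OF ia]] Neg_Comp[OF ia ia] Comp_Ident[OF ia] Neg_Neg[OF ia] by simp
  have invn: "is_invertible C (Neg C (Ident C a))" by (rule is_invertibleI[OF Neg_Hom[OF ia] Neg_Hom[OF ia] nn nn])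
  have "(Neg C f, g, Neg C h) \<in> Tri C"
  proof (rule Tri_iso[OF tri_Tri[OF t]])
    show "Neg C (Ident C a) \<in> Hom C (Src C f) (Src C (Neg C f))" "Ident C b \<in> Hom C (Src C g) (Src C g)"
      "Ident C c \<in> Hom C (Src C h) (Src C (Neg C h))" "Neg C f \<in> Hom C (Src C (Neg C f)) (Src C g)"
      "g \<in> Hom C (Src C g) (Src C (Neg C h))" "Neg C h \<in> Hom C (Src C (Neg C h)) (ShO C (Src C (Neg C f)))"
      using Neg_Hom[OF ia] ib ic Neg_Hom[OF tri1[OF t]] tri2[OF t] Neg_Hom[OF tri3[OF t]] Hom_Src[OF tri1[OF t]]
        Hom_Src[OF tri2[OF t]] Hom_Src[OF tri3[OF t]] Hom_Src[OF Neg_Hom[OF tri1[OF t]]]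
        Hom_Src[OF Neg_Hom[OF tri3[OF t]]] by simp_all
    show "Ident C b \<cdot> f = Neg C f \<cdot> Neg C (Ident C a)"
      using Ident_Comp[OF tri1[OF t]] Comp_Neg[OF ia Neg_Hom[OF tri1[OF t]]] Comp_Ident[OF Neg_Hom[OF tri1[OF t]]]
        Neg_Neg[OF tri1[OF t]] by simp
    show "Ident C c \<cdot> g = g \<cdot> Ident C b" using Ident_Comp[OF tri2[OF t]] Comp_Ident[OF tri2[OF t]] by simp
    show "ShA C (Neg C (Ident C a)) \<cdot> h = Neg C h \<cdot> Ident C c"
      using ShA_Neg[OF ia] ShA_Ident[OF o(1)] Neg_Comp[OF tri3[OF t] Ident_Hom[OF ShO_Obj[OF o(1)]]]
        Ident_Comp[OF tri3[OF t]] Comp_Ident[OF Neg_Hom[OF tri3[OF t]]] by simp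
  qed (rule inv invn o)+
  then show ?thesis using Neg_Hom[OF tri1[OF t]] tri2[OF t] Neg_Hom[OF tri3[OF t]] by (simp add: tri_def)
qed

end

section \<open>Metrics\<close>

locale metric_tri = triangulated_category C + good_metric C M
  for C :: "('o, 'm, 'z) tri_cat_scheme" (structure) and M :: "nat \<Rightarrow> 'o set"
begin

abbreviation T :: "nat \<Rightarrow> 'm \<Rightarrow> bool" where "T n f \<equiv> cone_in C f (M n)"

lemma M_Suc: "M (Suc i) \<subseteq> M i" and M_ShO: "c \<in> M (Suc i) \<Longrightarrow> ShO C c \<in> M i" and M_UnO: "c \<in> M (Suc i) \<Longrightarrow> UnO C c \<in> M i"
  using metric_shift[of i] by auto

lemma M_mono: "i \<le> j \<Longrightarrow> M j \<subseteq> M i"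
  by (rule lift_Suc_antimono_le[of M]) (rule M_Suc)

lemma T_mono: "T j f \<Longrightarrow> i \<le> j \<Longrightarrow> T i f"
  unfolding cone_in_def using M_mono by blast

lemma M_ext: assumes "tri a b c f g h" "a \<in> M i" "c \<in> M i" shows "b \<in> M i"
proof -
  have "b \<in> star C (M i) (M i)" unfolding star_def
    using tri_Tri[OF assms(1)] Hom_Src[OF tri1[OF assms(1)]] Hom_Tgt[OF tri1[OF assms(1)]] Hom_Tgt[OF tri2[OF assms(1)]]
      assms(2,3) by blast
  then show ?thesis using metric_star by blast
qed

lemma T_octa:
  assumes f: "f \<in> Hom C x y" and g: "g \<in> Hom C y z" and tf: "tri x y a f i i'" and tg: "tri y z b g j j'"
    and td: "tri x z c (g \<cdot> f) k k'"
  shows "\<exists>u v. tri a c b u v (ShA C i \<cdot> j') \<and> u \<cdot> i = k \<cdot> g \<and> k' \<cdot> u = i' \<and> v \<cdot> k = j \<and> j' \<cdot> v = ShA C f \<cdot> k'"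
proof -
  obtain u v where uv: "u \<in> Hom C (Src C i') (Src C k')" "v \<in> Hom C (Src C k') (Src C j')"
    "u \<cdot> i = k \<cdot> g" "k' \<cdot> u = i'" "v \<cdot> k = j" "j' \<cdot> v = ShA C f \<cdot> k'" "(u, v, ShA C i \<cdot> j') \<in> Tri C"
    using TR4[OF f g tri_Tri[OF tf] tri_Tri[OF tg] tri_Tri[OF td]] by blast
  have "tri a c b u v (ShA C i \<cdot> j')"
    using uv(1,2,7) Comp_Hom[OF tri3[OF tg] ShA_Hom[OF tri2[OF tf]]] Hom_Src[OF tri3[OF tf]]
      Hom_Src[OF tri3[OF tg]] Hom_Src[OF tri3[OF td]] by (simp add: tri_def)
  then show ?thesis using uv by blast
qed

lemma T_comp: assumes f: "f \<in> Hom C x y" and g: "g \<in> Hom C y z" and "T n f" "T n g" shows "T n (g \<cdot> f)"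
proof -
  obtain a i i' b j j' where tf: "tri x y a f i i'" "a \<in> M n" and tg: "tri y z b g j j'" "b \<in> M n"
    using assms(3,4) unfolding cone_in_iff[OF f] cone_in_iff[OF g] by blast
  obtain c k k' where td: "tri x z c (g \<cdot> f) k k'" using tri_exists[OF Comp_Hom[OF f g]] by blast
  show ?thesis
    using T_octa[OF f g tf(1) tg(1) td] M_ext tf(2) tg(2) td cone_in_iff[OF Comp_Hom[OF f g]] by blast
qed

text \<open>The octahedral axiom puts the three cones into a triangle. The cone of \<open>g\<close>
  is its third vertex, which is an extension only after a rotation: of the cone of the composite and
  the shifted cone of \<open>f\<close>. The shift costs one index.\<close>

lemma T_right: assumes f: "f \<in> Hom C x y" and g: "g \<in> Hom C y z" and "T (Suc n) f" "T (Suc n) (g \<cdot> f)" shows "T n g"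
proof -
  obtain a i i' c k k' where tf: "tri x y a f i i'" "a \<in> M (Suc n)" and td: "tri x z c (g \<cdot> f) k k'" "c \<in> M (Suc n)"
    using assms(3,4) unfolding cone_in_iff[OF f] cone_in_iff[OF Comp_Hom[OF f g]] by blast
  obtain b j j' where tg: "tri y z b g j j'" using tri_exists[OF g] by blast
  obtain u v w where "tri a c b u v w" using T_octa[OF f g tf(1) tg td(1)] by blast
  then have "b \<in> M n" using M_ext[OF rot] M_ShO[OF tf(2)] td(2) M_Suc by blast
  then show ?thesis using tg cone_in_iff[OF g] by blast
qed

text \<open>Here the triangle of cones is rotated backwards, so it is the desuspended cone of
  \<open>g\<close> that costs one index.\<close>

lemma T_left: assumes f: "f \<in> Hom C x y" and g: "g \<in> Hom C y z" and "T (Suc n) g" "T (Suc n) (g \<cdot> f)" shows "T n f"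
proof -
  obtain b j j' c k k' where tg: "tri y z b g j j'" "b \<in> M (Suc n)" and td: "tri x z c (g \<cdot> f) k k'" "c \<in> M (Suc n)"
    using assms(3,4) unfolding cone_in_iff[OF g] cone_in_iff[OF Comp_Hom[OF f g]] by blast
  obtain a i i' where tf: "tri x y a f i i'" using tri_exists[OF f] by blast
  obtain u v w where "tri a c b u v w" using T_octa[OF f g tf tg(1) td(1)] by blast
  then have "a \<in> M n" using M_ext[OF unrot] M_UnO[OF tg(2)] td(2) M_Suc by blast
  then show ?thesis using tf cone_in_iff[OF f] by blast
qed

lemma T_ident: assumes "a \<in> Obj C" shows "T n (Ident C a)"
proof -
  obtain z where z: "z \<in> M n" "is_zero_obj C z" using metric_zero by blast
  show ?thesis using tri_ident[OF assms z(2)] z(1) cone_in_iff[OF Ident_Hom[OF assms]] by blast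
qed

text \<open>The octahedron on \<open>f\<close> followed by an identity exhibits any cone of
  \<open>f\<close> as an extension of a given cone and a zero object. The extension axiom thus does
  the work of closure under isomorphism.\<close>

lemma T_cone: assumes f: "f \<in> Hom C x y" and T: "T n f" and td: "tri x y c f k k'" shows "c \<in> M n"
proof -
  obtain a i i' where tf: "tri x y a f i i'" "a \<in> M n" using T unfolding cone_in_iff[OF f] by blast
  obtain z where z: "z \<in> M n" "is_zero_obj C z" using metric_zero by blast
  note y = tri_Obj(2)[OF td]
  have "tri x y c (Ident C y \<cdot> f) k k'" using td Ident_Comp[OF f] by simp
  then show ?thesis using T_octa[OF f Ident_Hom[OF y] tf(1) tri_ident[OF y z(2)]] M_ext tf(2) z(1) by blast
qed

text \<open>A fill-in from TR3 comes without information on its cone. Here \<open>w\<close> is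
  composed of two maps through the cone of the diagonal \<open>v \<cdot> f = f' \<cdot> u\<close>,
  each from an octahedron; the cone of the first is the cone of \<open>v\<close>, that of the second
  is the shifted cone of \<open>u\<close>. The bound holds for all \<open>n\<close> with the same
  \<open>w\<close>.\<close>

lemma T_fill:
  assumes t: "tri a b c f g h" and t': "tri a' b' c' f' g' h'"
    and u: "u \<in> Hom C a a'" and v: "v \<in> Hom C b b'" and vf: "v \<cdot> f = f' \<cdot> u"
  shows "\<exists>w \<in> Hom C c c'. w \<cdot> g = g' \<cdot> v \<and> ShA C u \<cdot> h = h' \<cdot> w \<and> (\<forall>n. T (Suc n) u \<longrightarrow> T (Suc n) v \<longrightarrow> T n w)"
proof -
  note f = tri1[OF t] and f' = tri1[OF t'] and g = tri2[OF t] and h' = tri3[OF t']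
  obtain cd k k' where td: "tri a b' cd (v \<cdot> f) k k'" using tri_exists[OF Comp_Hom[OF f v]] by blast
  have *: "\<exists>w \<in> Hom C c c'. w \<cdot> g = g' \<cdot> v \<and> ShA C u \<cdot> h = h' \<cdot> w \<and> 
      (\<forall>n. cv \<in> M (Suc n) \<longrightarrow> cu \<in> M (Suc n) \<longrightarrow> T n w)"
    if tv: "tri b b' cv v j j'" and tu: "tri a a' cu u i i'" for cv j j' cu i i'
  proof -
    obtain u1 v1 where 1: "tri c cd cv u1 v1 (ShA C g \<cdot> j')" "u1 \<cdot> g = k \<cdot> v" "k' \<cdot> u1 = h"
      using T_octa[OF f v t tv td] by blast
    obtain u2 v2 where 2: "tri cu cd c' u2 v2 (ShA C i \<cdot> h')" "v2 \<cdot> k = g'" "h' \<cdot> v2 = ShA C u \<cdot> k'"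
      using T_octa[OF u f' tu t' td[unfolded vf]] by blast
    note u1 = tri1[OF 1(1)] and v2 = tri2[OF 2(1)]
    show ?thesis
    proof (intro bexI[of _ "v2 \<cdot> u1"] conjI allI impI)
      show "v2 \<cdot> u1 \<in> Hom C c c'" by (rule Comp_Hom[OF u1 v2])
      show "(v2 \<cdot> u1) \<cdot> g = g' \<cdot> v"
        using Comp_assoc[OF g u1 v2] Comp_assoc[OF v tri2[OF td] v2] 1(2) 2(2) by simp
      show "ShA C u \<cdot> h = h' \<cdot> (v2 \<cdot> u1)"
        using Comp_assoc[OF u1 v2 h'] Comp_assoc[OF u1 tri3[OF td] ShA_Hom[OF u]] 1(3) 2(3) by simp
      fix n assume m: "cv \<in> M (Suc n)" "cu \<in> M (Suc n)"
      show "T n (v2 \<cdot> u1)"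
      proof (rule T_comp[OF u1 v2])
        show "T n u1" unfolding cone_in_iff[OF u1] using 1(1) m(1) M_Suc by blast
        show "T n v2" unfolding cone_in_iff[OF v2] using rot[OF 2(1)] M_ShO[OF m(2)] by blast
      qed
    qed
  qed
  obtain cv j j' cu i i' where t0: "tri b b' cv v j j'" "tri a a' cu u i i'"
    using tri_exists[OF u] tri_exists[OF v] by blast
  \<comment> \<open>The cones of \<open>u\<close> and \<open>v\<close> used to construct
    \<open>w\<close> are fixed here once. \<open>T_cone\<close> places precisely these cones in
    \<open>M (Suc n)\<close> whenever some cone lies there, so one \<open>w\<close> serves every
    \<open>n\<close>.\<close>
  show ?thesis using *[OF t0] T_cone[OF v _ t0(1)] T_cone[OF u _ t0(2)] by blast
qed

end

context metric_tri
begin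

lemma T_Neg: assumes f: "f \<in> Hom C a b" and "T n f" shows "T n (Neg C f)"
  using assms(2) tri_Neg unfolding cone_in_iff[OF f] cone_in_iff[OF Neg_Hom[OF f]] by blast

text \<open>Three rotations shift a triangle up to signs.\<close>

lemma T_ShA: assumes f: "f \<in> Hom C a b" and T: "T (Suc n) f" shows "T n (ShA C f)"
proof -
  obtain c g h where t: "tri a b c f g h" and c: "c \<in> M (Suc n)" using T unfolding cone_in_iff[OF f] by blast
  have "tri (ShO C a) (ShO C b) (ShO C c) (Neg C (ShA C f)) (Neg C (ShA C g)) (Neg C (ShA C h))"
    by (rule rot[OF rot[OF rot[OF t]]])
  then have "T n (Neg C (ShA C f))"
    using cone_in_iff[OF Neg_Hom[OF ShA_Hom[OF f]]] M_ShO[OF c] by blast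
  then show ?thesis using T_Neg[OF Neg_Hom[OF ShA_Hom[OF f]]] Neg_Neg[OF ShA_Hom[OF f]] by simp
qed

lemma T_UnA: assumes f: "f \<in> Hom C a b" and T: "T (Suc n) f" shows "T n (UnA C f)"
proof -
  obtain c g h where t: "tri a b c f g h" and c: "c \<in> M (Suc n)" using T unfolding cone_in_iff[OF f] by blast
  have "tri (UnO C a) (UnO C b) (UnO C c) (Neg C (UnA C f)) (Neg C (UnA C g)) (Neg C (UnA C h))"
    by (rule unrot[OF unrot[OF unrot[OF t]]])
  then have "T n (Neg C (UnA C f))"
    using cone_in_iff[OF Neg_Hom[OF UnA_Hom[OF f]]] M_UnO[OF c] by blast
  then show ?thesis using T_Neg[OF Neg_Hom[OF UnA_Hom[OF f]]] Neg_Neg[OF UnA_Hom[OF f]] by simp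
qed

section \<open>Objects orthogonal to a piece of the metric\<close>

lemma left_perp_zero: "\<lbrakk>F \<in> left_perp C (M i); m \<in> M i; f \<in> Hom C F m\<rbrakk> \<Longrightarrow> f = ZeroArr C F m"
  unfolding left_perp_def by blast

lemma left_perp_Obj: "F \<in> left_perp C X \<Longrightarrow> F \<in> Obj C"
  unfolding left_perp_def by blast

text \<open>The obstruction is a map from \<open>F\<close> to the cone of \<open>f\<close>.\<close>

lemma perp_lift:
  assumes F: "F \<in> left_perp C (M i)" and f: "f \<in> Hom C x y" and T: "T (Suc i) f" and p: "\<psi> \<in> Hom C F y"
  shows "\<exists>\<phi> \<in> Hom C F x. f \<cdot> \<phi> = \<psi>"
proof -
  obtain c g h where t: "tri x y c f g h" and c: "c \<in> M (Suc i)" using T unfolding cone_in_iff[OF f] by blast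
  have "g \<cdot> \<psi> = ZeroArr C F c"
    using left_perp_zero[OF F _ Comp_Hom[OF p tri2[OF t]]] c M_Suc by blast
  then show ?thesis using tri_exact[OF t p] by blast
qed

text \<open>A map killed by \<open>f\<close> factors through the desuspended cone of
  \<open>f\<close>, and this desuspension takes \<open>M (Suc i)\<close> to
  \<open>M i\<close>.\<close>

lemma perp_cancel:
  assumes F: "F \<in> left_perp C (M i)" and f: "f \<in> Hom C x y" and T: "T (Suc i) f"
    and p: "\<phi> \<in> Hom C F x" "\<phi>' \<in> Hom C F x" "f \<cdot> \<phi> = f \<cdot> \<phi>'"
  shows "\<phi> = \<phi>'"
proof (rule mono_of_kernel[OF _ f p])
  obtain c g h where t: "tri x y c f g h" and c: "c \<in> M (Suc i)" using T unfolding cone_in_iff[OF f] by blast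
  fix h assume h: "h \<in> Hom C F x" "f \<cdot> h = ZeroArr C F y"
  obtain k where t': "tri (UnO C c) x y k f g" using unrot[OF t] by blast
  obtain u where u: "u \<in> Hom C F (UnO C c)" "k \<cdot> u = h" using tri_exact[OF t' h] by blast
  have "u = ZeroArr C F (UnO C c)" by (rule left_perp_zero[OF F M_UnO[OF c] u(1)])
  then show "h = ZeroArr C F x" using u(2) Comp_Zero[OF tri1[OF t'] left_perp_Obj[OF F]] by simp
qed

text \<open>Exactness at the middle term only; applied to rotated triangles it gives the whole long
  exact sequence.\<close>

definition homol :: "('o, 'm, 'v) presheaf \<Rightarrow> bool" where
  "homol A \<longleftrightarrow> is_module C A \<and> (\<forall>a b c f g h. tri a b c f g h \<longrightarrow>
     (\<forall>u \<in> el A b. FunA A f u = \<one>\<^bsub>FunO A a\<^esub> \<longrightarrow> (\<exists>v \<in> el A c. u = FunA A g v)))"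

text \<open>By the Yoneda lemma this is right orthogonality to the representables of
  \<open>M i\<close>, see \<open>vanish_right_perp\<close>. An object of the completion is compactly
  supported if this holds for some \<open>i\<close>.\<close>

definition vanish :: "('o, 'm, 'v) presheaf \<Rightarrow> nat \<Rightarrow> bool" where
  "vanish A i \<longleftrightarrow> (\<forall>m \<in> M i. \<forall>u \<in> el A m. u = \<one>\<^bsub>FunO A m\<^esub>)"

lemma homol_mod: "homol A \<Longrightarrow> is_module C A"
  by (simp add: homol_def)

lemma homolD: "\<lbrakk>homol A; tri a b c f g h; u \<in> el A b; FunA A f u = \<one>\<^bsub>FunO A a\<^esub>\<rbrakk> \<Longrightarrow> \<exists>v \<in> el A c. u = FunA A g v"
  unfolding homol_def by blast

lemma vanishD: "\<lbrakk>vanish A i; m \<in> M i; u \<in> el A m\<rbrakk> \<Longrightarrow> u = \<one>\<^bsub>FunO A m\<^esub>"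
  by (simp add: vanish_def)

lemma vanish_mono: "\<lbrakk>vanish A i; i \<le> j\<rbrakk> \<Longrightarrow> vanish A j"
  unfolding vanish_def using M_mono by blast

text \<open>Together with \<open>van_cancel\<close>: an arrow with cone in \<open>M (Suc i)\<close>
  acts bijectively on a homological module that vanishes on \<open>M i\<close>. The obstruction to
  surjectivity lies on the desuspended cone, that to injectivity on the cone itself.\<close>

lemma van_lift:
  assumes A: "homol A" "vanish A i" and f: "f \<in> Hom C y z" and T: "T (Suc i) f" and u: "u \<in> el A y"
  shows "\<exists>v \<in> el A z. FunA A f v = u"
proof -
  obtain c g h where t: "tri y z c f g h" and c: "c \<in> M (Suc i)" using T unfolding cone_in_iff[OF f] by blast
  obtain k where t': "tri (UnO C c) y z k f g" using unrot[OF t] by blast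
  have "FunA A k u = \<one>\<^bsub>FunO A (UnO C c)\<^esub>"
    by (rule vanishD[OF A(2) M_UnO[OF c] act_closed[OF homol_mod[OF A(1)] tri1[OF t'] u]])
  then show ?thesis using homolD[OF A(1) t' u] by auto
qed

lemma van_cancel:
  assumes A: "homol A" "vanish A i" and f: "f \<in> Hom C y z" and T: "T (Suc i) f"
    and v: "v \<in> el A z" "v' \<in> el A z" "FunA A f v = FunA A f v'"
  shows "v = v'"
proof -
  note m = homol_mod[OF A(1)] and o = Hom_Obj[OF f]
  obtain c g h where t: "tri y z c f g h" and c: "c \<in> M (Suc i)" using T unfolding cone_in_iff[OF f] by blast
  interpret Z: comm_group "FunO A z" by (rule module_group[OF m o(2)])
  interpret Y: comm_group "FunO A y" by (rule module_group[OF m o(1)])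
  let ?w = "v \<otimes>\<^bsub>FunO A z\<^esub> inv\<^bsub>FunO A z\<^esub> v'"
  have w: "?w \<in> el A z" using v by simp
  have "FunA A f ?w \<otimes>\<^bsub>FunO A y\<^esub> FunA A f v' = FunA A f (?w \<otimes>\<^bsub>FunO A z\<^esub> v')"
    using act_mult[OF m f w v(2)] by simp
  also have "?w \<otimes>\<^bsub>FunO A z\<^esub> v' = v" using v by (simp add: Z.m_assoc)
  finally have "FunA A f ?w = \<one>\<^bsub>FunO A y\<^esub>"
    using Y.r_cancel_one'[of "FunA A f v'" "FunA A f ?w"] act_closed[OF m f w] act_closed[OF m f v(2)] v(3) by simp
  then obtain x where x: "x \<in> el A c" "?w = FunA A g x" using homolD[OF A(1) t w] by blast
  have "x = \<one>\<^bsub>FunO A c\<^esub>" using vanishD[OF A(2) _ x(1)] c M_Suc by blast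
  then have "?w = \<one>\<^bsub>FunO A z\<^esub>" using x(2) act_one[OF m tri2[OF t]] by simp
  then show ?thesis using v Z.inv_equality[of v "inv\<^bsub>FunO A z\<^esub> v'"] by simp
qed

text \<open>A filtered colimit of homological functors is homological. In terms of elements: a
  representative of \<open>u\<close> is killed by \<open>f\<close> at some late stage
  \<open>k\<close>, and there it extends along \<open>g\<close>.\<close>

lemma pres_homol: assumes E: "is_seq C E" and A: "is_module C A" and p: "pres C E A t" shows "homol A"
  unfolding homol_def
proof (intro conjI A allI impI ballI)
  fix a b c f g h u assume t: "tri a b c f g h" and u: "u \<in> el A b" and z: "FunA A f u = \<one>\<^bsub>FunO A a\<^esub>"
  note o = tri_Obj[OF t]
  obtain n \<phi> where n: "\<phi> \<in> Hom C b (Src C (E n))" "u = FunA A \<phi> (t n)" using pres_surj[OF p o(2) u] by blast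
  have "FunA A (\<phi> \<cdot> f) (t n) = FunA A (ZeroArr C a (Src C (E n))) (t n)"
    using act_comp[OF A tri1[OF t] n(1) pres_el[OF p]] act_Zero[OF A o(1) seq_Obj[OF E] pres_el[OF p]] n(2) z by simp
  then obtain k where k: "k \<ge> n" "transition C E n k \<cdot> (\<phi> \<cdot> f) = transition C E n k \<cdot> ZeroArr C a (Src C (E n))"
    using pres_inj[OF p Comp_Hom[OF tri1[OF t] n(1)] Zero_Hom[OF o(1) seq_Obj[OF E]]] by blast
  note tr = trans_Hom[OF E k(1)]
  have "(transition C E n k \<cdot> \<phi>) \<cdot> f = ZeroArr C a (Src C (E k))"
    using Comp_assoc[OF tri1[OF t] n(1) tr] k(2) Comp_Zero[OF tr o(1)] by simp
  then obtain \<psi> where \<psi>: "\<psi> \<in> Hom C c (Src C (E k))" "\<psi> \<cdot> g = transition C E n k \<cdot> \<phi>"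
    using tri_coexact[OF t Comp_Hom[OF n(1) tr]] by blast
  have "u = FunA A g (FunA A \<psi> (t k))"
    using pres_push[OF E A p n(1) k(1)] act_comp[OF A tri2[OF t] \<psi>(1) pres_el[OF p]] \<psi>(2) n(2) by simp
  then show "\<exists>v\<in>el A c. u = FunA A g v" using act_closed[OF A \<psi>(1) pres_el[OF p]] by blast
qed

lemma cauchy_seq: "cauchy C M E \<Longrightarrow> is_seq C E"
  by (simp add: cauchy_def)

text \<open>The case \<open>k = j\<close>, which the definition leaves out, concerns an identity;
  its cone is a zero object.\<close>

lemma cauchyD: assumes "cauchy C M E" shows "\<exists>N. \<forall>j\<ge>N. \<forall>k\<ge>j. T i (transition C E j k)"
proof -
  obtain N where N: "\<And>j k. \<lbrakk>j \<ge> N; k > j\<rbrakk> \<Longrightarrow> T i (transition C E j k)" using assms unfolding cauchy_def by blast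
  have "T i (transition C E j j)" for j
    unfolding trans_refl by (rule T_ident[OF seq_Obj[OF cauchy_seq[OF assms]]])
  then show ?thesis using N le_neq_implies_less by metis
qed

text \<open>Since \<open>M i\<close> is closed under extensions, consecutive arrows are
  enough.\<close>

lemma cauchyI: assumes E: "is_seq C E" and s: "\<And>i. \<exists>N. \<forall>n\<ge>N. T i (E n)" shows "cauchy C M E"
  unfolding cauchy_def
proof (intro conjI E allI)
  fix i obtain N where N: "\<And>n. n \<ge> N \<Longrightarrow> T i (E n)" using s by blast
  have "T i (transition C E j k)" if j: "j \<ge> N" and "k \<ge> j" for j k
    using that(2)
  proof (induction k rule: dec_induct)
    case base then show ?case unfolding trans_refl by (rule T_ident[OF seq_Obj[OF E]])
  next
    case (step k) then show ?case
      using T_comp[OF trans_Hom[OF E step(1)] seq_Hom[OF E] step(3) N] j by (simp add: trans_Suc)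
  qed
  then show "\<exists>N. \<forall>j\<ge>N. \<forall>k>j. T i (transition C E j k)" by (meson less_imp_le)
qed

lemma cauchy_subseq: assumes c: "cauchy C M E" and r: "strict_mono r" shows "cauchy C M (subsequence C E r)"
proof (rule cauchyI[OF subseq_seq(1)[OF cauchy_seq[OF c] r]])
  fix i obtain N where N: "\<And>j k. \<lbrakk>j \<ge> N; k \<ge> j\<rbrakk> \<Longrightarrow> T i (transition C E j k)" using cauchyD[OF c] by blast
  have "n \<le> r n" for n by (rule strict_mono_imp_increasing[OF r])
  then have "\<forall>n\<ge>N. T i (subsequence C E r n)" unfolding subsequence_def
    using N r by (meson le_trans lessI order_less_imp_le strict_mono_less_eq)
  then show "\<exists>N. \<forall>n\<ge>N. T i (subsequence C E r n)" by blast
qed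

lemma cauchy_shift: assumes c: "cauchy C M E" shows "cauchy C M (\<lambda>n. ShA C (E n))"
proof (rule cauchyI[OF shift_seq(1)[OF cauchy_seq[OF c]]])
  note E = cauchy_seq[OF c]
  fix i obtain N where N: "\<And>j k. \<lbrakk>j \<ge> N; k \<ge> j\<rbrakk> \<Longrightarrow> T (Suc i) (transition C E j k)" using cauchyD[OF c] by blast
  have "T i (ShA C (E n))" if "n \<ge> N" for n
    using T_ShA[OF seq_Hom[OF E]] N[of n "Suc n"] that trans_step[OF E] by simp
  then show "\<exists>N. \<forall>n\<ge>N. T i (ShA C (E n))" by blast
qed

lemma cauchy_unshift: assumes c: "cauchy C M E" shows "cauchy C M (\<lambda>n. UnA C (E n))"
proof (rule cauchyI[OF unshift_seq(1)[OF cauchy_seq[OF c]]])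
  note E = cauchy_seq[OF c]
  fix i obtain N where N: "\<And>j k. \<lbrakk>j \<ge> N; k \<ge> j\<rbrakk> \<Longrightarrow> T (Suc i) (transition C E j k)" using cauchyD[OF c] by blast
  have "T i (UnA C (E n))" if "n \<ge> N" for n
    using T_UnA[OF seq_Hom[OF E]] N[of n "Suc n"] that trans_step[OF E] by simp
  then show "\<exists>N. \<forall>n\<ge>N. T i (UnA C (E n))" by blast
qed

end

section \<open>Presentations by Cauchy sequences\<close>

locale met = metric_tri C M + yoneda C e
  for C :: "('o, 'm, 'z) tri_cat_scheme" (structure) and M :: "nat \<Rightarrow> 'o set" and e :: "'m \<Rightarrow> 'u"
begin

abbreviation ob :: "(nat \<Rightarrow> 'm) \<Rightarrow> nat \<Rightarrow> 'o" where "ob E n \<equiv> Src C (E n)"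

text \<open>A presentation is kept as data rather than quantified away, because the type of a map
  depends on it.\<close>

definition CP :: "(nat \<Rightarrow> 'm) \<Rightarrow> ('o, 'm, 'u) presheaf \<Rightarrow> (nat \<Rightarrow> 'u) \<Rightarrow> bool" where
  "CP E A t \<longleftrightarrow> cauchy C M E \<and> is_module C A \<and> pres C E A t"

lemma CP_cauchy: "CP E A t \<Longrightarrow> cauchy C M E"
  and CP_seq: "CP E A t \<Longrightarrow> is_seq C E"
  and CP_mod: "CP E A t \<Longrightarrow> is_module C A"
  and CP_pres: "CP E A t \<Longrightarrow> pres C E A t"
  by (auto simp: CP_def cauchy_seq)

lemma CP_homol: "CP E A t \<Longrightarrow> homol A"
  using pres_homol[OF CP_seq CP_mod CP_pres] .

lemma CP_Obj: "CP E A t \<Longrightarrow> ob E n \<in> Obj C"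
  by (rule seq_Obj[OF CP_seq])

lemma CP_el: "CP E A t \<Longrightarrow> t n \<in> el A (ob E n)"
  by (rule pres_el[OF CP_pres])

lemma CP_trans: "CP E A t \<Longrightarrow> j \<le> k \<Longrightarrow> FunA A (transition C E j k) (t k) = t j"
  by (rule pres_trans[OF CP_seq CP_mod pres_el[OF CP_pres] pres_step[OF CP_pres]])

lemma CP_subseq: "\<lbrakk>CP E A t; strict_mono r\<rbrakk> \<Longrightarrow> CP (subsequence C E r) A (\<lambda>n. t (r n))"
  using pres_subseq[OF CP_seq CP_mod CP_pres] cauchy_subseq[OF CP_cauchy] CP_mod unfolding CP_def by blast

lemma CP_exists: assumes "cauchy C M E" shows "\<exists>A t. CP E A t"
  using colim_exists[OF cauchy_seq[OF assms]] assms unfolding CP_def by blast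

lemma LObj_iff: "A \<in> LObj e C M \<longleftrightarrow> (\<exists>E t. CP E A t)"
proof
  assume "A \<in> LObj e C M"
  then obtain E \<kappa> where E: "cauchy C M E" "Yon_colim e C E A \<kappa>" unfolding LObj_def by blast
  show "\<exists>E t. CP E A t" using Yon_colim_pres[OF cauchy_seq[OF E(1)] E(2)] E(1) unfolding CP_def by blast
next
  assume "\<exists>E t. CP E A t"
  then obtain E t where c: "CP E A t" by blast
  show "A \<in> LObj e C M" unfolding LObj_def
    using pres_Yon_colim[OF CP_seq[OF c] CP_mod[OF c] CP_pres[OF c]] CP_cauchy[OF c] by blast
qed

lemma CP_LObj: "CP E A t \<Longrightarrow> A \<in> LObj e C M"
  using LObj_iff by blast

lemma LiObj_iff: "A \<in> LiObj e C M i \<longleftrightarrow> (\<exists>E t. CP E A t \<and> (\<forall>n. ob E n \<in> M i))"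
proof
  assume "A \<in> LiObj e C M i"
  then obtain E \<kappa> where E: "cauchy C M E" "\<forall>n. ob E n \<in> M i" "Yon_colim e C E A \<kappa>" unfolding LiObj_def by blast
  show "\<exists>E t. CP E A t \<and> (\<forall>n. ob E n \<in> M i)"
    using Yon_colim_pres[OF cauchy_seq[OF E(1)] E(3)] E(1,2) unfolding CP_def by blast
next
  assume "\<exists>E t. CP E A t \<and> (\<forall>n. ob E n \<in> M i)"
  then obtain E t where c: "CP E A t" "\<forall>n. ob E n \<in> M i" by blast
  show "A \<in> LiObj e C M i" unfolding LiObj_def
    using pres_Yon_colim[OF CP_seq[OF c(1)] CP_mod[OF c(1)] CP_pres[OF c(1)]] CP_cauchy[OF c(1)] c(2) by blast
qed

lemma vanish_right_perp: assumes A: "is_module C A"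
  shows "A \<in> right_perp (ModCat C) (YonO e C ` M i) \<longleftrightarrow> vanish A i"
proof
  assume a: "A \<in> right_perp (ModCat C) (YonO e C ` M i)"
  show "vanish A i" unfolding vanish_def
  proof (intro ballI)
    fix m u assume m: "m \<in> M i" and u: "u \<in> el A m"
    have o: "m \<in> Obj C" using m metric_Obj by blast
    have "ymap A m u = ZeroArr (ModCat C) (YonO e C m) A"
      using a m ymap_Hom[OF A o u] unfolding right_perp_def by blast
    then have "At (ymap A m u) m (e (Ident C m)) = \<one>\<^bsub>FunO A m\<^esub>"
      using At_Zero[OF o Ident_el[OF o]] by simp
    then show "u = \<one>\<^bsub>FunO A m\<^esub>" using At_ymap[OF Ident_Hom[OF o]] act_ident[OF A o u] by simp
  qed
next
  assume v: "vanish A i"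
  show "A \<in> right_perp (ModCat C) (YonO e C ` M i)" unfolding right_perp_def
  proof (intro CollectI conjI ballI)
    show "A \<in> Obj (ModCat C)" using A by simp
    fix Y assume "Y \<in> YonO e C ` M i"
    then obtain m where m: "m \<in> M i" and Y: "Y = YonO e C m" by blast
    have o: "m \<in> Obj C" using m metric_Obj by blast
    have z: "ZeroArr (ModCat C) Y A \<in> Hom (ModCat C) Y A" unfolding Y by (rule MZero_Hom[OF module_Yon[OF o] A])
    have "G = ZeroArr (ModCat C) Y A" if G: "G \<in> Hom (ModCat C) Y A" for G
      using Yon_map_eqI[OF G[unfolded Y] z[unfolded Y]] vanishD[OF v m MH_closed[OF G[unfolded Y] o Ident_el[OF o]]]
        At_Zero[OF o Ident_el[OF o]] Y by simp
    then show "Hom (ModCat C) Y A = {ZeroArr (ModCat C) Y A}" using z by blast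
  qed
qed

lemma SObj_iff: "A \<in> SObj e C M \<longleftrightarrow> (\<exists>E t. CP E A t) \<and> (\<exists>i. vanish A i)"
proof -
  have m: "is_module C A" if "CP E A t" for E t using CP_mod[OF that] .
  show ?thesis unfolding SObj_def using vanish_right_perp[of A] LObj_iff m by blast
qed

lemma SObj_homol: "A \<in> SObj e C M \<Longrightarrow> homol A"
  unfolding SObj_iff using CP_homol by blast

text \<open>A constant sequence on an object of \<open>M i\<close> puts its representable into
  \<open>LiObj\<close>.\<close>

lemma LiObj_perp_vanish:
  assumes A: "A \<in> right_perp (ModCat C) (LiObj e C M i)" shows "vanish A i"
proof -
  have mA: "is_module C A" using A by (simp add: right_perp_def)
  have "YonO e C ` M i \<subseteq> LiObj e C M i"
  proof
    fix Y assume "Y \<in> YonO e C ` M i"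
    then obtain m where m: "m \<in> M i" and Y: "Y = YonO e C m" by blast
    have o: "m \<in> Obj C" using m metric_Obj by blast
    have "cauchy C M (const_seq C m)"
      by (rule cauchyI[OF const_seq_seq(1)[OF o]]) (simp add: const_seq_def T_ident[OF o])
    then have "CP (const_seq C m) Y (\<lambda>n. e (Ident C m))"
      unfolding CP_def Y using module_Yon[OF o] pres_const[OF o] by blast
    then show "Y \<in> LiObj e C M i" unfolding LiObj_iff using const_seq_seq(2)[OF o] m by auto
  qed
  then have "A \<in> right_perp (ModCat C) (YonO e C ` M i)" using A unfolding right_perp_def by blast
  then show ?thesis using vanish_right_perp[OF mA] by blast
qed

text \<open>The transitions after stage \<open>j\<close> have cones in \<open>M (Suc i)\<close>, so
  they act bijectively on the values of \<open>D\<close>. Hence \<open>Hom(A, D)\<close> is the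
  value of \<open>D\<close> at the \<open>j\<close>-th object; this is the injective half, and
  \<open>stage_ext\<close> the surjective one.\<close>

lemma stage_eq:
  assumes c: "CP E A t" and D: "homol D" "vanish D i" and j: "\<And>k. k \<ge> j \<Longrightarrow> T (Suc i) (transition C E j k)"
    and G: "G \<in> Hom (ModCat C) A D" "G' \<in> Hom (ModCat C) A D" and eq: "At G (ob E j) (t j) = At G' (ob E j) (t j)"
  shows "G = G'"
proof (rule pres_eqI[OF CP_seq[OF c] CP_pres[OF c] G])
  fix n assume n: "n \<ge> j"
  note tr = trans_Hom[OF CP_seq[OF c] n] and o = CP_Obj[OF c, of n]
  have "FunA D (transition C E j n) (At G (ob E n) (t n)) = FunA D (transition C E j n) (At G' (ob E n) (t n))"
    using MH_act[OF G(1) tr CP_el[OF c]] MH_act[OF G(2) tr CP_el[OF c]] CP_trans[OF c n] eq by simp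
  then show "At G (ob E n) (t n) = At G' (ob E n) (t n)"
    by (rule van_cancel[OF D tr j[OF n] MH_closed[OF G(1) o CP_el[OF c]] MH_closed[OF G(2) o CP_el[OF c]]])
qed

lemma stage_ext:
  assumes c: "CP E A t" and D: "homol D" "vanish D i" and j: "\<And>k. k \<ge> j \<Longrightarrow> T (Suc i) (transition C E j k)"
    and u: "u \<in> el D (ob E j)"
  shows "\<exists>G \<in> Hom (ModCat C) A D. At G (ob E j) (t j) = u"
proof -
  define r where "r = (\<lambda>n. j + n)"
  have r: "strict_mono r" by (simp add: r_def strict_mono_def)
  note E = CP_seq[OF c] and mD = homol_mod[OF D(1)]
  have jr: "j \<le> r n" for n by (simp add: r_def)
  \<comment> \<open>The preimages of \<open>u\<close> at the later stages are unique, hence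
    compatible, and define a map on the cofinal part of the sequence that starts at
    \<open>j\<close>.\<close>
  define s where "s n = (SOME v. v \<in> el D (ob E (r n)) \<and> FunA D (transition C E j (r n)) v = u)" for n
  have s: "s n \<in> el D (ob E (r n)) \<and> FunA D (transition C E j (r n)) (s n) = u" for n
    unfolding s_def by (rule someI_ex) (use van_lift[OF D trans_Hom[OF E jr] j[OF jr] u] in blast)
  have rS: "r n \<le> r (Suc n)" for n by (simp add: r_def)
  have st: "FunA D (subsequence C E r n) (s (Suc n)) = s n" for n
  proof (rule van_cancel[OF D trans_Hom[OF E jr] j[OF jr]])
    note tr = trans_Hom[OF E rS, of n]
    show "FunA D (subsequence C E r n) (s (Suc n)) \<in> el D (ob E (r n))" unfolding subsequence_def
      using act_closed[OF mD tr] s by blast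
    show "s n \<in> el D (ob E (r n))" using s by blast
    show "FunA D (transition C E j (r n)) (FunA D (subsequence C E r n) (s (Suc n))) = FunA D (transition C E j (r n)) (s n)"
      unfolding subsequence_def
      using act_comp[OF mD trans_Hom[OF E jr] tr, of "s (Suc n)"] trans_comp[OF E jr rS, of n] s by simp
  qed
  have s1: "s n \<in> el D (Src C (subsequence C E r n))" for n using s subseq_seq(2)[OF E r] by simp
  obtain G where G: "G \<in> Hom (ModCat C) A D" "\<And>n. At G (Src C (subsequence C E r n)) (t (r n)) = s n"
    using pres_hom[OF subseq_seq(1)[OF E r] CP_mod[OF c] pres_subseq[OF E CP_mod[OF c] CP_pres[OF c] r] mD s1 st] by blast
  have r0: "r 0 = j" by (simp add: r_def)
  have "At G (ob E j) (t j) = s 0" using G(2)[of 0] subseq_seq(2)[OF E r, of 0] r0 by simp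
  moreover have "s 0 = u" using s[of 0] act_ident[OF mD CP_Obj[OF c], of "s 0" j] r0 by (simp add: trans_refl)
  ultimately show ?thesis using G(1) by blast
qed

text \<open>\<open>tyF m x E D t u\<close>: the map \<open>Y(x) \<rightarrow> D = colim Y(E)\<close> given by \<open>u\<close> is of type \<open>m\<close>;
  \<open>ty m E t E' t' G\<close>: the map \<open>G : colim Y(E) \<rightarrow> colim Y(E')\<close> is of type \<open>m\<close>.\<close>

definition tyF :: "nat \<Rightarrow> 'o \<Rightarrow> (nat \<Rightarrow> 'm) \<Rightarrow> ('o, 'm, 'u) presheaf \<Rightarrow> (nat \<Rightarrow> 'u) \<Rightarrow> 'u \<Rightarrow> bool" where
  "tyF m x E D t u \<longleftrightarrow> (\<exists>K. \<forall>k\<ge>K. \<exists>f \<in> Hom C x (ob E k). T m f \<and> FunA D f (t k) = u)"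

definition ty :: "nat \<Rightarrow> (nat \<Rightarrow> 'm) \<Rightarrow> (nat \<Rightarrow> 'u) \<Rightarrow> (nat \<Rightarrow> 'm) \<Rightarrow> (nat \<Rightarrow> 'u) \<Rightarrow> ('o, 'm, 'u) presheaf_map \<Rightarrow> bool" where
  "ty m E t E' t' G \<longleftrightarrow> (\<exists>N. \<forall>j\<ge>N. tyF m (ob E j) E' (MTgt G) t' (At G (ob E j) (t j)))"

section \<open>Calculus of morphisms of type m\<close>

lemma tyF_mono: "tyF m x E D t u \<Longrightarrow> n \<le> m \<Longrightarrow> tyF n x E D t u"
  unfolding tyF_def using T_mono by meson

lemma ty_mono: "ty m E t E' t' G \<Longrightarrow> n \<le> m \<Longrightarrow> ty n E t E' t' G"
  unfolding ty_def using tyF_mono by meson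

lemma tyD: assumes "ty m E t E' t' G" "G \<in> Hom (ModCat C) A A'"
  shows "\<exists>N. \<forall>j\<ge>N. tyF m (ob E j) E' A' t' (At G (ob E j) (t j))"
  using assms unfolding ty_def Hom_ModCat by blast

lemma tyI: assumes "G \<in> Hom (ModCat C) A A'" "\<And>j. j \<ge> N \<Longrightarrow> tyF m (ob E j) E' A' t' (At G (ob E j) (t j))"
  shows "ty m E t E' t' G"
  using assms unfolding ty_def Hom_ModCat by blast

lemma tyF_closed: assumes c: "CP E D t" and u: "tyF m x E D t u" shows "u \<in> el D x"
  using u act_closed[OF CP_mod[OF c] _ CP_el[OF c]] unfolding tyF_def by blast

lemma tyFI:
  assumes c: "CP E D t" and f: "f \<in> Hom C x (ob E k)" "T m f" and k: "\<And>l. l \<ge> k \<Longrightarrow> T m (transition C E k l)"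
  shows "tyF m x E D t (FunA D f (t k))"
  unfolding tyF_def
proof (intro exI[of _ k] allI impI)
  fix l assume l: "l \<ge> k"
  note tr = trans_Hom[OF CP_seq[OF c] l]
  show "\<exists>g \<in> Hom C x (ob E l). T m g \<and> FunA D g (t l) = FunA D f (t k)"
    using T_comp[OF f(1) tr f(2) k[OF l]] Comp_Hom[OF f(1) tr] pres_push[OF CP_seq[OF c] CP_mod[OF c] CP_pres[OF c] f(1) l]
    by blast
qed

text \<open>\<open>tyF\<close> provides some representative with small cone at each late stage. Any
  other representative \<open>f\<close> agrees with it further on, so \<open>f\<close> too acquires
  a small cone once it is pushed far enough.\<close>

lemma tyF_lift:
  assumes c: "CP E D t" and u: "tyF m x E D t u" and f: "f \<in> Hom C x (ob E k)" "FunA D f (t k) = u"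
  shows "\<exists>K. \<forall>l\<ge>K. k \<le> l \<and> T m (transition C E k l \<cdot> f)"
proof -
  note E = CP_seq[OF c]
  obtain N where N: "\<And>j l. \<lbrakk>j \<ge> N; l \<ge> j\<rbrakk> \<Longrightarrow> T m (transition C E j l)" using cauchyD[OF CP_cauchy[OF c]] by blast
  obtain K where K: "\<And>j. j \<ge> K \<Longrightarrow> \<exists>f \<in> Hom C x (ob E j). T m f \<and> FunA D f (t j) = u" using u unfolding tyF_def by blast
  obtain g where g: "g \<in> Hom C x (ob E (max N K))" "T m g" "FunA D g (t (max N K)) = u" using K[of "max N K"] by auto
  have "FunA D f (t k) = FunA D g (t (max N K))" using f g by simp
  from pres_inj_ge[OF E CP_mod[OF c] CP_pres[OF c] f(1) g(1) this]
  obtain L where L: "\<And>l. l \<ge> L \<Longrightarrow> k \<le> l \<and> max N K \<le> l \<and> transition C E k l \<cdot> f = transition C E (max N K) l \<cdot> g" by blast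
  have "k \<le> l \<and> T m (transition C E k l \<cdot> f)" if "l \<ge> L" for l
    using L[OF that] T_comp[OF g(1) trans_Hom[OF E] g(2) N, of l] by simp
  then show ?thesis by blast
qed

lemma tyF_post:
  assumes "tyF m x E D t u" "G \<in> Hom (ModCat C) D D'" "ty m E t E' t' G" and c: "CP E D t" "CP E' D' t'"
  shows "tyF m x E' D' t' (At G x u)"
proof -
  obtain K where K: "\<And>j. j \<ge> K \<Longrightarrow> \<exists>f \<in> Hom C x (ob E j). T m f \<and> FunA D f (t j) = u" using assms(1) unfolding tyF_def by blast
  obtain N where N: "\<And>j. j \<ge> N \<Longrightarrow> tyF m (ob E j) E' D' t' (At G (ob E j) (t j))" using tyD[OF assms(3,2)] by blast
  define k where "k = max K N"
  obtain f where f: "f \<in> Hom C x (ob E k)" "T m f" "FunA D f (t k) = u" using K[of k] by (auto simp: k_def)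
  obtain L where L: "\<And>l. l \<ge> L \<Longrightarrow> \<exists>g \<in> Hom C (ob E k) (ob E' l). T m g \<and> FunA D' g (t' l) = At G (ob E k) (t k)"
    using N[of k] unfolding tyF_def by (auto simp: k_def)
  show ?thesis unfolding tyF_def
  proof (intro exI[of _ L] allI impI)
    fix l assume "l \<ge> L"
    then obtain g where g: "g \<in> Hom C (ob E k) (ob E' l)" "T m g" "FunA D' g (t' l) = At G (ob E k) (t k)" using L by blast
    have "FunA D' (g \<cdot> f) (t' l) = At G x u"
      using act_comp[OF CP_mod[OF c(2)] f(1) g(1) CP_el[OF c(2)]] g(3) MH_act[OF assms(2) f(1) CP_el[OF c(1)]] f(3) by simp
    then show "\<exists>f \<in> Hom C x (ob E' l). T m f \<and> FunA D' f (t' l) = At G x u"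
      using Comp_Hom[OF f(1) g(1)] T_comp[OF f(1) g(1) f(2) g(2)] by blast
  qed
qed

text \<open>At a late stage the composite of \<open>f\<close> with a representative of
  \<open>u\<close> has small cone, and \<open>T_right\<close> removes \<open>f\<close>.\<close>

lemma tyF_cancel_pre:
  assumes c: "CP E D t" and f: "f \<in> Hom C y x" "T (Suc m) f" and u: "u \<in> el D x" "tyF (Suc m) y E D t (FunA D f u)"
  shows "tyF m x E D t u"
proof -
  note E = CP_seq[OF c] and mD = CP_mod[OF c] and p = CP_pres[OF c]
  obtain k g where g: "g \<in> Hom C x (ob E k)" "u = FunA D g (t k)" using pres_surj[OF p Hom_Obj(2)[OF f(1)] u(1)] by blast
  have "FunA D (g \<cdot> f) (t k) = FunA D f u" using act_comp[OF mD f(1) g(1) CP_el[OF c]] g(2) by simp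
  from tyF_lift[OF c u(2) Comp_Hom[OF f(1) g(1)] this]
  obtain K where K: "\<And>l. l \<ge> K \<Longrightarrow> k \<le> l \<and> T (Suc m) (transition C E k l \<cdot> (g \<cdot> f))" by blast
  show ?thesis unfolding tyF_def
  proof (intro exI[of _ K] allI impI)
    fix l assume "l \<ge> K"
    then have l: "k \<le> l" "T (Suc m) (transition C E k l \<cdot> (g \<cdot> f))" using K by auto
    note tr = trans_Hom[OF E l(1)] and tg = trans_push[OF E g(1) l(1)]
    have "T m (transition C E k l \<cdot> g)"
      using T_right[OF f(1) tg f(2)] l(2) Comp_assoc[OF f(1) g(1) tr] by simp
    then show "\<exists>f \<in> Hom C x (ob E l). T m f \<and> FunA D f (t l) = u"
      using tg pres_push[OF E mD p g(1) l(1)] g(2) by auto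
  qed
qed

text \<open>At a common late stage \<open>i\<close> of the target, \<open>G\<close> on the
  \<open>k\<close>-th object and its composite with a representative \<open>f\<close> of
  \<open>u\<close> both have small cones; \<open>T_left\<close> then bounds the cone of
  \<open>f\<close>.\<close>

lemma tyF_cancel_post:
  assumes c: "CP E D t" and c': "CP E' D' t'" and G: "G \<in> Hom (ModCat C) D D'" "ty (Suc m) E t E' t' G"
    and u: "u \<in> el D x" "tyF (Suc m) x E' D' t' (At G x u)" and x: "x \<in> Obj C"
  shows "tyF m x E D t u"
proof -
  note E = CP_seq[OF c] and mD = CP_mod[OF c] and p = CP_pres[OF c]
  obtain N where N: "\<And>j. j \<ge> N \<Longrightarrow> tyF (Suc m) (ob E j) E' D' t' (At G (ob E j) (t j))" using tyD[OF G(2,1)] by blast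
  obtain K where K: "\<And>k. k \<ge> K \<Longrightarrow> \<exists>f \<in> Hom C x (ob E k). u = FunA D f (t k)" using pres_surj_all[OF E mD p x u(1)] by blast
  show ?thesis unfolding tyF_def
  proof (intro exI[of _ "max N K"] allI impI)
    fix k assume "k \<ge> max N K"
    then have k: "k \<ge> N" "k \<ge> K" by auto
    obtain f where f: "f \<in> Hom C x (ob E k)" "u = FunA D f (t k)" using K[OF k(2)] by blast
    note tk = N[OF k(1)]
    obtain l g where g: "g \<in> Hom C (ob E k) (ob E' l)" "FunA D' g (t' l) = At G (ob E k) (t k)"
      using tk unfolding tyF_def by blast
    obtain K1 where K1: "\<And>i. i \<ge> K1 \<Longrightarrow> l \<le> i \<and> T (Suc m) (transition C E' l i \<cdot> g)" using tyF_lift[OF c' tk g] by blast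
    have "FunA D' (g \<cdot> f) (t' l) = At G x u"
      using act_comp[OF CP_mod[OF c'] f(1) g(1) CP_el[OF c']] g(2) MH_act[OF G(1) f(1) CP_el[OF c]] f(2) by simp
    from tyF_lift[OF c' u(2) Comp_Hom[OF f(1) g(1)] this]
    obtain K2 where K2: "\<And>i. i \<ge> K2 \<Longrightarrow> l \<le> i \<and> T (Suc m) (transition C E' l i \<cdot> (g \<cdot> f))" by blast
    define i where "i = max K1 K2"
    have i: "l \<le> i" "T (Suc m) (transition C E' l i \<cdot> g)" "T (Suc m) (transition C E' l i \<cdot> (g \<cdot> f))"
      using K1[of i] K2[of i] by (auto simp: i_def)
    have "T m f"
      using T_left[OF f(1) trans_push[OF CP_seq[OF c'] g(1) i(1)] i(2)] i(3)
        Comp_assoc[OF f(1) g(1) trans_Hom[OF CP_seq[OF c'] i(1)]] by simp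
    then show "\<exists>f \<in> Hom C x (ob E k). T m f \<and> FunA D f (t k) = u" using f by auto
  qed
qed

lemma tyF_cancel_arrow:
  assumes c: "CP E D t" and f: "f \<in> Hom C y x" and u: "tyF (Suc m) x E D t u" "tyF (Suc m) y E D t (FunA D f u)"
  shows "T m f"
proof -
  note E = CP_seq[OF c] and mD = CP_mod[OF c] and p = CP_pres[OF c]
  obtain k g where g: "g \<in> Hom C x (ob E k)" "FunA D g (t k) = u" using u(1) unfolding tyF_def by blast
  obtain K1 where K1: "\<And>i. i \<ge> K1 \<Longrightarrow> k \<le> i \<and> T (Suc m) (transition C E k i \<cdot> g)" using tyF_lift[OF c u(1) g] by blast
  have "FunA D (g \<cdot> f) (t k) = FunA D f u" using act_comp[OF mD f g(1) CP_el[OF c]] g(2) by simp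
  from tyF_lift[OF c u(2) Comp_Hom[OF f g(1)] this]
  obtain K2 where K2: "\<And>i. i \<ge> K2 \<Longrightarrow> k \<le> i \<and> T (Suc m) (transition C E k i \<cdot> (g \<cdot> f))" by blast
  define i where "i = max K1 K2"
  have i: "k \<le> i" "T (Suc m) (transition C E k i \<cdot> g)" "T (Suc m) (transition C E k i \<cdot> (g \<cdot> f))"
    using K1[of i] K2[of i] by (auto simp: i_def)
  show "T m f"
    using T_left[OF f trans_push[OF E g(1) i(1)] i(2)] i(3) Comp_assoc[OF f g(1) trans_Hom[OF E i(1)]] by simp
qed

lemma ty_comp:
  assumes c: "CP E A t" "CP E' A' t'" "CP E'' A'' t''" and G: "G \<in> Hom (ModCat C) A A'" "ty m E t E' t' G"
    and H: "H \<in> Hom (ModCat C) A' A''" "ty m E' t' E'' t'' H"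
  shows "ty m E t E'' t'' (H \<cdot>\<^bsub>ModCat C\<^esub> G)"
proof -
  obtain N where N: "\<And>j. j \<ge> N \<Longrightarrow> tyF m (ob E j) E' A' t' (At G (ob E j) (t j))" using tyD[OF G(2,1)] by blast
  show ?thesis
    by (rule tyI[OF MComp_Hom[OF G(1) H(1)], of N])
      (simp add: At_Comp[OF G(1) CP_Obj[OF c(1)] CP_el[OF c(1)]] tyF_post[OF N H c(2,3)])
qed

lemma ty_ident: assumes c: "CP E A t" shows "ty m E t E t (Ident (ModCat C) A)"
proof -
  obtain N where N: "\<And>j l. \<lbrakk>j \<ge> N; l \<ge> j\<rbrakk> \<Longrightarrow> T m (transition C E j l)" using cauchyD[OF CP_cauchy[OF c]] by blast
  show ?thesis
  proof (rule tyI[OF MIdent_Hom[OF CP_mod[OF c]], of N])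
    fix j assume j: "j \<ge> N"
    note o = CP_Obj[OF c, of j]
    show "tyF m (ob E j) E A t (At (Ident (ModCat C) A) (ob E j) (t j))"
      using tyFI[OF c Ident_Hom[OF o] T_ident[OF o] N[OF j]] act_ident[OF CP_mod[OF c] o CP_el[OF c]]
      by (simp add: At_Ident[OF o CP_el[OF c]])
  qed
qed

text \<open>A late stage of \<open>E'\<close> receives an arrow with small cone from a fixed stage
  of \<open>E\<close> that represents \<open>G\<close>; removing this arrow costs the index.\<close>

lemma ty_cancel:
  assumes c: "CP E A t" "CP E' A' t'" "CP E'' A'' t''" and G: "G \<in> Hom (ModCat C) A A'" "ty (Suc m) E t E' t' G"
    and H: "H \<in> Hom (ModCat C) A' A''" and HG: "ty (Suc m) E t E'' t'' (H \<cdot>\<^bsub>ModCat C\<^esub> G)"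
  shows "ty m E' t' E'' t'' H"
proof -
  obtain N where N: "\<And>j. j \<ge> N \<Longrightarrow> tyF (Suc m) (ob E j) E' A' t' (At G (ob E j) (t j))" using tyD[OF G(2,1)] by blast
  obtain N' where N': "\<And>j. j \<ge> N' \<Longrightarrow> tyF (Suc m) (ob E j) E'' A'' t'' (At (H \<cdot>\<^bsub>ModCat C\<^esub> G) (ob E j) (t j))"
    using tyD[OF HG MComp_Hom[OF G(1) H]] by blast
  define j where "j = max N N'"
  note o = CP_Obj[OF c(1), of j]
  have HGj: "tyF (Suc m) (ob E j) E'' A'' t'' (At H (ob E j) (At G (ob E j) (t j)))"
    using N'[of j] At_Comp[OF G(1) o CP_el[OF c(1)]] by (simp add: j_def)
  obtain K where K: "\<And>k. k \<ge> K \<Longrightarrow> \<exists>f \<in> Hom C (ob E j) (ob E' k). T (Suc m) f \<and> FunA A' f (t' k) = At G (ob E j) (t j)"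
    using N[of j] unfolding tyF_def by (auto simp: j_def)
  show ?thesis
  proof (rule tyI[OF H, of K])
    fix k assume "k \<ge> K"
    then obtain f where f: "f \<in> Hom C (ob E j) (ob E' k)" "T (Suc m) f" "FunA A' f (t' k) = At G (ob E j) (t j)" using K by blast
    have "FunA A'' f (At H (ob E' k) (t' k)) = At H (ob E j) (At G (ob E j) (t j))"
      using MH_act[OF H f(1) CP_el[OF c(2)]] f(3) by simp
    then show "tyF m (ob E' k) E'' A'' t'' (At H (ob E' k) (t' k))"
      using tyF_cancel_pre[OF c(3) f(1,2) MH_closed[OF H CP_Obj[OF c(2)] CP_el[OF c(2)]]] HGj by simp
  qed
qed

text \<open>One late stage decides the type: the later ones are reached from it by a transition with
  small cone, and cancelling this transition costs one index.\<close>

lemma ty_of_stage: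
  assumes c: "CP E B s" and c': "CP d D t" and G: "G \<in> Hom (ModCat C) B D"
    and j: "\<And>k. k \<ge> j \<Longrightarrow> T (Suc m) (transition C E j k)" and u: "tyF (Suc m) (ob E j) d D t (At G (ob E j) (s j))"
  shows "ty m E s d t G"
proof (rule tyI[OF G, of j])
  fix k assume k: "k \<ge> j"
  note tr = trans_Hom[OF CP_seq[OF c] k]
  have "FunA D (transition C E j k) (At G (ob E k) (s k)) = At G (ob E j) (s j)"
    using MH_act[OF G tr CP_el[OF c]] CP_trans[OF c k] by simp
  then show "tyF m (ob E k) d D t (At G (ob E k) (s k))"
    using tyF_cancel_pre[OF c' tr j[OF k] MH_closed[OF G CP_Obj[OF c] CP_el[OF c]]] u by simp
qed

text \<open>This reduces questions about \<open>G\<close> to one arrow \<open>f\<close> of the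
  category between stages that are late on both sides, so that maps out of \<open>A\<close> and
  \<open>A'\<close> into a module vanishing on \<open>M i\<close> are read off at the two ends of
  \<open>f\<close>.\<close>

lemma ty_stage:
  assumes c: "CP E A t" "CP E' A' t'" and G: "G \<in> Hom (ModCat C) A A'" "ty (Suc i) E t E' t' G"
  shows "\<exists>j k f. (\<forall>l\<ge>j. T (Suc i) (transition C E j l)) \<and> (\<forall>l\<ge>k. T (Suc i) (transition C E' k l)) \<and>
    f \<in> Hom C (ob E j) (ob E' k) \<and> T (Suc i) f \<and> FunA A' f (t' k) = At G (ob E j) (t j)"
proof -
  obtain N where N: "\<And>j l. \<lbrakk>j \<ge> N; l \<ge> j\<rbrakk> \<Longrightarrow> T (Suc i) (transition C E j l)" using cauchyD[OF CP_cauchy[OF c(1)]] by blast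
  obtain N' where N': "\<And>j l. \<lbrakk>j \<ge> N'; l \<ge> j\<rbrakk> \<Longrightarrow> T (Suc i) (transition C E' j l)" using cauchyD[OF CP_cauchy[OF c(2)]] by blast
  obtain L where L: "\<And>j. j \<ge> L \<Longrightarrow> tyF (Suc i) (ob E j) E' A' t' (At G (ob E j) (t j))" using tyD[OF G(2,1)] by blast
  obtain K where K: "\<And>k. k \<ge> K \<Longrightarrow> \<exists>f \<in> Hom C (ob E (max N L)) (ob E' k). T (Suc i) f \<and> FunA A' f (t' k) = At G (ob E (max N L)) (t (max N L))"
    using L[of "max N L"] unfolding tyF_def by auto
  obtain f where "f \<in> Hom C (ob E (max N L)) (ob E' (max N' K))" "T (Suc i) f"
    "FunA A' f (t' (max N' K)) = At G (ob E (max N L)) (t (max N L))" using K[of "max N' K"] by auto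
  then show ?thesis using N N' max.cobounded1 by meson
qed

text \<open>By \<open>stage_eq\<close> and \<open>stage_ext\<close>, maps from \<open>A\<close> and
  \<open>A'\<close> into \<open>D\<close> are values of \<open>D\<close> at late stages. Composition
  with \<open>G\<close> becomes the action of one arrow with small cone, which is bijective on
  \<open>D\<close>; \<open>ty_epi\<close> is the injectivity.\<close>

lemma ty_ext:
  assumes c: "CP E A t" "CP E' A' t'" and G: "G \<in> Hom (ModCat C) A A'" "ty (Suc i) E t E' t' G"
    and D: "homol D" "vanish D i" and H: "H \<in> Hom (ModCat C) A D"
  shows "\<exists>H' \<in> Hom (ModCat C) A' D. H' \<cdot>\<^bsub>ModCat C\<^esub> G = H"
proof -
  obtain j k f where j: "\<And>l. l \<ge> j \<Longrightarrow> T (Suc i) (transition C E j l)" and k: "\<And>l. l \<ge> k \<Longrightarrow> T (Suc i) (transition C E' k l)"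
    and f: "f \<in> Hom C (ob E j) (ob E' k)" "T (Suc i) f" "FunA A' f (t' k) = At G (ob E j) (t j)"
    using ty_stage[OF c G] by blast
  note o = CP_Obj[OF c(1), of j]
  obtain v where v: "v \<in> el D (ob E' k)" "FunA D f v = At H (ob E j) (t j)"
    using van_lift[OF D f(1,2) MH_closed[OF H o CP_el[OF c(1)]]] by blast
  obtain H' where H': "H' \<in> Hom (ModCat C) A' D" "At H' (ob E' k) (t' k) = v" using stage_ext[OF c(2) D k v(1)] by blast
  have "H' \<cdot>\<^bsub>ModCat C\<^esub> G = H"
    by (rule stage_eq[OF c(1) D j MComp_Hom[OF G(1) H'(1)] H])
      (use MH_act[OF H'(1) f(1) CP_el[OF c(2)]] f(3) H'(2) v(2) in \<open>simp_all add: At_Comp[OF G(1) o CP_el[OF c(1)]]\<close>)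
  then show ?thesis using H'(1) by blast
qed

lemma ty_epi:
  assumes c: "CP E A t" "CP E' A' t'" and G: "G \<in> Hom (ModCat C) A A'" "ty (Suc i) E t E' t' G"
    and D: "homol D" "vanish D i" and H: "H \<in> Hom (ModCat C) A' D" "H' \<in> Hom (ModCat C) A' D"
    and eq: "H \<cdot>\<^bsub>ModCat C\<^esub> G = H' \<cdot>\<^bsub>ModCat C\<^esub> G"
  shows "H = H'"
proof -
  obtain j k f where j: "\<And>l. l \<ge> j \<Longrightarrow> T (Suc i) (transition C E j l)" and k: "\<And>l. l \<ge> k \<Longrightarrow> T (Suc i) (transition C E' k l)"
    and f: "f \<in> Hom C (ob E j) (ob E' k)" "T (Suc i) f" "FunA A' f (t' k) = At G (ob E j) (t j)"
    using ty_stage[OF c G] by blast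
  note o = CP_Obj[OF c(1), of j] and o' = CP_Obj[OF c(2), of k]
  have "At H (ob E j) (At G (ob E j) (t j)) = At H' (ob E j) (At G (ob E j) (t j))"
    using At_Comp[OF G(1) o CP_el[OF c(1)], of H] At_Comp[OF G(1) o CP_el[OF c(1)], of H'] eq by simp
  then have "FunA D f (At H (ob E' k) (t' k)) = FunA D f (At H' (ob E' k) (t' k))"
    using MH_act[OF H(1) f(1) CP_el[OF c(2)]] MH_act[OF H(2) f(1) CP_el[OF c(2)]] f(3) by simp
  then have "At H (ob E' k) (t' k) = At H' (ob E' k) (t' k)"
    by (rule van_cancel[OF D f(1,2) MH_closed[OF H(1) o' CP_el[OF c(2)]] MH_closed[OF H(2) o' CP_el[OF c(2)]]])
  from stage_eq[OF c(2) D _ H this] k show ?thesis by blast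
qed

lemma tyF_perp_lift:
  assumes c: "CP E D t" and F: "F \<in> left_perp C (M i)" and u: "tyF (Suc i) x E D t u" and w: "w \<in> el D F"
  shows "\<exists>\<phi> \<in> Hom C F x. FunA D \<phi> u = w"
proof -
  note E = CP_seq[OF c] and mD = CP_mod[OF c] and p = CP_pres[OF c]
  obtain K where K: "\<And>k. k \<ge> K \<Longrightarrow> \<exists>f \<in> Hom C x (ob E k). T (Suc i) f \<and> FunA D f (t k) = u" using u unfolding tyF_def by blast
  obtain n \<psi> where n: "n \<ge> K" "\<psi> \<in> Hom C F (ob E n)" "w = FunA D \<psi> (t n)"
    using pres_surj_ge[OF E mD p left_perp_Obj[OF F] w] by blast
  obtain f where f: "f \<in> Hom C x (ob E n)" "T (Suc i) f" "FunA D f (t n) = u" using K[OF n(1)] by blast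
  obtain \<phi> where \<phi>: "\<phi> \<in> Hom C F x" "f \<cdot> \<phi> = \<psi>" using perp_lift[OF F f(1,2) n(2)] by blast
  show ?thesis using \<phi> act_comp[OF mD \<phi>(1) f(1) CP_el[OF c]] f(3) n(3) by auto
qed

lemma tyF_perp_cancel:
  assumes c: "CP E D t" and F: "F \<in> left_perp C (M i)" and u: "tyF (Suc i) x E D t u"
    and \<phi>: "\<phi> \<in> Hom C F x" "\<phi>' \<in> Hom C F x" "FunA D \<phi> u = FunA D \<phi>' u"
  shows "\<phi> = \<phi>'"
proof -
  note E = CP_seq[OF c] and mD = CP_mod[OF c] and p = CP_pres[OF c]
  obtain k f where f: "f \<in> Hom C x (ob E k)" "FunA D f (t k) = u" using u unfolding tyF_def by blast
  obtain K where K: "\<And>l. l \<ge> K \<Longrightarrow> k \<le> l \<and> T (Suc i) (transition C E k l \<cdot> f)" using tyF_lift[OF c u f] by blast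
  have "FunA D (f \<cdot> \<phi>) (t k) = FunA D (f \<cdot> \<phi>') (t k)"
    using act_comp[OF mD \<phi>(1) f(1) CP_el[OF c]] act_comp[OF mD \<phi>(2) f(1) CP_el[OF c]] f(2) \<phi>(3) by simp
  from pres_inj_ge[OF E mD p Comp_Hom[OF \<phi>(1) f(1)] Comp_Hom[OF \<phi>(2) f(1)] this]
  obtain L where L: "\<And>l. l \<ge> L \<Longrightarrow> transition C E k l \<cdot> (f \<cdot> \<phi>) = transition C E k l \<cdot> (f \<cdot> \<phi>')" by blast
  define l where "l = max K L"
  have l: "k \<le> l" "T (Suc i) (transition C E k l \<cdot> f)" using K[of l] by (auto simp: l_def)
  note tr = trans_Hom[OF E l(1)]
  have "(transition C E k l \<cdot> f) \<cdot> \<phi> = (transition C E k l \<cdot> f) \<cdot> \<phi>'"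
    using L[of l] Comp_assoc[OF \<phi>(1) f(1) tr] Comp_assoc[OF \<phi>(2) f(1) tr] by (simp add: l_def)
  then show ?thesis by (rule perp_cancel[OF F trans_push[OF E f(1) l(1)] l(2) \<phi>(1,2)])
qed

text \<open>Maps out of \<open>F\<close> do not see cones in \<open>M (Suc i)\<close> or their
  desuspensions, so \<open>G\<close> is bijective on the values at \<open>F\<close>; injectivity is
  \<open>ty_perp_inj\<close>.\<close>

lemma ty_perp_surj:
  assumes c: "CP E A t" "CP E' A' t'" and G: "G \<in> Hom (ModCat C) A A'" "ty (Suc i) E t E' t' G"
    and F: "F \<in> left_perp C (M i)" and w: "w \<in> el A' F"
  shows "\<exists>u \<in> el A F. At G F u = w"
proof -
  obtain N where N: "\<And>j. j \<ge> N \<Longrightarrow> tyF (Suc i) (ob E j) E' A' t' (At G (ob E j) (t j))" using tyD[OF G(2,1)] by blast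
  obtain \<phi> where \<phi>: "\<phi> \<in> Hom C F (ob E N)" "FunA A' \<phi> (At G (ob E N) (t N)) = w"
    using tyF_perp_lift[OF c(2) F N[OF le_refl] w] by blast
  show ?thesis using MH_act[OF G(1) \<phi>(1) CP_el[OF c(1)]] \<phi>(2) act_closed[OF CP_mod[OF c(1)] \<phi>(1) CP_el[OF c(1)]] by auto
qed

lemma ty_perp_inj:
  assumes c: "CP E A t" "CP E' A' t'" and G: "G \<in> Hom (ModCat C) A A'" "ty (Suc i) E t E' t' G"
    and F: "F \<in> left_perp C (M i)" and u: "u \<in> el A F" "v \<in> el A F" "At G F u = At G F v"
  shows "u = v"
proof -
  note E = CP_seq[OF c(1)] and mA = CP_mod[OF c(1)] and p = CP_pres[OF c(1)] and o = left_perp_Obj[OF F]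
  obtain N where N: "\<And>j. j \<ge> N \<Longrightarrow> tyF (Suc i) (ob E j) E' A' t' (At G (ob E j) (t j))" using tyD[OF G(2,1)] by blast
  obtain K where K: "\<And>k. k \<ge> K \<Longrightarrow> \<exists>f \<in> Hom C F (ob E k). u = FunA A f (t k)" using pres_surj_all[OF E mA p o u(1)] by blast
  obtain L where L: "\<And>k. k \<ge> L \<Longrightarrow> \<exists>f \<in> Hom C F (ob E k). v = FunA A f (t k)" using pres_surj_all[OF E mA p o u(2)] by blast
  define k where "k = max N (max K L)"
  obtain f where f: "f \<in> Hom C F (ob E k)" "u = FunA A f (t k)" using K[of k] unfolding k_def by force
  obtain g where g: "g \<in> Hom C F (ob E k)" "v = FunA A g (t k)" using L[of k] unfolding k_def by force
  have "FunA A' f (At G (ob E k) (t k)) = FunA A' g (At G (ob E k) (t k))"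
    using MH_act[OF G(1) f(1) CP_el[OF c(1)]] MH_act[OF G(1) g(1) CP_el[OF c(1)]] u(3) f(2) g(2) by simp
  then have "f = g" by (rule tyF_perp_cancel[OF c(2) F N f(1) g(1), rotated]) (simp add: k_def)
  then show ?thesis using f g by simp
qed

end

section \<open>Strong triangles\<close>

text \<open>A strong triangle with all its data exposed and its maps described on the presenting
  elements. The isomorphism of \<open>Y(\<Sigma> x)\<close> with \<open>\<Sigma> Y(x)\<close>
  disappears, because \<open>\<alpha> n\<close> is literally an element of the shifted module at the
  shifted object.\<close>

definition ST :: "('o, 'm, 'z) tri_cat_scheme \<Rightarrow> (nat \<Rightarrow> 'o set) \<Rightarrow> (nat \<Rightarrow> 'm) \<Rightarrow> (nat \<Rightarrow> 'u) \<Rightarrow> (nat \<Rightarrow> 'm) \<Rightarrow> (nat \<Rightarrow> 'u)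
    \<Rightarrow> (nat \<Rightarrow> 'm) \<Rightarrow> (nat \<Rightarrow> 'u) \<Rightarrow> (nat \<Rightarrow> 'm) \<Rightarrow> (nat \<Rightarrow> 'm) \<Rightarrow> (nat \<Rightarrow> 'm)
    \<Rightarrow> ('o, 'm, 'u) presheaf \<Rightarrow> ('o, 'm, 'u) presheaf \<Rightarrow> ('o, 'm, 'u) presheaf
    \<Rightarrow> ('o, 'm, 'u) presheaf_map \<Rightarrow> ('o, 'm, 'u) presheaf_map \<Rightarrow> ('o, 'm, 'u) presheaf_map \<Rightarrow> bool" where
  "ST C M a \<alpha> b \<beta> c \<gamma> f g h A B D F G H \<longleftrightarrow> cauchy_triangles C M a b c f g h \<and>
     is_module C A \<and> is_module C B \<and> is_module C D \<and> pres C a A \<alpha> \<and> pres C b B \<beta> \<and> pres C c D \<gamma> \<and>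
     F \<in> Hom (ModCat C) A B \<and> G \<in> Hom (ModCat C) B D \<and> H \<in> Hom (ModCat C) D (ShO (ModCat C) A) \<and>
     (\<forall>n. At F (Src C (a n)) (\<alpha> n) = FunA B (f n) (\<beta> n) \<and> At G (Src C (b n)) (\<beta> n) = FunA D (g n) (\<gamma> n) \<and>
       At H (Src C (c n)) (\<gamma> n) = FunA (ShO (ModCat C) A) (h n) (\<alpha> n))"

text \<open>The record has a set of triangles but only the axioms of \<open>yoneda\<close> are
  imposed, so that strong triangles can be described both over the given category and over the
  opposite of its completion.\<close>

locale yonT = yoneda C e for C :: "('o, 'm, 'z) tri_cat_scheme" (structure) and e :: "'m \<Rightarrow> 'u"
begin

lemma Yon_shift_Hom: assumes x: "x \<in> Obj C"
  shows "Yon_shift e C x \<in> Hom (ModCat C) (YonO e C (ShO C x)) (ShO (ModCat C) (YonO e C x))"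
proof -
  have o: "ShO C x \<in> Obj C" by (rule ShO_Obj[OF x])
  have eq: "Yon_shift e C x = mkmap C (YonO e C (ShO C x)) (ShO (ModCat C) (YonO e C x)) (\<lambda>a u. e (UnA C (decode e u)))"
  proof (rule presheaf_map_eqI)
    show "At (Yon_shift e C x) = At (mkmap C (YonO e C (ShO C x)) (ShO (ModCat C) (YonO e C x)) (\<lambda>a u. e (UnA C (decode e u))))"
      unfolding Yon_shift_def mkmap_def presheaf_map.simps by (rule restrict_ext) (simp add: Yon_O)
  qed (simp_all add: Yon_shift_def)
  have un: "UnA C f \<in> Hom C (UnO C a) x" if "f \<in> Hom C a (ShO C x)" for f a
    using UnA_Hom[OF that] by (simp add: UnO_ShO[OF x])
  show ?thesis unfolding eq
  proof (rule mkmap_Hom[OF module_Yon[OF o] module_shift[OF module_Yon[OF x]]])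
    fix a u assume a: "a \<in> Obj C" and "u \<in> el (YonO e C (ShO C x)) a"
    then obtain f where f: "f \<in> Hom C a (ShO C x)" "u = e f" unfolding el_Yon[OF a] by blast
    show "e (UnA C (decode e u)) \<in> el (ShO (ModCat C) (YonO e C x)) a"
      using un[OF f(1)] f(2) by (simp add: shM_simps a el_Yon UnO_Obj)
    fix v assume "v \<in> el (YonO e C (ShO C x)) a"
    then obtain g where g: "g \<in> Hom C a (ShO C x)" "v = e g" unfolding el_Yon[OF a] by blast
    show "e (UnA C (decode e (u \<otimes>\<^bsub>FunO (YonO e C (ShO C x)) a\<^esub> v))) =
      e (UnA C (decode e u)) \<otimes>\<^bsub>FunO (ShO (ModCat C) (YonO e C x)) a\<^esub> e (UnA C (decode e v))"
      unfolding f(2) g(2) Yon_O[OF a] hom_in_mult[OF f(1) g(1)] dec shM_simps(1)[OF a] Yon_O[OF UnO_Obj[OF a]]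
        hom_in_mult[OF un[OF f(1)] un[OF g(1)]] UnA_Add[OF f(1) g(1)] ..
  next
    fix a b f u assume f: "f \<in> Hom C a b" and "u \<in> el (YonO e C (ShO C x)) b"
    then obtain g where g: "g \<in> Hom C b (ShO C x)" "u = e g" unfolding el_Yon[OF Hom_Obj(2)[OF f]] by blast
    show "FunA (ShO (ModCat C) (YonO e C x)) f (e (UnA C (decode e u))) = e (UnA C (decode e (FunA (YonO e C (ShO C x)) f u)))"
      unfolding g(2) Yon_act[OF f g(1)] dec shM_simps(2)[OF Hom_Arr[OF f]] Yon_act[OF UnA_Hom[OF f] un[OF g(1)]]
        UnA_Comp[OF f g(1)] ..
  qed
qed

lemma At_Yon_shift: "\<lbrakk>f \<in> Hom C a (ShO C x); x \<in> Obj C\<rbrakk> \<Longrightarrow> At (Yon_shift e C x) a (e f) = e (UnA C f)"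
  using Hom_Obj(1)[of f a] by (simp add: Yon_shift_def hom_in_carrier)

text \<open>By the Yoneda lemma each square of module maps out of a representable is tested on an
  identity. In the third family \<open>Yon_shift\<close> contributes a desuspension of
  \<open>h n\<close>, which is how \<open>h n\<close> acts on the shifted module.\<close>

lemma strong_iff:
  "(F, G, H) \<in> strong_triangles e C M \<longleftrightarrow> (\<exists>a \<alpha> b \<beta> c \<gamma> f g h A B D. ST C M a \<alpha> b \<beta> c \<gamma> f g h A B D F G H)"
proof -
  have sq: "(F \<cdot>\<^bsub>ModCat C\<^esub> ymap A x u = ymap B y v \<cdot>\<^bsub>ModCat C\<^esub> YonA e C f) \<longleftrightarrow> At F x u = FunA B f v"
    if F: "F \<in> Hom (ModCat C) A B" and f: "f \<in> Hom C x y" and u: "u \<in> el A x" and v: "v \<in> el B y" for F A B f x y u v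
  proof -
    note o = Hom_Obj[OF f] and mA = MH_mod(1)[OF F] and mB = MH_mod(2)[OF F]
    note 1 = ymap_Hom[OF mA o(1) u] and 2 = ymap_Hom[OF mB o(2) v] and 3 = YonA_Hom[OF f]
    have l: "At (F \<cdot>\<^bsub>ModCat C\<^esub> ymap A x u) x (e (Ident C x)) = At F x u"
      unfolding At_Comp[OF 1 o(1) Ident_el[OF o(1)]] At_ymap[OF Ident_Hom[OF o(1)]] act_ident[OF mA o(1) u] ..
    have r: "At (ymap B y v \<cdot>\<^bsub>ModCat C\<^esub> YonA e C f) x (e (Ident C x)) = FunA B f v"
      unfolding At_Comp[OF 3 o(1) Ident_el[OF o(1)]] At_YonA[OF f Ident_Hom[OF o(1)]] Comp_Ident[OF f] At_ymap[OF f] ..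
    show ?thesis using Yon_map_eqI[OF MComp_Hom[OF 1 F] MComp_Hom[OF 3 2]] l r by auto
  qed
  have sqH: "(H \<cdot>\<^bsub>ModCat C\<^esub> ymap D y v =
      ShA (ModCat C) (ymap A x u) \<cdot>\<^bsub>ModCat C\<^esub> (Yon_shift e C x \<cdot>\<^bsub>ModCat C\<^esub> YonA e C h)) \<longleftrightarrow>
      At H y v = FunA (ShO (ModCat C) A) h u"
    if H: "H \<in> Hom (ModCat C) D (ShO (ModCat C) A)" and h: "h \<in> Hom C y (ShO C x)" and x: "x \<in> Obj C"
      and u: "u \<in> el A x" and v: "v \<in> el D y" and mA: "is_module C A" for H D A h x y u v
  proof -
    note o = Hom_Obj[OF h] and mD = MH_mod(1)[OF H]
    note 1 = ymap_Hom[OF mD o(1) v] and 2 = MShA_Hom[OF ymap_Hom[OF mA x u]] and 3 = YonA_Hom[OF h]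
      and 4 = Yon_shift_Hom[OF x]
    have un: "UnA C h \<in> Hom C (UnO C y) x" using UnA_Hom[OF h] by (simp add: UnO_ShO[OF x])
    have l: "At (H \<cdot>\<^bsub>ModCat C\<^esub> ymap D y v) y (e (Ident C y)) = At H y v"
      unfolding At_Comp[OF 1 o(1) Ident_el[OF o(1)]] At_ymap[OF Ident_Hom[OF o(1)]] act_ident[OF mD o(1) v] ..
    have r: "At (ShA (ModCat C) (ymap A x u) \<cdot>\<^bsub>ModCat C\<^esub> (Yon_shift e C x \<cdot>\<^bsub>ModCat C\<^esub> YonA e C h)) y (e (Ident C y)) =
        FunA (ShO (ModCat C) A) h u"
      unfolding At_Comp[OF MComp_Hom[OF 3 4] o(1) Ident_el[OF o(1)]] At_Comp[OF 3 o(1) Ident_el[OF o(1)]]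
        At_YonA[OF h Ident_Hom[OF o(1)]] Comp_Ident[OF h] At_Yon_shift[OF h x] shM_simps(3)[OF o(1)]
        At_ymap[OF un] shM_simps(2)[OF Hom_Arr[OF h]] ..
    show ?thesis using Yon_map_eqI[OF MComp_Hom[OF 1 H] MComp_Hom[OF MComp_Hom[OF 3 4] 2]] l r by auto
  qed
  have key: "ST C M a \<alpha> b \<beta> c \<gamma> f g h A B D F G H \<longleftrightarrow> cauchy_triangles C M a b c f g h \<and>
      Yon_colim e C a A (\<lambda>n. ymap A (Src C (a n)) (\<alpha> n)) \<and> Yon_colim e C b B (\<lambda>n. ymap B (Src C (b n)) (\<beta> n)) \<and>
      Yon_colim e C c D (\<lambda>n. ymap D (Src C (c n)) (\<gamma> n)) \<and> pres C a A \<alpha> \<and> pres C b B \<beta> \<and> pres C c D \<gamma> \<and>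
      F \<in> Hom (ModCat C) A B \<and> G \<in> Hom (ModCat C) B D \<and> H \<in> Hom (ModCat C) D (ShO (ModCat C) A) \<and>
      (\<forall>n. F \<cdot>\<^bsub>ModCat C\<^esub> ymap A (Src C (a n)) (\<alpha> n) = ymap B (Src C (b n)) (\<beta> n) \<cdot>\<^bsub>ModCat C\<^esub> YonA e C (f n) \<and>
        G \<cdot>\<^bsub>ModCat C\<^esub> ymap B (Src C (b n)) (\<beta> n) = ymap D (Src C (c n)) (\<gamma> n) \<cdot>\<^bsub>ModCat C\<^esub> YonA e C (g n) \<and>
        H \<cdot>\<^bsub>ModCat C\<^esub> ymap D (Src C (c n)) (\<gamma> n) = ShA (ModCat C) (ymap A (Src C (a n)) (\<alpha> n)) \<cdot>\<^bsub>ModCat C\<^esub>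
          (Yon_shift e C (Src C (a n)) \<cdot>\<^bsub>ModCat C\<^esub> YonA e C (h n)))" (is "_ \<longleftrightarrow> ?R")
    for a \<alpha> b \<beta> c \<gamma> f g h A B D
  proof (cases "cauchy_triangles C M a b c f g h \<and> pres C a A \<alpha> \<and> pres C b B \<beta> \<and> pres C c D \<gamma> \<and>
      F \<in> Hom (ModCat C) A B \<and> G \<in> Hom (ModCat C) B D \<and> H \<in> Hom (ModCat C) D (ShO (ModCat C) A)")
    case True
    then have ct: "cauchy_triangles C M a b c f g h" and p: "pres C a A \<alpha>" "pres C b B \<beta>" "pres C c D \<gamma>"
      and F: "F \<in> Hom (ModCat C) A B" and G: "G \<in> Hom (ModCat C) B D" and H: "H \<in> Hom (ModCat C) D (ShO (ModCat C) A)"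
      by auto
    have s: "is_seq C a" "is_seq C b" "is_seq C c" using ct unfolding cauchy_triangles_def cauchy_def by auto
    have f: "f n \<in> Hom C (Src C (a n)) (Src C (b n))" and g: "g n \<in> Hom C (Src C (b n)) (Src C (c n))"
      and h: "h n \<in> Hom C (Src C (c n)) (ShO C (Src C (a n)))" for n
      using ct shift_seq(2)[OF s(1)] unfolding cauchy_triangles_def seq_map_def by auto
    note m = MH_mod[OF F] MH_mod(2)[OF G]
    note y = pres_Yon_colim[OF s(1) m(1) p(1)] pres_Yon_colim[OF s(2) m(2) p(2)] pres_Yon_colim[OF s(3) m(3) p(3)]
    show ?thesis
      unfolding ST_def sq[OF F f pres_el[OF p(1)] pres_el[OF p(2)]] sq[OF G g pres_el[OF p(2)] pres_el[OF p(3)]]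
        sqH[OF H h seq_Obj[OF s(1)] pres_el[OF p(1)] pres_el[OF p(3)] m(1)]
      using True m y by blast
  next
    case False then show ?thesis unfolding ST_def by blast
  qed
  show ?thesis (is "?l \<longleftrightarrow> ?r")
  proof
    assume ?r then show ?l unfolding key strong_triangles_def by blast
  next
    assume ?l
    then obtain a b c f g h A \<kappa> B \<mu> D \<nu> where t: "cauchy_triangles C M a b c f g h"
      "Yon_colim e C a A \<kappa>" "Yon_colim e C b B \<mu>" "Yon_colim e C c D \<nu>"
      "F \<in> Hom (ModCat C) A B" "G \<in> Hom (ModCat C) B D" "H \<in> Hom (ModCat C) D (ShO (ModCat C) A)"
      "\<forall>n. F \<cdot>\<^bsub>ModCat C\<^esub> \<kappa> n = \<mu> n \<cdot>\<^bsub>ModCat C\<^esub> YonA e C (f n) \<and> G \<cdot>\<^bsub>ModCat C\<^esub> \<mu> n = \<nu> n \<cdot>\<^bsub>ModCat C\<^esub> YonA e C (g n) \<and>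
        H \<cdot>\<^bsub>ModCat C\<^esub> \<nu> n = ShA (ModCat C) (\<kappa> n) \<cdot>\<^bsub>ModCat C\<^esub> (Yon_shift e C (Src C (a n)) \<cdot>\<^bsub>ModCat C\<^esub> YonA e C (h n))"
      unfolding strong_triangles_def by blast
    have s: "is_seq C a" "is_seq C b" "is_seq C c" using t(1) unfolding cauchy_triangles_def cauchy_def by auto
    obtain \<alpha> \<beta> \<gamma> where "pres C a A \<alpha>" "\<kappa> = (\<lambda>n. ymap A (Src C (a n)) (\<alpha> n))" "pres C b B \<beta>" "\<mu> = (\<lambda>n. ymap B (Src C (b n)) (\<beta> n))"
      "pres C c D \<gamma>" "\<nu> = (\<lambda>n. ymap D (Src C (c n)) (\<gamma> n))"
      using Yon_colim_pres[OF s(1) t(2)] Yon_colim_pres[OF s(2) t(3)] Yon_colim_pres[OF s(3) t(4)] by blast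
    with t show ?r unfolding key by blast
  qed
qed

end

sublocale met \<subseteq> yonT ..

context met
begin

section \<open>Strong triangles and maps of sequences\<close>

lemma ST_D:
  fixes F :: "('o, 'm, 'u) presheaf_map"
  assumes "ST C M a \<alpha> b \<beta> c \<gamma> f g h A B D F G H"
  shows ST_CP: "CP a A \<alpha>" "CP b B \<beta>" "CP c D \<gamma>"
    and ST_Hom: "F \<in> Hom (ModCat C) A B" "G \<in> Hom (ModCat C) B D" "H \<in> Hom (ModCat C) D (ShO (ModCat C) A)"
    and ST_map: "seq_map C a b f" "seq_map C b c g" "seq_map C c (\<lambda>n. ShA C (a n)) h"
    and ST_tri: "tri (ob a n) (ob b n) (ob c n) (f n) (g n) (h n)"
    and ST_at: "At F (ob a n) (\<alpha> n) = FunA B (f n) (\<beta> n)" "At G (ob b n) (\<beta> n) = FunA D (g n) (\<gamma> n)"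
      "At H (ob c n) (\<gamma> n) = FunA (ShO (ModCat C) A) (h n) (\<alpha> n)"
proof -
  have ct: "cauchy_triangles C M a b c f g h" using assms by (simp add: ST_def)
  show CP: "CP a A \<alpha>" "CP b B \<beta>" "CP c D \<gamma>" using assms unfolding ST_def CP_def cauchy_triangles_def by auto
  show "F \<in> Hom (ModCat C) A B" "G \<in> Hom (ModCat C) B D" "H \<in> Hom (ModCat C) D (ShO (ModCat C) A)"
    using assms unfolding ST_def by auto
  show "seq_map C a b f" "seq_map C b c g" "seq_map C c (\<lambda>n. ShA C (a n)) h" using ct unfolding cauchy_triangles_def by auto
  then have "f n \<in> Hom C (ob a n) (ob b n)" "g n \<in> Hom C (ob b n) (ob c n)" "h n \<in> Hom C (ob c n) (ShO C (ob a n))"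
    using shift_seq(2)[OF CP_seq[OF CP(1)]] unfolding seq_map_def by auto
  then show "tri (ob a n) (ob b n) (ob c n) (f n) (g n) (h n)" using ct unfolding cauchy_triangles_def tri_def by auto
  show "At F (ob a n) (\<alpha> n) = FunA B (f n) (\<beta> n)" "At G (ob b n) (\<beta> n) = FunA D (g n) (\<gamma> n)"
      "At H (ob c n) (\<gamma> n) = FunA (ShO (ModCat C) A) (h n) (\<alpha> n)" using assms unfolding ST_def by auto
qed

lemma CP_shift: assumes c: "CP E A t" shows "CP (\<lambda>n. ShA C (E n)) (ShO (ModCat C) A) t"
  unfolding CP_def using cauchy_shift[OF CP_cauchy[OF c]] module_shift[OF CP_mod[OF c]]
    pres_shift[OF CP_seq[OF c] CP_mod[OF c] CP_pres[OF c]] by blast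

lemma CP_unshift: assumes c: "CP E A t" shows "CP (\<lambda>n. UnA C (E n)) (unshO C A) t"
  unfolding CP_def using cauchy_unshift[OF CP_cauchy[OF c]] module_unshift[OF CP_mod[OF c]]
    pres_unshift[OF CP_seq[OF c] CP_mod[OF c] CP_pres[OF c]] by blast

lemma vanish_shift: assumes A: "is_module C A" "vanish A i" shows "vanish (ShO (ModCat C) A) (Suc i)"
  unfolding vanish_def
proof (intro ballI)
  fix m u assume m: "m \<in> M (Suc i)" and u: "u \<in> el (ShO (ModCat C) A) m"
  have o: "m \<in> Obj C" using m metric_Obj by blast
  show "u = \<one>\<^bsub>FunO (ShO (ModCat C) A) m\<^esub>" using vanishD[OF A(2) M_UnO[OF m]] u by (simp add: shM_simps o)
qed

lemma vanish_unshift: assumes A: "is_module C A" "vanish A i" shows "vanish (unshO C A) (Suc i)"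
  unfolding vanish_def
proof (intro ballI)
  fix m u assume m: "m \<in> M (Suc i)" and u: "u \<in> el (unshO C A) m"
  have o: "m \<in> Obj C" using m metric_Obj by blast
  show "u = \<one>\<^bsub>FunO (unshO C A) m\<^esub>" using vanishD[OF A(2) M_ShO[OF m]] u by (simp add: unsh_simps o)
qed

lemma SObj_shift: "A \<in> SObj e C M \<Longrightarrow> ShO (ModCat C) A \<in> SObj e C M"
  unfolding SObj_iff using CP_shift vanish_shift CP_mod by blast

lemma SObj_unshift: "A \<in> SObj e C M \<Longrightarrow> unshO C A \<in> SObj e C M"
  unfolding SObj_iff using CP_unshift vanish_unshift CP_mod by blast

lemma map_of_seq_map:
  assumes c: "CP a A \<alpha>" "CP b B \<beta>" and f: "seq_map C a b f"
  shows "\<exists>F \<in> Hom (ModCat C) A B. \<forall>n. At F (ob a n) (\<alpha> n) = FunA B (f n) (\<beta> n)"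
proof (rule pres_hom[OF CP_seq[OF c(1)] CP_mod[OF c(1)] CP_pres[OF c(1)] CP_mod[OF c(2)]])
  note m = CP_mod[OF c(2)]
  have fH: "f n \<in> Hom C (ob a n) (ob b n)" and fs: "f (Suc n) \<cdot> a n = b n \<cdot> f n" for n
    using f by (auto simp: seq_map_def)
  fix n show "FunA B (f n) (\<beta> n) \<in> el B (ob a n)" by (rule act_closed[OF m fH CP_el[OF c(2)]])
  show "FunA B (a n) (FunA B (f (Suc n)) (\<beta> (Suc n))) = FunA B (f n) (\<beta> n)"
    using act_comp[OF m seq_Hom[OF CP_seq[OF c(1)]] fH CP_el[OF c(2)], of n] act_comp[OF m fH seq_Hom[OF CP_seq[OF c(2)]] CP_el[OF c(2)], of n]
      fs[of n] pres_step[OF CP_pres[OF c(2)], of n] by simp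
qed

text \<open>A map of colimits is represented at every stage, but only at a late stage of the target.
  The target indices are chosen recursively, each so late that the next square commutes and, if
  \<open>G\<close> is of type \<open>m\<close>, that the cone is small. On the source side only an
  initial segment is dropped.\<close>

lemma lift_seq:
  assumes c: "CP E A t" "CP E' A' t'" and G: "G \<in> Hom (ModCat C) A A'"
  shows "\<exists>r s f. strict_mono r \<and> strict_mono s \<and> seq_map C (subsequence C E r) (subsequence C E' s) f \<and>
    (\<forall>i. At G (ob E (r i)) (t (r i)) = FunA A' (f i) (t' (s i)) \<and> (ty m E t E' t' G \<longrightarrow> T m (f i)))"
proof -
  note E = CP_seq[OF c(1)] and E' = CP_seq[OF c(2)] and mA' = CP_mod[OF c(2)] and p' = CP_pres[OF c(2)]
  obtain N where N: "\<And>j. j \<ge> N \<Longrightarrow> ty m E t E' t' G \<Longrightarrow> tyF m (ob E j) E' A' t' (At G (ob E j) (t j))"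
    using tyD[OF _ G] by blast
  define r where "r = (\<lambda>i. N + i)"
  have r: "strict_mono r" by (simp add: r_def strict_mono_def)
  let ?P = "\<lambda>i (s, f). f \<in> Hom C (ob E (r i)) (ob E' s) \<and> At G (ob E (r i)) (t (r i)) = FunA A' f (t' s) \<and>
    (ty m E t E' t' G \<longrightarrow> T m f)"
  let ?Q = "\<lambda>i (s, f) (s', f'). s < s' \<and> f' \<cdot> E (r i) = transition C E' s s' \<cdot> f"
  have ex: "\<exists>k\<ge>K. \<exists>f. ?P i (k, f)" for i K
  proof -
    have el: "At G (ob E (r i)) (t (r i)) \<in> el A' (ob E (r i))" by (rule MH_closed[OF G CP_Obj[OF c(1)] CP_el[OF c(1)]])
    obtain k f where k: "k \<ge> K" and f: "f \<in> Hom C (ob E (r i)) (ob E' k)" "At G (ob E (r i)) (t (r i)) = FunA A' f (t' k)"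
      using pres_surj_ge[OF E' mA' p' CP_Obj[OF c(1)] el] by blast
    show ?thesis
    proof (cases "ty m E t E' t' G")
      case True
      have "tyF m (ob E (r i)) E' A' t' (At G (ob E (r i)) (t (r i)))" by (rule N[OF _ True]) (simp add: r_def)
      from tyF_lift[OF c(2) this f(1) f(2)[symmetric]]
      obtain L where L: "\<And>l. l \<ge> L \<Longrightarrow> k \<le> l \<and> T m (transition C E' k l \<cdot> f)" by blast
      have kL: "k \<le> L" using L[OF le_refl] by simp
      have "?P i (L, transition C E' k L \<cdot> f)"
        using trans_push[OF E' f(1) kL] pres_push[OF E' mA' p' f(1) kL] f(2) L[OF le_refl] by simp
      then show ?thesis using k kL by (meson le_trans)
    next
      case False then show ?thesis using k f by blast
    qed
  qed
  have step: "\<exists>y. ?P (Suc i) y \<and> ?Q i x y" if x: "?P i x" for i x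
  proof -
    obtain s f where xe: "x = (s, f)" by (cases x)
    have f: "f \<in> Hom C (ob E (r i)) (ob E' s)" "At G (ob E (r i)) (t (r i)) = FunA A' f (t' s)" using x xe by auto
    obtain k f1 where k: "k \<ge> Suc s" and "?P (Suc i) (k, f1)" using ex by blast
    then have f1: "f1 \<in> Hom C (ob E (r (Suc i))) (ob E' k)" "At G (ob E (r (Suc i))) (t (r (Suc i))) = FunA A' f1 (t' k)"
      "ty m E t E' t' G \<longrightarrow> T m f1" by auto
    have Er: "E (r i) \<in> Hom C (ob E (r i)) (ob E (r (Suc i)))" using seq_Hom[OF E, of "r i"] by (simp add: r_def)
    have "FunA A' (f1 \<cdot> E (r i)) (t' k) = FunA A' (E (r i)) (At G (ob E (r (Suc i))) (t (r (Suc i))))"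
      using act_comp[OF mA' Er f1(1) CP_el[OF c(2)]] f1(2) by simp
    also have "\<dots> = At G (ob E (r i)) (t (r i))"
      using MH_act[OF G Er CP_el[OF c(1)]] pres_step[OF CP_pres[OF c(1)], of "r i"] by (simp add: r_def)
    finally have "FunA A' (f1 \<cdot> E (r i)) (t' k) = FunA A' f (t' s)" using f(2) by simp
    from pres_inj_ge[OF E' mA' p' Comp_Hom[OF Er f1(1)] f(1) this]
    obtain L where L: "\<And>l. l \<ge> L \<Longrightarrow> k \<le> l \<and> s \<le> l \<and> transition C E' k l \<cdot> (f1 \<cdot> E (r i)) = transition C E' s l \<cdot> f" by blast
    obtain N' where N': "\<And>j l. \<lbrakk>j \<ge> N'; l \<ge> j\<rbrakk> \<Longrightarrow> T m (transition C E' j l)" using cauchyD[OF CP_cauchy[OF c(2)]] by blast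
    obtain L' where L': "\<And>l. l \<ge> L' \<Longrightarrow> ty m E t E' t' G \<Longrightarrow> T m (transition C E' k l \<cdot> f1)"
    proof (cases "ty m E t E' t' G")
      case True
      have "tyF m (ob E (r (Suc i))) E' A' t' (At G (ob E (r (Suc i))) (t (r (Suc i))))" by (rule N[OF _ True]) (simp add: r_def)
      from tyF_lift[OF c(2) this f1(1) f1(2)[symmetric]] that show thesis by blast
    qed (use that in blast)
    define l where "l = max L L'"
    have l: "k \<le> l" "s \<le> l" "transition C E' k l \<cdot> (f1 \<cdot> E (r i)) = transition C E' s l \<cdot> f"
      "ty m E t E' t' G \<Longrightarrow> T m (transition C E' k l \<cdot> f1)" using L[of l] L'[of l] by (auto simp: l_def)
    let ?f = "transition C E' k l \<cdot> f1"
    have "?P (Suc i) (l, ?f)"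
      using trans_push[OF E' f1(1) l(1)] pres_push[OF E' mA' p' f1(1) l(1)] f1(2) l(4) by simp
    moreover have "?Q i x (l, ?f)" unfolding xe
      using k l(1,3) Comp_assoc[OF Er f1(1) trans_Hom[OF E' l(1)]] by simp
    ultimately show ?thesis by blast
  qed
  have "\<exists>F. \<forall>i. ?P i (F i) \<and> ?Q i (F i) (F (Suc i))"
  proof (rule dependent_nat_choice)
    show "\<exists>x. ?P 0 x" using ex by blast
    fix x i assume "?P i x" then show "\<exists>y. ?P (Suc i) y \<and> ?Q i x y" by (rule step)
  qed
  then obtain Fs where Fs: "\<forall>i. ?P i (Fs i) \<and> ?Q i (Fs i) (Fs (Suc i))" by (rule exE)
  define s where "s i = fst (Fs i)" for i
  define f where "f i = snd (Fs i)" for i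
  have P: "f i \<in> Hom C (ob E (r i)) (ob E' (s i))" "At G (ob E (r i)) (t (r i)) = FunA A' (f i) (t' (s i))"
    "ty m E t E' t' G \<longrightarrow> T m (f i)" and Q: "s i < s (Suc i)" "f (Suc i) \<cdot> E (r i) = transition C E' (s i) (s (Suc i)) \<cdot> f i" for i
    using spec[OF Fs, of i] unfolding s_def f_def by (auto simp: case_prod_beta)
  have s: "strict_mono s" using Q(1) by (simp add: strict_mono_Suc_iff)
  have "seq_map C (subsequence C E r) (subsequence C E' s) f"
    unfolding seq_map_def subseq_seq(2)[OF E r] subseq_seq(2)[OF E' s]
  proof (intro allI conjI P(1))
    fix n
    have "subsequence C E r n = E (r n)" unfolding subsequence_def using trans_step[OF E, of "r n"] by (simp add: r_def)
    then show "f (Suc n) \<cdot> subsequence C E r n = subsequence C E' s n \<cdot> f n"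
      using Q(2)[of n] by (simp add: subsequence_def)
  qed
  then show ?thesis using r s P(2,3) by blast
qed

text \<open>\<open>T_fill\<close> bounds the connecting map between two cones for every index at
  once in terms of the arrows of \<open>a\<close> and \<open>b\<close>. Hence the cones form a
  Cauchy sequence.\<close>

lemma complete_cone:
  assumes a: "cauchy C M a" and b: "cauchy C M b" and f: "seq_map C a b f"
  shows "\<exists>c g h. cauchy_triangles C M a b c f g h \<and> (\<forall>n m. T m (f n) \<longrightarrow> ob c n \<in> M m)"
proof -
  note sa = cauchy_seq[OF a] and sb = cauchy_seq[OF b]
  have fH: "f n \<in> Hom C (ob a n) (ob b n)" "f (Suc n) \<cdot> a n = b n \<cdot> f n" for n using f by (auto simp: seq_map_def)
  have "\<forall>n. \<exists>z g h. tri (ob a n) (ob b n) z (f n) g h" using tri_exists[OF fH(1)] by blast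
  then obtain z g h where t: "\<And>n. tri (ob a n) (ob b n) (z n) (f n) (g n) (h n)" by metis
  have "\<exists>w. w \<in> Hom C (z n) (z (Suc n)) \<and> w \<cdot> g n = g (Suc n) \<cdot> b n \<and> ShA C (a n) \<cdot> h n = h (Suc n) \<cdot> w \<and>
      (\<forall>i. T (Suc i) (a n) \<longrightarrow> T (Suc i) (b n) \<longrightarrow> T i w)" for n
    using T_fill[OF t[of n] t[of "Suc n"] seq_Hom[OF sa] seq_Hom[OF sb] fH(2)[symmetric]] by blast
  then obtain c where cH: "\<And>n. c n \<in> Hom C (z n) (z (Suc n))" and cg: "\<And>n. c n \<cdot> g n = g (Suc n) \<cdot> b n"
    and ch: "\<And>n. ShA C (a n) \<cdot> h n = h (Suc n) \<cdot> c n" and cT: "\<And>n i. T (Suc i) (a n) \<Longrightarrow> T (Suc i) (b n) \<Longrightarrow> T i (c n)" by metis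
  have sc: "is_seq C c" and oc: "\<And>n. ob c n = z n" using is_seqI[of c z, OF cH] by auto
  have cc: "cauchy C M c"
  proof (rule cauchyI[OF sc])
    fix i
    obtain N where N: "\<And>j k. \<lbrakk>j \<ge> N; k \<ge> j\<rbrakk> \<Longrightarrow> T (Suc i) (transition C a j k)" using cauchyD[OF a] by blast
    obtain N' where N': "\<And>j k. \<lbrakk>j \<ge> N'; k \<ge> j\<rbrakk> \<Longrightarrow> T (Suc i) (transition C b j k)" using cauchyD[OF b] by blast
    have "T i (c n)" if "n \<ge> max N N'" for n
      using cT[of n i] N[of n "Suc n"] N'[of n "Suc n"] trans_step[OF sa] trans_step[OF sb] that by simp
    then show "\<exists>N. \<forall>n\<ge>N. T i (c n)" by blast
  qed
  have "cauchy_triangles C M a b c f g h"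
    unfolding cauchy_triangles_def seq_map_def oc shift_seq(2)[OF sa]
    using a b cc fH tri2[OF t] tri3[OF t] tri_Tri[OF t] cg ch by simp
  moreover have "ob c n \<in> M m" if "T m (f n)" for n m unfolding oc by (rule T_cone[OF fH(1) that t])
  ultimately show ?thesis by blast
qed

text \<open>Filtered colimits are exact. The stagewise exactness is an abstract hypothesis, so that
  the same argument covers the three consecutive pairs of maps in a sequence of triangles.\<close>

lemma seq_exact:
  assumes c: "CP a A \<alpha>" "CP b B \<beta>" "CP d D \<delta>" and F: "F \<in> Hom (ModCat C) A B" and G: "G \<in> Hom (ModCat C) B D"
    and f: "seq_map C a b f" and g: "seq_map C b d g"
    and Fa: "\<And>n. At F (ob a n) (\<alpha> n) = FunA B (f n) (\<beta> n)" and Gb: "\<And>n. At G (ob b n) (\<beta> n) = FunA D (g n) (\<delta> n)"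
    and z: "\<And>n. g n \<cdot> f n = ZeroArr C (ob a n) (ob d n)"
    and ex: "\<And>n x v. \<lbrakk>v \<in> Hom C x (ob b n); g n \<cdot> v = ZeroArr C x (ob d n)\<rbrakk> \<Longrightarrow> \<exists>u \<in> Hom C x (ob a n). f n \<cdot> u = v"
    and x: "x \<in> Obj C"
  shows "w \<in> el A x \<Longrightarrow> At G x (At F x w) = \<one>\<^bsub>FunO D x\<^esub>"
    and "\<lbrakk>v \<in> el B x; At G x v = \<one>\<^bsub>FunO D x\<^esub>\<rbrakk> \<Longrightarrow> \<exists>w \<in> el A x. v = At F x w"
proof -
  note sa = CP_seq[OF c(1)] and sb = CP_seq[OF c(2)] and sd = CP_seq[OF c(3)]
  note mA = CP_mod[OF c(1)] and mB = CP_mod[OF c(2)] and mD = CP_mod[OF c(3)]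
  have fH: "f n \<in> Hom C (ob a n) (ob b n)" and gH: "g n \<in> Hom C (ob b n) (ob d n)" for n
    using f g by (auto simp: seq_map_def)
  { assume w: "w \<in> el A x"
    obtain n \<phi> where \<phi>: "\<phi> \<in> Hom C x (ob a n)" "w = FunA A \<phi> (\<alpha> n)" using pres_surj[OF CP_pres[OF c(1)] x w] by blast
    have "At F x w = FunA B (f n \<cdot> \<phi>) (\<beta> n)"
      using MH_act[OF F \<phi>(1) CP_el[OF c(1)]] Fa act_comp[OF mB \<phi>(1) fH CP_el[OF c(2)]] \<phi>(2) by simp
    then have "At G x (At F x w) = FunA D (g n \<cdot> (f n \<cdot> \<phi>)) (\<delta> n)"
      using MH_act[OF G Comp_Hom[OF \<phi>(1) fH] CP_el[OF c(2)]] Gb act_comp[OF mD Comp_Hom[OF \<phi>(1) fH] gH CP_el[OF c(3)]] by simp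
    also have "g n \<cdot> (f n \<cdot> \<phi>) = ZeroArr C x (ob d n)"
      using Comp_assoc[OF \<phi>(1) fH gH] z Zero_Comp[OF \<phi>(1) CP_Obj[OF c(3)]] by simp
    also have "FunA D (ZeroArr C x (ob d n)) (\<delta> n) = \<one>\<^bsub>FunO D x\<^esub>" by (rule act_Zero[OF mD x CP_Obj[OF c(3)] CP_el[OF c(3)]])
    finally show "At G x (At F x w) = \<one>\<^bsub>FunO D x\<^esub>" . }
  assume v: "v \<in> el B x" and Gv: "At G x v = \<one>\<^bsub>FunO D x\<^esub>"
  obtain n \<phi> where \<phi>: "\<phi> \<in> Hom C x (ob b n)" "v = FunA B \<phi> (\<beta> n)" using pres_surj[OF CP_pres[OF c(2)] x v] by blast
  have "FunA D (g n \<cdot> \<phi>) (\<delta> n) = FunA D (ZeroArr C x (ob d n)) (\<delta> n)"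
    using MH_act[OF G \<phi>(1) CP_el[OF c(2)]] Gb act_comp[OF mD \<phi>(1) gH CP_el[OF c(3)]] \<phi>(2) Gv
      act_Zero[OF mD x CP_Obj[OF c(3)] CP_el[OF c(3)]] by simp
  then obtain k where k: "k \<ge> n" "transition C d n k \<cdot> (g n \<cdot> \<phi>) = transition C d n k \<cdot> ZeroArr C x (ob d n)"
    using pres_inj[OF CP_pres[OF c(3)] Comp_Hom[OF \<phi>(1) gH] Zero_Hom[OF x CP_Obj[OF c(3)]]] by blast
  note td = trans_Hom[OF sd k(1)] and tb = trans_Hom[OF sb k(1)]
  have "g k \<cdot> (transition C b n k \<cdot> \<phi>) = ZeroArr C x (ob d k)"
    using Comp_assoc[OF \<phi>(1) tb gH] Comp_assoc[OF \<phi>(1) gH td] map_trans[OF sb sd g k(1)] k(2) Comp_Zero[OF td x] by simp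
  then obtain u where u: "u \<in> Hom C x (ob a k)" "f k \<cdot> u = transition C b n k \<cdot> \<phi>"
    using ex[OF Comp_Hom[OF \<phi>(1) tb]] by blast
  have "v = At F x (FunA A u (\<alpha> k))"
    using pres_push[OF sb mB CP_pres[OF c(2)] \<phi>(1) k(1)] \<phi>(2) u(2) act_comp[OF mB u(1) fH CP_el[OF c(2)]] Fa
      MH_act[OF F u(1) CP_el[OF c(1)]] by simp
  then show "\<exists>w \<in> el A x. v = At F x w" using act_closed[OF mA u(1) CP_el[OF c(1)]] by blast
qed

lemma ST_exact:
  fixes F :: "('o, 'm, 'u) presheaf_map"
  assumes s: "ST C M a \<alpha> b \<beta> c \<gamma> f g h A B D F G H" and x: "x \<in> Obj C"
  shows ST_GF: "w \<in> el A x \<Longrightarrow> At G x (At F x w) = \<one>\<^bsub>FunO D x\<^esub>"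
    and ST_exB: "\<lbrakk>v \<in> el B x; At G x v = \<one>\<^bsub>FunO D x\<^esub>\<rbrakk> \<Longrightarrow> \<exists>w \<in> el A x. v = At F x w"
    and ST_HG: "w' \<in> el B x \<Longrightarrow> At H x (At G x w') = \<one>\<^bsub>FunO (ShO (ModCat C) A) x\<^esub>"
    and ST_exD: "\<lbrakk>v' \<in> el D x; At H x v' = \<one>\<^bsub>FunO (ShO (ModCat C) A) x\<^esub>\<rbrakk> \<Longrightarrow> \<exists>w \<in> el B x. v' = At G x w"
    and ST_FH: "w'' \<in> el D x \<Longrightarrow> At (ShA (ModCat C) F) x (At H x w'') = \<one>\<^bsub>FunO (ShO (ModCat C) B) x\<^esub>"
    and ST_exA: "\<lbrakk>v'' \<in> el (ShO (ModCat C) A) x; At (ShA (ModCat C) F) x v'' = \<one>\<^bsub>FunO (ShO (ModCat C) B) x\<^esub>\<rbrakk>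
      \<Longrightarrow> \<exists>w \<in> el D x. v'' = At H x w"
proof -
  note cp = ST_CP[OF s] and hom = ST_Hom[OF s] and mp = ST_map[OF s] and at = ST_at[OF s] and t = ST_tri[OF s]
  note sa = CP_seq[OF cp(1)] and sb = CP_seq[OF cp(2)] and o = CP_Obj[OF cp(1)] CP_Obj[OF cp(2)]
  note csa = CP_shift[OF cp(1)] and csb = CP_shift[OF cp(2)]
  have osa: "ob (\<lambda>n. ShA C (a n)) n = ShO C (ob a n)" and osb: "ob (\<lambda>n. ShA C (b n)) n = ShO C (ob b n)" for n
    by (rule shift_seq(2)[OF sa] shift_seq(2)[OF sb])+
  have mf: "seq_map C (\<lambda>n. ShA C (a n)) (\<lambda>n. ShA C (b n)) (\<lambda>n. ShA C (f n))"
    unfolding seq_map_def osa osb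
  proof (intro allI conjI)
    fix n show "ShA C (f n) \<in> Hom C (ShO C (ob a n)) (ShO C (ob b n))" by (rule ShA_Hom[OF tri1[OF t]])
    show "ShA C (f (Suc n)) \<cdot> ShA C (a n) = ShA C (b n) \<cdot> ShA C (f n)"
      using ShA_Comp[OF seq_Hom[OF sa] tri1[OF t], of n] ShA_Comp[OF tri1[OF t] seq_Hom[OF sb], of n] mp(1)
      by (simp add: seq_map_def)
  qed
  have atF: "At (ShA (ModCat C) F) (ob (\<lambda>n. ShA C (a n)) n) (\<alpha> n) = FunA (ShO (ModCat C) B) (ShA C (f n)) (\<beta> n)" for n
    using at(1)[of n] Hom_Arr[OF ShA_Hom[OF tri1[OF t]], of n] Hom_Arr[OF tri1[OF t], of n]
    by (simp add: osa shM_simps ShO_Obj[OF o(1)] UnO_ShO[OF o(1)] UnA_ShA)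
  \<comment> \<open>Rotating twice puts a sign on the shift of \<open>f n\<close>. A sign affects
    neither zero composites nor kernels, so it may be dropped.\<close>
  have hn: "(Neg C (ShA C (f n)) \<cdot> v = ZeroArr C y (ShO C (ob b n))) \<longleftrightarrow> (ShA C (f n) \<cdot> v = ZeroArr C y (ShO C (ob b n)))"
    if v: "v \<in> Hom C y (ShO C (ob a n))" for v y n
  proof -
    note sf = ShA_Hom[OF tri1[OF t[of n]]]
    have "Neg C (ShA C (f n)) \<cdot> v = Neg C (ShA C (f n) \<cdot> v)" by (rule Neg_Comp[OF v sf])
    then show ?thesis
      using Neg_Zero[OF Hom_Obj(1)[OF v] Hom_Obj(2)[OF sf]] Neg_inj[OF Comp_Hom[OF v sf] Zero_Hom[OF Hom_Obj(1)[OF v] Hom_Obj(2)[OF sf]]] by auto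
  qed
  have z1: "g n \<cdot> f n = ZeroArr C (ob a n) (ob c n)" for n by (rule tri_comp_zero[OF t])
  have z2: "h n \<cdot> g n = ZeroArr C (ob b n) (ob (\<lambda>n. ShA C (a n)) n)" for n
    unfolding osa by (rule tri_comp_zero[OF rot[OF t]])
  have z3: "ShA C (f n) \<cdot> h n = ZeroArr C (ob c n) (ob (\<lambda>n. ShA C (b n)) n)" for n
    unfolding osb using tri_comp_zero[OF rot[OF rot[OF t]]] hn[OF tri3[OF t]] by simp
  note e1 = tri_exact[OF t]
  have e2: "\<exists>u \<in> Hom C x (ob b n). g n \<cdot> u = v"
    if "v \<in> Hom C x (ob c n)" "h n \<cdot> v = ZeroArr C x (ob (\<lambda>n. ShA C (a n)) n)" for n x v
    using tri_exact[OF rot[OF t] that(1)] that(2) unfolding osa by blast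
  have e3: "\<exists>u \<in> Hom C x (ob c n). h n \<cdot> u = v"
    if "v \<in> Hom C x (ob (\<lambda>n. ShA C (a n)) n)" "ShA C (f n) \<cdot> v = ZeroArr C x (ob (\<lambda>n. ShA C (b n)) n)" for n x v
    using tri_exact[OF rot[OF rot[OF t]]] that hn unfolding osa osb by blast
  show "w \<in> el A x \<Longrightarrow> At G x (At F x w) = \<one>\<^bsub>FunO D x\<^esub>"
    "\<lbrakk>v \<in> el B x; At G x v = \<one>\<^bsub>FunO D x\<^esub>\<rbrakk> \<Longrightarrow> \<exists>w \<in> el A x. v = At F x w"
    by (rule seq_exact[OF cp hom(1,2) mp(1,2) at(1,2) z1 e1 x]; assumption)+
  show "w' \<in> el B x \<Longrightarrow> At H x (At G x w') = \<one>\<^bsub>FunO (ShO (ModCat C) A) x\<^esub>"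
    "\<lbrakk>v' \<in> el D x; At H x v' = \<one>\<^bsub>FunO (ShO (ModCat C) A) x\<^esub>\<rbrakk> \<Longrightarrow> \<exists>w \<in> el B x. v' = At G x w"
    by (rule seq_exact[OF cp(2,3) csa hom(2,3) mp(2,3) at(2,3) z2 e2 x]; assumption)+
  show "w'' \<in> el D x \<Longrightarrow> At (ShA (ModCat C) F) x (At H x w'') = \<one>\<^bsub>FunO (ShO (ModCat C) B) x\<^esub>"
    "\<lbrakk>v'' \<in> el (ShO (ModCat C) A) x; At (ShA (ModCat C) F) x v'' = \<one>\<^bsub>FunO (ShO (ModCat C) B) x\<^esub>\<rbrakk> \<Longrightarrow> \<exists>w \<in> el D x. v'' = At H x w"
    by (rule seq_exact[OF cp(3) csa csb hom(3) MShA_Hom[OF hom(1)] mp(3) mf at(3) atF z3 e3 x]; assumption)+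
qed

text \<open>In the exact sequence \<open>D\<close> lies between \<open>B\<close> and the shift of
  \<open>A\<close>; this shift raises the bound by one.\<close>

lemma ST_vanish_cone:
  fixes F :: "('o, 'm, 'u) presheaf_map"
  assumes s: "ST C M a \<alpha> b \<beta> c \<gamma> f g h A B D F G H" and A: "vanish A i" and B: "vanish B i"
  shows "vanish D (Suc i)"
  unfolding vanish_def
proof (intro ballI)
  fix m v assume m: "m \<in> M (Suc i)" and v: "v \<in> el D m"
  have o: "m \<in> Obj C" using m metric_Obj by blast
  note hom = ST_Hom[OF s]
  have "At H m v = \<one>\<^bsub>FunO (ShO (ModCat C) A) m\<^esub>"
    by (rule vanishD[OF vanish_shift[OF MH_mod(1)[OF hom(1)] A] m MH_closed[OF hom(3) o v]])
  then obtain w where w: "w \<in> el B m" "v = At G m w" using ST_exD[OF s o v] by blast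
  have "w = \<one>\<^bsub>FunO B m\<^esub>" using vanishD[OF B _ w(1)] m M_Suc by blast
  then show "v = \<one>\<^bsub>FunO D m\<^esub>" using w(2) MH_one[OF hom(2) o] by simp
qed

lemma ST_vanish_mid:
  fixes F :: "('o, 'm, 'u) presheaf_map"
  assumes s: "ST C M a \<alpha> b \<beta> c \<gamma> f g h A B D F G H" and A: "vanish A i" and D: "vanish D i"
  shows "vanish B i"
  unfolding vanish_def
proof (intro ballI)
  fix m v assume m: "m \<in> M i" and v: "v \<in> el B m"
  have o: "m \<in> Obj C" using m metric_Obj by blast
  note hom = ST_Hom[OF s]
  have "At G m v = \<one>\<^bsub>FunO D m\<^esub>" by (rule vanishD[OF D m MH_closed[OF hom(2) o v]])
  then obtain w where w: "w \<in> el A m" "v = At F m w" using ST_exB[OF s o v] by blast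
  then show "v = \<one>\<^bsub>FunO B m\<^esub>" using vanishD[OF A m w(1)] w(2) MH_one[OF hom(1) o] by simp
qed

text \<open>The map is lifted to subsequences, completed by cones at every stage, and the colimit is
  taken. The vertex comes with the presentation by these cones, so the type of \<open>q\<close>
  bounds its terms.\<close>

lemma ST_of_map:
  assumes c: "CP x X s" "CP y Y t" and q: "q \<in> Hom (ModCat C) X Y"
  shows "\<exists>r r' c \<gamma> f g h D G H. strict_mono r \<and> strict_mono r' \<and>
    ST C M (subsequence C x r) (\<lambda>n. s (r n)) (subsequence C y r') (\<lambda>n. t (r' n)) c \<gamma> f g h X Y D q G H \<and>
    (ty m x s y t q \<longrightarrow> (\<forall>n. ob c n \<in> M m))"
proof -
  obtain r r' f where r: "strict_mono r" "strict_mono r'" and f: "seq_map C (subsequence C x r) (subsequence C y r') f"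
    and fa: "\<And>i. At q (ob x (r i)) (s (r i)) = FunA Y (f i) (t (r' i))" and fT: "\<And>i. ty m x s y t q \<Longrightarrow> T m (f i)"
    using lift_seq[OF c q, of m] by blast
  note c1 = CP_subseq[OF c(1) r(1)] and c2 = CP_subseq[OF c(2) r(2)]
  obtain d g h where d: "cauchy_triangles C M (subsequence C x r) (subsequence C y r') d f g h"
    and dM: "\<And>n m. T m (f n) \<Longrightarrow> ob d n \<in> M m" using complete_cone[OF CP_cauchy[OF c1] CP_cauchy[OF c2] f] by blast
  have cd: "cauchy C M d" and g: "seq_map C (subsequence C y r') d g" and h: "seq_map C d (\<lambda>n. ShA C (subsequence C x r n)) h"
    using d unfolding cauchy_triangles_def by auto
  obtain D \<gamma> where D: "CP d D \<gamma>" using CP_exists[OF cd] by blast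
  obtain G where G: "G \<in> Hom (ModCat C) Y D" "\<And>n. At G (ob (subsequence C y r') n) (t (r' n)) = FunA D (g n) (\<gamma> n)"
    using map_of_seq_map[OF c2 D g] by blast
  obtain H where H: "H \<in> Hom (ModCat C) D (ShO (ModCat C) X)" "\<And>n. At H (ob d n) (\<gamma> n) = FunA (ShO (ModCat C) X) (h n) (s (r n))"
    using map_of_seq_map[OF D CP_shift[OF c1] h] by blast
  have "ST C M (subsequence C x r) (\<lambda>n. s (r n)) (subsequence C y r') (\<lambda>n. t (r' n)) d \<gamma> f g h X Y D q G H"
    unfolding ST_def using d CP_mod[OF c(1)] CP_mod[OF c(2)] CP_mod[OF D] CP_pres[OF c1] CP_pres[OF c2] CP_pres[OF D]
      q G H fa by (simp add: subseq_seq(2)[OF CP_seq[OF c(1)] r(1)])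
  then show ?thesis using r dM fT by blast
qed

text \<open>Here \<open>q\<close> is the last map of the triangle, because cones in the opposite
  category are fibres. The cone triangles of a lift of \<open>q\<close> are rotated backwards twice;
  the signs fall on the first two maps. The terms of \<open>B\<close> are desuspended cones, so
  \<open>M (Suc m)\<close> becomes \<open>M m\<close>.\<close>

lemma ST_fiber:
  assumes c: "CP x X s" "CP y Y t" and q: "q \<in> Hom (ModCat C) X Y" and ty: "ty (Suc m) x s y t q"
  shows "\<exists>a \<alpha> b \<beta> c \<gamma> f g h B F G. ST C M a \<alpha> b \<beta> c \<gamma> f g h (unshO C Y) B X F G q \<and> B \<in> LiObj e C M m"
proof -
  obtain r r' f where r: "strict_mono r" "strict_mono r'" and f: "seq_map C (subsequence C x r) (subsequence C y r') f"
    and fa: "\<And>i. At q (ob x (r i)) (s (r i)) = FunA Y (f i) (t (r' i))" and fT: "\<And>i. T (Suc m) (f i)"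
    using lift_seq[OF c q, of "Suc m"] ty by blast
  define x' where "x' = subsequence C x r"
  define y' where "y' = subsequence C y r'"
  have c1: "CP x' X (\<lambda>n. s (r n))" and c2: "CP y' Y (\<lambda>n. t (r' n))"
    unfolding x'_def y'_def by (rule CP_subseq[OF c(1) r(1)], rule CP_subseq[OF c(2) r(2)])
  note sx = CP_seq[OF c1] and sy = CP_seq[OF c2]
  obtain z g h where z: "cauchy_triangles C M x' y' z f g h" and zM: "\<And>n m. T m (f n) \<Longrightarrow> ob z n \<in> M m"
    using complete_cone[OF CP_cauchy[OF c1] CP_cauchy[OF c2]] f unfolding x'_def y'_def by blast
  have cz: "cauchy C M z" and mg: "seq_map C y' z g" and mh: "seq_map C z (\<lambda>n. ShA C (x' n)) h" and mf: "seq_map C x' y' f"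
    using z unfolding cauchy_triangles_def by auto
  note sz = cauchy_seq[OF cz]
  have t0: "tri (ob x' n) (ob y' n) (ob z n) (f n) (g n) (h n)" for n
    using z shift_seq(2)[OF sx] unfolding cauchy_triangles_def seq_map_def tri_def by auto
  define a where "a = (\<lambda>n. UnA C (y' n))"
  define b where "b = (\<lambda>n. UnA C (z n))"
  define f0 where "f0 = (\<lambda>n. Neg C (UnA C (g n)))"
  define g0 where "g0 = (\<lambda>n. Neg C (UnA C (h n)))"
  have ca: "CP a (unshO C Y) (\<lambda>n. t (r' n))" unfolding a_def by (rule CP_unshift[OF c2])
  have cb: "cauchy C M b" unfolding b_def by (rule cauchy_unshift[OF cz])
  obtain B \<beta> where B: "CP b B \<beta>" using CP_exists[OF cb] by blast
  have oa: "ob a n = UnO C (ob y' n)" and ob': "ob b n = UnO C (ob z n)" for n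
    unfolding a_def b_def by (rule unshift_seq(2)[OF sy], rule unshift_seq(2)[OF sz])
  have t1: "tri (ob a n) (ob b n) (ob x' n) (f0 n) (g0 n) (f n)" for n
    unfolding oa ob' f0_def g0_def by (rule unrot[OF unrot[OF t0]])
  have sha: "ShA C (a n) = y' n" for n unfolding a_def by (rule ShA_UnA[OF Hom_Arr[OF seq_Hom[OF sy]]])
  note gH = tri2[OF t0] and hH = tri3[OF t0]
  have m1: "seq_map C a b f0" unfolding seq_map_def
  proof (intro allI conjI)
    fix n show "f0 n \<in> Hom C (ob a n) (ob b n)" by (rule tri1[OF t1])
    have "UnA C (g (Suc n)) \<cdot> a n = b n \<cdot> UnA C (g n)"
      unfolding a_def b_def using UnA_Comp[OF seq_Hom[OF sy] gH, of n] UnA_Comp[OF gH seq_Hom[OF sz], of n] mg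
      by (simp add: seq_map_def)
    moreover have ug: "UnA C (g k) \<in> Hom C (ob a k) (ob b k)" for k unfolding oa ob' by (rule UnA_Hom[OF gH])
    ultimately show "f0 (Suc n) \<cdot> a n = b n \<cdot> f0 n" unfolding f0_def
      using Neg_Comp[OF seq_Hom[OF CP_seq[OF ca]] ug] Comp_Neg[OF ug seq_Hom[OF cauchy_seq[OF cb]]] by simp
  qed
  have m2: "seq_map C b x' g0" unfolding seq_map_def
  proof (intro allI conjI)
    fix n show "g0 n \<in> Hom C (ob b n) (ob x' n)" by (rule tri2[OF t1])
    have uh: "UnA C (h k) \<in> Hom C (ob b k) (ob x' k)" for k
      using UnA_Hom[OF hH[of k]] UnO_ShO[OF CP_Obj[OF c1, of k]] unfolding ob' by simp
    have hc: "h (Suc n) \<cdot> z n = ShA C (x' n) \<cdot> h n" using mh by (simp add: seq_map_def)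
    have "UnA C (h (Suc n)) \<cdot> b n = x' n \<cdot> UnA C (h n)"
      unfolding b_def using UnA_Comp[OF seq_Hom[OF sz] hH, of n] UnA_Comp[OF hH ShA_Hom[OF seq_Hom[OF sx]], of n] hc
        UnA_ShA[OF Hom_Arr[OF seq_Hom[OF sx]], of n] by simp
    then show "g0 (Suc n) \<cdot> b n = x' n \<cdot> g0 n" unfolding g0_def
      using Neg_Comp[OF seq_Hom[OF cauchy_seq[OF cb]] uh] Comp_Neg[OF uh seq_Hom[OF sx]] by simp
  qed
  have ct: "cauchy_triangles C M a b x' f0 g0 f"
    unfolding cauchy_triangles_def using CP_cauchy[OF ca] cb CP_cauchy[OF c1] m1 m2 mf tri_Tri[OF t1] by (simp add: sha)
  obtain F where F: "F \<in> Hom (ModCat C) (unshO C Y) B" "\<And>n. At F (ob a n) (t (r' n)) = FunA B (f0 n) (\<beta> n)"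
    using map_of_seq_map[OF ca B m1] by blast
  obtain G where G: "G \<in> Hom (ModCat C) B X" "\<And>n. At G (ob b n) (\<beta> n) = FunA X (g0 n) (s (r n))"
    using map_of_seq_map[OF B c1 m2] by blast
  have ox: "ob x' n = ob x (r n)" for n unfolding x'_def by (rule subseq_seq(2)[OF CP_seq[OF c(1)] r(1)])
  have "ST C M a (\<lambda>n. t (r' n)) b \<beta> x' (\<lambda>n. s (r n)) f0 g0 f (unshO C Y) B X F G q"
    unfolding ST_def sh_unsh[OF CP_mod[OF c(2)]]
    using ct CP_mod[OF ca] CP_mod[OF B] CP_mod[OF c1] CP_pres[OF ca] CP_pres[OF B] CP_pres[OF c1] F G q fa by (simp add: ox)
  moreover have "B \<in> LiObj e C M m" unfolding LiObj_iff
    using B M_UnO[OF zM[OF fT]] ob' by auto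
  ultimately show ?thesis by blast
qed

end

section \<open>The opposite category of the completion\<close>

lemma op_tri_simps [simp]:
  "Obj (op_tri C) = Obj C" "Arr (op_tri C) = Arr C" "Src (op_tri C) = Tgt C" "Tgt (op_tri C) = Src C"
  "Ident (op_tri C) = Ident C" "Comp (op_tri C) g f = f \<cdot>\<^bsub>C\<^esub> g" "Add (op_tri C) = Add C"
  "ZeroArr (op_tri C) x y = ZeroArr C y x" "ShO (op_tri C) = UnO C" "ShA (op_tri C) = UnA C"
  "(f, g, h) \<in> Tri (op_tri C) \<longleftrightarrow> (h, g, f) \<in> Tri C"
  by (simp_all add: op_tri_def)

lemma Hom_op_tri: "Hom (op_tri C) a b = Hom C b a"
  by (auto simp: Hom_def)

lemma shifted_op:
  fixes D :: "('o, 'm, 'y) tri_cat_scheme"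
  assumes D: "shifted D" shows "shifted (op_tri D)"
proof -
  interpret D: shifted D by fact
  have hg: "hom_group (op_tri D) a b = hom_group D b a" for a b by (simp add: hom_group_def Hom_op_tri)
  show ?thesis
  proof (intro shifted.intro preadditive.intro category.intro preadditive_axioms.intro shifted_axioms.intro)
    show "is_functor (op_tri D) (op_tri D) (ShO (op_tri D)) (ShA (op_tri D))"
      unfolding is_functor_def Hom_op_tri op_tri_simps
      using D.UnO_Obj D.UnA_Ident D.UnA_Hom[OF Arr_Hom] D.UnA_Comp[OF _ Arr_Hom] Arr_Hom by (metis)
    show "bij_betw (ShO (op_tri D)) (Obj (op_tri D)) (Obj (op_tri D))"
      using bij_betw_inv_into[OF D.shift_bij_Obj] by (simp add: UnO_def)
    show "bij_betw (ShA (op_tri D)) (Arr (op_tri D)) (Arr (op_tri D))"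
      using bij_betw_inv_into[OF D.shift_bij_Arr] by (simp add: UnA_def)
    fix a b assume "a \<in> Obj (op_tri D)" "b \<in> Obj (op_tri D)"
    then show "comm_group (hom_group (op_tri D) a b)" unfolding hg using D.hom_comm_group by simp
  qed (simp_all add: Hom_op_tri D.Src_Obj D.Tgt_Obj D.Ident_Hom D.Comp_Hom D.Comp_Ident D.Ident_Comp D.Comp_assoc
      D.Comp_Add D.Add_Comp D.UnA_Add)
qed

lemma SCat_simps [simp]:
  "Obj (SCat e C M) = SObj e C M"
  "Arr (SCat e C M) = {\<eta>. is_module_map C \<eta> \<and> MSrc \<eta> \<in> SObj e C M \<and> MTgt \<eta> \<in> SObj e C M}"
  "Src (SCat e C M) = MSrc" "Tgt (SCat e C M) = MTgt"
  "Ident (SCat e C M) = Ident (ModCat C)" "Comp (SCat e C M) = Comp (ModCat C)"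
  "Add (SCat e C M) = Add (ModCat C)" "ZeroArr (SCat e C M) = ZeroArr (ModCat C)"
  "ShO (SCat e C M) = ShO (ModCat C)" "ShA (SCat e C M) = ShA (ModCat C)"
  "Tri (SCat e C M) = {(F, G, H). (F, G, H) \<in> strong_triangles e C M \<and>
     MSrc F \<in> SObj e C M \<and> MSrc G \<in> SObj e C M \<and> MSrc H \<in> SObj e C M}"
  by (auto simp: SCat_def shift_cat.defs tri_cat.defs full_subcat_def)

locale exc = met C M e + excellent_metric C M e
  for C :: "('o, 'm, 'z) tri_cat_scheme" (structure) and M :: "nat \<Rightarrow> 'o set" and e :: "'m \<Rightarrow> 'u"
begin

abbreviation "X \<equiv> SObj e C M"

lemma Hom_SCat: "Hom (SCat e C M) A B = (if A \<in> X \<and> B \<in> X then Hom (ModCat C) A B else {})"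
  by (auto simp: Hom_def)

lemma X_mod: "A \<in> X \<Longrightarrow> is_module C A"
  using SObj_homol homol_mod by blast

lemma XI: "\<lbrakk>CP E A t; vanish A i\<rbrakk> \<Longrightarrow> A \<in> X"
  unfolding SObj_iff by blast

lemma X_E: assumes "A \<in> X" obtains E t i where "CP E A t" "vanish A i"
  using assms unfolding SObj_iff by blast

text \<open>The compactly supported objects form a full subcategory of modules closed under the
  shift and its inverse, so all the structure restricts.\<close>

lemma shifted_SCat: "shifted (SCat e C M)"
proof -
  interpret D: shifted "ModCat C :: (('o, 'm, 'u) presheaf, ('o, 'm, 'u) presheaf_map) shift_cat" by (rule shifted_ModCat)
  have hg: "hom_group (SCat e C M) A B = hom_group (ModCat C) A B" if "A \<in> X" "B \<in> X" for A B
    using that by (simp add: hom_group_def Hom_SCat)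
  have mX: "A \<in> X \<Longrightarrow> A \<in> Obj (ModCat C)" for A using X_mod by simp
  have sh: "ShO (ModCat C) A \<in> X" "unshO C A \<in> X" if "A \<in> X" for A using SObj_shift[OF that] SObj_unshift[OF that] by auto
  have mm: "\<eta> \<in> Hom (ModCat C) (MSrc \<eta>) (MTgt \<eta>)" if "is_module_map C \<eta>" for \<eta> :: "('o, 'm, 'u) presheaf_map"
    using that by (simp add: Hom_ModCat)
  have sA: "is_module_map C (ShA (ModCat C) \<eta>)" "MSrc (ShA (ModCat C) \<eta>) = ShO (ModCat C) (MSrc \<eta>)"
    "MTgt (ShA (ModCat C) \<eta>) = ShO (ModCat C) (MTgt \<eta>)" if "is_module_map C \<eta>" for \<eta> :: "('o, 'm, 'u) presheaf_map"
    using MShA_Hom[OF mm[OF that]] by (auto simp: Hom_ModCat)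
  have uA: "is_module_map C (unshA C \<eta>)" "MSrc (unshA C \<eta>) = unshO C (MSrc \<eta>)"
    "MTgt (unshA C \<eta>) = unshO C (MTgt \<eta>)" if "is_module_map C \<eta>" for \<eta> :: "('o, 'm, 'u) presheaf_map"
    using unshA_Hom[OF mm[OF that]] by (auto simp: Hom_ModCat)
  show ?thesis
  proof (intro shifted.intro preadditive.intro category.intro preadditive_axioms.intro shifted_axioms.intro)
    show "is_functor (SCat e C M) (SCat e C M) (ShO (SCat e C M)) (ShA (SCat e C M))"
      unfolding is_functor_def Hom_SCat SCat_simps
    proof (intro conjI ballI impI)
      fix A assume A: "A \<in> X"
      show "ShO (ModCat C) A \<in> X" by (rule sh[OF A])
      show "ShA (ModCat C) (Ident (ModCat C) A) = Ident (ModCat C) (ShO (ModCat C) A)" by (rule D.ShA_Ident[OF mX[OF A]])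
    next
      fix f assume f: "f \<in> {\<eta>. is_module_map C \<eta> \<and> MSrc \<eta> \<in> X \<and> MTgt \<eta> \<in> X}"
      then show "ShA (ModCat C) f \<in> (if ShO (ModCat C) (MSrc f) \<in> X \<and> ShO (ModCat C) (MTgt f) \<in> X
        then Hom (ModCat C) (ShO (ModCat C) (MSrc f)) (ShO (ModCat C) (MTgt f)) else {})"
        using sh MShA_Hom[OF mm] by simp
    next
      fix f g assume f: "f \<in> {\<eta>. is_module_map C \<eta> \<and> MSrc \<eta> \<in> X \<and> MTgt \<eta> \<in> X}" and
        g: "g \<in> {\<eta>. is_module_map C \<eta> \<and> MSrc \<eta> \<in> X \<and> MTgt \<eta> \<in> X}" and "MTgt f = MSrc g"
      then have "f \<in> Hom (ModCat C) (MSrc f) (MTgt f)" "g \<in> Hom (ModCat C) (MTgt f) (MTgt g)" by (auto simp: Hom_ModCat)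
      then show "ShA (ModCat C) (g \<cdot>\<^bsub>ModCat C\<^esub> f) = ShA (ModCat C) g \<cdot>\<^bsub>ModCat C\<^esub> ShA (ModCat C) f" by (rule D.ShA_Comp)
    qed
    show "bij_betw (ShO (SCat e C M)) (Obj (SCat e C M)) (Obj (SCat e C M))"
      by (rule bij_betwI[of _ _ _ "unshO C"]) (simp_all add: sh sh_unsh unsh_sh X_mod)
    show "bij_betw (ShA (SCat e C M)) (Arr (SCat e C M)) (Arr (SCat e C M))"
      by (rule bij_betwI[of _ _ _ "unshA C"]) (auto simp: sh sA uA sh_unshA[OF mm] unsh_shA[OF mm])
    fix A B assume "A \<in> Obj (SCat e C M)" "B \<in> Obj (SCat e C M)"
    then show "comm_group (hom_group (SCat e C M) A B)" using hg D.hom_comm_group mX by auto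
  qed (auto simp: Hom_SCat is_module_map_def MIdent_Hom X_mod D.Comp_Ident D.Ident_Comp D.Comp_assoc
      D.Comp_Add D.Add_Comp D.shift_Add intro: MComp_Hom split: if_splits)
qed

lemma UnO_SCat: assumes "A \<in> X" shows "UnO (SCat e C M) A = unshO C A"
proof -
  interpret S: shifted "SCat e C M" by (rule shifted_SCat)
  show ?thesis using S.UnO_ShO[of "unshO C A"] SObj_unshift[OF assms] sh_unsh[OF X_mod[OF assms]] by simp
qed

lemma UnA_SCat: assumes "f \<in> Hom (ModCat C) A B" "A \<in> X" "B \<in> X" shows "UnA (SCat e C M) f = unshA C f"
proof -
  interpret S: shifted "SCat e C M" by (rule shifted_SCat)
  have "unshA C f \<in> Arr (SCat e C M)"
    using unshA_Hom[OF assms(1)] SObj_unshift[OF assms(2)] SObj_unshift[OF assms(3)] by (auto simp: Hom_ModCat)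
  then show ?thesis using S.UnA_ShA[of "unshA C f"] sh_unshA[OF assms(1)] by simp
qed

text \<open>Axiom (c) in terms of elements. As the source is a constant sequence, a map of type
  \<open>m\<close> is a family of arrows from \<open>F\<close>, and one late member of it gives
  \<open>tyF\<close>; orthogonality to \<open>LiObj\<close> contains orthogonality to
  representables.\<close>

lemma approx_repr:
  "\<exists>n>m. \<forall>F \<in> Obj C. \<exists>d D t u. CP d D t \<and> vanish D n \<and> tyF m F d D t u"
proof -
  obtain n where n: "n > m" and ex: "\<And>F. F \<in> Obj C \<Longrightarrow> \<exists>d D \<delta> G.
      cauchy C M d \<and> Yon_colim e C d D \<delta> \<and> D \<in> X \<inter> right_perp (ModCat C) (LiObj e C M n) \<and>
      G \<in> Hom (ModCat C) (YonO e C F) D \<and>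
      type_n e C M m (const_seq C F) (\<lambda>i. Ident (ModCat C) (YonO e C F)) d \<delta> G" using excellent_c by blast
  interpret D: category "ModCat C :: (('o, 'm, 'u) presheaf, ('o, 'm, 'u) presheaf_map) shift_cat" by (rule category_ModCat)
  have "\<exists>d D t u. CP d D t \<and> vanish D n \<and> tyF m F d D t u" if F: "F \<in> Obj C" for F
  proof -
    obtain d D \<delta> G where d: "cauchy C M d" "Yon_colim e C d D \<delta>" and D: "D \<in> right_perp (ModCat C) (LiObj e C M n)"
      and G: "G \<in> Hom (ModCat C) (YonO e C F) D" and
      t: "type_n e C M m (const_seq C F) (\<lambda>i. Ident (ModCat C) (YonO e C F)) d \<delta> G" using ex[OF F] by blast
    obtain t where c: "CP d D t" and \<delta>: "\<delta> = (\<lambda>n. ymap D (ob d n) (t n))"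
      using Yon_colim_pres[OF cauchy_seq[OF d(1)] d(2)] d(1) unfolding CP_def by blast
    obtain r s f N where rs: "strict_mono r" "strict_mono s" and f: "seq_map C (subsequence C (const_seq C F) r) (subsequence C d s) f"
      and fG: "\<And>i. G \<cdot>\<^bsub>ModCat C\<^esub> Ident (ModCat C) (YonO e C F) = \<delta> (s i) \<cdot>\<^bsub>ModCat C\<^esub> YonA e C (f i)"
      and N: "\<And>i. i \<ge> N \<Longrightarrow> T m (f i)"
      using t unfolding type_n_def by blast
    have fH: "f i \<in> Hom C F (ob d (s i))" for i
      using f subseq_seq(2)[OF const_seq_seq(1)[OF F] rs(1)] const_seq_seq(2)[OF F] subseq_seq(2)[OF CP_seq[OF c] rs(2)]
      unfolding seq_map_def by metis
    obtain L where L: "\<And>j k. \<lbrakk>j \<ge> L; k \<ge> j\<rbrakk> \<Longrightarrow> T m (transition C d j k)" using cauchyD[OF d(1)] by blast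
    \<comment> \<open>From \<open>N\<close> on the cone of \<open>f i\<close> is small; from
      \<open>L\<close> on those of the transitions of \<open>d\<close> are, and \<open>s i\<close>
      is beyond \<open>L\<close> because it is at least \<open>i\<close>.\<close>
    define i where "i = max N L"
    have "i \<le> s i" by (rule strict_mono_imp_increasing[OF rs(2)])
    then have si: "s i \<ge> L" by (simp add: i_def)
    have "tyF m F d D t (FunA D (f i) (t (s i)))"
      by (rule tyFI[OF c fH N L]) (use si in \<open>auto simp: i_def\<close>)
    then show ?thesis using c LiObj_perp_vanish[OF D] by blast
  qed
  then show ?thesis using n by blast
qed

text \<open>Axiom (c) is applied to a single late object \<open>E j\<close>. Its target vanishes on
  \<open>M n\<close>, so the element obtained there extends to a map on all of \<open>B\<close>.
  Reading the type from one stage costs an index, so (c) is used with \<open>Suc m\<close>.\<close>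

lemma approx:
  "\<exists>n>m. \<forall>E B s. CP E B s \<longrightarrow> (\<exists>d D t G. CP d D t \<and> vanish D n \<and> G \<in> Hom (ModCat C) B D \<and> ty m E s d t G)"
proof -
  obtain n where n: "n > Suc m" and ex: "\<And>F. F \<in> Obj C \<Longrightarrow> \<exists>d D t u. CP d D t \<and> vanish D n \<and> tyF (Suc m) F d D t u"
    using approx_repr[of "Suc m"] by blast
  have "\<exists>d D t G. CP d D t \<and> vanish D n \<and> G \<in> Hom (ModCat C) B D \<and> ty m E s d t G" if c: "CP E B s" for E B s
  proof -
    obtain j where j: "\<And>k. k \<ge> j \<Longrightarrow> T (Suc n) (transition C E j k)" using cauchyD[OF CP_cauchy[OF c]] by blast
    obtain d D t u where D: "CP d D t" "vanish D n" and u: "tyF (Suc m) (ob E j) d D t u" using ex[OF CP_Obj[OF c]] by blast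
    obtain G where G: "G \<in> Hom (ModCat C) B D" "At G (ob E j) (s j) = u"
      using stage_ext[OF c CP_homol[OF D(1)] D(2) _ tyF_closed[OF D(1) u]] j by blast
    have "ty m E s d t G"
      by (rule ty_of_stage[OF c D(1) G(1), of j]) (use T_mono[OF j, of _ "Suc m"] n u G(2) in auto)
    then show ?thesis using D G by blast
  qed
  then show ?thesis using n by (meson Suc_lessD)
qed

lemma strict_ge: assumes "\<And>k. m k \<le> n k" "\<And>k. n k < (m (Suc k) :: nat)" shows "k \<le> m k" "j \<le> k \<Longrightarrow> m j \<le> m k"
proof -
  have s: "m k < m (Suc k)" for k using assms[of k] by simp
  then show "j \<le> k \<Longrightarrow> m j \<le> m k" by (simp add: lift_Suc_mono_le less_imp_le)
  show "k \<le> m k" using s by (intro strict_mono_imp_increasing) (simp add: strict_mono_Suc_iff)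
qed

end

section \<open>The restricted Yoneda functor\<close>

lemma infinite_presheaf_maps:
  assumes "infinite (UNIV :: 'u set)" shows "infinite (UNIV :: ('o, 'm, 'u) presheaf_map set)"
proof -
  let ?i = "\<lambda>u :: 'u. \<lparr>MSrc = undefined, MTgt = undefined, At = (\<lambda>_ _. u)\<rparr> :: ('o, 'm, 'u) presheaf_map"
  have "inj ?i" by (rule injI) (auto dest: fun_cong)
  then show ?thesis using assms finite_imageD[of ?i UNIV] by (metis finite_subset subset_UNIV)
qed

text \<open>There are two encodings: \<open>e\<close> for arrows of the category, giving its
  modules, and \<open>e'\<close> for maps of these modules, which are the arrows of the category
  whose modules are the target of the restricted Yoneda functor.\<close>

locale dual = exc C M e
  for C :: "('o, 'm, 'z) tri_cat_scheme" (structure) and M :: "nat \<Rightarrow> 'o set" and e :: "'m \<Rightarrow> 'u" +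
  fixes e' :: "('o, 'm, 'u) presheaf_map \<Rightarrow> 'v"
  assumes inj_e': "inj e'"
begin

abbreviation "D \<equiv> ModCat C :: (('o, 'm, 'u) presheaf, ('o, 'm, 'u) presheaf_map) shift_cat"
abbreviation "BB \<equiv> op_tri (SCat e C M)"
abbreviation "N \<equiv> SMetric e C M"
abbreviation "Yh \<equiv> YhatO e' D X"
abbreviation "YhA \<equiv> YhatA e' D X"

lemma infinite_universe': "infinite (UNIV :: 'v set)"
  using infinite_presheaf_maps[OF infinite_universe] inj_e' finite_imageD[of e' UNIV] by (metis finite_subset subset_UNIV)

end

sublocale dual \<subseteq> D: yoneda D e'
  by (intro yoneda.intro yoneda_axioms.intro shifted_ModCat inj_e' infinite_universe')

sublocale dual \<subseteq> B: yonT BB e'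
  by (intro yonT.intro yoneda.intro yoneda_axioms.intro shifted_op shifted_SCat inj_e' infinite_universe')

context dual
begin

lemma Hom_BB: "Hom BB A B = (if A \<in> X \<and> B \<in> X then Hom D B A else {})"
  by (auto simp: Hom_op_tri Hom_SCat)

lemma Hom_BBI: "\<lbrakk>A \<in> X; B \<in> X; f \<in> Hom D B A\<rbrakk> \<Longrightarrow> f \<in> Hom BB A B"
  by (simp add: Hom_BB)

lemma Hom_BBD: assumes "f \<in> Hom BB A B" shows "A \<in> X" "B \<in> X" "f \<in> Hom D B A"
  using assms by (auto simp: Hom_BB split: if_splits)

lemma Yh_O: "x \<in> X \<Longrightarrow> FunO (Yh m) x = hom_in e' D m x"
  by (simp add: YhatO_def)

lemma el_Yh: "x \<in> X \<Longrightarrow> el (Yh m) x = e' ` Hom D m x"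
  by (simp add: Yh_O D.hom_in_carrier)

lemma Yh_act: assumes g: "g \<in> Hom BB x y" and f: "f \<in> Hom D m y" shows "FunA (Yh m) g (e' f) = e' (g \<cdot>\<^bsub>D\<^esub> f)"
proof -
  note h = Hom_BBD[OF g]
  have "g \<in> Arr (full_subcat D X)" "Src D g = y" using h by (auto simp: Hom_ModCat)
  then show ?thesis using f D.hom_in_carrier[of m y] by (simp add: YhatO_def)
qed

lemma module_Yh: assumes m: "is_module C m" shows "is_module BB (Yh m)"
  unfolding is_module_def
proof (intro conjI ballI impI)
  have mX: "x \<in> X \<Longrightarrow> x \<in> Obj D" for x using X_mod by simp
  have mo: "m \<in> Obj D" using m by simp
  show "FunO (Yh m) \<in> extensional (Obj BB)" "FunA (Yh m) \<in> extensional (Arr BB)"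
    by (auto simp: YhatO_def extensional_def restrict_def)
  { fix x assume "x \<in> Obj BB"
    then have x: "x \<in> X" by simp
    show "comm_group (FunO (Yh m) x)" using D.hom_in_group[OF mo mX[OF x]] by (simp add: Yh_O[OF x])
    fix u assume "u \<in> el (Yh m) x"
    then obtain f where f: "f \<in> Hom D m x" "u = e' f" unfolding el_Yh[OF x] by blast
    show "FunA (Yh m) (Ident BB x) u = u"
      using Yh_act[OF Hom_BBI[OF x x D.Ident_Hom[OF mX[OF x]]] f(1)] f(2) D.Ident_Comp[OF f(1)] by simp }
  { fix f assume f': "f \<in> Arr BB"
    note f = Arr_Hom[OF f'] and h = Hom_BBD[OF Arr_Hom[OF f']]
    show "FunA (Yh m) f \<in> hom (FunO (Yh m) (Tgt BB f)) (FunO (Yh m) (Src BB f))"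
      unfolding Yh_O[OF h(1)] Yh_O[OF h(2)]
    proof (rule homI)
      fix u v assume "u \<in> carrier (hom_in e' D m (Tgt BB f))" "v \<in> carrier (hom_in e' D m (Tgt BB f))"
      then obtain g k where g: "g \<in> Hom D m (Tgt BB f)" "u = e' g" and k: "k \<in> Hom D m (Tgt BB f)" "v = e' k"
        unfolding D.hom_in_carrier by blast
      note fg = D.Comp_Hom[OF g(1) h(3)] and fk = D.Comp_Hom[OF k(1) h(3)]
      show "FunA (Yh m) f u \<in> carrier (hom_in e' D m (Src BB f))"
        unfolding g(2) Yh_act[OF f g(1)] D.hom_in_carrier using fg by blast
      show "FunA (Yh m) f (u \<otimes>\<^bsub>hom_in e' D m (Tgt BB f)\<^esub> v) =
        FunA (Yh m) f u \<otimes>\<^bsub>hom_in e' D m (Src BB f)\<^esub> FunA (Yh m) f v"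
        unfolding g(2) k(2) D.hom_in_mult[OF g(1) k(1)] Yh_act[OF f g(1)] Yh_act[OF f k(1)]
          Yh_act[OF f D.Add_Hom[OF g(1) k(1)]] D.hom_in_mult[OF fg fk] D.Comp_Add[OF g(1) k(1) h(3)] ..
    qed
    show "FunA (Yh m) f \<in> extensional (el (Yh m) (Tgt BB f))"
      using f' h by (auto simp: YhatO_def)
    fix g u assume g: "g \<in> Hom BB (Src BB f) (Tgt BB f)" and "u \<in> el (Yh m) (Tgt BB f)"
    then obtain k where k: "k \<in> Hom D m (Tgt BB f)" "u = e' k" unfolding el_Yh[OF h(2)] by blast
    note g' = Hom_BBD(3)[OF g]
    have "Add BB f g = Add D f g" by simp
    then show "FunA (Yh m) (Add BB f g) u = FunA (Yh m) f u \<otimes>\<^bsub>FunO (Yh m) (Src BB f)\<^esub> FunA (Yh m) g u"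
      unfolding k(2) Yh_O[OF h(1)] Yh_act[OF f k(1)] Yh_act[OF g k(1)] Yh_act[OF B.Add_Hom[OF f g] k(1)]
        D.hom_in_mult[OF D.Comp_Hom[OF k(1) h(3)] D.Comp_Hom[OF k(1) g']] using D.Add_Comp[OF k(1) h(3) g'] by simp }
  fix f g u assume f': "f \<in> Arr BB" and g': "g \<in> Arr BB" and fg: "Tgt BB f = Src BB g" and u: "u \<in> el (Yh m) (Tgt BB g)"
  have f: "f \<in> Hom BB (Src BB f) (Src BB g)" and g: "g \<in> Hom BB (Src BB g) (Tgt BB g)" using f' g' fg by (auto simp: Hom_def)
  obtain h where h: "h \<in> Hom D m (Tgt BB g)" "u = e' h" using u unfolding el_Yh[OF Hom_BBD(2)[OF g]] by blast
  note fD = Hom_BBD(3)[OF f] and gD = Hom_BBD(3)[OF g]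
  show "FunA (Yh m) (g \<cdot>\<^bsub>BB\<^esub> f) u = FunA (Yh m) f (FunA (Yh m) g u)"
    unfolding h(2) Yh_act[OF B.Comp_Hom[OF f g] h(1)] Yh_act[OF g h(1)] Yh_act[OF f D.Comp_Hom[OF h(1) gD]]
    using D.Comp_assoc[OF h(1) gD fD] by simp
qed

lemma YhA_Hom: assumes f: "f \<in> Hom D m n" shows "YhA f \<in> Hom (ModCat BB) (Yh n) (Yh m)"
proof -
  note mn = MH_mod[OF f]
  have eq: "YhA f = mkmap BB (Yh n) (Yh m) (\<lambda>x u. e' (decode e' u \<cdot>\<^bsub>D\<^esub> f))"
  proof (rule presheaf_map_eqI)
    show "At (YhA f) = At (mkmap BB (Yh n) (Yh m) (\<lambda>x u. e' (decode e' u \<cdot>\<^bsub>D\<^esub> f)))"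
      unfolding YhatA_def mkmap_def presheaf_map.simps Hom_Tgt[OF f] op_tri_simps SCat_simps by (rule restrict_ext) (simp add: Yh_O)
  qed (use f in \<open>simp_all add: YhatA_def Hom_ModCat\<close>)
  show ?thesis unfolding eq
  proof (rule B.mkmap_Hom[OF module_Yh[OF mn(2)] module_Yh[OF mn(1)]])
    fix x u assume "x \<in> Obj BB" and u: "u \<in> el (Yh n) x"
    then have x: "x \<in> X" by simp
    obtain g where g: "g \<in> Hom D n x" "u = e' g" using u unfolding el_Yh[OF x] by blast
    show "e' (decode e' u \<cdot>\<^bsub>D\<^esub> f) \<in> el (Yh m) x" unfolding g(2) D.dec el_Yh[OF x] using D.Comp_Hom[OF f g(1)] by blast
    fix v assume v: "v \<in> el (Yh n) x"
    obtain k where k: "k \<in> Hom D n x" "v = e' k" using v unfolding el_Yh[OF x] by blast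
    show "e' (decode e' (u \<otimes>\<^bsub>FunO (Yh n) x\<^esub> v) \<cdot>\<^bsub>D\<^esub> f) = e' (decode e' u \<cdot>\<^bsub>D\<^esub> f) \<otimes>\<^bsub>FunO (Yh m) x\<^esub> e' (decode e' v \<cdot>\<^bsub>D\<^esub> f)"
      unfolding g(2) k(2) Yh_O[OF x] D.hom_in_mult[OF g(1) k(1)] D.dec D.hom_in_mult[OF D.Comp_Hom[OF f g(1)] D.Comp_Hom[OF f k(1)]]
        D.Add_Comp[OF f g(1) k(1)] ..
  next
    fix x y g u assume g: "g \<in> Hom BB x y" and u: "u \<in> el (Yh n) y"
    note h = Hom_BBD[OF g]
    obtain k where k: "k \<in> Hom D n y" "u = e' k" using u unfolding el_Yh[OF h(2)] by blast
    show "FunA (Yh m) g (e' (decode e' u \<cdot>\<^bsub>D\<^esub> f)) = e' (decode e' (FunA (Yh n) g u) \<cdot>\<^bsub>D\<^esub> f)"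
      unfolding k(2) Yh_act[OF g k(1)] D.dec Yh_act[OF g D.Comp_Hom[OF f k(1)]] D.Comp_assoc[OF f k(1) h(3)] ..
  qed
qed

lemma At_YhA: assumes f: "f \<in> Hom D m n" and g: "g \<in> Hom D n x" and x: "x \<in> X" shows "At (YhA f) x (e' g) = e' (g \<cdot>\<^bsub>D\<^esub> f)"
proof -
  have "MTgt f = n" using f by (simp add: Hom_ModCat)
  then show ?thesis using g x by (simp add: YhatA_def D.hom_in_carrier)
qed

section \<open>Towers\<close>

text \<open>Elements of \<open>Yh A\<close> are maps out of \<open>A\<close>, so the hypotheses on
  factorisations are the surjectivity and injectivity clauses of \<open>pres\<close>, with all
  arrows reversed.\<close>

lemma pres_Yh:
  assumes q: "is_seq BB q" and p: "\<And>k. p k \<in> Hom D A (Src BB (q k))" and qp: "\<And>k. q k \<cdot>\<^bsub>D\<^esub> p (Suc k) = p k"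
    and su: "\<And>x g. \<lbrakk>x \<in> X; g \<in> Hom D A x\<rbrakk> \<Longrightarrow> \<exists>k. \<exists>f \<in> Hom D (Src BB (q k)) x. f \<cdot>\<^bsub>D\<^esub> p k = g"
    and inj: "\<And>j x f f'. \<lbrakk>x \<in> X; f \<in> Hom D (Src BB (q j)) x; f' \<in> Hom D (Src BB (q j)) x; f \<cdot>\<^bsub>D\<^esub> p j = f' \<cdot>\<^bsub>D\<^esub> p j\<rbrakk> \<Longrightarrow>
      \<exists>k\<ge>j. f \<cdot>\<^bsub>D\<^esub> transition BB q j k = f' \<cdot>\<^bsub>D\<^esub> transition BB q j k"
  shows "pres BB q (Yh A) (\<lambda>k. e' (p k))"
  unfolding pres_def
proof (intro conjI allI ballI impI)
  have o: "Src BB (q k) \<in> X" for k using B.seq_Obj[OF q] by simp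
  fix k show "e' (p k) \<in> el (Yh A) (Src BB (q k))" unfolding el_Yh[OF o] using p by blast
  show "FunA (Yh A) (q k) (e' (p (Suc k))) = e' (p k)" unfolding Yh_act[OF B.seq_Hom[OF q] p] qp ..
next
  fix x u assume x': "x \<in> Obj BB" and u: "u \<in> el (Yh A) x"
  have x: "x \<in> X" using x' by simp
  obtain g where g: "g \<in> Hom D A x" "u = e' g" using u unfolding el_Yh[OF x] by blast
  obtain k f where f: "f \<in> Hom D (Src BB (q k)) x" "f \<cdot>\<^bsub>D\<^esub> p k = g" using su[OF x g(1)] by blast
  have o: "Src BB (q k) \<in> X" using B.seq_Obj[OF q] by simp
  note fB = Hom_BBI[OF x o f(1)]
  have "u = FunA (Yh A) f (e' (p k))" unfolding Yh_act[OF fB p] f(2) g(2) ..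
  then show "\<exists>n. \<exists>f\<in>Hom BB x (Src BB (q n)). u = FunA (Yh A) f (e' (p n))" using fB by blast
next
  fix n x f g assume f: "f \<in> Hom BB x (Src BB (q n))" and g: "g \<in> Hom BB x (Src BB (q n))"
    and "FunA (Yh A) f (e' (p n)) = FunA (Yh A) g (e' (p n))"
  then have "f \<cdot>\<^bsub>D\<^esub> p n = g \<cdot>\<^bsub>D\<^esub> p n" unfolding Yh_act[OF f p] Yh_act[OF g p] by simp
  from inj[OF Hom_BBD(1)[OF f] Hom_BBD(3)[OF f] Hom_BBD(3)[OF g] this]
  show "\<exists>k\<ge>n. transition BB q n k \<cdot>\<^bsub>BB\<^esub> f = transition BB q n k \<cdot>\<^bsub>BB\<^esub> g" by simp
qed

lemma inverse_trans:
  assumes q: "is_seq BB q" and p: "\<And>k. p k \<in> Hom D A (Src BB (q k))" and qp: "\<And>k. q k \<cdot>\<^bsub>D\<^esub> p (Suc k) = p k" and "j \<le> k"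
  shows "transition BB q j k \<in> Hom D (Src BB (q k)) (Src BB (q j))" "transition BB q j k \<cdot>\<^bsub>D\<^esub> p k = p j"
proof -
  have H: "transition BB q j k \<in> Hom D (Src BB (q k)) (Src BB (q j))" if "j \<le> k" for j k
    by (rule Hom_BBD(3)[OF B.trans_Hom[OF q that]])
  show "transition BB q j k \<in> Hom D (Src BB (q k)) (Src BB (q j))" by (rule H) fact
  show "transition BB q j k \<cdot>\<^bsub>D\<^esub> p k = p j"
    using assms(4)
  proof (induction k rule: dec_induct)
    case base then show ?case using B.trans_refl[of q j] D.Ident_Comp[OF p[of j]] by simp
  next
    case (step k)
    then show ?case
      using B.trans_Suc[OF step(1), of q] D.Comp_assoc[OF p Hom_BBD(3)[OF B.seq_Hom[OF q]] H[OF step(1)]] qp by simp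
  qed
qed

text \<open>If \<open>x\<close> vanishes on \<open>M i\<close>, then every \<open>p k\<close> with
  \<open>k \<ge> Suc i\<close> is of type \<open>Suc i\<close> and induces a bijection on maps into
  \<open>x\<close>. Maps from \<open>A\<close> to \<open>x\<close> thus factor through
  \<open>p (Suc i)\<close>, and two maps with equal composites from \<open>A\<close> agree on the
  object with index \<open>max j (Suc i)\<close>.\<close>

lemma approx_pres:
  assumes A: "CP a A \<alpha>" and c: "\<And>k. CP (d k) (Z k) (s k)" and q: "is_seq BB q" "\<And>k. Src BB (q k) = Z k"
    and p: "\<And>k. p k \<in> Hom D A (Z k)" "\<And>k. ty k a \<alpha> (d k) (s k) (p k)" and qp: "\<And>k. q k \<cdot>\<^bsub>D\<^esub> p (Suc k) = p k"
  shows "pres BB q (Yh A) (\<lambda>k. e' (p k))"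
proof (rule pres_Yh[OF q(1)], unfold q(2))
  show "p k \<in> Hom D A (Z k)" for k by (rule p)
  show "q k \<cdot>\<^bsub>D\<^esub> p (Suc k) = p k" for k by (rule qp)
next
  fix x g assume x: "x \<in> X" and g: "g \<in> Hom D A x"
  obtain i where v: "vanish x i" using x by (rule X_E)
  from ty_ext[OF A c p(1) p(2) SObj_homol[OF x] v g] show "\<exists>k. \<exists>f \<in> Hom D (Z k) x. f \<cdot>\<^bsub>D\<^esub> p k = g" by blast
next
  fix j x f f' assume x: "x \<in> X" and f: "f \<in> Hom D (Z j) x" "f' \<in> Hom D (Z j) x"
    and eq: "f \<cdot>\<^bsub>D\<^esub> p j = f' \<cdot>\<^bsub>D\<^esub> p j"
  obtain i where v: "vanish x i" using x by (rule X_E)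
  define k where "k = max j (Suc i)"
  have k: "j \<le> k" "Suc i \<le> k" by (auto simp: k_def)
  have p': "p k \<in> Hom D A (Src BB (q k))" for k unfolding q(2) by (rule p(1))
  note tr = inverse_trans[OF q(1) p' qp k(1), unfolded q(2)] and pk = p(1)[of k]
  have "(f \<cdot>\<^bsub>D\<^esub> transition BB q j k) \<cdot>\<^bsub>D\<^esub> p k = (f' \<cdot>\<^bsub>D\<^esub> transition BB q j k) \<cdot>\<^bsub>D\<^esub> p k"
    using D.Comp_assoc[OF pk tr(1) f(1)] D.Comp_assoc[OF pk tr(1) f(2)] tr(2) eq by simp
  then have "f \<cdot>\<^bsub>D\<^esub> transition BB q j k = f' \<cdot>\<^bsub>D\<^esub> transition BB q j k"
    by (rule ty_epi[OF A c pk ty_mono[OF p(2) k(2)] SObj_homol[OF x] v D.Comp_Hom[OF tr(1) f(1)] D.Comp_Hom[OF tr(1) f(2)]])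
  then show "\<exists>k\<ge>j. f \<cdot>\<^bsub>D\<^esub> transition BB q j k = f' \<cdot>\<^bsub>D\<^esub> transition BB q j k" using k(1) by blast
qed

text \<open>A tower over \<open>A\<close>: an inverse system of objects of the completion approximating \<open>A\<close>.  The \<open>k\<close>-th
  object sees nothing of \<open>M (n k)\<close>, and \<open>A\<close> maps to it with cone in \<open>M (m k)\<close>.\<close>

definition tower :: "('o, 'm, 'u) presheaf \<Rightarrow> (nat \<Rightarrow> 'm) \<Rightarrow> (nat \<Rightarrow> 'u) \<Rightarrow> (nat \<Rightarrow> ('o, 'm, 'u) presheaf) \<Rightarrow> (nat \<Rightarrow> nat \<Rightarrow> 'm)
    \<Rightarrow> (nat \<Rightarrow> nat \<Rightarrow> 'u) \<Rightarrow> (nat \<Rightarrow> ('o, 'm, 'u) presheaf_map) \<Rightarrow> (nat \<Rightarrow> ('o, 'm, 'u) presheaf_map)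
    \<Rightarrow> (nat \<Rightarrow> nat) \<Rightarrow> (nat \<Rightarrow> nat) \<Rightarrow> bool" where
  "tower A a \<alpha> TT d s p q m n \<longleftrightarrow> CP a A \<alpha> \<and> (\<forall>k. CP (d k) (TT k) (s k) \<and> vanish (TT k) (n k) \<and>
     p k \<in> Hom D A (TT k) \<and> ty (m k) a \<alpha> (d k) (s k) (p k) \<and> q k \<in> Hom D (TT (Suc k)) (TT k) \<and>
     q k \<cdot>\<^bsub>D\<^esub> p (Suc k) = p k \<and> m k \<le> n k \<and> n k < m (Suc k))"

lemma towerD:
  assumes "tower A a \<alpha> TT d s p q m n"
  shows tw_A: "CP a A \<alpha>" and tw_CP: "CP (d k) (TT k) (s k)" and tw_van: "vanish (TT k) (n k)" and tw_p: "p k \<in> Hom D A (TT k)"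
    and tw_ty: "ty (m k) a \<alpha> (d k) (s k) (p k)" and tw_q: "q k \<in> Hom D (TT (Suc k)) (TT k)"
    and tw_qp: "q k \<cdot>\<^bsub>D\<^esub> p (Suc k) = p k" and tw_mn: "m k \<le> n k" "n k < m (Suc k)"
  using assms unfolding tower_def by blast+

text \<open>\<open>TT k\<close> vanishes on \<open>M (n k)\<close> and the type
  \<open>m (Suc k)\<close> of \<open>p (Suc k)\<close> exceeds \<open>n k\<close>, so
  \<open>p k\<close> factors through \<open>p (Suc k)\<close>; the factor is
  \<open>q k\<close>.\<close>

lemma towerI:
  assumes A: "CP a A \<alpha>" and c: "\<And>k. CP (d k) (TT k) (s k)" and v: "\<And>k. vanish (TT k) (n k)"
    and p: "\<And>k. p k \<in> Hom D A (TT k)" "\<And>k. ty (m k) a \<alpha> (d k) (s k) (p k)" and mn: "\<And>k. m k \<le> n k" "\<And>k. n k < m (Suc k)"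
  shows "\<exists>q. tower A a \<alpha> TT d s p q m n"
proof -
  have "\<exists>q. q \<in> Hom D (TT (Suc k)) (TT k) \<and> q \<cdot>\<^bsub>D\<^esub> p (Suc k) = p k" for k
    using ty_ext[OF A c[of "Suc k"] p(1)[of "Suc k"] ty_mono[OF p(2)[of "Suc k"]] CP_homol[OF c[of k]] v[of k] p(1)[of k]]
      mn(2)[of k] by (auto simp: Suc_le_eq)
  then obtain q where "\<And>k. q k \<in> Hom D (TT (Suc k)) (TT k) \<and> q k \<cdot>\<^bsub>D\<^esub> p (Suc k) = p k" by metis
  then show ?thesis unfolding tower_def using assms by blast
qed

lemma tower_exists: assumes c: "CP E B s" shows "\<exists>TT d t p q m n. tower B E s TT d t p q m n"
proof -
  have "\<forall>m. \<exists>n. n > m \<and> (\<exists>d D' t G. CP d D' t \<and> vanish D' n \<and> G \<in> Hom D B D' \<and> ty m E s d t G)" using approx c by blast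
  then obtain nn where nn: "\<And>m. nn m > m" and ex: "\<And>m. \<exists>d D' t G. CP d D' t \<and> vanish D' (nn m) \<and> G \<in> Hom D B D' \<and> ty m E s d t G" by metis
  obtain d TT t p where h: "\<And>m. CP (d m) (TT m) (t m)" "\<And>m. vanish (TT m) (nn m)" "\<And>m. p m \<in> Hom D B (TT m)" "\<And>m. ty m E s (d m) (t m) (p m)"
    using ex by metis
  \<comment> \<open>This recursion makes each type exceed the vanishing bound of the previous level,
    as the connecting maps require.\<close>
  define m where "m k = ((\<lambda>i. Suc (nn i)) ^^ k) 0" for k
  have "\<exists>q. tower B E s (\<lambda>k. TT (m k)) (\<lambda>k. d (m k)) (\<lambda>k. t (m k)) (\<lambda>k. p (m k)) q m (\<lambda>k. nn (m k))"
    by (rule towerI[OF c]) (use h nn in \<open>simp_all add: m_def less_imp_le\<close>)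
  then show ?thesis by blast
qed

lemma tower_seq:
  assumes t: "tower A a \<alpha> TT d s p q m n"
  shows tw_X: "TT k \<in> X" and tw_seq: "is_seq BB q" "Src BB (q k) = TT k" and tw_trH: "j \<le> k \<Longrightarrow> transition BB q j k \<in> Hom D (TT k) (TT j)"
    and tw_trp: "j \<le> k \<Longrightarrow> transition BB q j k \<cdot>\<^bsub>D\<^esub> p k = p j"
proof -
  show X: "TT k \<in> X" for k by (rule XI[OF tw_CP[OF t] tw_van[OF t]])
  have "q k \<in> Hom BB (TT k) (TT (Suc k))" for k by (rule Hom_BBI[OF X X tw_q[OF t]])
  from B.is_seqI[of q TT, OF this] show sq: "is_seq BB q" "Src BB (q k) = TT k" for k by auto
  have p': "p k \<in> Hom D A (Src BB (q k))" for k unfolding sq(2) by (rule tw_p[OF t])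
  show "j \<le> k \<Longrightarrow> transition BB q j k \<in> Hom D (TT k) (TT j)" "j \<le> k \<Longrightarrow> transition BB q j k \<cdot>\<^bsub>D\<^esub> p k = p j"
    using inverse_trans[OF sq(1) p' tw_qp[OF t], unfolded sq(2)] by blast+
qed

lemma tower_m: assumes t: "tower A a \<alpha> TT d s p q m n" shows "k \<le> m k" "j \<le> k \<Longrightarrow> m j \<le> m k"
  using strict_ge[of m n, OF tw_mn[OF t]] by auto

lemma tower_pres: assumes t: "tower A a \<alpha> TT d s p q m n" shows "pres BB q (Yh A) (\<lambda>k. e' (p k))"
  by (rule approx_pres[OF tw_A[OF t] tw_CP[OF t] tw_seq[OF t] tw_p[OF t] ty_mono[OF tw_ty[OF t] tower_m(1)[OF t]] tw_qp[OF t]])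

text \<open>In the opposite category the cone of \<open>q\<close> is the fibre of \<open>q\<close>,
  and \<open>ST_fiber\<close> places it in \<open>LiObj\<close>. It is compactly supported because
  it lies between a desuspension of \<open>Z\<close> and \<open>Y\<close>, which both are.\<close>

lemma cone_BB:
  assumes c: "CP x Y s" "CP y Z t" and v: "vanish Y i" "vanish Z i'" and q: "q \<in> Hom D Y Z" "ty (Suc k) x s y t q"
  shows "cone_in BB q (N k)"
proof -
  obtain a \<alpha> b \<beta> c' \<gamma> f g h B F G where st: "ST C M a \<alpha> b \<beta> c' \<gamma> f g h (unshO C Z) B Y F G q" and B: "B \<in> LiObj e C M k"
    using ST_fiber[OF c q] by blast
  define l where "l = max i (Suc i')"
  have "vanish (unshO C Z) l" by (rule vanish_mono[OF vanish_unshift[OF CP_mod[OF c(2)] v(2)]]) (simp add: l_def)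
  moreover have "vanish Y l" by (rule vanish_mono[OF v(1)]) (simp add: l_def)
  ultimately have "vanish B l" by (rule ST_vanish_mid[OF st])
  then have BX: "B \<in> X" by (rule XI[OF ST_CP(2)[OF st]])
  have YX: "Y \<in> X" and ZX: "Z \<in> X" using XI c v by auto
  have "(F, G, q) \<in> strong_triangles e C M" using st strong_iff by blast
  moreover have src: "MSrc F = unshO C Z" "MSrc G = B" "MSrc q = Y"
    using ST_Hom[OF st] by (auto simp: Hom_ModCat)
  ultimately have "(q, G, F) \<in> Tri BB" using BX YX SObj_unshift[OF ZX] by simp
  moreover have "Tgt BB G \<in> N k" using src B BX by (simp add: SMetric_def)
  ultimately show ?thesis unfolding cone_in_def by blast
qed

text \<open>Cancelling \<open>p k\<close> from \<open>p j\<close> costs one index and passing to the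
  fibre another, whence the threshold \<open>Suc (Suc i)\<close>.\<close>

lemma tower_cauchy: assumes t: "tower A a \<alpha> TT d s p q m n" shows "cauchy BB N q"
  unfolding cauchy_def
proof (intro conjI tw_seq(1)[OF t] allI)
  fix i
  have "cone_in BB (transition BB q j k) (N i)" if j: "j \<ge> Suc (Suc i)" and k: "k > j" for j k
  proof (rule cone_BB[OF tw_CP[OF t] tw_CP[OF t] tw_van[OF t] tw_van[OF t]])
    show tr: "transition BB q j k \<in> Hom D (TT k) (TT j)" using tw_trH[OF t] k by simp
    have mj: "Suc (Suc i) \<le> m j" using tower_m(1)[OF t, of j] j by simp
    have mk: "Suc (Suc i) \<le> m k" using tower_m(2)[OF t, of j k] mj k by simp
    show "ty (Suc i) (d k) (s k) (d j) (s j) (transition BB q j k)"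
      by (rule ty_cancel[OF tw_A[OF t] tw_CP[OF t] tw_CP[OF t] tw_p[OF t] ty_mono[OF tw_ty[OF t] mk] tr])
        (use tw_trp[OF t, of j k] k ty_mono[OF tw_ty[OF t] mj] in simp)
  qed
  then show "\<exists>L. \<forall>j\<ge>L. \<forall>k>j. cone_in BB (transition BB q j k) (N i)" by blast
qed

lemma LObj_BB_I: assumes "is_module BB W" "cauchy BB N q" "pres BB q W \<tau>" shows "W \<in> LObj e' BB N"
proof -
  have "is_seq BB q" using assms(2) by (simp add: cauchy_def)
  from B.pres_Yon_colim[OF this assms(1,3)] show ?thesis unfolding LObj_def using assms(2) by blast
qed

lemma Yh_LObj: assumes "A \<in> LObj e C M" shows "Yh A \<in> LObj e' BB N"
proof -
  obtain E t where c: "CP E A t" using assms LObj_iff by blast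
  obtain TT d u p q m n where t: "tower A E t TT d u p q m n" using tower_exists[OF c] by blast
  show ?thesis by (rule LObj_BB_I[OF module_Yh[OF CP_mod[OF c]] tower_cauchy[OF t] tower_pres[OF t]])
qed

text \<open>The tower is eventually constant on each object of \<open>C\<close>, so \<open>A\<close> is its pointwise limit.\<close>

lemma tower_bij:
  assumes t: "tower A a \<alpha> TT d s p q m n" and F: "F \<in> Obj C"
  shows "\<exists>K. \<forall>k\<ge>K. (\<forall>v \<in> el (TT k) F. \<exists>u \<in> el A F. At (p k) F u = v) \<and>
    (\<forall>u \<in> el A F. \<forall>u' \<in> el A F. At (p k) F u = At (p k) F u' \<longrightarrow> u = u')"
proof -
  obtain i where i: "F \<in> left_perp C (M i)" using F excellent_a by blast
  have "Suc i \<le> m k" if "k \<ge> Suc i" for k using tower_m(1)[OF t, of k] that by simp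
  then have "ty (Suc i) a \<alpha> (d k) (s k) (p k)" if "k \<ge> Suc i" for k using ty_mono[OF tw_ty[OF t]] that by blast
  then show ?thesis
    using ty_perp_surj[OF tw_A[OF t] tw_CP[OF t] tw_p[OF t] _ i] ty_perp_inj[OF tw_A[OF t] tw_CP[OF t] tw_p[OF t] _ i] by blast
qed

lemma tower_mono:
  assumes t: "tower B a \<alpha> TT d s p q m n" and g: "g \<in> Hom D A B" "g' \<in> Hom D A B" and eq: "\<And>k. p k \<cdot>\<^bsub>D\<^esub> g = p k \<cdot>\<^bsub>D\<^esub> g'"
  shows "g = g'"
proof (rule MH_eqI[OF g])
  fix F u assume F: "F \<in> Obj C" and u: "u \<in> el A F"
  obtain k where k: "\<forall>u \<in> el B F. \<forall>u' \<in> el B F. At (p k) F u = At (p k) F u' \<longrightarrow> u = u'" using tower_bij[OF t F] by blast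
  have "At (p k) F (At g F u) = At (p k) F (At g' F u)"
    using At_Comp[OF g(1) F u, of "p k"] At_Comp[OF g(2) F u, of "p k"] eq[of k] by simp
  then show "At g F u = At g' F u" using k MH_closed[OF g(1) F u] MH_closed[OF g(2) F u] by blast
qed

text \<open>At each object the maps \<open>p k\<close> are eventually bijective, so compatible
  elements of the tower come from exactly one element of \<open>B\<close>. This uniqueness makes the
  resulting assignment additive and natural.\<close>

lemma tower_lim:
  assumes t: "tower B a \<alpha> TT d s p q m n" and A: "is_module C A"
    and r: "\<And>k. r k \<in> Hom D A (TT k)" "\<And>k. q k \<cdot>\<^bsub>D\<^esub> r (Suc k) = r k"
  shows "\<exists>g \<in> Hom D A B. \<forall>k. p k \<cdot>\<^bsub>D\<^esub> g = r k"
proof -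
  note mB = CP_mod[OF tw_A[OF t]]
  have down: "At (p j) F v = At (r j) F u" if F: "F \<in> Obj C" and u: "u \<in> el A F" and v: "v \<in> el B F"
    and jk: "j \<le> k" and eq: "At (p k) F v = At (r k) F u" for F u v j k
    using jk eq
  proof (induction rule: inc_induct)
    case (step i)
    then have "At (p (Suc i)) F v = At (r (Suc i)) F u" by simp
    then show ?case
      using At_Comp[OF tw_p[OF t] F v, of "q i" "Suc i"] At_Comp[OF r(1) F u, of "q i" "Suc i"] tw_qp[OF t, of i] r(2)[of i] by simp
  qed
  have ex: "\<exists>v \<in> el B F. \<forall>k. At (p k) F v = At (r k) F u" if F: "F \<in> Obj C" and u: "u \<in> el A F" for F u
  proof -
    obtain K where K: "\<And>k v. \<lbrakk>k \<ge> K; v \<in> el (TT k) F\<rbrakk> \<Longrightarrow> \<exists>u \<in> el B F. At (p k) F u = v"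
      and K': "\<And>k u u'. \<lbrakk>k \<ge> K; u \<in> el B F; u' \<in> el B F; At (p k) F u = At (p k) F u'\<rbrakk> \<Longrightarrow> u = u'"
      using tower_bij[OF t F] by blast
    obtain v where v: "v \<in> el B F" "At (p K) F v = At (r K) F u" using K[OF le_refl MH_closed[OF r(1) F u]] by blast
    have "At (p k) F v = At (r k) F u" for k
    proof (cases "k \<le> K")
      case True then show ?thesis by (rule down[OF F u v(1) _ v(2)])
    next
      case False
      then have k: "K \<le> k" by simp
      \<comment> \<open>The element found at the later level \<open>k\<close> also fits at level
        \<open>K\<close>; injectivity of \<open>p K\<close> identifies it with the one found
        there.\<close>
      obtain v' where v': "v' \<in> el B F" "At (p k) F v' = At (r k) F u" using K[OF k MH_closed[OF r(1) F u]] by blast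
      have "At (p K) F v' = At (r K) F u" by (rule down[OF F u v'(1) k v'(2)])
      then have "v' = v" using K'[OF le_refl v'(1) v(1)] v(2) by simp
      then show ?thesis using v'(2) by simp
    qed
    then show ?thesis using v(1) by blast
  qed
  have uq: "v = v'" if F: "F \<in> Obj C" and v: "v \<in> el B F" "v' \<in> el B F" "\<And>k. At (p k) F v = At (p k) F v'" for F v v'
    using tower_bij[OF t F] v by blast
  define \<phi> where "\<phi> F u = (SOME v. v \<in> el B F \<and> (\<forall>k. At (p k) F v = At (r k) F u))" for F u
  have \<phi>: "\<phi> F u \<in> el B F \<and> (\<forall>k. At (p k) F (\<phi> F u) = At (r k) F u)" if "F \<in> Obj C" "u \<in> el A F" for F u
    unfolding \<phi>_def by (rule someI_ex) (use ex[OF that] in blast)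
  have G: "mkmap C A B \<phi> \<in> Hom D A B"
  proof (rule mkmap_Hom[OF A mB])
    fix F u assume F: "F \<in> Obj C" and u: "u \<in> el A F"
    show "\<phi> F u \<in> el B F" using \<phi>[OF F u] by blast
    fix v assume v: "v \<in> el A F"
    note uv = module_mult[OF A F u v]
    show "\<phi> F (u \<otimes>\<^bsub>FunO A F\<^esub> v) = \<phi> F u \<otimes>\<^bsub>FunO B F\<^esub> \<phi> F v"
    proof (rule uq[OF F])
      show "\<phi> F (u \<otimes>\<^bsub>FunO A F\<^esub> v) \<in> el B F" "\<phi> F u \<otimes>\<^bsub>FunO B F\<^esub> \<phi> F v \<in> el B F"
        using \<phi>[OF F uv] \<phi>[OF F u] \<phi>[OF F v] module_mult[OF mB F] by blast+
      fix k show "At (p k) F (\<phi> F (u \<otimes>\<^bsub>FunO A F\<^esub> v)) = At (p k) F (\<phi> F u \<otimes>\<^bsub>FunO B F\<^esub> \<phi> F v)"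
        using \<phi>[OF F uv] \<phi>[OF F u] \<phi>[OF F v] MH_mult[OF tw_p[OF t] F] MH_mult[OF r(1) F u v] by simp
    qed
  next
    fix F F' f u assume f: "f \<in> Hom C F F'" and u: "u \<in> el A F'"
    note o = Hom_Obj[OF f]
    note fu = act_closed[OF A f u]
    show "FunA B f (\<phi> F' u) = \<phi> F (FunA A f u)"
    proof (rule uq[OF o(1)])
      show "FunA B f (\<phi> F' u) \<in> el B F" "\<phi> F (FunA A f u) \<in> el B F" using \<phi>[OF o(2) u] \<phi>[OF o(1) fu] act_closed[OF mB f] by auto
      fix k show "At (p k) F (FunA B f (\<phi> F' u)) = At (p k) F (\<phi> F (FunA A f u))"
        using \<phi>[OF o(2) u] \<phi>[OF o(1) fu] MH_act[OF tw_p[OF t] f, of "\<phi> F' u"] MH_act[OF r(1) f u] by simp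
    qed
  qed
  have "p k \<cdot>\<^bsub>D\<^esub> mkmap C A B \<phi> = r k" for k
    by (rule MH_eqI[OF D.Comp_Hom[OF G tw_p[OF t]] r(1)]) (simp add: At_Comp[OF G] At_mkmap \<phi>)
  then show ?thesis using G by blast
qed

text \<open>\<open>Yh B\<close> is presented by the elements \<open>p k\<close>, so \<open>G\<close>
  amounts to their images. These are maps from \<open>A\<close> to the levels of the tower,
  compatible by naturality of \<open>G\<close>; as \<open>B\<close> is the limit of the tower, they
  come from a unique map from \<open>A\<close> to \<open>B\<close>.\<close>

lemma Yh_full_faithful:
  assumes A: "is_module C A" and B: "B \<in> LObj e C M" and G: "G \<in> Hom (ModCat BB) (Yh B) (Yh A)"
  shows "\<exists>!g. g \<in> Hom D A B \<and> YhA g = G"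
proof -
  obtain E t where c: "CP E B t" using B LObj_iff by blast
  obtain TT d u p q m n where t: "tower B E t TT d u p q m n" using tower_exists[OF c] by blast
  note XT = tw_X[OF t]
  have "At G (TT k) (e' (p k)) \<in> el (Yh A) (TT k)" for k
    by (rule B.MH_closed[OF G]) (use XT tw_p[OF t] in \<open>simp_all add: el_Yh\<close>)
  then have "\<forall>k. \<exists>r. r \<in> Hom D A (TT k) \<and> At G (TT k) (e' (p k)) = e' r" unfolding el_Yh[OF XT] by blast
  then obtain r where r: "\<And>k. r k \<in> Hom D A (TT k)" "\<And>k. At G (TT k) (e' (p k)) = e' (r k)" by metis
  have qr: "q k \<cdot>\<^bsub>D\<^esub> r (Suc k) = r k" for k
  proof -
    have qB: "q k \<in> Hom BB (TT k) (TT (Suc k))" by (rule Hom_BBI[OF XT XT tw_q[OF t]])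
    have "e' (p (Suc k)) \<in> el (Yh B) (TT (Suc k))" using XT tw_p[OF t] by (simp add: el_Yh)
    from B.MH_act[OF G qB this] have "e' (q k \<cdot>\<^bsub>D\<^esub> r (Suc k)) = e' (r k)"
      by (simp add: r(2) Yh_act[OF qB r(1)] Yh_act[OF qB tw_p[OF t]] tw_qp[OF t])
    then show ?thesis by simp
  qed
  obtain g where g: "g \<in> Hom D A B" "\<And>k. p k \<cdot>\<^bsub>D\<^esub> g = r k" using tower_lim[OF t A r(1) qr] by blast
  show ?thesis
  proof (rule ex1I[of _ g])
    have "YhA g = G"
      by (rule B.pres_eqI[OF tw_seq(1)[OF t] tower_pres[OF t] YhA_Hom[OF g(1)] G])
        (simp add: tw_seq(2)[OF t] At_YhA[OF g(1) tw_p[OF t] XT] g(2) r(2) del: op_tri_simps)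
    then show "g \<in> Hom D A B \<and> YhA g = G" using g(1) by blast
    fix g' assume g': "g' \<in> Hom D A B \<and> YhA g' = G"
    show "g' = g"
    proof (rule tower_mono[OF t _ g(1)])
      show g1: "g' \<in> Hom D A B" using g' by blast
      fix k
      have "e' (p k \<cdot>\<^bsub>D\<^esub> g') = e' (r k)" using At_YhA[OF g1 tw_p[OF t] XT, of k] g' r(2)[of k] by simp
      then show "p k \<cdot>\<^bsub>D\<^esub> g' = p k \<cdot>\<^bsub>D\<^esub> g" using g(2) by simp
    qed
  qed
qed

end

section \<open>Maps between strong triangles\<close>

context met
begin

text \<open>Since the target is compactly supported, it suffices to fill in one late stage of the sequences.\<close>

lemma ST_fill:
  fixes F F' :: "('o, 'm, 'u) presheaf_map"
  assumes s: "ST C M a \<alpha> b \<beta> c \<gamma> f g h A B P F G H" and s': "ST C M a' \<alpha>' b' \<beta>' c' \<gamma>' f' g' h' A' B' P' F' G' H'"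
    and v: "vanish P' i" "vanish A' i" and U: "U \<in> Hom (ModCat C) A A'" and V: "V \<in> Hom (ModCat C) B B'"
    and sq: "V \<cdot>\<^bsub>ModCat C\<^esub> F = F' \<cdot>\<^bsub>ModCat C\<^esub> U"
  shows "\<exists>W \<in> Hom (ModCat C) P P'. W \<cdot>\<^bsub>ModCat C\<^esub> G = G' \<cdot>\<^bsub>ModCat C\<^esub> V \<and>
    H' \<cdot>\<^bsub>ModCat C\<^esub> W = ShA (ModCat C) U \<cdot>\<^bsub>ModCat C\<^esub> H \<and>
    (ty (Suc (Suc m)) a \<alpha> a' \<alpha>' U \<and> ty (Suc (Suc m)) b \<beta> b' \<beta>' V \<longrightarrow> ty m c \<gamma> c' \<gamma>' W)"
proof -
  note cp = ST_CP[OF s] and cp' = ST_CP[OF s'] and hom = ST_Hom[OF s] and hom' = ST_Hom[OF s'] and t = ST_tri[OF s] and t' = ST_tri[OF s']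
  note at = ST_at[OF s] and at' = ST_at[OF s'] and mp' = ST_map[OF s']
  note sa' = CP_seq[OF cp'(1)] and sb' = CP_seq[OF cp'(2)] and mA' = CP_mod[OF cp'(1)] and mB' = CP_mod[OF cp'(2)] and mP' = CP_mod[OF cp'(3)]
  \<comment> \<open>\<open>Suc (Suc i)\<close> serves the extension and comparison of maps into
    \<open>P'\<close> and the shift of \<open>A'\<close>, which vanish on \<open>M (Suc i)\<close>;
    \<open>Suc m\<close> serves the type of \<open>W\<close>.\<close>
  define I where "I = max (max (Suc (Suc i)) (Suc m)) i"
  obtain Nc where Nc: "\<And>j k. \<lbrakk>j \<ge> Nc; k \<ge> j\<rbrakk> \<Longrightarrow> T I (transition C c j k)" using cauchyD[OF CP_cauchy[OF cp(3)]] by blast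
  obtain Nb where Nb: "\<And>j k. \<lbrakk>j \<ge> Nb; k \<ge> j\<rbrakk> \<Longrightarrow> T I (transition C b j k)" using cauchyD[OF CP_cauchy[OF cp(2)]] by blast
  obtain Nc' where Nc': "\<And>j k. \<lbrakk>j \<ge> Nc'; k \<ge> j\<rbrakk> \<Longrightarrow> T I (transition C c' j k)" using cauchyD[OF CP_cauchy[OF cp'(3)]] by blast
  let ?ty = "ty (Suc (Suc m)) a \<alpha> a' \<alpha>' U \<and> ty (Suc (Suc m)) b \<beta> b' \<beta>' V"
  obtain Nu where Nu: "\<And>j. j \<ge> Nu \<Longrightarrow> ?ty \<Longrightarrow> tyF (Suc (Suc m)) (ob a j) a' A' \<alpha>' (At U (ob a j) (\<alpha> j))" using tyD[OF _ U] by blast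
  obtain Nv where Nv: "\<And>j. j \<ge> Nv \<Longrightarrow> ?ty \<Longrightarrow> tyF (Suc (Suc m)) (ob b j) b' B' \<beta>' (At V (ob b j) (\<beta> j))" using tyD[OF _ V] by blast
  define j where "j = max (max Nc Nb) (max Nu Nv)"
  have j: "j \<ge> Nc" "j \<ge> Nb" "j \<ge> Nu" "j \<ge> Nv" by (auto simp: j_def)
  note oa = CP_Obj[OF cp(1), of j] and obj = CP_Obj[OF cp(2), of j] and oc = CP_Obj[OF cp(3), of j]
  obtain k1 u where u: "u \<in> Hom C (ob a j) (ob a' k1)" "At U (ob a j) (\<alpha> j) = FunA A' u (\<alpha>' k1)"
    using pres_surj[OF CP_pres[OF cp'(1)] oa MH_closed[OF U oa CP_el[OF cp(1)]]] by blast
  obtain k2 w where w: "w \<in> Hom C (ob b j) (ob b' k2)" "At V (ob b j) (\<beta> j) = FunA B' w (\<beta>' k2)"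
    using pres_surj[OF CP_pres[OF cp'(2)] obj MH_closed[OF V obj CP_el[OF cp(2)]]] by blast
  obtain K1 where K1: "\<And>l. l \<ge> K1 \<Longrightarrow> ?ty \<Longrightarrow> T (Suc (Suc m)) (transition C a' k1 l \<cdot> u)"
    using tyF_lift[OF cp'(1) Nu[OF j(3)] u(1) u(2)[symmetric]] by blast
  obtain K2 where K2: "\<And>l. l \<ge> K2 \<Longrightarrow> ?ty \<Longrightarrow> T (Suc (Suc m)) (transition C b' k2 l \<cdot> w)"
    using tyF_lift[OF cp'(2) Nv[OF j(4)] w(1) w(2)[symmetric]] by blast
  have fu: "f' k1 \<cdot> u \<in> Hom C (ob a j) (ob b' k1)" and wf: "w \<cdot> f j \<in> Hom C (ob a j) (ob b' k2)"
    using Comp_Hom[OF u(1) tri1[OF t']] Comp_Hom[OF tri1[OF t] w(1)] by auto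
  have "FunA B' (f' k1 \<cdot> u) (\<beta>' k1) = At F' (ob a j) (At U (ob a j) (\<alpha> j))"
    using act_comp[OF mB' u(1) tri1[OF t'] CP_el[OF cp'(2)]] at'(1)[of k1] MH_act[OF hom'(1) u(1) CP_el[OF cp'(1)]] u(2) by simp
  also have "\<dots> = At V (ob a j) (At F (ob a j) (\<alpha> j))"
    using At_Comp[OF U oa CP_el[OF cp(1)], of F'] At_Comp[OF hom(1) oa CP_el[OF cp(1)], of V] sq by simp
  also have "\<dots> = FunA B' (w \<cdot> f j) (\<beta>' k2)"
    using act_comp[OF mB' tri1[OF t] w(1) CP_el[OF cp'(2)]] w(2) at(1)[of j] MH_act[OF V tri1[OF t[of j]] CP_el[OF cp(2)], symmetric] by simp
  finally have "FunA B' (f' k1 \<cdot> u) (\<beta>' k1) = FunA B' (w \<cdot> f j) (\<beta>' k2)" .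
  from pres_inj_ge[OF sb' mB' CP_pres[OF cp'(2)] fu wf this]
  obtain L where L: "\<And>l. l \<ge> L \<Longrightarrow> k1 \<le> l \<and> k2 \<le> l \<and> transition C b' k1 l \<cdot> (f' k1 \<cdot> u) = transition C b' k2 l \<cdot> (w \<cdot> f j)" by blast
  \<comment> \<open>At this stage of the second triangle, \<open>U\<close> and \<open>V\<close> on
    the \<open>j\<close>-th objects are represented, their square with \<open>f j\<close> and
    \<open>f' k\<close> commutes, and the cones are small if both are of the given type.\<close>
  define k where "k = max (max K1 K2) (max L Nc')"
  have k: "k \<ge> Nc'" "k1 \<le> k" "k2 \<le> k" "transition C b' k1 k \<cdot> (f' k1 \<cdot> u) = transition C b' k2 k \<cdot> (w \<cdot> f j)"
    using L[of k] by (auto simp: k_def)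
  define u' where "u' = transition C a' k1 k \<cdot> u"
  define w' where "w' = transition C b' k2 k \<cdot> w"
  have u': "u' \<in> Hom C (ob a j) (ob a' k)" "FunA A' u' (\<alpha>' k) = At U (ob a j) (\<alpha> j)"
    unfolding u'_def using trans_push[OF sa' u(1) k(2)] pres_push[OF sa' mA' CP_pres[OF cp'(1)] u(1) k(2)] u(2) by auto
  have w': "w' \<in> Hom C (ob b j) (ob b' k)" "FunA B' w' (\<beta>' k) = At V (ob b j) (\<beta> j)"
    unfolding w'_def using trans_push[OF sb' w(1) k(3)] pres_push[OF sb' mB' CP_pres[OF cp'(2)] w(1) k(3)] w(2) by auto
  have "w' \<cdot> f j = f' k \<cdot> u'"
    unfolding u'_def w'_def
    using Comp_assoc[OF tri1[OF t] w(1) trans_Hom[OF sb' k(3)]] k(4) Comp_assoc[OF u(1) tri1[OF t'] trans_Hom[OF sb' k(2)]]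
      map_trans[OF sa' sb' mp'(1) k(2)] Comp_assoc[OF u(1) trans_Hom[OF sa' k(2)] tri1[OF t']] by simp
  \<comment> \<open>This fill-in loses one index and the passage from one stage to the type of
    \<open>W\<close> another, which explains \<open>Suc (Suc m)\<close> in the statement.\<close>
  from T_fill[OF t t' u'(1) w'(1) this]
  obtain \<omega> where om: "\<omega> \<in> Hom C (ob c j) (ob c' k)" "\<omega> \<cdot> g j = g' k \<cdot> w'" "ShA C u' \<cdot> h j = h' k \<cdot> \<omega>"
    and omT: "\<And>n. T (Suc n) u' \<Longrightarrow> T (Suc n) w' \<Longrightarrow> T n \<omega>" by blast
  have el: "FunA P' \<omega> (\<gamma>' k) \<in> el P' (ob c j)" by (rule act_closed[OF mP' om(1) CP_el[OF cp'(3)]])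
  note hP = CP_homol[OF cp'(3)] and v' = vanish_mono[OF v(1), of "Suc i"]
  have TT: "T (Suc (Suc i)) (transition C c j l)" "T (Suc m) (transition C c j l)" "T (Suc (Suc i)) (transition C b j l)" if "l \<ge> j" for l
    using Nc[OF j(1) that] Nb[OF j(2) that] T_mono unfolding I_def by (meson max.cobounded1 max.cobounded2 le_trans)+
  obtain W where W: "W \<in> Hom (ModCat C) P P'" "At W (ob c j) (\<gamma> j) = FunA P' \<omega> (\<gamma>' k)"
    using stage_ext[OF cp(3) hP v', of j] TT(1) el by auto
  have "W \<cdot>\<^bsub>ModCat C\<^esub> G = G' \<cdot>\<^bsub>ModCat C\<^esub> V"
  proof (rule stage_eq[OF cp(2) hP v' TT(3) MComp_Hom[OF hom(2) W(1)] MComp_Hom[OF V hom'(2)]])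
    have "At W (ob b j) (At G (ob b j) (\<beta> j)) = FunA P' (\<omega> \<cdot> g j) (\<gamma>' k)"
      using at(2)[of j] MH_act[OF W(1) tri2[OF t[of j]] CP_el[OF cp(3)], symmetric] W(2) act_comp[OF mP' tri2[OF t] om(1) CP_el[OF cp'(3)]] by simp
    also have "\<dots> = At G' (ob b j) (At V (ob b j) (\<beta> j))"
      unfolding om(2) using act_comp[OF mP' w'(1) tri2[OF t'] CP_el[OF cp'(3)]] at'(2)[of k] MH_act[OF hom'(2) w'(1) CP_el[OF cp'(2)]] w'(2) by simp
    finally show "At (W \<cdot>\<^bsub>ModCat C\<^esub> G) (ob b j) (\<beta> j) = At (G' \<cdot>\<^bsub>ModCat C\<^esub> V) (ob b j) (\<beta> j)"
      by (simp add: At_Comp[OF hom(2) obj CP_el[OF cp(2)]] At_Comp[OF V obj CP_el[OF cp(2)]])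
  qed auto
  moreover have "H' \<cdot>\<^bsub>ModCat C\<^esub> W = ShA (ModCat C) U \<cdot>\<^bsub>ModCat C\<^esub> H"
  proof (rule stage_eq[OF cp(3) CP_homol[OF CP_shift[OF cp'(1)]] vanish_shift[OF mA' v(2)] TT(1) MComp_Hom[OF W(1) hom'(3)] MComp_Hom[OF hom(3) MShA_Hom[OF U]]])
    note shA = module_shift[OF mA'] and elA = CP_el[OF CP_shift[OF cp'(1)], of k, unfolded shift_seq(2)[OF sa']]
    note elA2 = CP_el[OF CP_shift[OF cp(1)], of j, unfolded shift_seq(2)[OF CP_seq[OF cp(1)]]]
    have "At H' (ob c j) (At W (ob c j) (\<gamma> j)) = FunA (ShO (ModCat C) A') (h' k \<cdot> \<omega>) (\<alpha>' k)"
      using W(2) MH_act[OF hom'(3) om(1) CP_el[OF cp'(3)]] at'(3)[of k] act_comp[OF shA om(1) tri3[OF t'] elA] by simp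
    also have "\<dots> = FunA (ShO (ModCat C) A') (h j) (FunA (ShO (ModCat C) A') (ShA C u') (\<alpha>' k))"
      unfolding om(3)[symmetric] by (rule act_comp[OF shA tri3[OF t] ShA_Hom[OF u'(1)] elA])
    also have "FunA (ShO (ModCat C) A') (ShA C u') (\<alpha>' k) = At (ShA (ModCat C) U) (ShO C (ob a j)) (\<alpha> j)"
      using u'(2) Hom_Arr[OF u'(1)] Hom_Arr[OF ShA_Hom[OF u'(1)]] by (simp add: shM_simps ShO_Obj[OF oa] UnO_ShO[OF oa] UnA_ShA)
    also have "FunA (ShO (ModCat C) A') (h j) \<dots> = At (ShA (ModCat C) U) (ob c j) (At H (ob c j) (\<gamma> j))"
      using MH_act[OF MShA_Hom[OF U] tri3[OF t] elA2] at(3)[of j] by simp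
    finally show "At (H' \<cdot>\<^bsub>ModCat C\<^esub> W) (ob c j) (\<gamma> j) = At (ShA (ModCat C) U \<cdot>\<^bsub>ModCat C\<^esub> H) (ob c j) (\<gamma> j)"
      by (simp add: At_Comp[OF W(1) oc CP_el[OF cp(3)]] At_Comp[OF hom(3) oc CP_el[OF cp(3)]])
  qed auto
  moreover have "ty m c \<gamma> c' \<gamma>' W" if ty: ?ty
  proof (rule ty_of_stage[OF cp(3) cp'(3) W(1) TT(2)])
    have "T (Suc m) \<omega>"
      by (rule omT) (use K1[OF _ ty, of k] K2[OF _ ty, of k] in \<open>auto simp: u'_def w'_def k_def\<close>)
    moreover have "T (Suc m) (transition C c' k l)" if "l \<ge> k" for l
      by (rule T_mono[OF Nc'[OF k(1) that]]) (simp add: I_def)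
    ultimately show "tyF (Suc m) (ob c j) c' P' \<gamma>' (At W (ob c j) (\<gamma> j))"
      unfolding W(2) by (intro tyFI[OF cp'(3) om(1)])
  qed auto
  ultimately show ?thesis using W(1) by blast
qed

text \<open>The five lemma for the exact sequences of values at \<open>x\<close>, applied to a
  fill-in over two identities.\<close>

lemma ST_unique:
  fixes F :: "('o, 'm, 'u) presheaf_map"
  assumes s: "ST C M a \<alpha> b \<beta> c \<gamma> f g h A B P F G H" and s': "ST C M a' \<alpha>' b' \<beta>' c' \<gamma>' f' g' h' A B P' F G' H'"
    and v: "vanish P' i" "vanish A i"
  shows "\<exists>W \<in> Hom (ModCat C) P P'. H' \<cdot>\<^bsub>ModCat C\<^esub> W = H \<and> (\<forall>x \<in> Obj C. bij_betw (At W x) (el P x) (el P' x))"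
proof -
  note hom = ST_Hom[OF s] and hom' = ST_Hom[OF s']
  interpret D: shifted "ModCat C :: (('o, 'm, 'u) presheaf, ('o, 'm, 'u) presheaf_map) shift_cat" by (rule shifted_ModCat)
  note m = MH_mod[OF hom(1)] and mP = MH_mod(2)[OF hom(2)] and mP' = MH_mod(2)[OF hom'(2)]
  note iA = MIdent_Hom[OF m(1)] and iB = MIdent_Hom[OF m(2)]
  have "Ident (ModCat C) B \<cdot>\<^bsub>ModCat C\<^esub> F = F \<cdot>\<^bsub>ModCat C\<^esub> Ident (ModCat C) A"
    using D.Ident_Comp[OF hom(1)] D.Comp_Ident[OF hom(1)] by simp
  from ST_fill[OF s s' v iA iB this]
  obtain W where W: "W \<in> Hom (ModCat C) P P'" and WG: "W \<cdot>\<^bsub>ModCat C\<^esub> G = G' \<cdot>\<^bsub>ModCat C\<^esub> Ident (ModCat C) B"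
    and HW: "H' \<cdot>\<^bsub>ModCat C\<^esub> W = ShA (ModCat C) (Ident (ModCat C) A) \<cdot>\<^bsub>ModCat C\<^esub> H" by blast
  have WG: "W \<cdot>\<^bsub>ModCat C\<^esub> G = G'" using WG D.Comp_Ident[OF hom'(2)] by simp
  have HW: "H' \<cdot>\<^bsub>ModCat C\<^esub> W = H" using HW D.ShA_Ident[of A] D.Ident_Comp[OF hom(3)] m(1) by simp
  have "bij_betw (At W x) (el P x) (el P' x)" if x: "x \<in> Obj C" for x
  proof -
    have WGx: "At W x (At G x w) = At G' x w" if "w \<in> el B x" for w using At_Comp[OF hom(2) x that, of W] WG by simp
    have HWx: "At H' x (At W x w) = At H x w" if "w \<in> el P x" for w using At_Comp[OF W x that, of H'] HW by simp
    interpret P: comm_group "FunO P x" by (rule module_group[OF mP x])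
    interpret P': comm_group "FunO P' x" by (rule module_group[OF mP' x])
    interpret W: group_hom "FunO P x" "FunO P' x" "At W x"
      by (intro group_hom.intro group_hom_axioms.intro P.is_group P'.is_group)
        (auto simp: hom_def MH_closed[OF W x] MH_mult[OF W x])
    interpret H': group_hom "FunO P' x" "FunO (ShO (ModCat C) A) x" "At H' x"
      by (intro group_hom.intro group_hom_axioms.intro P'.is_group
          comm_group.axioms(2)[OF module_group[OF module_shift[OF m(1)] x]])
        (auto simp: hom_def MH_closed[OF hom'(3) x] MH_mult[OF hom'(3) x])
    have ker: "u = \<one>\<^bsub>FunO P x\<^esub>" if u: "u \<in> el P x" "At W x u = \<one>\<^bsub>FunO P' x\<^esub>" for u
    proof -
      have "At H x u = \<one>\<^bsub>FunO (ShO (ModCat C) A) x\<^esub>" using HWx[OF u(1)] u(2) MH_one[OF hom'(3) x] by simp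
      then obtain w where w: "w \<in> el B x" "u = At G x w" using ST_exD[OF s x u(1)] by blast
      have "At G' x w = \<one>\<^bsub>FunO P' x\<^esub>" using WGx[OF w(1)] w(2) u(2) by simp
      then obtain y where "y \<in> el A x" "w = At F x y" using ST_exB[OF s' x w(1)] by blast
      then show ?thesis using ST_GF[OF s x] w(2) by simp
    qed
    have inj: "inj_on (At W x) (el P x)"
      unfolding W.inj_on_one_iff using ker by blast
    have "\<exists>u \<in> el P x. At W x u = v" if v: "v \<in> el P' x" for v
    proof -
      have "At (ShA (ModCat C) F) x (At H' x v) = \<one>\<^bsub>FunO (ShO (ModCat C) B) x\<^esub>" by (rule ST_FH[OF s' x v])
      then obtain u where u: "u \<in> el P x" "At H' x v = At H x u" using ST_exA[OF s x MH_closed[OF hom'(3) x v]] by blast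
      note Wu = MH_closed[OF W x u(1)]
      let ?d = "v \<otimes>\<^bsub>FunO P' x\<^esub> inv\<^bsub>FunO P' x\<^esub> (At W x u)"
      have "At H' x ?d = \<one>\<^bsub>FunO (ShO (ModCat C) A) x\<^esub>"
        using v Wu HWx[OF u(1)] u(2) H'.H.r_inv[OF MH_closed[OF hom(3) x u(1)]] by simp
      then obtain w where w: "w \<in> el B x" "?d = At G' x w" using ST_exD[OF s' x, of ?d] v Wu by auto
      note Gw = MH_closed[OF hom(2) x w(1)]
      have "At W x (At G x w \<otimes>\<^bsub>FunO P x\<^esub> u) = ?d \<otimes>\<^bsub>FunO P' x\<^esub> At W x u" using WGx[OF w(1)] w(2) Gw u(1) by simp
      also have "\<dots> = v" using v Wu by (simp add: P'.m_assoc)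
      finally show ?thesis using P.m_closed[OF Gw u(1)] by blast
    qed
    then show ?thesis using inj MH_closed[OF W x] unfolding bij_betw_def by blast
  qed
  then show ?thesis using W HW by blast
qed

text \<open>The presentation of \<open>P\<close> has to be constructed along with the type: with respect to an unrelated
  presentation the cones are only direct summands of objects of \<open>M i\<close>.\<close>

lemma new_pres:
  fixes F :: "('o, 'm, 'u) presheaf_map"
  assumes s: "ST C M a \<alpha> b \<beta> c \<gamma> f g h A B P F G q" and X: "A \<in> SObj e C M" "B \<in> SObj e C M" "P \<in> SObj e C M"
    and B: "B \<in> LiObj e C M (Suc i)" and y: "CP y (ShO (ModCat C) A) \<tau>"
  shows "\<exists>z \<zeta>. CP z P \<zeta> \<and> ty i z \<zeta> y \<tau> q"
proof -
  note hom = ST_Hom[OF s]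
  have mA: "is_module C A" by (rule MH_mod(1)[OF hom(1)])
  have cA: "CP (\<lambda>n. UnA C (y n)) A \<tau>" using CP_unshift[OF y] unsh_sh[OF mA] by simp
  obtain b' \<beta>' where cB: "CP b' B \<beta>'" and bM: "\<And>n. ob b' n \<in> M (Suc i)" using B unfolding LiObj_iff by blast
  \<comment> \<open>A second strong triangle on \<open>F\<close> is built from the presentation of
    \<open>A\<close> that \<open>y\<close> dictates and one of \<open>B\<close> inside
    \<open>M (Suc i)\<close>. Its vertex \<open>P'\<close> comes with a suitable presentation, which
    is then carried to \<open>P\<close> by the isomorphism \<open>W\<close>.\<close>
  obtain r r' z \<gamma>' f' g' h' P' G' H' where r: "strict_mono r" "strict_mono r'" and
    s': "ST C M (subsequence C (\<lambda>n. UnA C (y n)) r) (\<lambda>n. \<tau> (r n)) (subsequence C b' r') (\<lambda>n. \<beta>' (r' n)) z \<gamma>' f' g' h' A B P' F G' H'"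
    using ST_of_map[OF cA cB hom(1), of 0] by blast
  obtain i1 i2 i3 where v: "vanish A i1" "vanish B i2" "vanish P i3" using X unfolding SObj_iff by blast
  define l where "l = max (max i1 i2) i3"
  have vl: "vanish A l" "vanish B l" "vanish P l" using vanish_mono[OF v(1), of l] vanish_mono[OF v(2), of l] vanish_mono[OF v(3), of l]
    by (auto simp: l_def)
  obtain W where W: "W \<in> Hom (ModCat C) P' P" "q \<cdot>\<^bsub>ModCat C\<^esub> W = H'"
    and bij: "\<And>x. x \<in> Obj C \<Longrightarrow> bij_betw (At W x) (el P' x) (el P x)" using ST_unique[OF s' s vl(3,1)] by blast
  note cp' = ST_CP[OF s'] and t' = ST_tri[OF s']
  define \<zeta> where "\<zeta> n = At W (ob z n) (\<gamma>' n)" for n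
  have cz: "CP z P \<zeta>" unfolding CP_def \<zeta>_def
    using CP_cauchy[OF cp'(3)] MH_mod(2)[OF W(1)] pres_transport[OF CP_seq[OF cp'(3)] CP_pres[OF cp'(3)] W(1) bij] by blast
  have sy: "is_seq C y" by (rule CP_seq[OF y])
  have oa: "ob (subsequence C (\<lambda>n. UnA C (y n)) r) n = UnO C (ob y (r n))" for n
    using subseq_seq(2)[OF CP_seq[OF cA] r(1)] unshift_seq(2)[OF sy] by simp
  have hH: "h' n \<in> Hom C (ob z n) (ob y (r n))" for n
    using tri3[OF t'[of n]] unfolding oa using ShO_UnO[OF seq_Obj[OF sy]] by simp
  \<comment> \<open>The cone of \<open>h' n\<close> is the shift of a term of \<open>b'\<close>, and
    these terms lie in \<open>M (Suc i)\<close>.\<close>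
  have hT: "T i (h' n)" for n
  proof -
    have "tri (ob z n) (ob y (r n)) (ShO C (ob b' (r' n))) (h' n) (Neg C (ShA C (f' n))) (Neg C (ShA C (g' n)))"
      using rot[OF rot[OF t'[of n]]] unfolding oa ShO_UnO[OF seq_Obj[OF sy]] subseq_seq(2)[OF CP_seq[OF cB] r(2)] .
    then show ?thesis unfolding cone_in_iff[OF hH] using M_ShO[OF bM] by blast
  qed
  have qz: "At q (ob z n) (\<zeta> n) = FunA (ShO (ModCat C) A) (h' n) (\<tau> (r n))" for n
    using At_Comp[OF W(1) CP_Obj[OF cp'(3)] CP_el[OF cp'(3)], of q n] W(2) ST_at(3)[OF s', of n] by (simp add: \<zeta>_def)
  obtain L where L: "\<And>j k. \<lbrakk>j \<ge> L; k \<ge> j\<rbrakk> \<Longrightarrow> T i (transition C y j k)" using cauchyD[OF CP_cauchy[OF y]] by blast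
  have "ty i z \<zeta> y \<tau> q"
  proof (rule tyI[OF hom(3), of L])
    fix n assume n: "n \<ge> L"
    have "n \<le> r n" by (rule strict_mono_imp_increasing[OF r(1)])
    then show "tyF i (ob z n) y (ShO (ModCat C) A) \<tau> (At q (ob z n) (\<zeta> n))"
      unfolding qz by (intro tyFI[OF y hH hT] L) (use n in auto)
  qed
  then show ?thesis using cz by blast
qed

text \<open>A tail of the sequence is cofinal, so compatible elements on it suffice.\<close>

lemma pres_hom_ge:
  assumes c: "CP E A t" and B: "is_module C B"
    and s: "\<And>n. n \<ge> L \<Longrightarrow> s n \<in> el B (ob E n)" "\<And>n. n \<ge> L \<Longrightarrow> FunA B (E n) (s (Suc n)) = s n"
  shows "\<exists>G \<in> Hom (ModCat C) A B. \<forall>n\<ge>L. At G (ob E n) (t n) = s n"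
proof -
  define r where "r = (\<lambda>n. L + n)"
  have r: "strict_mono r" by (simp add: r_def strict_mono_def)
  note E = CP_seq[OF c]
  have sub: "subsequence C E r n = E (r n)" for n unfolding subsequence_def using trans_step[OF E, of "r n"] by (simp add: r_def)
  have s1: "s (r n) \<in> el B (ob (subsequence C E r) n)" for n unfolding sub by (rule s) (simp add: r_def)
  have s2: "FunA B (subsequence C E r n) (s (r (Suc n))) = s (r n)" for n
    unfolding sub using s(2)[of "r n"] by (simp add: r_def)
  have "\<exists>G \<in> Hom (ModCat C) A B. \<forall>n. At G (ob (subsequence C E r) n) (t (r n)) = s (r n)"
    by (rule pres_hom[OF subseq_seq(1)[OF E r] CP_mod[OF c] pres_subseq[OF E CP_mod[OF c] CP_pres[OF c] r] B s1 s2])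
  then obtain G where G: "G \<in> Hom (ModCat C) A B" "\<And>n. At G (ob E (r n)) (t (r n)) = s (r n)" by (auto simp: sub)
  have "At G (ob E n) (t n) = s n" if "n \<ge> L" for n using G(2)[of "n - L"] that by (simp add: r_def)
  then show ?thesis using G(1) by blast
qed

end

section \<open>Essential surjectivity\<close>

lemma strict_mono_dominating: "\<exists>r :: nat \<Rightarrow> nat. strict_mono r \<and> (\<forall>i. L i \<le> r i)"
proof -
  define r where "r = rec_nat (L 0) (\<lambda>i x. max (L (Suc i)) (Suc x))"
  have "r i < r (Suc i)" for i by (simp add: r_def)
  moreover have "L i \<le> r i" for i by (cases i) (simp_all add: r_def)
  ultimately show ?thesis by (auto simp: strict_mono_Suc_iff)
qed

context dual
begin

text \<open>A converse of \<open>cone_BB\<close>: the triangle witnessing the cone is a strong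
  triangle ending in \<open>q\<close>, to which \<open>new_pres\<close> applies. The type refers to
  a presentation of the source that is adapted to the one given on the target.\<close>

lemma cone_BB_D:
  assumes "cone_in BB q (N (Suc i))" and q: "q \<in> Hom D Y Z" and y: "CP y Z \<tau>"
  shows "\<exists>z \<zeta>. CP z Y \<zeta> \<and> ty i z \<zeta> y \<tau> q"
proof -
  obtain G F where GF: "(q, G, F) \<in> Tri BB" "Tgt BB G \<in> N (Suc i)" using assms(1) unfolding cone_in_def by blast
  then have st: "(F, G, q) \<in> strong_triangles e C M" and X: "MSrc F \<in> X" "MSrc G \<in> X" "MSrc q \<in> X" by auto
  obtain a \<alpha> b \<beta> c \<gamma> f g h A B P where s: "ST C M a \<alpha> b \<beta> c \<gamma> f g h A B P F G q" using st[unfolded strong_iff] by (elim exE) (rule that)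
  have e: "MSrc F = A" "MSrc G = B" "MSrc q = P" "MTgt q = ShO D A" "MSrc q = Y" "MTgt q = Z"
    using ST_Hom[OF s] q by (auto simp: Hom_ModCat)
  have "B \<in> LiObj e C M (Suc i)" using GF(2) e by (simp add: SMetric_def)
  then show ?thesis using new_pres[OF s _ _ _ _ , of i y \<tau>] X y e by auto
qed

text \<open>The approximations \<open>x i\<close> have to map forwards, against the direction of the
  inverse system. This works because \<open>x i\<close> is left orthogonal to \<open>M (k i)\<close>
  and the type of the map from the next level exceeds \<open>k i\<close>: the element
  \<open>u i\<close> lifts to that level and then factors through \<open>x (Suc i)\<close>.\<close>

lemma Yh_ess_surj:
  assumes q: "cauchy BB N q" and W: "is_module BB W" "pres BB q W \<tau>"
  shows "\<exists>A \<in> LObj e C M. \<exists>G \<in> Hom (ModCat BB) (Yh A) W. \<forall>x \<in> X. bij_betw (At G x) (el (Yh A) x) (el W x)"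
proof -
  have sq: "is_seq BB q" using q by (simp add: cauchy_def)
  \<comment> \<open>The index \<open>Suc (Suc i)\<close> allows for the loss in
    \<open>cone_BB_D\<close>, so that the \<open>i\<close>-th connecting map will be of type
    \<open>Suc i\<close>.\<close>
  have "\<forall>i. \<exists>L. \<forall>j\<ge>L. \<forall>k>j. cone_in BB (transition BB q j k) (N (Suc (Suc i)))" using q unfolding cauchy_def by blast
  then obtain L where L: "\<And>i j k. \<lbrakk>j \<ge> L i; k > j\<rbrakk> \<Longrightarrow> cone_in BB (transition BB q j k) (N (Suc (Suc i)))" by metis
  obtain r where r: "strict_mono r" and rL: "\<And>i. L i \<le> r i" using strict_mono_dominating by blast
  define q1 where "q1 = subsequence BB q r"
  define Z where "Z = (\<lambda>i. Src BB (q1 i))"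
  have sq1: "is_seq BB q1" unfolding q1_def by (rule B.subseq_seq(1)[OF sq r])
  have p1: "pres BB q1 W (\<lambda>i. \<tau> (r i))" unfolding q1_def by (rule B.pres_subseq[OF sq W r])
  have ZX: "Z i \<in> X" for i using B.seq_Obj[OF sq1] by (simp add: Z_def)
  have q1H: "q1 i \<in> Hom D (Z (Suc i)) (Z i)" for i unfolding Z_def by (rule Hom_BBD(3)[OF B.seq_Hom[OF sq1]])
  have q1c: "cone_in BB (q1 i) (N (Suc (Suc i)))" for i
    unfolding q1_def subsequence_def by (rule L[OF rL]) (use r in \<open>simp add: strict_mono_Suc_iff\<close>)
  \<comment> \<open>The presentations are chosen recursively, that of \<open>Z (Suc i)\<close>
    depending on that of \<open>Z i\<close>, so that each presentation fits both neighbouring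
    connecting maps.\<close>
  have "\<exists>x. \<forall>i. CP (fst (x i)) (Z i) (snd (x i)) \<and> ty (Suc i) (fst (x (Suc i))) (snd (x (Suc i))) (fst (x i)) (snd (x i)) (q1 i)"
  proof (rule dependent_nat_choice)
    obtain E t where "CP E (Z 0) t" using ZX[of 0] unfolding SObj_iff by blast
    then show "\<exists>x. CP (fst x) (Z 0) (snd x)" by auto
    fix x i assume c: "CP (fst x) (Z i) (snd x)"
    show "\<exists>y. CP (fst y) (Z (Suc i)) (snd y) \<and> ty (Suc i) (fst y) (snd y) (fst x) (snd x) (q1 i)"
      using cone_BB_D[OF q1c q1H c] by auto
  qed
  then obtain x where x: "\<And>i. CP (fst (x i)) (Z i) (snd (x i))"
    "\<And>i. ty (Suc i) (fst (x (Suc i))) (snd (x (Suc i))) (fst (x i)) (snd (x i)) (q1 i)" by blast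
  define d where "d i = fst (x i)" for i
  define t where "t i = snd (x i)" for i
  have cd: "CP (d i) (Z i) (t i)" and tq1: "ty (Suc i) (d (Suc i)) (t (Suc i)) (d i) (t i) (q1 i)" for i
    using x by (auto simp: d_def t_def)
  have tr1: "transition BB q1 i l \<in> Hom D (Z l) (Z i)" if "i \<le> l" for i l
    unfolding Z_def by (rule Hom_BBD(3)[OF B.trans_Hom[OF sq1 that]])
  have ttr1: "ty (Suc i) (d l) (t l) (d i) (t i) (transition BB q1 i l)" if "i \<le> l" for i l
    using that
  proof (induction l rule: dec_induct)
    case base
    have "MTgt (q1 i) = Z i" by (simp add: Z_def)
    then show ?case using ty_ident[OF cd] B.trans_refl[of q1 i] by simp
  next
    case (step l)
    have "ty (Suc i) (d (Suc l)) (t (Suc l)) (d l) (t l) (q1 l)" by (rule ty_mono[OF tq1]) (use step in simp)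
    from ty_comp[OF cd cd cd q1H this tr1[OF step(1)] step(3)] show ?case
      using B.trans_Suc[OF step(1), of q1] by simp
  qed
  have "\<forall>m. \<exists>n>m. \<forall>F \<in> Obj C. \<exists>f g h. (f, g, h) \<in> Tri C \<and> Src C f \<in> left_perp C (M n) \<and> Tgt C f = F \<and> Tgt C g \<in> M m"
    using excellent_b by blast
  then obtain nn where nn: "\<And>m. nn m > m" and nb: "\<And>m F. F \<in> Obj C \<Longrightarrow>
      \<exists>f g h. (f, g, h) \<in> Tri C \<and> Src C f \<in> left_perp C (M (nn m)) \<and> Tgt C f = F \<and> Tgt C g \<in> M m" by metis
  \<comment> \<open>The type \<open>m (Suc i)\<close> of \<open>u (Suc i)\<close> is one more than
    the orthogonality index \<open>k i\<close> of \<open>x i\<close>, as factoring through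
    \<open>x (Suc i)\<close> requires. The start 3 ensures that \<open>m i - 2\<close>, what remains
    after two cancellations, is at least \<open>i + 1\<close>.\<close>
  define m where "m i = ((\<lambda>j. Suc (nn j)) ^^ i) 3" for i
  define k where "k i = nn (m i)" for i
  have mS: "m (Suc i) = Suc (k i)" for i by (simp add: m_def k_def)
  have mk: "m i < k i" for i by (simp add: k_def nn)
  have mi: "m i \<ge> i + 3" for i
  proof (induction i)
    case (Suc i) then show ?case using mS[of i] mk[of i] by linarith
  qed (simp add: m_def)
  have "k i < k (Suc i)" for i using mS[of i] mk[of "Suc i"] by linarith
  then have kk: "strict_mono k" by (simp add: strict_mono_Suc_iff)
  \<comment> \<open>Along the indices \<open>k i\<close> the connecting map into the
    \<open>i\<close>-th object is of type \<open>Suc (k i)\<close>, enough to act bijectively on the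
    values at \<open>x i\<close>.\<close>
  define q2 where "q2 = subsequence BB q1 k"
  have sq2: "is_seq BB q2" and Sq2: "Src BB (q2 i) = Z (k i)" for i
    unfolding q2_def Z_def by (rule B.subseq_seq[OF sq1 kk])+
  have p2: "pres BB q2 W (\<lambda>i. \<tau> (r (k i)))" unfolding q2_def by (rule B.pres_subseq[OF sq1 W(1) p1 kk])
  define Y where "Y i = Z (k i)" for i
  define \<delta> where "\<delta> i = d (k i)" for i
  define \<sigma> where "\<sigma> i = t (k i)" for i
  have cY: "CP (\<delta> i) (Y i) (\<sigma> i)" for i unfolding Y_def \<delta>_def \<sigma>_def by (rule cd)
  have q2H: "q2 i \<in> Hom D (Y (Suc i)) (Y i)" for i using Hom_BBD(3)[OF B.seq_Hom[OF sq2]] unfolding Sq2 Y_def .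
  have tq2: "ty (Suc (k i)) (\<delta> (Suc i)) (\<sigma> (Suc i)) (\<delta> i) (\<sigma> i) (q2 i)" for i
    unfolding q2_def subsequence_def \<delta>_def \<sigma>_def
    by (rule ttr1) (use kk in \<open>simp add: strict_mono_less_eq\<close>)
  have tr2: "transition BB q2 i l \<in> Hom D (Y l) (Y i)" if "i \<le> l" for i l
    using Hom_BBD(3)[OF B.trans_Hom[OF sq2 that]] unfolding Sq2 Y_def .
  \<comment> \<open>Axiom (b) is applied to one object in the presentation of \<open>Y i\<close>, so
    late that the later transitions have cones in \<open>M (m i)\<close>; composing with the map
    from axiom (b) gives \<open>u\<close>.\<close>
  have "\<exists>x u. x \<in> left_perp C (M (k i)) \<and> u \<in> el (Y i) x \<and> tyF (m i) x (\<delta> i) (Y i) (\<sigma> i) u" for i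
  proof -
    obtain j where j: "\<And>l. l \<ge> j \<Longrightarrow> T (m i) (transition C (\<delta> i) j l)" using cauchyD[OF CP_cauchy[OF cY]] by blast
    obtain f g h where f: "(f, g, h) \<in> Tri C" "Src C f \<in> left_perp C (M (k i))" "Tgt C f = ob (\<delta> i) j" "Tgt C g \<in> M (m i)"
      using nb[OF CP_Obj[OF cY[of i], of j], of "m i"] unfolding k_def by blast
    have fH: "f \<in> Hom C (Src C f) (ob (\<delta> i) j)" using tri1[OF triI[OF f(1)]] f(3) by simp
    have fT: "T (m i) f" unfolding cone_in_def using f by blast
    have "tyF (m i) (Src C f) (\<delta> i) (Y i) (\<sigma> i) (FunA (Y i) f (\<sigma> i j))" by (rule tyFI[OF cY fH fT j])
    then show ?thesis using f(2) tyF_closed[OF cY] by blast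
  qed
  then obtain x u where xp: "\<And>i. x i \<in> left_perp C (M (k i))" and u: "\<And>i. u i \<in> el (Y i) (x i)"
    and ut: "\<And>i. tyF (m i) (x i) (\<delta> i) (Y i) (\<sigma> i) (u i)" by metis
  have xo: "x i \<in> Obj C" for i using left_perp_Obj[OF xp] .
  have "\<exists>f \<in> Hom C (x i) (x (Suc i)). At (q2 i) (x i) (FunA (Y (Suc i)) f (u (Suc i))) = u i \<and> T (i + 1) f" for i
  proof -
    obtain v where v: "v \<in> el (Y (Suc i)) (x i)" "At (q2 i) (x i) v = u i"
      using ty_perp_surj[OF cY cY q2H tq2 xp u] by blast
    \<comment> \<open>Cancelling \<open>q2 i\<close> leaves the lift \<open>v\<close> of
      \<open>u i\<close> with type \<open>m i - 1\<close>; cancelling \<open>u (Suc i)\<close>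
      leaves the arrow to \<open>x (Suc i)\<close> with cone in \<open>M (m i - 2)\<close>.\<close>
    define a where "a = m i - 2"
    have a: "m i = Suc (Suc a)" "i + 1 \<le> a" using mi[of i] by (simp_all add: a_def)
    have "tyF (Suc a) (x i) (\<delta> (Suc i)) (Y (Suc i)) (\<sigma> (Suc i)) v"
    proof (rule tyF_cancel_post[OF cY cY q2H _ v(1) _ xo])
      show "ty (Suc (Suc a)) (\<delta> (Suc i)) (\<sigma> (Suc i)) (\<delta> i) (\<sigma> i) (q2 i)" by (rule ty_mono[OF tq2]) (use mk[of i] a in simp)
      show "tyF (Suc (Suc a)) (x i) (\<delta> i) (Y i) (\<sigma> i) (At (q2 i) (x i) v)" using ut[of i] v(2) a(1) by simp
    qed
    moreover obtain f where f: "f \<in> Hom C (x i) (x (Suc i))" "FunA (Y (Suc i)) f (u (Suc i)) = v"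
      using tyF_perp_lift[OF cY[of "Suc i"] xp[of i] _ v(1)] ut[of "Suc i"] unfolding mS by blast
    moreover have "tyF (Suc a) (x (Suc i)) (\<delta> (Suc i)) (Y (Suc i)) (\<sigma> (Suc i)) (u (Suc i))"
      by (rule tyF_mono[OF ut]) (use mS[of i] mk[of i] a in simp)
    ultimately have "T a f" using tyF_cancel_arrow[OF cY f(1)] by simp
    then show ?thesis using f v(2) T_mono[OF _ a(2)] by auto
  qed
  then obtain E where EH: "\<And>i. E i \<in> Hom C (x i) (x (Suc i))" and EQ: "\<And>i. At (q2 i) (x i) (FunA (Y (Suc i)) (E i) (u (Suc i))) = u i"
    and ET: "\<And>i. T (i + 1) (E i)" by metis
  have sE: "is_seq C E" and oE: "\<And>i. ob E i = x i" using is_seqI[of E x, OF EH] by auto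
  have cE: "cauchy C M E"
  proof (rule cauchyI[OF sE])
    fix i have "\<forall>n\<ge>i. T i (E n)" using T_mono[OF ET] by auto
    then show "\<exists>n. \<forall>l\<ge>n. T i (E l)" by blast
  qed
  obtain A t' where A: "CP E A t'" using CP_exists[OF cE] by blast
  have mY: "is_module C (Y i)" for i by (rule CP_mod[OF cY])
  \<comment> \<open>The image of \<open>u i\<close> in the lower level \<open>Y l\<close>. For fixed
    \<open>l\<close> these elements are compatible along the tail of \<open>E\<close> from
    \<open>l\<close> on and define the projection \<open>p l\<close> from the colimit
    \<open>A\<close>.\<close>
  define w where "w l i = At (transition BB q2 l i) (x i) (u i)" for l i
  have w: "w l i \<in> el (Y l) (ob E i)" and wE: "FunA (Y l) (E i) (w l (Suc i)) = w l i"
    and wq: "l < i \<Longrightarrow> At (q2 l) (x i) (w (Suc l) i) = w l i" if li: "l \<le> i" for l i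
  proof -
    show "w l i \<in> el (Y l) (ob E i)" unfolding w_def oE by (rule MH_closed[OF tr2[OF li] xo u])
    have "FunA (Y l) (E i) (w l (Suc i)) = At (transition BB q2 l (Suc i)) (x i) (FunA (Y (Suc i)) (E i) (u (Suc i)))"
      unfolding w_def by (rule MH_act[OF tr2 EH u]) (use li in simp)
    also have "transition BB q2 l (Suc i) = transition BB q2 l i \<cdot>\<^bsub>D\<^esub> q2 i" using B.trans_Suc[OF li, of q2] by simp
    also have "At (transition BB q2 l i \<cdot>\<^bsub>D\<^esub> q2 i) (x i) (FunA (Y (Suc i)) (E i) (u (Suc i))) = w l i"
      unfolding At_Comp[OF q2H xo act_closed[OF mY EH u]] EQ w_def ..
    finally show "FunA (Y l) (E i) (w l (Suc i)) = w l i" .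
    assume l: "l < i"
    have "transition BB q2 l i = q2 l \<cdot>\<^bsub>D\<^esub> transition BB q2 (Suc l) i"
      using B.trans_comp[OF sq2, of l "Suc l" i] B.trans_step[OF sq2, of l] l by simp
    then show "At (q2 l) (x i) (w (Suc l) i) = w l i"
      unfolding w_def using At_Comp[OF tr2 xo u, of "Suc l" i "q2 l"] l by simp
  qed
  have "\<forall>l. \<exists>p. p \<in> Hom D A (Y l) \<and> (\<forall>i\<ge>l. At p (x i) (t' i) = w l i)"
    using pres_hom_ge[OF A mY w wE] unfolding oE by blast
  then obtain p where p: "\<And>l. p l \<in> Hom D A (Y l)" and pw: "\<And>l i. i \<ge> l \<Longrightarrow> At (p l) (x i) (t' i) = w l i" by metis
  have t'e: "t' i \<in> el A (x i)" for i using CP_el[OF A, of i] unfolding oE .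
  have qp: "q2 l \<cdot>\<^bsub>D\<^esub> p (Suc l) = p l" for l
    by (rule pres_eqI[OF sE CP_pres[OF A] D.Comp_Hom[OF p q2H] p, of "Suc l"])
      (simp add: oE At_Comp[OF p xo t'e] pw wq)
  \<comment> \<open>On the \<open>l\<close>-th object \<open>p l\<close> is \<open>u l\<close>, of
    type \<open>m l\<close>, and from there on the arrows of \<open>E\<close> have cones in
    \<open>M (Suc l)\<close>; so one stage gives type \<open>l\<close>.\<close>
  have tp: "ty l E t' (\<delta> l) (\<sigma> l) (p l)" for l
  proof (rule ty_of_stage[OF A cY p, of l])
    fix n assume n: "n \<ge> l"
    show "T (Suc l) (transition C E l n)"
      using n
    proof (induction n rule: dec_induct)
      case base show ?case unfolding trans_refl oE by (rule T_ident[OF xo])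
    next
      case (step n)
      then show ?case using T_comp[OF trans_Hom[OF sE step(1)] seq_Hom[OF sE] step(3)] T_mono[OF ET[of n], of "Suc l"]
        by (simp add: trans_Suc)
    qed
  next
    have "At (p l) (x l) (t' l) = u l"
      using pw[OF le_refl, of l] B.trans_refl[of q2 l] At_Ident[OF xo u] Sq2[of l] by (simp add: w_def Y_def)
    then show "tyF (Suc l) (ob E l) (\<delta> l) (Y l) (\<sigma> l) (At (p l) (ob E l) (t' l))"
      unfolding oE using tyF_mono[OF ut[of l], of "Suc l"] mi[of l] by simp
  qed
  have "pres BB q2 (Yh A) (\<lambda>k. e' (p k))"
    by (rule approx_pres[OF A cY sq2 _ p tp qp]) (simp add: Sq2 Y_def del: op_tri_simps)
  from B.pres_unique[OF sq2 module_Yh[OF CP_mod[OF A]] this W(1) p2] CP_LObj[OF A] show ?thesis by auto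
qed

lemma Yh_equivalence:
  "is_equivalence (op_cat (full_subcat D (LObj e C M))) (full_subcat (ModCat BB) (LObj e' BB N)) Yh YhA"
proof (rule fully_faithful_ess_surj_equivalence)
  let ?L = "LObj e C M" and ?L' = "LObj e' BB N"
  have Lm: "is_module C A" if "A \<in> ?L" for A using that CP_mod unfolding LObj_iff by blast
  have L'm: "is_module BB W" if "W \<in> ?L'" for W
  proof -
    obtain q \<kappa> where q: "cauchy BB N q" "Yon_colim e' BB q W \<kappa>" using \<open>W \<in> ?L'\<close> unfolding LObj_def by blast
    then show ?thesis using B.Yon_colim_pres[of q W \<kappa>] by (simp add: cauchy_def)
  qed
  show "category (op_cat (full_subcat D ?L))"
    by (rule category.category_op_cat[OF D.category_full_subcat]) (use Lm in auto)
  interpret DB: category "ModCat BB :: ((('o, 'm, 'u) presheaf, ('o, 'm, 'u) presheaf_map, 'v) presheaf,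
      (('o, 'm, 'u) presheaf, ('o, 'm, 'u) presheaf_map, 'v) presheaf_map) shift_cat" by (rule B.category_ModCat)
  show "category (full_subcat (ModCat BB) ?L')"
    by (rule DB.category_full_subcat) (use L'm in auto)
  have comp: "YhA (g \<cdot>\<^bsub>D\<^esub> f) = YhA f \<cdot>\<^bsub>ModCat BB\<^esub> YhA g" if f: "f \<in> Hom D x y" and g: "g \<in> Hom D y z" for f g x y z
  proof (rule B.MH_eqI[OF YhA_Hom[OF D.Comp_Hom[OF f g]] DB.Comp_Hom[OF YhA_Hom[OF g] YhA_Hom[OF f]]])
    fix w u assume "w \<in> Obj BB" and u: "u \<in> el (Yh z) w"
    then have w: "w \<in> X" by simp
    obtain h where h: "h \<in> Hom D z w" "u = e' h" using u unfolding el_Yh[OF w] by blast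
    show "At (YhA (g \<cdot>\<^bsub>D\<^esub> f)) w u = At (YhA f \<cdot>\<^bsub>ModCat BB\<^esub> YhA g) w u"
      using B.At_Comp[OF YhA_Hom[OF g], of w u "YhA f"] u w At_YhA[OF D.Comp_Hom[OF f g] h(1) w] At_YhA[OF g h(1) w]
        At_YhA[OF f D.Comp_Hom[OF g h(1)] w] D.Comp_assoc[OF f g h(1)] h(2) by simp
  qed
  have ident: "YhA (Ident D x) = Ident (ModCat BB) (Yh x)" if x: "is_module C x" for x
  proof (rule B.MH_eqI[OF YhA_Hom[OF MIdent_Hom[OF x]] DB.Ident_Hom])
    show "Yh x \<in> Obj (ModCat BB)" using module_Yh[OF x] by simp
    fix w u assume w': "w \<in> Obj BB" and u: "u \<in> el (Yh x) w"
    then have w: "w \<in> X" by simp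
    obtain h where h: "h \<in> Hom D x w" "u = e' h" using u unfolding el_Yh[OF w] by blast
    show "At (YhA (Ident D x)) w u = At (Ident (ModCat BB) (Yh x)) w u"
      using B.At_Ident[OF w' u] At_YhA[OF MIdent_Hom[OF x] h(1) w] D.Comp_Ident[OF h(1)] h(2) by simp
  qed
  show "is_functor (op_cat (full_subcat D ?L)) (full_subcat (ModCat BB) ?L') Yh YhA"
    unfolding is_functor_def Hom_full_subcat op_cat_simps full_subcat_simps
  proof (intro conjI ballI impI)
    fix x assume x: "x \<in> ?L"
    show "Yh x \<in> ?L'" by (rule Yh_LObj[OF x])
    show "YhA (Ident D x) = Ident (ModCat BB) (Yh x)" by (rule ident[OF Lm[OF x]])
  next
    fix f assume f: "f \<in> {f \<in> Arr D. Src D f \<in> ?L \<and> Tgt D f \<in> ?L}"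
    then show "YhA f \<in> (if Yh (Tgt D f) \<in> ?L' \<and> Yh (Src D f) \<in> ?L' then Hom (ModCat BB) (Yh (Tgt D f)) (Yh (Src D f)) else {})"
      using Yh_LObj YhA_Hom[OF Arr_Hom[of f D]] by simp
  next
    fix f g assume f: "f \<in> {f \<in> Arr D. Src D f \<in> ?L \<and> Tgt D f \<in> ?L}" and g: "g \<in> {f \<in> Arr D. Src D f \<in> ?L \<and> Tgt D f \<in> ?L}"
      and eq: "Src D f = Tgt D g"
    then have "g \<in> Hom D (Src D g) (Src D f)" "f \<in> Hom D (Src D f) (Tgt D f)" by (auto simp: Hom_def)
    then show "YhA (f \<cdot>\<^bsub>D\<^esub> g) = YhA g \<cdot>\<^bsub>ModCat BB\<^esub> YhA f" by (rule comp)
  qed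
  fix x y G assume x: "x \<in> Obj (op_cat (full_subcat D ?L))" and y: "y \<in> Obj (op_cat (full_subcat D ?L))"
    and G: "G \<in> Hom (full_subcat (ModCat BB) ?L') (Yh x) (Yh y)"
  then have xy: "x \<in> ?L" "y \<in> ?L" and G': "G \<in> Hom (ModCat BB) (Yh x) (Yh y)"
    by (auto simp: Hom_full_subcat split: if_splits)
  show "\<exists>!f. f \<in> Hom (op_cat (full_subcat D ?L)) x y \<and> YhA f = G"
    using Yh_full_faithful[OF Lm[OF xy(2)] xy(1) G'] xy by (simp add: Hom_op_cat Hom_full_subcat)
next
  let ?L = "LObj e C M" and ?L' = "LObj e' BB N"
  fix W assume "W \<in> Obj (full_subcat (ModCat BB) ?L')"
  then have WL: "W \<in> ?L'" by simp
  obtain q \<kappa> where q: "cauchy BB N q" "Yon_colim e' BB q W \<kappa>" using WL unfolding LObj_def by blast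
  have sq: "is_seq BB q" using q by (simp add: cauchy_def)
  obtain \<tau> where W: "is_module BB W" "pres BB q W \<tau>" using B.Yon_colim_pres[OF sq q(2)] by blast
  obtain A G where A: "A \<in> ?L" and G: "G \<in> Hom (ModCat BB) (Yh A) W"
    and b: "\<And>x. x \<in> X \<Longrightarrow> bij_betw (At G x) (el (Yh A) x) (el W x)" using Yh_ess_surj[OF q(1) W] by blast
  obtain G' where G': "G' \<in> Hom (ModCat BB) W (Yh A)" "G' \<cdot>\<^bsub>ModCat BB\<^esub> G = Ident (ModCat BB) (Yh A)"
    "G \<cdot>\<^bsub>ModCat BB\<^esub> G' = Ident (ModCat BB) W" using B.bij_invertible[OF G] b by auto
  note AL = Yh_LObj[OF A]
  have "MSrc G = Yh A" "MTgt G = W" "is_module_map BB G" using G by (auto simp: Hom_ModCat)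
  then have "is_invertible (full_subcat (ModCat BB) ?L') G"
    unfolding is_invertible_def using G' AL WL by (auto simp: Hom_full_subcat)
  moreover have "G \<in> Hom (full_subcat (ModCat BB) ?L') (Yh A) W" using G AL WL by (simp add: Hom_full_subcat)
  ultimately show "\<exists>x\<in>Obj (op_cat (full_subcat D ?L)). \<exists>i\<in>Hom (full_subcat (ModCat BB) ?L') (Yh x) W. is_invertible (full_subcat (ModCat BB) ?L') i"
    using A by auto
qed

end

section \<open>Strong triangles under the restricted Yoneda functor\<close>

context met
begin

text \<open>Shifting a representing arrow shifts its cone, which passes from
  \<open>M (Suc m)\<close> to \<open>M m\<close>.\<close>

lemma ty_shift:
  assumes c: "CP E A t" "CP E' A' t'" and G: "G \<in> Hom (ModCat C) A A'" "ty (Suc m) E t E' t' G"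
  shows "ty m (\<lambda>n. ShA C (E n)) t (\<lambda>n. ShA C (E' n)) t' (ShA (ModCat C) G)"
proof -
  note s = CP_seq[OF c(1)] and s' = CP_seq[OF c(2)]
  obtain L where L: "\<And>j. j \<ge> L \<Longrightarrow> tyF (Suc m) (ob E j) E' A' t' (At G (ob E j) (t j))" using tyD[OF G(2,1)] by blast
  show ?thesis
  proof (rule tyI[OF MShA_Hom[OF G(1)], of L])
    fix j assume "j \<ge> L"
    then obtain K where K: "\<And>k. k \<ge> K \<Longrightarrow> \<exists>f \<in> Hom C (ob E j) (ob E' k). T (Suc m) f \<and> FunA A' f (t' k) = At G (ob E j) (t j)"
      using L unfolding tyF_def by blast
    note o = CP_Obj[OF c(1), of j]
    show "tyF m (ob (\<lambda>n. ShA C (E n)) j) (\<lambda>n. ShA C (E' n)) (ShO (ModCat C) A') t'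
        (At (ShA (ModCat C) G) (ob (\<lambda>n. ShA C (E n)) j) (t j))"
      unfolding tyF_def shift_seq(2)[OF s] shift_seq(2)[OF s']
    proof (intro exI[of _ K] allI impI)
      fix k assume "k \<ge> K"
      then obtain f where f: "f \<in> Hom C (ob E j) (ob E' k)" "T (Suc m) f" "FunA A' f (t' k) = At G (ob E j) (t j)" using K by blast
      have "FunA (ShO (ModCat C) A') (ShA C f) (t' k) = At (ShA (ModCat C) G) (ShO C (ob E j)) (t j)"
        using f(3) Hom_Arr[OF f(1)] Hom_Arr[OF ShA_Hom[OF f(1)]] by (simp add: shM_simps ShO_Obj[OF o] UnO_ShO[OF o] UnA_ShA)
      then show "\<exists>f \<in> Hom C (ShO C (ob E j)) (ShO C (ob E' k)). T m f \<and>
          FunA (ShO (ModCat C) A') f (t' k) = At (ShA (ModCat C) G) (ShO C (ob E j)) (t j)"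
        using ShA_Hom[OF f(1)] T_ShA[OF f(1,2)] by blast
    qed
  qed
qed

lemma ty_subseq:
  assumes c: "CP E' A' t'" and r: "strict_mono r" and ty: "ty m E t E' t' G"
  shows "ty m E t (subsequence C E' r) (\<lambda>n. t' (r n)) G"
proof -
  have "tyF m x (subsequence C E' r) B (\<lambda>n. t' (r n)) u" if u: "tyF m x E' B t' u" for x B u
  proof -
    obtain K where K: "\<And>k. k \<ge> K \<Longrightarrow> \<exists>f \<in> Hom C x (ob E' k). T m f \<and> FunA B f (t' k) = u" using u unfolding tyF_def by blast
    have "k \<le> r k" for k by (rule strict_mono_imp_increasing[OF r])
    then have "r k \<ge> K" if "k \<ge> K" for k using that le_trans by blast
    then show ?thesis unfolding tyF_def subseq_seq(2)[OF CP_seq[OF c] r] using K by blast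
  qed
  then show ?thesis using ty unfolding ty_def by blast
qed

end

context dual
begin

text \<open>The shift of the opposite category is the desuspension, so its inverse is the shift of
  modules.\<close>

lemma UnO_BB: assumes "x \<in> X" shows "UnO BB x = ShO D x"
  using B.UnO_ShO[of "ShO D x"] SObj_shift[OF assms] UnO_SCat[OF SObj_shift[OF assms]] unsh_sh[OF X_mod[OF assms]] by simp

lemma UnA_BB: assumes g: "g \<in> Hom BB x y" shows "UnA BB g = ShA D g"
proof -
  note h = Hom_BBD[OF g]
  have s: "ShA D g \<in> Hom BB (ShO D x) (ShO D y)" using MShA_Hom[OF h(3)] SObj_shift h by (simp add: Hom_BB)
  have "ShA BB (ShA D g) = g"
    using UnA_SCat[OF MShA_Hom[OF h(3)] SObj_shift[OF h(2)] SObj_shift[OF h(1)]] unsh_shA[OF h(3)] by simp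
  then show ?thesis using B.UnA_ShA[OF Hom_Arr[OF s]] by simp
qed

lemma ShA_BB: assumes "g \<in> Hom D y x" "x \<in> X" "y \<in> X" shows "ShA BB (ShA D g) = g"
  using UnA_SCat[OF MShA_Hom[OF assms(1)] SObj_shift[OF assms(3)] SObj_shift[OF assms(2)]] unsh_shA[OF assms(1)] by simp

lemma Yhat_shift_Hom: assumes A: "is_module C A"
  shows "Yhat_shift e' BB D X A \<in> Hom (ModCat BB) (Yh A) (ShO (ModCat BB) (Yh (ShO D A)))"
proof -
  have eq: "Yhat_shift e' BB D X A = mkmap BB (Yh A) (ShO (ModCat BB) (Yh (ShO D A))) (\<lambda>x u. e' (ShA D (decode e' u)))"
  proof (rule presheaf_map_eqI)
    show "At (Yhat_shift e' BB D X A) = At (mkmap BB (Yh A) (ShO (ModCat BB) (Yh (ShO D A))) (\<lambda>x u. e' (ShA D (decode e' u))))"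
      unfolding Yhat_shift_def mkmap_def presheaf_map.simps op_tri_simps SCat_simps by (rule restrict_ext) (simp add: Yh_O)
  qed (simp_all add: Yhat_shift_def)
  have FO: "FunO (ShO (ModCat BB) (Yh (ShO D A))) x = hom_in e' D (ShO D A) (ShO D x)" if x: "x \<in> X" for x
  proof -
    have "x \<in> Obj BB" using x by simp
    then show ?thesis by (simp only: B.shM_simps(1) UnO_BB[OF x] Yh_O[OF SObj_shift[OF x]])
  qed
  show ?thesis unfolding eq
  proof (rule B.mkmap_Hom[OF module_Yh[OF A] B.module_shift[OF module_Yh[OF module_shift[OF A]]]])
    fix x u assume "x \<in> Obj BB" and u: "u \<in> el (Yh A) x"
    then have x: "x \<in> X" by simp
    obtain f where f: "f \<in> Hom D A x" "u = e' f" using u unfolding el_Yh[OF x] by blast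
    show "e' (ShA D (decode e' u)) \<in> el (ShO (ModCat BB) (Yh (ShO D A))) x"
      unfolding f(2) D.dec FO[OF x] D.hom_in_carrier using D.ShA_Hom[OF f(1)] by blast
    fix v assume v: "v \<in> el (Yh A) x"
    obtain g where g: "g \<in> Hom D A x" "v = e' g" using v unfolding el_Yh[OF x] by blast
    show "e' (ShA D (decode e' (u \<otimes>\<^bsub>FunO (Yh A) x\<^esub> v))) =
        e' (ShA D (decode e' u)) \<otimes>\<^bsub>FunO (ShO (ModCat BB) (Yh (ShO D A))) x\<^esub> e' (ShA D (decode e' v))"
      unfolding f(2) g(2) Yh_O[OF x] FO[OF x] D.hom_in_mult[OF f(1) g(1)] D.dec
        D.hom_in_mult[OF D.ShA_Hom[OF f(1)] D.ShA_Hom[OF g(1)]] D.shift_Add[OF f(1) g(1)] ..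
  next
    fix x y g u assume g: "g \<in> Hom BB x y" and u: "u \<in> el (Yh A) y"
    note h = Hom_BBD[OF g]
    obtain f where f: "f \<in> Hom D A y" "u = e' f" using u unfolding el_Yh[OF h(2)] by blast
    have sg: "ShA D g \<in> Hom BB (ShO D x) (ShO D y)" by (rule Hom_BBI[OF SObj_shift[OF h(1)] SObj_shift[OF h(2)] D.ShA_Hom[OF h(3)]])
    show "FunA (ShO (ModCat BB) (Yh (ShO D A))) g (e' (ShA D (decode e' u))) = e' (ShA D (decode e' (FunA (Yh A) g u)))"
      unfolding f(2) D.dec B.shM_simps(2)[OF Hom_Arr[OF g]] UnA_BB[OF g] Yh_act[OF sg D.ShA_Hom[OF f(1)]] Yh_act[OF g f(1)]
        D.ShA_Comp[OF f(1) h(3)] ..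
  qed
qed

lemma At_Yhat_shift: assumes "f \<in> Hom D A x" "x \<in> X" shows "At (Yhat_shift e' BB D X A) x (e' f) = e' (ShA D f)"
  using assms D.hom_in_carrier[of A x] by (simp add: Yhat_shift_def)

text \<open>A shift lowers the types by one and raises the vanishing bounds by one; the hypothesis
  on \<open>n\<close> is the interleaving condition for the new bounds.\<close>

lemma tower_shift:
  assumes t: "tower A a \<alpha> Z d s p q m n" and m: "\<And>k. m k = Suc (m' k)" and n: "\<And>k. Suc (n k) < m' (Suc k)"
  shows "tower (ShO D A) (\<lambda>i. ShA C (a i)) \<alpha> (\<lambda>k. ShO D (Z k)) (\<lambda>k i. ShA C (d k i)) s (\<lambda>k. ShA D (p k)) (\<lambda>k. ShA D (q k)) m' (\<lambda>k. Suc (n k))"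
  unfolding tower_def
proof (intro conjI allI)
  show "CP (\<lambda>i. ShA C (a i)) (ShO D A) \<alpha>" by (rule CP_shift[OF tw_A[OF t]])
  fix k
  show "CP (\<lambda>i. ShA C (d k i)) (ShO D (Z k)) (s k)" by (rule CP_shift[OF tw_CP[OF t]])
  show "vanish (ShO D (Z k)) (Suc (n k))" by (rule vanish_shift[OF CP_mod[OF tw_CP[OF t]] tw_van[OF t]])
  show "ShA D (p k) \<in> Hom D (ShO D A) (ShO D (Z k))" "ShA D (q k) \<in> Hom D (ShO D (Z (Suc k))) (ShO D (Z k))"
    by (rule D.ShA_Hom[OF tw_p[OF t]], rule D.ShA_Hom[OF tw_q[OF t]])
  show "ty (m' k) (\<lambda>i. ShA C (a i)) \<alpha> (\<lambda>i. ShA C (d k i)) (s k) (ShA D (p k))"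
    by (rule ty_shift[OF tw_A[OF t] tw_CP[OF t] tw_p[OF t]]) (use tw_ty[OF t, of k] m[of k] in simp)
  show "ShA D (q k) \<cdot>\<^bsub>D\<^esub> ShA D (p (Suc k)) = ShA D (p k)"
    using D.ShA_Comp[OF tw_p[OF t, of "Suc k"] tw_q[OF t, of k]] tw_qp[OF t, of k] by simp
  show "m' k \<le> Suc (n k)" using tw_mn(1)[OF t, of k] m[of k] by simp
  show "Suc (n k) < m' (Suc k)" by (rule n)
qed

text \<open>The two sides agree after composition with \<open>p (Suc k)\<close>, whose type exceeds
  the vanishing bound \<open>n' k\<close> of the common target, so \<open>p (Suc k)\<close> can be
  cancelled.\<close>

lemma tower_square:
  assumes t: "tower A a \<alpha> Z d s p q m n" and t': "tower A' a' \<alpha>' Z' d' s' p' q' m' n'"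
    and f: "\<And>k. f k \<in> Hom D (Z k) (Z' k)" and F: "F \<in> Hom D A A'" and fp: "\<And>k. f k \<cdot>\<^bsub>D\<^esub> p k = p' k \<cdot>\<^bsub>D\<^esub> F"
    and n: "\<And>k. n' k < m (Suc k)"
  shows "f k \<cdot>\<^bsub>D\<^esub> q k = q' k \<cdot>\<^bsub>D\<^esub> f (Suc k)"
proof (rule ty_epi[OF tw_A[OF t] tw_CP[OF t] tw_p[OF t, of "Suc k"] ty_mono[OF tw_ty[OF t]] CP_homol[OF tw_CP[OF t']] tw_van[OF t', of k]
    D.Comp_Hom[OF tw_q[OF t] f] D.Comp_Hom[OF f tw_q[OF t']]])
  show "Suc (n' k) \<le> m (Suc k)" using n[of k] by simp
  show "(f k \<cdot>\<^bsub>D\<^esub> q k) \<cdot>\<^bsub>D\<^esub> p (Suc k) = (q' k \<cdot>\<^bsub>D\<^esub> f (Suc k)) \<cdot>\<^bsub>D\<^esub> p (Suc k)"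
    using D.Comp_assoc[OF tw_p[OF t] tw_q[OF t] f] D.Comp_assoc[OF tw_p[OF t] f tw_q[OF t']] fp tw_qp[OF t, of k]
      D.Comp_assoc[OF F tw_p[OF t', of "Suc k"] tw_q[OF t', of k], symmetric] tw_qp[OF t', of k] by simp
qed

lemma tower_BB:
  assumes t: "tower A a \<alpha> Z d s p q m n"
  shows "cauchy BB N q" "pres BB q (Yh A) (\<lambda>k. e' (p k))" "is_module BB (Yh A)" "Src BB (q k) = Z k" "q k \<in> Hom BB (Z k) (Z (Suc k))"
proof -
  show "cauchy BB N q" "pres BB q (Yh A) (\<lambda>k. e' (p k))" by (rule tower_cauchy[OF t], rule tower_pres[OF t])
  show "is_module BB (Yh A)" by (rule module_Yh[OF CP_mod[OF tw_A[OF t]]])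
  show "Src BB (q k) = Z k" by (rule tw_seq(2)[OF t])
  show "q k \<in> Hom BB (Z k) (Z (Suc k))" by (rule Hom_BBI[OF tw_X[OF t] tw_X[OF t] tw_q[OF t]])
qed

text \<open>The triangle is approximated by triangles with terms \<open>ZA k, ZB k, ZC k\<close>: choose \<open>ZB k\<close>, then \<open>ZA k\<close> so much
  closer to \<open>A\<close> that the composite \<open>A \<rightarrow> B \<rightarrow> ZB k\<close> factors through it, and complete \<open>ZA k \<rightarrow> ZB k\<close>.\<close>

lemma strong_triangle_towers:
  fixes F :: "('o, 'm, 'u) presheaf_map"
  assumes st: "ST C M a \<alpha> b \<beta> c \<gamma> f g h A B P F G H"
  shows "\<exists>ZA dA sA pA qA mA nA ZB dB sB pB qB mB nB ZC dC sC pC qC mC nC \<phi> \<psi> \<chi>.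
    tower A a \<alpha> ZA dA sA pA qA mA nA \<and> tower B b \<beta> ZB dB sB pB qB mB nB \<and> tower P c \<gamma> ZC dC sC pC qC mC nC \<and>
    (\<forall>k. (\<phi> k, \<psi> k, \<chi> k) \<in> strong_triangles e C M \<and> \<phi> k \<in> Hom D (ZA k) (ZB k) \<and> \<psi> k \<in> Hom D (ZB k) (ZC k) \<and>
      \<chi> k \<in> Hom D (ZC k) (ShO D (ZA k)) \<and> \<phi> k \<cdot>\<^bsub>D\<^esub> pA k = pB k \<cdot>\<^bsub>D\<^esub> F \<and> \<psi> k \<cdot>\<^bsub>D\<^esub> pB k = pC k \<cdot>\<^bsub>D\<^esub> G \<and>
      \<chi> k \<cdot>\<^bsub>D\<^esub> pC k = ShA D (pA k) \<cdot>\<^bsub>D\<^esub> H \<and>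
      nB k < mA (Suc k) \<and> nC k < mB (Suc k) \<and> Suc (nA k) < mC (Suc k) \<and> Suc (Suc (nA k)) < mA (Suc k) \<and> 0 < mA k)"
proof -
  note cp = ST_CP[OF st] and hom = ST_Hom[OF st]
  have "\<forall>m. \<exists>n. n > m \<and> (\<forall>E B s. CP E B s \<longrightarrow> (\<exists>d D' t G. CP d D' t \<and> vanish D' n \<and> G \<in> Hom D B D' \<and> ty m E s d t G))"
    using approx by blast
  then obtain nn where nn: "\<And>m. nn m > m"
    and ex: "\<And>m E B s. CP E B s \<Longrightarrow> \<exists>d D' t G. CP d D' t \<and> vanish D' (nn m) \<and> G \<in> Hom D B D' \<and> ty m E s d t G" by metis
  obtain uA vA wA rA where uA: "\<And>m. CP (uA m) (vA m) (wA m)" "\<And>m. vanish (vA m) (nn m)" "\<And>m. rA m \<in> Hom D A (vA m)"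
    "\<And>m. ty m a \<alpha> (uA m) (wA m) (rA m)" using ex[OF cp(1)] by metis
  obtain uB vB wB rB where uB: "\<And>m. CP (uB m) (vB m) (wB m)" "\<And>m. vanish (vB m) (nn m)" "\<And>m. rB m \<in> Hom D B (vB m)"
    "\<And>m. ty m b \<beta> (uB m) (wB m) (rB m)" using ex[OF cp(2)] by metis
  \<comment> \<open>At each level \<open>mB < nB < mA < nA\<close>, since \<open>ZA k\<close> must
    be closer to \<open>A\<close> than \<open>ZB k\<close> can detect. The third vertex loses two
    indices of type in \<open>ST_fill\<close> and gains one of vanishing bound in
    \<open>ST_vanish_cone\<close>, hence \<open>mC\<close> and \<open>nC\<close>. The start 2 keeps
    \<open>mB k - 2\<close> from being truncated; the gap 4 gives
    \<open>mC (Suc k) = nA k + 2\<close>, above the bound \<open>Suc (nA k)\<close> of the shifted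
    tower of \<open>A\<close>.\<close>
  define mB where "mB k = ((\<lambda>i. nn (Suc (nn i)) + 4) ^^ k) 2" for k
  define nB where "nB k = nn (mB k)" for k
  define mA where "mA k = Suc (nB k)" for k
  define nA where "nA k = nn (mA k)" for k
  define mC where "mC k = mB k - 2" for k
  define nC where "nC k = Suc (nA k)" for k
  have mBS: "mB (Suc k) = nA k + 4" for k by (simp add: mB_def nA_def mA_def nB_def)
  have ord: "mB k < nB k" "nB k < mA k" "mA k < nA k" for k by (simp_all add: nB_def nA_def mA_def nn)
  have mB2: "mB k = Suc (Suc (mC k))" for k
    unfolding mC_def by (cases k) (simp_all add: mBS, simp add: mB_def)
  define ZA where "ZA k = vA (mA k)" for k
  define dA where "dA k = uA (mA k)" for k
  define sA where "sA k = wA (mA k)" for k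
  define pA where "pA k = rA (mA k)" for k
  define ZB where "ZB k = vB (mB k)" for k
  define dB where "dB k = uB (mB k)" for k
  define sB where "sB k = wB (mB k)" for k
  define pB where "pB k = rB (mB k)" for k
  have cA: "CP (dA k) (ZA k) (sA k)" and vanA: "vanish (ZA k) (nA k)" and pA: "pA k \<in> Hom D A (ZA k)"
    and tA: "ty (mA k) a \<alpha> (dA k) (sA k) (pA k)" for k
    unfolding dA_def ZA_def sA_def pA_def nA_def by (rule uA)+
  have cB: "CP (dB k) (ZB k) (sB k)" and vanB: "vanish (ZB k) (nB k)" and pB: "pB k \<in> Hom D B (ZB k)"
    and tB: "ty (mB k) b \<beta> (dB k) (sB k) (pB k)" for k
    unfolding dB_def ZB_def sB_def pB_def nB_def by (rule uB)+
  \<comment> \<open>\<open>ZB k\<close> vanishes on \<open>M (nB k)\<close> and \<open>pA k\<close>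
    is of type \<open>mA k = Suc (nB k)\<close>, so the composite from \<open>A\<close> to
    \<open>ZB k\<close> factors through \<open>pA k\<close>.\<close>
  have "\<exists>\<phi>. \<phi> \<in> Hom D (ZA k) (ZB k) \<and> \<phi> \<cdot>\<^bsub>D\<^esub> pA k = pB k \<cdot>\<^bsub>D\<^esub> F" for k
    using ty_ext[OF cp(1) cA[of k] pA[of k] ty_mono[OF tA[of k]] CP_homol[OF cB[of k]] vanB[of k] D.Comp_Hom[OF hom(1) pB[of k]]]
    by (auto simp: mA_def)
  then obtain \<phi> where \<phi>: "\<And>k. \<phi> k \<in> Hom D (ZA k) (ZB k)" "\<And>k. \<phi> k \<cdot>\<^bsub>D\<^esub> pA k = pB k \<cdot>\<^bsub>D\<^esub> F" by metis
  have "\<exists>z d s \<psi> \<chi> p. CP d z s \<and> vanish z (nC k) \<and> (\<phi> k, \<psi>, \<chi>) \<in> strong_triangles e C M \<and> \<psi> \<in> Hom D (ZB k) z \<and>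
      \<chi> \<in> Hom D z (ShO D (ZA k)) \<and> p \<in> Hom D P z \<and> p \<cdot>\<^bsub>D\<^esub> G = \<psi> \<cdot>\<^bsub>D\<^esub> pB k \<and> \<chi> \<cdot>\<^bsub>D\<^esub> p = ShA D (pA k) \<cdot>\<^bsub>D\<^esub> H \<and>
      ty (mC k) c \<gamma> d s p" for k
  proof -
    obtain r r' d s f' g' h' z \<psi> \<chi> where r: "strict_mono r" "strict_mono r'" and
      s: "ST C M (subsequence C (dA k) r) (\<lambda>n. sA k (r n)) (subsequence C (dB k) r') (\<lambda>n. sB k (r' n)) d s f' g' h' (ZA k) (ZB k) z (\<phi> k) \<psi> \<chi>"
      using ST_of_map[OF cA[of k] cB[of k] \<phi>(1)[of k], of 0] by blast
    have vz: "vanish z (nC k)" unfolding nC_def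
      by (rule ST_vanish_cone[OF s vanA vanish_mono[OF vanB]]) (use ord[of k] in simp)
    have vA': "vanish (ZA k) (nC k)" by (rule vanish_mono[OF vanA]) (simp add: nC_def)
    have "ty (Suc (Suc (mC k))) a \<alpha> (subsequence C (dA k) r) (\<lambda>n. sA k (r n)) (pA k)"
      by (rule ty_subseq[OF cA r(1) ty_mono[OF tA]]) (use mB2[of k] ord[of k] in simp)
    moreover have "ty (Suc (Suc (mC k))) b \<beta> (subsequence C (dB k) r') (\<lambda>n. sB k (r' n)) (pB k)"
      by (rule ty_subseq[OF cB r(2)]) (use tB[of k] mB2[of k] in simp)
    \<comment> \<open>The fill-in from the given triangle to the one over the approximations is the
      map from \<open>P\<close> to the new vertex; its type refers to the presentation of
      \<open>z\<close> that comes with this triangle.\<close>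
    ultimately obtain p where "p \<in> Hom D P z" "p \<cdot>\<^bsub>D\<^esub> G = \<psi> \<cdot>\<^bsub>D\<^esub> pB k" "\<chi> \<cdot>\<^bsub>D\<^esub> p = ShA D (pA k) \<cdot>\<^bsub>D\<^esub> H" "ty (mC k) c \<gamma> d s p"
      using ST_fill[OF st s vz vA' pA pB \<phi>(2)[symmetric], of "mC k"] by blast
    moreover have "(\<phi> k, \<psi>, \<chi>) \<in> strong_triangles e C M" using s strong_iff by blast
    ultimately show ?thesis using ST_CP(3)[OF s] ST_Hom[OF s] vz by blast
  qed
  then obtain ZC dC sC \<psi> \<chi> pC where C: "\<And>k. CP (dC k) (ZC k) (sC k)" "\<And>k. vanish (ZC k) (nC k)" and
    tri: "\<And>k. (\<phi> k, \<psi> k, \<chi> k) \<in> strong_triangles e C M" and \<psi>: "\<And>k. \<psi> k \<in> Hom D (ZB k) (ZC k)" and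
    \<chi>: "\<And>k. \<chi> k \<in> Hom D (ZC k) (ShO D (ZA k))" and pC: "\<And>k. pC k \<in> Hom D P (ZC k)" and
    eq: "\<And>k. pC k \<cdot>\<^bsub>D\<^esub> G = \<psi> k \<cdot>\<^bsub>D\<^esub> pB k" "\<And>k. \<chi> k \<cdot>\<^bsub>D\<^esub> pC k = ShA D (pA k) \<cdot>\<^bsub>D\<^esub> H"
    and tC: "\<And>k. ty (mC k) c \<gamma> (dC k) (sC k) (pC k)" by metis
  have le: "mA k \<le> nA k" "nA k < mA (Suc k)" "mB k \<le> nB k" "nB k < mB (Suc k)" "mC k \<le> nC k" "nC k < mC (Suc k)"
    "nB k < mA (Suc k)" "nC k < mB (Suc k)" "Suc (nA k) < mC (Suc k)" "Suc (Suc (nA k)) < mA (Suc k)" "0 < mA k" for k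
    using ord[of k] ord[of "Suc k"] mBS[of k] by (simp_all add: nC_def mC_def)
  obtain qA where qA: "tower A a \<alpha> ZA dA sA pA qA mA nA" using towerI[of a A \<alpha> dA ZA sA nA pA mA, OF cp(1) cA vanA pA tA le(1,2)] by blast
  obtain qB where qB: "tower B b \<beta> ZB dB sB pB qB mB nB" using towerI[of b B \<beta> dB ZB sB nB pB mB, OF cp(2) cB vanB pB tB le(3,4)] by blast
  obtain qC where qC: "tower P c \<gamma> ZC dC sC pC qC mC nC" using towerI[of c P \<gamma> dC ZC sC nC pC mC, OF cp(3) C pC tC le(5,6)] by blast
  have "\<forall>k. (\<phi> k, \<psi> k, \<chi> k) \<in> strong_triangles e C M \<and> \<phi> k \<in> Hom D (ZA k) (ZB k) \<and> \<psi> k \<in> Hom D (ZB k) (ZC k) \<and>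
      \<chi> k \<in> Hom D (ZC k) (ShO D (ZA k)) \<and> \<phi> k \<cdot>\<^bsub>D\<^esub> pA k = pB k \<cdot>\<^bsub>D\<^esub> F \<and> \<psi> k \<cdot>\<^bsub>D\<^esub> pB k = pC k \<cdot>\<^bsub>D\<^esub> G \<and>
      \<chi> k \<cdot>\<^bsub>D\<^esub> pC k = ShA D (pA k) \<cdot>\<^bsub>D\<^esub> H \<and>
      nB k < mA (Suc k) \<and> nC k < mB (Suc k) \<and> Suc (nA k) < mC (Suc k) \<and> Suc (Suc (nA k)) < mA (Suc k) \<and> 0 < mA k"
    using tri \<phi> \<psi> \<chi> eq le(7-11) by simp
  then show ?thesis by (intro exI conjI) (rule qA qB qC | assumption)+
qed

text \<open>Read in the opposite category, the approximating triangles run from the shift of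
  \<open>ZA k\<close> through \<open>ZC k\<close> and \<open>ZB k\<close>; the shift of that
  category takes their first vertex back to \<open>ZA k\<close>. The squares between levels commute
  by \<open>tower_square\<close>, so this is a Cauchy sequence of triangles, with colimits given by
  the towers.\<close>

lemma Yh_strong:
  assumes "(F, G, H) \<in> strong_triangles e C M"
  shows "(YhA H, YhA G, Yhat_shift e' BB D X (Src D F) \<cdot>\<^bsub>ModCat BB\<^esub> YhA F) \<in> strong_triangles e' BB N"
proof -
  obtain a \<alpha> b \<beta> c \<gamma> f g h A B P where st: "ST C M a \<alpha> b \<beta> c \<gamma> f g h A B P F G H"
    using assms[unfolded strong_iff] by (elim exE) (rule that)
  note hom = ST_Hom[OF st] and mA' = MH_mod(1)[OF ST_Hom(1)[OF st]]
  from strong_triangle_towers[OF st]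
  obtain ZA dA sA pA qA mA nA ZB dB sB pB qB mB nB ZC dC sC pC qC mC nC \<phi> \<psi> \<chi> where
    tA: "tower A a \<alpha> ZA dA sA pA qA mA nA" and tB: "tower B b \<beta> ZB dB sB pB qB mB nB" and tC: "tower P c \<gamma> ZC dC sC pC qC mC nC"
    and all: "\<forall>k. (\<phi> k, \<psi> k, \<chi> k) \<in> strong_triangles e C M \<and> \<phi> k \<in> Hom D (ZA k) (ZB k) \<and> \<psi> k \<in> Hom D (ZB k) (ZC k) \<and>
      \<chi> k \<in> Hom D (ZC k) (ShO D (ZA k)) \<and> \<phi> k \<cdot>\<^bsub>D\<^esub> pA k = pB k \<cdot>\<^bsub>D\<^esub> F \<and> \<psi> k \<cdot>\<^bsub>D\<^esub> pB k = pC k \<cdot>\<^bsub>D\<^esub> G \<and>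
      \<chi> k \<cdot>\<^bsub>D\<^esub> pC k = ShA D (pA k) \<cdot>\<^bsub>D\<^esub> H \<and>
      nB k < mA (Suc k) \<and> nC k < mB (Suc k) \<and> Suc (nA k) < mC (Suc k) \<and> Suc (Suc (nA k)) < mA (Suc k) \<and> 0 < mA k"
    by (elim exE conjE) (rule that)
  have tri: "(\<phi> k, \<psi> k, \<chi> k) \<in> strong_triangles e C M" and \<phi>: "\<phi> k \<in> Hom D (ZA k) (ZB k)" and \<psi>: "\<psi> k \<in> Hom D (ZB k) (ZC k)"
    and \<chi>: "\<chi> k \<in> Hom D (ZC k) (ShO D (ZA k))" and \<phi>p: "\<phi> k \<cdot>\<^bsub>D\<^esub> pA k = pB k \<cdot>\<^bsub>D\<^esub> F" and \<psi>p: "\<psi> k \<cdot>\<^bsub>D\<^esub> pB k = pC k \<cdot>\<^bsub>D\<^esub> G"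
    and \<chi>p: "\<chi> k \<cdot>\<^bsub>D\<^esub> pC k = ShA D (pA k) \<cdot>\<^bsub>D\<^esub> H"
    and le: "nB k < mA (Suc k)" "nC k < mB (Suc k)" "Suc (nA k) < mC (Suc k)" "Suc (Suc (nA k)) < mA (Suc k)" "0 < mA k" for k
    using all by blast+
  have tS: "tower (ShO D A) (\<lambda>i. ShA C (a i)) \<alpha> (\<lambda>k. ShO D (ZA k)) (\<lambda>k i. ShA C (dA k i)) sA (\<lambda>k. ShA D (pA k)) (\<lambda>k. ShA D (qA k))
      (\<lambda>k. mA k - 1) (\<lambda>k. Suc (nA k))"
  proof (rule tower_shift[OF tA])
    fix k show "mA k = Suc (mA k - 1)" using le(5)[of k] by simp
    show "Suc (nA k) < mA (Suc k) - 1" using le(4)[of k] by simp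
  qed
  note sqA = tower_square[OF tA tB \<phi> hom(1) \<phi>p le(1)] and sqB = tower_square[OF tB tC \<psi> hom(2) \<psi>p le(2)]
    and sqC = tower_square[OF tC tS \<chi> hom(3) \<chi>p le(3)]
  note XA = tw_X[OF tA] and XB = tw_X[OF tB] and XC = tw_X[OF tC] and XS = tw_X[OF tS]
  note BS = tower_BB[OF tS] and BC = tower_BB[OF tC] and BB = tower_BB[OF tB]
  \<comment> \<open>The target of the third map is the shift, in the opposite category, of the
    shifted tower of \<open>A\<close>; this is the original tower again.\<close>
  have shq: "ShA BB (ShA D (qA k)) = qA k" for k by (rule ShA_BB[OF tw_q[OF tA] XA XA])
  have qAB: "Src BB (qA k) = ZA k" for k by (rule tw_seq(2)[OF tA])
  have \<phi>B: "\<phi> k \<in> Hom BB (ZB k) (ZA k)" and \<psi>B: "\<psi> k \<in> Hom BB (ZC k) (ZB k)" and \<chi>B: "\<chi> k \<in> Hom BB (ShO D (ZA k)) (ZC k)" for k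
    by (rule Hom_BBI[OF XB XA \<phi>], rule Hom_BBI[OF XC XB \<psi>], rule Hom_BBI[OF XS XC \<chi>])
  have ct: "cauchy_triangles BB N (\<lambda>k. ShA D (qA k)) qC qB \<chi> \<psi> \<phi>"
    unfolding cauchy_triangles_def
  proof (intro conjI allI)
    show "cauchy BB N (\<lambda>k. ShA D (qA k))" "cauchy BB N qC" "cauchy BB N qB" by (rule BS(1), rule BC(1), rule BB(1))
    show "seq_map BB (\<lambda>k. ShA D (qA k)) qC \<chi>" unfolding seq_map_def BS(4) BC(4) using \<chi>B sqC by simp
    show "seq_map BB qC qB \<psi>" unfolding seq_map_def BB(4) BC(4) using \<psi>B sqB by simp
    show "seq_map BB qB (\<lambda>n. ShA BB (ShA D (qA n))) \<phi>" unfolding seq_map_def BB(4) shq qAB using \<phi>B sqA by simp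
    fix k
    have "MSrc (\<phi> k) = ZA k" "MSrc (\<psi> k) = ZB k" "MSrc (\<chi> k) = ZC k" using \<phi> \<psi> \<chi> by (auto simp: Hom_ModCat)
    then show "(\<chi> k, \<psi> k, \<phi> k) \<in> Tri BB" using tri[of k] XA XB XC by simp
  qed
  let ?H = "Yhat_shift e' BB D X A \<cdot>\<^bsub>ModCat BB\<^esub> YhA F"
  note YF = YhA_Hom[OF hom(1)] and YS = Yhat_shift_Hom[OF mA']
  have "ST BB N (\<lambda>k. ShA D (qA k)) (\<lambda>k. e' (ShA D (pA k))) qC (\<lambda>k. e' (pC k)) qB (\<lambda>k. e' (pB k)) \<chi> \<psi> \<phi>
      (Yh (ShO D A)) (Yh P) (Yh B) (YhA H) (YhA G) ?H"
    unfolding ST_def BS(4) BC(4) BB(4)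
  proof (intro conjI allI ct BS(2,3) BC(2,3) BB(2,3))
    show "YhA H \<in> Hom (ModCat BB) (Yh (ShO D A)) (Yh P)" "YhA G \<in> Hom (ModCat BB) (Yh P) (Yh B)"
      by (rule YhA_Hom[OF hom(3)], rule YhA_Hom[OF hom(2)])
    show "?H \<in> Hom (ModCat BB) (Yh B) (ShO (ModCat BB) (Yh (ShO D A)))" by (rule B.MComp_Hom[OF YF YS])
    fix k
    note pA = tw_p[OF tA, of k] and pB = tw_p[OF tB, of k] and pC = tw_p[OF tC, of k] and pS = tw_p[OF tS, of k]
    show "At (YhA H) (ShO D (ZA k)) (e' (ShA D (pA k))) = FunA (Yh P) (\<chi> k) (e' (pC k))"
      unfolding At_YhA[OF hom(3) pS XS] Yh_act[OF \<chi>B pC] \<chi>p ..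
    show "At (YhA G) (ZC k) (e' (pC k)) = FunA (Yh B) (\<psi> k) (e' (pB k))"
      unfolding At_YhA[OF hom(2) pC XC] Yh_act[OF \<psi>B pB] \<psi>p ..
    have pBo: "ZB k \<in> Obj BB" using XB by simp
    have pBe: "e' (pB k) \<in> el (Yh B) (ZB k)" unfolding el_Yh[OF XB] using pB by blast
    have s\<phi>: "ShA D (\<phi> k) \<in> Hom BB (ShO D (ZB k)) (ShO D (ZA k))"
      by (rule Hom_BBI[OF SObj_shift[OF XB] XS D.ShA_Hom[OF \<phi>]])
    \<comment> \<open>Both sides encode the shift of \<open>pB k\<close> composed with
      \<open>F\<close>. On the left the shift comes from \<open>Yhat_shift\<close>; on the right
      \<open>\<phi> k\<close> acts on a shifted module through the inverse shift of the opposite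
      category, which is the shift of modules.\<close>
    show "At ?H (ZB k) (e' (pB k)) = FunA (ShO (ModCat BB) (Yh (ShO D A))) (\<phi> k) (e' (ShA D (pA k)))"
      unfolding B.At_Comp[OF YF pBo pBe] At_YhA[OF hom(1) pB XB] At_Yhat_shift[OF D.Comp_Hom[OF hom(1) pB] XB]
        B.shM_simps(2)[OF Hom_Arr[OF \<phi>B]] UnA_BB[OF \<phi>B] Yh_act[OF s\<phi> pS] D.ShA_Comp[OF pA \<phi>, symmetric] \<phi>p ..
  qed
  moreover have "Src D F = A" using hom(1) by (simp add: Hom_ModCat)
  ultimately show ?thesis unfolding B.strong_iff by blast
qed

end

theorem lemma0p14:
  fixes S :: "('o, 'm) tri_cat" and M :: "nat \<Rightarrow> 'o set"
    and e :: "'m \<Rightarrow> 'u" and e' :: "('o, 'm, 'u) presheaf_map \<Rightarrow> 'v"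
  assumes "infinite (UNIV :: 'u set)" and "inj e" and "inj e'"
    and "triangulated_category S" and "excellent_metric S M e"
  shows "let D = ModCat S; X = SObj e S M; B = op_tri (SCat e S M); N = SMetric e S M in
      is_equivalence
        (op_cat (full_subcat D (LObj e S M)))
        (full_subcat (ModCat B) (LObj e' B N))
        (YhatO e' D X) (YhatA e' D X) \<and>
      (\<forall>f g h. (f, g, h) \<in> strong_triangles e S M \<longrightarrow>
         (YhatA e' D X h, YhatA e' D X g,
          Yhat_shift e' B D X (Src D f) \<cdot>\<^bsub>ModCat B\<^esub> YhatA e' D X f)
         \<in> strong_triangles e' B N)"
proof -
  interpret S: triangulated_category S by fact
  interpret E: excellent_metric S M e by fact
  interpret S: dual S M e e'
    by (intro dual.intro exc.intro met.intro metric_tri.intro yoneda.intro yoneda_axioms.intro dual_axioms.intro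
      S.triangulated_category_axioms E.good_metric_axioms E.excellent_metric_axioms S.shifted_axioms assms)
  show ?thesis unfolding Let_def using S.Yh_equivalence S.Yh_strong by blast
qed

end
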